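(* Fix a positive integer $\Delta$. There is an algorithm which, given a tree $T$ of maximum degree at most $\Delta$ together with a weight function $w\colon V(T)\cup E(T)\to\mathbb{N}_+$, computes an optimal connected search strategy for $(T,w)$, i.e. a connected search strategy using exactly $\textup{cs}(T)$ searchers, in $O(n^3\log n)$ time, where $n=|V(T)|$.
   Context: Connected searching of a weighted graph $G=(V,E,w)$, $w\colon V\cup E\to\mathbb{N}_+$ (positive integers): for an integer $k\ge 0$, a connected $k$-search strategy starts with all edges contaminated and places $k$ searchers on a chosen starting vertex. Each move slides $j\ge 1$ searchers along an edge $e$; if $e$ is contaminated, the move requires $j\ge w(e)$ and $e$ becomes clear. An edge $uv$ becomes contaminated (again) whenever there is a contaminated edge $vy$ and fewer than $w(v)$ searchers occupy $v$. After every move the subgraph formed by the clear edges must be connected, and at the end all edges are clear. The connected search number $\textup{cs}(G)$ is the least $k$ for which a connected $k$-search strategy exists (over all starting vertices). A strategy is optimal if it uses $\textup{cs}(G)$ searchers. *)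

theory Defs
  imports Complex_Main "HOL-Library.Landau_Symbols"
begin

section \<open>Weighted graphs and trees\<close>

text \<open>Undirected edges are two-element vertex sets. The weight function on the disjoint union
  of vertices and edges is split into its two restrictions.\<close>

record 'a wgraph =
  verts :: "'a set"
  edges :: "'a set set"
  vweight :: "'a \<Rightarrow> nat"
  eweight :: "'a set \<Rightarrow> nat"

definition finite_weighted_graph :: "'a wgraph \<Rightarrow> bool" where
  "finite_weighted_graph G \<longleftrightarrow>
     finite (verts G) \<and> verts G \<noteq> {} \<and>
     (\<forall>e\<in>edges G. e \<subseteq> verts G \<and> card e = 2) \<and>
     (\<forall>v\<in>verts G. 0 < vweight G v) \<and> (\<forall>e\<in>edges G. 0 < eweight G e)"

text \<open>The graph with vertex set \<open>V\<close> and edge set \<open>E\<close> is connected; the empty graph counts as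
  connected.\<close>

definition connected_graph :: "'a set \<Rightarrow> 'a set set \<Rightarrow> bool" where
  "connected_graph V E \<longleftrightarrow> (\<forall>x\<in>V. \<forall>y\<in>V. (x, y) \<in> {(a, b). {a, b} \<in> E}\<^sup>*)"

definition is_cycle :: "'a set set \<Rightarrow> 'a list \<Rightarrow> bool" where
  "is_cycle E vs \<longleftrightarrow> 3 \<le> length vs \<and> distinct vs \<and>
     (\<forall>i. Suc i < length vs \<longrightarrow> {vs ! i, vs ! Suc i} \<in> E) \<and> {last vs, hd vs} \<in> E"

definition weighted_tree :: "'a wgraph \<Rightarrow> bool" where
  "weighted_tree G \<longleftrightarrow> finite_weighted_graph G \<and>
     connected_graph (verts G) (edges G) \<and> (\<nexists>vs. is_cycle (edges G) vs)"

definition degree :: "'a wgraph \<Rightarrow> 'a \<Rightarrow> nat" where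
  "degree G v = card {e \<in> edges G. v \<in> e}"

definition max_degree :: "'a wgraph \<Rightarrow> nat" where
  "max_degree G = Max (degree G ` verts G)"

section \<open>Connected searching\<close>

text \<open>\<open>contaminated G C s e\<close>: starting from the situation where exactly the edges outside \<open>C\<close> are
  contaminated and \<open>s v\<close> searchers occupy each vertex \<open>v\<close>, contamination spreads to \<open>e\<close>.\<close>

inductive contaminated :: "'a wgraph \<Rightarrow> 'a set set \<Rightarrow> ('a \<Rightarrow> nat) \<Rightarrow> 'a set \<Rightarrow> bool"
  for G C s where
  initial: "e \<in> edges G \<Longrightarrow> e \<notin> C \<Longrightarrow> contaminated G C s e"
| spread: "contaminated G C s {v, y} \<Longrightarrow> s v < vweight G v \<Longrightarrow> {u, v} \<in> edges G \<Longrightarrow>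
    contaminated G C s {u, v}"

text \<open>A search state is the set of clear edges together with the number of searchers on each
  vertex. A move \<open>(u, v, j)\<close> slides \<open>j\<close> searchers from \<open>u\<close> to \<open>v\<close>.\<close>

type_synonym 'a search_state = "'a set set \<times> ('a \<Rightarrow> nat)"
type_synonym 'a move = "'a \<times> 'a \<times> nat"

fun legal_move :: "'a wgraph \<Rightarrow> 'a search_state \<Rightarrow> 'a move \<Rightarrow> bool" where
  "legal_move G (C, s) (u, v, j) \<longleftrightarrow>
     {u, v} \<in> edges G \<and> 1 \<le> j \<and> j \<le> s u \<and> ({u, v} \<notin> C \<longrightarrow> eweight G {u, v} \<le> j)"

fun after_move :: "'a wgraph \<Rightarrow> 'a search_state \<Rightarrow> 'a move \<Rightarrow> 'a search_state" where
  "after_move G (C, s) (u, v, j) =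
     (let s' = s(u := s u - j, v := s v + j)
      in ({e \<in> edges G. \<not> contaminated G (insert {u, v} C) s' e}, s'))"

text \<open>The subgraph formed by a set \<open>C\<close> of edges has vertex set \<open>\<Union>C\<close>.\<close>

fun connected_search_from :: "'a wgraph \<Rightarrow> 'a search_state \<Rightarrow> 'a move list \<Rightarrow> bool" where
  "connected_search_from G (C, s) [] \<longleftrightarrow> C = edges G"
| "connected_search_from G (C, s) (m # ms) \<longleftrightarrow>
     legal_move G (C, s) m \<and>
     (let (C', s') = after_move G (C, s) m
      in connected_graph (\<Union>C') C' \<and> connected_search_from G (C', s') ms)"

definition connected_search_strategy :: "'a wgraph \<Rightarrow> nat \<Rightarrow> 'a \<Rightarrow> 'a move list \<Rightarrow> bool" where
  "connected_search_strategy G k r ms \<longleftrightarrow>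
     r \<in> verts G \<and> connected_search_from G ({}, (\<lambda>_. 0)(r := k)) ms"

definition connected_search_number :: "'a wgraph \<Rightarrow> nat" where
  "connected_search_number G = (LEAST k. \<exists>r ms. connected_search_strategy G k r ms)"

section \<open>Random access machines\<close>

text \<open>Unit-cost random access machines over the natural numbers, with structured control flow.
  The only arithmetic is addition and truncated subtraction, so that the cost measure is
  not inflated by multiplication of unbounded numbers. A program mentions only finitely many
  registers; unbounded storage is the memory, addressed through registers.
  Output is appended to a write-only tape.\<close>

type_synonym reg = nat

datatype test = Less reg reg | LessEq reg reg | Equal reg reg | NotEqual reg reg

datatype program =
    Skip
  | Const reg nat
  | Copy reg reg
  | Add reg reg reg
  | Sub reg reg reg
  | Load reg reg
  | Store reg reg
  | Write reg
  | Seq program program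
  | Cond test program program
  | While test program

record ram_state =
  regs :: "reg \<Rightarrow> nat"
  mem :: "nat \<Rightarrow> nat"
  out :: "nat list"

fun holds :: "test \<Rightarrow> ram_state \<Rightarrow> bool" where
  "holds (Less x y) \<sigma> \<longleftrightarrow> regs \<sigma> x < regs \<sigma> y"
| "holds (LessEq x y) \<sigma> \<longleftrightarrow> regs \<sigma> x \<le> regs \<sigma> y"
| "holds (Equal x y) \<sigma> \<longleftrightarrow> regs \<sigma> x = regs \<sigma> y"
| "holds (NotEqual x y) \<sigma> \<longleftrightarrow> regs \<sigma> x \<noteq> regs \<sigma> y"

definition set_reg :: "reg \<Rightarrow> nat \<Rightarrow> ram_state \<Rightarrow> ram_state" where
  "set_reg x a \<sigma> = \<sigma>\<lparr>regs := (regs \<sigma>)(x := a)\<rparr>"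

text \<open>\<open>exec P \<sigma> t \<sigma>'\<close>: started in \<open>\<sigma>\<close>, the program \<open>P\<close> halts in \<open>\<sigma>'\<close> after \<open>t\<close> steps, where every
  elementary instruction and every evaluation of a test is one step.\<close>

inductive exec :: "program \<Rightarrow> ram_state \<Rightarrow> nat \<Rightarrow> ram_state \<Rightarrow> bool" where
  Skip: "exec Skip \<sigma> 1 \<sigma>"
| Const: "exec (Const x a) \<sigma> 1 (set_reg x a \<sigma>)"
| Copy: "exec (Copy x y) \<sigma> 1 (set_reg x (regs \<sigma> y) \<sigma>)"
| Add: "exec (Add x y z) \<sigma> 1 (set_reg x (regs \<sigma> y + regs \<sigma> z) \<sigma>)"
| Sub: "exec (Sub x y z) \<sigma> 1 (set_reg x (regs \<sigma> y - regs \<sigma> z) \<sigma>)"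
| Load: "exec (Load x y) \<sigma> 1 (set_reg x (mem \<sigma> (regs \<sigma> y)) \<sigma>)"
| Store: "exec (Store x y) \<sigma> 1 (\<sigma>\<lparr>mem := (mem \<sigma>)(regs \<sigma> x := regs \<sigma> y)\<rparr>)"
| Write: "exec (Write x) \<sigma> 1 (\<sigma>\<lparr>out := out \<sigma> @ [regs \<sigma> x]\<rparr>)"
| Seq: "exec P \<sigma> t \<sigma>' \<Longrightarrow> exec Q \<sigma>' t' \<sigma>'' \<Longrightarrow> exec (Seq P Q) \<sigma> (t + t') \<sigma>''"
| CondTrue: "holds b \<sigma> \<Longrightarrow> exec P \<sigma> t \<sigma>' \<Longrightarrow> exec (Cond b P Q) \<sigma> (Suc t) \<sigma>'"
| CondFalse: "\<not> holds b \<sigma> \<Longrightarrow> exec Q \<sigma> t \<sigma>' \<Longrightarrow> exec (Cond b P Q) \<sigma> (Suc t) \<sigma>'"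
| WhileFalse: "\<not> holds b \<sigma> \<Longrightarrow> exec (While b P) \<sigma> 1 \<sigma>"
| WhileTrue: "holds b \<sigma> \<Longrightarrow> exec P \<sigma> t \<sigma>' \<Longrightarrow> exec (While b P) \<sigma>' t' \<sigma>'' \<Longrightarrow>
    exec (While b P) \<sigma> (Suc (t + t')) \<sigma>''"

inductive_cases exec_elims:
  "exec Skip \<sigma> t \<sigma>'" "exec (Const x a) \<sigma> t \<sigma>'" "exec (Copy x y) \<sigma> t \<sigma>'"
  "exec (Add x y z) \<sigma> t \<sigma>'" "exec (Sub x y z) \<sigma> t \<sigma>'" "exec (Load x y) \<sigma> t \<sigma>'"
  "exec (Store x y) \<sigma> t \<sigma>'" "exec (Write x) \<sigma> t \<sigma>'" "exec (Seq P Q) \<sigma> t \<sigma>'"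
  "exec (Cond b P Q) \<sigma> t \<sigma>'" "exec (While b P) \<sigma> t \<sigma>'"

lemma exec_deterministic:
  assumes "exec P \<sigma> t \<sigma>'" "exec P \<sigma> t' \<sigma>''"
  shows "t = t' \<and> \<sigma>' = \<sigma>''"
  using assms
proof (induction arbitrary: t' \<sigma>'' rule: exec.induct)
  case (Seq P \<sigma> t \<sigma>1 Q u \<sigma>2)
  from Seq.prems obtain a b \<tau> where "t' = a + b" "exec P \<sigma> a \<tau>" "exec Q \<tau> b \<sigma>''"
    by (rule exec_elims) auto
  with Seq.IH show ?case by metis
next
  case (CondTrue b \<sigma> P t \<sigma>1 Q)
  from CondTrue.prems obtain a where "t' = Suc a" "exec P \<sigma> a \<sigma>''"
    by (rule exec_elims) (use CondTrue.hyps in auto)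
  with CondTrue.IH show ?case by metis
next
  case (CondFalse b \<sigma> Q t \<sigma>1 P)
  from CondFalse.prems obtain a where "t' = Suc a" "exec Q \<sigma> a \<sigma>''"
    by (rule exec_elims) (use CondFalse.hyps in auto)
  with CondFalse.IH show ?case by metis
next
  case (WhileFalse b \<sigma> P)
  from WhileFalse.prems show ?case
    by (rule exec_elims) (use WhileFalse.hyps in auto)
next
  case (WhileTrue b \<sigma> P t \<sigma>1 u \<sigma>2)
  from WhileTrue.prems obtain a c \<tau>
    where "t' = Suc (a + c)" "exec P \<sigma> a \<tau>" "exec (While b P) \<tau> c \<sigma>''"
    by (rule exec_elims) (use WhileTrue.hyps in auto)
  with WhileTrue.IH show ?case by metis
qed (erule exec_elims; simp)+

definition initial_state :: "nat list \<Rightarrow> ram_state" where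
  "initial_state xs =
     \<lparr>regs = (\<lambda>_. 0), mem = (\<lambda>i. if i < length xs then xs ! i else 0), out = []\<rparr>"

section \<open>Encoding of inputs and outputs\<close>

text \<open>The vertices of an input graph are numbered \<open>0, \<dots>, n - 1\<close>; its edges are listed once each,
  in any order and orientation.\<close>

definition edge_listing :: "nat wgraph \<Rightarrow> (nat \<times> nat) list \<Rightarrow> bool" where
  "edge_listing G es \<longleftrightarrow> verts G = {..<card (verts G)} \<and>
     distinct (map (\<lambda>(u, v). {u, v}) es) \<and> (\<lambda>(u, v). {u, v}) ` set es = edges G"

definition encode_input :: "nat wgraph \<Rightarrow> (nat \<times> nat) list \<Rightarrow> nat list" where
  "encode_input G es =
     [card (verts G), length es] @ map (vweight G) [0..<card (verts G)] @
     concat (map (\<lambda>(u, v). [u, v, eweight G {u, v}]) es)"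

definition encode_strategy :: "nat \<Rightarrow> nat \<Rightarrow> nat move list \<Rightarrow> nat list" where
  "encode_strategy k r ms = [k, r] @ concat (map (\<lambda>(u, v, j). [u, v, j]) ms)"

end

theory Submission
  imports Defs
begin

text \<open>
  A connected search can be made monotone and is then described by a growing connected vertex set
  \<open>X\<close>: the searchers guard the boundary of \<open>X\<close>, whose total weight is \<open>cost X\<close>, and adding a vertex
  requires some further searchers for the slide. The boundary cost is submodular on connected subsets
  of a tree, so extensions reachable with the same number of searchers can be intersected and united.
  Monotonicity follows from this, and so does the following greedy principle.

  For a vertex \<open>v\<close> and a set \<open>R\<close> of its neighbours, consider the situation in which exactly the
  branches of \<open>v\<close> through \<open>R\<close> are still contaminated. Among the extensions into these branches whose
  cost is below the weight of \<open>v\<close>, take one with the least number of searchers and then the least cost;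
  call it the jump of \<open>(v, R)\<close>. Jumps at different boundary vertices of \<open>X\<close> do not interact, so
  repeatedly performing the affordable jumps is optimal: once none is affordable, the current cost is
  the minimum over everything reachable. The jump of \<open>(v, R)\<close> is itself found by trying each first
  neighbour \<open>c\<close> in \<open>R\<close> and then running jumps of pairs with smaller branches. Bounded degree leaves
  \<open>O(n)\<close> pairs \<open>(v, R)\<close>, each computed in \<open>O(n\<^sup>2)\<close> steps, and each possible starting vertex
  afterwards costs \<open>O(n\<^sup>2)\<close> steps as well.

  Searchers that guard nothing are kept at the starting vertex and are walked to the next edge and back,
  so a strategy consists of \<open>O(n\<^sup>2)\<close> moves.
\<close>

section \<open>Connected vertex sets of a weighted tree\<close>

text \<open>The independence of jumps is an exact decomposition: for \<open>X\<close> contained in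
  \<open>D\<close>, the cost of \<open>D\<close> is the sum, over the boundary vertices
  \<open>u\<close> of \<open>X\<close>, of the cost of \<open>D\<close> with all branches filled
  except those at \<open>u\<close>. Seen from one branch the rest of the tree is a constant number
  of guards. Hence a jump can be defined on the complement of its branches, whatever the current set
  is, and if no jump is affordable, no branch ever contributes less than its guard.

  Uniting an extension with the current set is harmless only while this set is a cheapest connected
  set between the start and itself; this is \<open>low\<close>, and the tie-breaking by cost makes
  every jump preserve it. Dually, a search can be cut down to \<open>Y\<close> when \<open>Y\<close>
  is cheapest among the connected sets above it inside the union; this yields monotonicity.

  A jump is stored as a list of records with two entries per new vertex. A run therefore appends
  O(n) entries, and each of its O(n) rounds is a linear scan and a copy, which keeps a run
  quadratic.\<close>

lemma simple_path:
  assumes "(a, b) \<in> {(x, y). {x, y} \<in> C}\<^sup>*"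
  shows "\<exists>xs. xs \<noteq> [] \<and> hd xs = a \<and> last xs = b \<and> distinct xs \<and>
           (\<forall>i. Suc i < length xs \<longrightarrow> {xs ! i, xs ! Suc i} \<in> C)"
  using assms
proof (induction rule: rtrancl_induct)
  case base
  show ?case by (rule exI[of _ "[a]"]) simp
next
  case (step b c)
  then obtain xs where xs: "xs \<noteq> []" "hd xs = a" "last xs = b" "distinct xs"
    "\<forall>i. Suc i < length xs \<longrightarrow> {xs ! i, xs ! Suc i} \<in> C" by blast
  show ?case
  proof (cases "c \<in> set xs")
    case True
    \<comment> \<open>The walk returns to \<open>c\<close>; cutting the path there keeps it
      simple.\<close>
    then obtain ys zs where s: "xs = ys @ c # zs" by (meson split_list)
    have "{(ys @ [c]) ! i, (ys @ [c]) ! Suc i} \<in> C" if "Suc i < length (ys @ [c])" for i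
    proof -
      have "(ys @ [c]) ! i = xs ! i" "(ys @ [c]) ! Suc i = xs ! Suc i"
        using that by (auto simp: s nth_append less_Suc_eq)
      then show ?thesis using xs(5) that by (simp add: s)
    qed
    moreover have "hd (ys @ [c]) = a" using xs(2) s by (cases ys) auto
    ultimately show ?thesis using xs(4) s by (intro exI[of _ "ys @ [c]"]) auto
  next
    case False
    have "{(xs @ [c]) ! i, (xs @ [c]) ! Suc i} \<in> C" if "Suc i < length (xs @ [c])" for i
    proof (cases "Suc i < length xs")
      case True
      then show ?thesis using xs(5) by (simp add: nth_append)
    next
      case nl: False
      then have "i = length xs - 1" "Suc i = length xs" using that xs(1) by auto
      then show ?thesis using step(2) xs(1,3) by (simp add: nth_append last_conv_nth)
    qed
    then show ?thesis using xs False by (intro exI[of _ "xs @ [c]"]) auto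
  qed
qed

locale wtree =
  fixes T :: "'a wgraph"
  assumes tree: "weighted_tree T"
begin

abbreviation "V \<equiv> verts T"
abbreviation "E \<equiv> edges T"
abbreviation "vw \<equiv> vweight T"
abbreviation "ew \<equiv> eweight T"

definition nb :: "'a \<Rightarrow> 'a set" where "nb v = {u. {u, v} \<in> E}"

definition arc :: "'a set \<Rightarrow> ('a \<times> 'a) set" where
  "arc S = {(a, b). a \<in> S \<and> b \<in> S \<and> {a, b} \<in> E}"

definition conn :: "'a set \<Rightarrow> bool" where
  "conn X \<longleftrightarrow> X \<noteq> {} \<and> X \<subseteq> V \<and> (\<forall>x\<in>X. \<forall>y\<in>X. (x, y) \<in> (arc X)\<^sup>*)"

definition bd :: "'a set \<Rightarrow> 'a set" where "bd X = {x \<in> X. \<not> nb x \<subseteq> X}"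

text \<open>The weight is a parameter because submodularity is also applied to
  \<open>vw(y := 0)\<close>, the guards that stay behind while \<open>y\<close> is entered.\<close>

definition cost :: "('a \<Rightarrow> nat) \<Rightarrow> 'a set \<Rightarrow> nat" where "cost w X = sum w (bd X)"

text \<open>\<open>p\<close> is the only neighbour of \<open>y\<close> in a connected set that
  contains \<open>p\<close> but not \<open>y\<close>. Hence the test
  \<open>nb y \<subseteq> {p}\<close> decides whether \<open>y\<close> will lie on the boundary, and
  the value depends on the edge alone.\<close>

definition slide :: "'a \<Rightarrow> 'a \<Rightarrow> nat" where
  "slide p y = max (ew {p, y}) (if nb y \<subseteq> {p} then 0 else vw y)"

text \<open>While \<open>y\<close> is being entered, the guards of all other boundary vertices of the new set stay behind;
  a leaf needs no guard, so the slide to it only has to pay for the edge.\<close>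

definition need :: "'a set \<Rightarrow> 'a \<Rightarrow> 'a \<Rightarrow> nat" where
  "need X p y = cost (vw(y := 0)) (insert y X) + slide p y"

text \<open>Only the steps are charged, not the starting set: \<open>reach b X X\<close> holds for
  every \<open>b\<close>, even below the cost of \<open>X\<close>. This matches the search game,
  where a lone starting vertex needs no guard before an edge is clear.\<close>

inductive reach :: "nat \<Rightarrow> 'a set \<Rightarrow> 'a set \<Rightarrow> bool" for b X where
  reach_refl: "reach b X X"
| reach_step: "reach b X Y \<Longrightarrow> p \<in> Y \<Longrightarrow> {p, y} \<in> E \<Longrightarrow> y \<notin> Y \<Longrightarrow> need Y p y \<le> b \<Longrightarrow>
    reach b X (insert y Y)"

section \<open>Trees, bridges and connected vertex sets\<close>

lemma finV: "finite V" and V_ne: "V \<noteq> {}"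
  using tree by (auto simp: weighted_tree_def finite_weighted_graph_def)

lemma vw_pos: "v \<in> V \<Longrightarrow> 0 < vw v" and ew_pos: "e \<in> E \<Longrightarrow> 0 < ew e"
  using tree by (auto simp: weighted_tree_def finite_weighted_graph_def)

lemma edge_card: "e \<in> E \<Longrightarrow> card e = 2" and edge_sub: "e \<in> E \<Longrightarrow> e \<subseteq> V"
  using tree by (auto simp: weighted_tree_def finite_weighted_graph_def)

lemma edgeD:
  assumes "{a, b} \<in> E" shows "a \<in> V" "b \<in> V" "a \<noteq> b"
  using edge_card[OF assms] edge_sub[OF assms] by auto

lemma edge_ends: "e \<in> E \<Longrightarrow> \<exists>a b. e = {a, b} \<and> a \<noteq> b"
  using edge_card card_2_iff by metis

lemma nb_iff: "u \<in> nb v \<longleftrightarrow> {u, v} \<in> E" "u \<in> nb v \<longleftrightarrow> {v, u} \<in> E"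
  by (auto simp: nb_def insert_commute)

lemma nb_sub: "nb v \<subseteq> V"
  using edgeD by (auto simp: nb_def)

lemma V_connected: "x \<in> V \<Longrightarrow> y \<in> V \<Longrightarrow> (x, y) \<in> {(a, b). {a, b} \<in> E}\<^sup>*"
  using tree by (auto simp: weighted_tree_def connected_graph_def)

text \<open>Every edge of a tree is a bridge: a simple path between its ends that avoids it has at
  least three vertices and closes up to a cycle. Acyclicity is used only in this form.
  \<open>R\<close> collects the steps of a walk, so it suffices to check that none of them is the
  edge.\<close>

lemma no_bypass:
  assumes R: "(a, b) \<in> R\<^sup>*" and sub: "R \<subseteq> {(x, y). {x, y} \<in> E \<and> {x, y} \<noteq> {a, b}}"
    and e: "{a, b} \<in> E"
  shows False
proof -
  have "(a, b) \<in> {(x, y). {x, y} \<in> E - {{a, b}}}\<^sup>*"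
    using R sub rtrancl_mono[of R "{(x, y). {x, y} \<in> E - {{a, b}}}"] by auto
  then obtain xs where xs: "xs \<noteq> []" "hd xs = a" "last xs = b" "distinct xs"
    "\<forall>i. Suc i < length xs \<longrightarrow> {xs ! i, xs ! Suc i} \<in> E - {{a, b}}"
    using simple_path[of a b "E - {{a, b}}"] by blast
  have "length xs \<ge> 3"
  proof (rule ccontr)
    assume "\<not> 3 \<le> length xs"
    moreover have "length xs \<noteq> 0" using xs(1) by simp
    ultimately have "length xs = 1 \<or> length xs = 2" by arith
    then show False
    proof
      assume "length xs = 1"
      then show False using xs(2,3) edgeD(3)[OF e] by (cases xs) auto
    next
      assume l: "length xs = 2"
      then have "xs ! 0 = a" "xs ! 1 = b" using xs by (auto simp: hd_conv_nth last_conv_nth)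
      then show False using xs(5) l by (metis DiffE One_nat_def Suc_1 lessI singletonI)
    qed
  qed
  then have "is_cycle E xs" using xs e by (auto simp: is_cycle_def insert_commute)
  then show False using tree by (auto simp: weighted_tree_def)
qed

lemma sym_arc: "sym (arc S)"
  by (auto simp: sym_def arc_def insert_commute)

lemma arc_sym: "(a, b) \<in> (arc S)\<^sup>* \<Longrightarrow> (b, a) \<in> (arc S)\<^sup>*"
  using sym_rtrancl[OF sym_arc] by (auto simp: sym_def)

lemma arc_mono: "S \<subseteq> S' \<Longrightarrow> (a, b) \<in> (arc S)\<^sup>* \<Longrightarrow> (a, b) \<in> (arc S')\<^sup>*"
  by (rule rtrancl_mono[THEN subsetD, of "arc S"]) (auto simp: arc_def)

lemma arc_in: "(a, b) \<in> (arc S)\<^sup>* \<Longrightarrow> a \<in> S \<Longrightarrow> b \<in> S"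
  by (induction rule: rtrancl_induct) (auto simp: arc_def)

lemma conn_V: "conn V"
proof -
  have "arc V = {(a, b). {a, b} \<in> E}" using edgeD by (auto simp: arc_def)
  then show ?thesis using V_connected V_ne by (auto simp: conn_def)
qed

lemma conn_sub: "conn X \<Longrightarrow> X \<subseteq> V" and conn_ne: "conn X \<Longrightarrow> X \<noteq> {}"
  by (auto simp: conn_def)

lemma conn_fin: "conn X \<Longrightarrow> finite X"
  using conn_sub finV finite_subset by blast

lemma conn_single: "v \<in> V \<Longrightarrow> conn {v}"
  by (auto simp: conn_def)

lemma conn_star:
  assumes "x \<in> X" "X \<subseteq> V" "\<And>y. y \<in> X \<Longrightarrow> (x, y) \<in> (arc X)\<^sup>*"
  shows "conn X"
  unfolding conn_def using assms arc_sym by (metis empty_iff rtrancl_trans)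

lemma conn_Un:
  assumes "conn X" "conn Y" "X \<inter> Y \<noteq> {}"
  shows "conn (X \<union> Y)"
proof -
  obtain x where x: "x \<in> X" "x \<in> Y" using assms by auto
  show ?thesis
  proof (rule conn_star[of x])
    show "x \<in> X \<union> Y" "X \<union> Y \<subseteq> V" using x assms conn_sub by auto
    fix y assume "y \<in> X \<union> Y"
    then show "(x, y) \<in> (arc (X \<union> Y))\<^sup>*"
      using arc_mono[of X "X \<union> Y" x y] arc_mono[of Y "X \<union> Y" x y] x assms by (auto simp: conn_def)
  qed
qed

lemma conn_insert:
  assumes "conn X" "p \<in> X" "{p, y} \<in> E"
  shows "conn (insert y X)"
proof (rule conn_star[of p])
  show "p \<in> insert y X" "insert y X \<subseteq> V" using assms conn_sub edgeD by auto
  fix z assume "z \<in> insert y X"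
  then show "(p, z) \<in> (arc (insert y X))\<^sup>*"
    using arc_mono[of X "insert y X" p z] assms by (auto simp: conn_def arc_def)
qed

text \<open>A walk in \<open>X\<close> that leaves \<open>Y\<close> through the edge
  \<open>{z, x'}\<close> can come back only at \<open>z\<close>: otherwise a walk inside
  \<open>Y\<close>, the returning edge and the excursion outside \<open>Y\<close> together bypass
  \<open>{z, x'}\<close>. The induction therefore remembers the exit edge while the walk is outside
  \<open>Y\<close>.\<close>

lemma conn_Int:
  assumes X: "conn X" and Y: "conn Y" and ne: "X \<inter> Y \<noteq> {}"
  shows "conn (X \<inter> Y)"
proof -
  obtain a where a: "a \<in> X" "a \<in> Y" using ne by auto
  have main: "(x \<in> Y \<longrightarrow> (a, x) \<in> (arc (X \<inter> Y))\<^sup>*) \<and>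
      (x \<notin> Y \<longrightarrow> (\<exists>z x'. z \<in> X \<inter> Y \<and> (a, z) \<in> (arc (X \<inter> Y))\<^sup>* \<and> x' \<in> X - Y \<and> {z, x'} \<in> E \<and>
         (x', x) \<in> (arc (X - Y))\<^sup>*))" if "(a, x) \<in> (arc X)\<^sup>*" for x
    using that
  proof (induction rule: rtrancl_induct)
    case base
    then show ?case using a by simp
  next
    case (step x y)
    then have xy: "x \<in> X" "y \<in> X" "{x, y} \<in> E" by (auto simp: arc_def)
    show ?case
    proof (cases "x \<in> Y")
      case True
      then have ax: "(a, x) \<in> (arc (X \<inter> Y))\<^sup>*" using step by simp
      show ?thesis
      proof (cases "y \<in> Y")
        case yY: True
        have "(x, y) \<in> arc (X \<inter> Y)" using xy True yY by (auto simp: arc_def)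
        then show ?thesis using ax yY by (meson rtrancl.rtrancl_into_rtrancl)
      next
        case False
        then show ?thesis using ax xy True by blast
      qed
    next
      case False
      then obtain z x' where z: "z \<in> X \<inter> Y" "(a, z) \<in> (arc (X \<inter> Y))\<^sup>*" "x' \<in> X - Y" "{z, x'} \<in> E"
         "(x', x) \<in> (arc (X - Y))\<^sup>*" using step by blast
      show ?thesis
      proof (cases "y \<in> Y")
        case yY: True
        show ?thesis
        proof (cases "y = z")
          case True
          then show ?thesis using z yY by simp
        next
          case yz: False
          let ?R = "{(p, q). {p, q} \<in> E \<and> {p, q} \<noteq> {z, x'}}"
          have "arc Y \<subseteq> ?R" using z(3) by (auto simp: arc_def doubleton_eq_iff)
          moreover have "(z, y) \<in> (arc Y)\<^sup>*" using Y z(1) yY by (auto simp: conn_def)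
          ultimately have 1: "(z, y) \<in> ?R\<^sup>*" using rtrancl_mono by blast
          have "{y, x} \<noteq> {z, x'}" using yz yY z(3) by (auto simp: doubleton_eq_iff)
          then have 2: "(y, x) \<in> ?R" using xy by (auto simp: insert_commute)
          have "arc (X - Y) \<subseteq> ?R" using z(1) by (auto simp: arc_def doubleton_eq_iff)
          moreover have "(x, x') \<in> (arc (X - Y))\<^sup>*" using z(5) arc_sym by blast
          ultimately have 3: "(x, x') \<in> ?R\<^sup>*" using rtrancl_mono by blast
          have "(z, x') \<in> ?R\<^sup>*" using 1 2 3 by (meson rtrancl.rtrancl_into_rtrancl rtrancl_trans)
          then show ?thesis using no_bypass[of z x' ?R] z(4) by blast
        qed
      next
        case nY: False
        have "(x, y) \<in> arc (X - Y)" using xy False nY by (auto simp: arc_def)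
        then show ?thesis using z nY by (meson rtrancl.rtrancl_into_rtrancl)
      qed
    qed
  qed
  show ?thesis
  proof (rule conn_star[of a])
    show "a \<in> X \<inter> Y" "X \<inter> Y \<subseteq> V" using a X conn_sub by auto
    fix y assume "y \<in> X \<inter> Y"
    then show "(a, y) \<in> (arc (X \<inter> Y))\<^sup>*" using main[of y] X a by (auto simp: conn_def)
  qed
qed

text \<open>Two different neighbours \<open>p\<close> and \<open>q\<close> of \<open>y\<close> would
  be joined inside \<open>X\<close>, and going on from \<open>q\<close> to \<open>y\<close> would
  bypass the edge \<open>{p, y}\<close>.\<close>

lemma conn_unique_nb:
  assumes X: "conn X" and y: "y \<notin> X" and p: "p \<in> X" "{p, y} \<in> E" and q: "q \<in> X" "{q, y} \<in> E"
  shows "p = q"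
proof (rule ccontr)
  assume pq: "p \<noteq> q"
  let ?R = "{(a, b). {a, b} \<in> E \<and> {a, b} \<noteq> {p, y}}"
  have "arc X \<subseteq> ?R" using y by (auto simp: arc_def doubleton_eq_iff)
  moreover have "(p, q) \<in> (arc X)\<^sup>*" using X p q by (auto simp: conn_def)
  ultimately have "(p, q) \<in> ?R\<^sup>*" using rtrancl_mono by blast
  moreover have "(q, y) \<in> ?R" using q pq y p by (auto simp: doubleton_eq_iff)
  ultimately have "(p, y) \<in> ?R\<^sup>*" by (meson rtrancl.rtrancl_into_rtrancl)
  then show False using no_bypass[of p y ?R] p by blast
qed

lemma conn_nb:
  assumes "conn X" "y \<in> X" "X \<noteq> {y}"
  shows "\<exists>q\<in>X. {q, y} \<in> E"
proof -
  obtain x where x: "x \<in> X" "x \<noteq> y" using assms by blast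
  then have "(x, y) \<in> (arc X)\<^sup>*" using assms by (auto simp: conn_def)
  then show ?thesis using x by (cases rule: rtranclE) (auto simp: arc_def)
qed

section \<open>Boundary cost and its submodularity\<close>

lemma bd_sub: "bd X \<subseteq> X"
  by (auto simp: bd_def)

lemma fin_bd: "X \<subseteq> V \<Longrightarrow> finite (bd X)"
  using finV bd_sub finite_subset by (metis order_trans)

lemma cost_alt: "X \<subseteq> V \<Longrightarrow> cost w X = (\<Sum>x\<in>V. if x \<in> bd X then w x else 0)"
  unfolding cost_def using finV bd_sub by (subst sum.If_cases) (auto intro!: sum.cong)

text \<open>The inequality holds vertex by vertex. A boundary vertex of the intersection or of the
  union is a boundary vertex of \<open>X\<close> or of \<open>Y\<close>; one that is counted twice
  on the left lies in both sets and has a neighbour outside both, so it is also counted twice on the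
  right.\<close>

lemma cost_submod:
  assumes "X \<subseteq> V" "Y \<subseteq> V"
  shows "cost w (X \<inter> Y) + cost w (X \<union> Y) \<le> cost w X + cost w Y"
proof -
  have "X \<inter> Y \<subseteq> V" "X \<union> Y \<subseteq> V" using assms by auto
  then show ?thesis using assms
    by (simp add: cost_alt flip: sum.distrib) (rule sum_mono, auto simp: bd_def)
qed

lemma cost_upd:
  assumes "X \<subseteq> V"
  shows "cost w X = cost (w(y := 0)) X + (if y \<in> bd X then w y else 0)"
proof (cases "y \<in> bd X")
  case True
  then show ?thesis unfolding cost_def
    by (simp add: sum.remove[OF fin_bd[OF assms] True])
next
  case False
  then show ?thesis unfolding cost_def by (auto intro: sum.cong)
qed

lemma cost_cong: "(\<And>x. x \<in> bd X \<Longrightarrow> w x = w' x) \<Longrightarrow> cost w X = cost w' X"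
  unfolding cost_def by (rule sum.cong) auto

lemma cost_upd_out: "y \<notin> X \<Longrightarrow> cost (w(y := 0)) X = cost w X"
  by (rule cost_cong) (auto simp: bd_def)

lemma cost_V: "cost w V = 0"
  using nb_sub by (auto simp: cost_def bd_def)

lemma bd_ne:
  assumes "conn X" "X \<noteq> V" shows "bd X \<noteq> {}"
proof -
  obtain y x where yx: "y \<in> V" "y \<notin> X" "x \<in> X" using assms conn_sub conn_ne by blast
  have "(x, y) \<in> (arc V)\<^sup>*" using conn_V yx assms conn_sub by (auto simp: conn_def)
  then have "y \<notin> X \<longrightarrow> bd X \<noteq> {}"
  proof (induction rule: rtrancl_induct)
    case (step y z)
    then show ?case by (auto simp: arc_def bd_def nb_def insert_commute)
  qed (use yx in auto)
  then show ?thesis using yx by simp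
qed

section \<open>Cutting down and uniting monotone extensions\<close>

lemma reach_conn: "reach b X Y \<Longrightarrow> conn X \<Longrightarrow> conn Y"
  by (induction rule: reach.induct) (auto intro: conn_insert)

lemma reach_sup: "reach b X Y \<Longrightarrow> X \<subseteq> Y"
  by (induction rule: reach.induct) auto

lemma reach_trans: "reach b Y Z \<Longrightarrow> reach b X Y \<Longrightarrow> reach b X Z"
  by (induction rule: reach.induct) (auto intro: reach.intros)

text \<open>The inductive definition adds the last vertex; this splits off the first one
  instead.\<close>

lemma reach_first:
  "reach b X Y \<Longrightarrow> Y = X \<or> (\<exists>p y. p \<in> X \<and> {p, y} \<in> E \<and> y \<notin> X \<and> need X p y \<le> b \<and> reach b (insert y X) Y)"
  by (induction rule: reach.induct) (blast intro: reach.intros)+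

text \<open>The condition under which extensions of \<open>X0\<close> can be carried over to
  \<open>X\<close> by union, see \<open>reach_Un\<close>.\<close>

definition low :: "'a set \<Rightarrow> 'a set \<Rightarrow> bool" where
  "low X0 X \<longleftrightarrow> (\<forall>D. conn D \<and> X0 \<subseteq> D \<and> D \<subseteq> X \<longrightarrow> cost vw X \<le> cost vw D)"

text \<open>\<open>insert y Z \<inter> Y\<close> is connected and larger than \<open>{y}\<close>, so
  it contains a neighbour of \<open>y\<close>, which can only be \<open>p\<close>. The bound is
  submodularity for \<open>insert y Z\<close> and \<open>Y\<close> with the guard of
  \<open>y\<close> removed, together with the minimality of \<open>Y\<close>.\<close>

lemma step_Int:
  assumes Z: "conn Z" and p: "p \<in> Z" "{p, y} \<in> E" "y \<notin> Z" and Y: "conn Y" "y \<in> Y" "Z \<inter> Y \<noteq> {}"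
    and n: "need Z p y \<le> b"
    and min: "cost vw Y \<le> cost vw (Z \<union> Y)"
  shows "p \<in> Y" "need (Z \<inter> Y) p y \<le> b"
proof -
  have ZY: "conn (insert y Z \<inter> Y)" using conn_Int[OF conn_insert[OF Z p(1,2)] Y(1)] Y(3) by blast
  have "insert y Z \<inter> Y \<noteq> {y}" using Y p by auto
  then obtain q where q: "q \<in> insert y Z \<inter> Y" "{q, y} \<in> E"
    using conn_nb[OF ZY, of y] Y(2) by blast
  then have "q \<in> Z" using edgeD(3) by auto
  then have "q = p" using conn_unique_nb[OF Z p(3) _ q(2) p(1,2)] by blast
  then show "p \<in> Y" using q by auto
  let ?w = "vw(y := 0)"
  have sub: "insert y Z \<subseteq> V" "Y \<subseteq> V" using conn_sub[OF conn_insert[OF Z p(1,2)]] conn_sub[OF Y(1)] .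
  have e: "insert y Z \<inter> Y = insert y (Z \<inter> Y)" "insert y Z \<union> Y = Z \<union> Y" using Y(2) by auto
  have "cost ?w (insert y (Z \<inter> Y)) + cost ?w (Z \<union> Y) \<le> cost ?w (insert y Z) + cost ?w Y"
    using cost_submod[OF sub, of ?w] unfolding e .
  moreover have "cost ?w Y \<le> cost ?w (Z \<union> Y)"
  proof -
    \<comment> \<open>Removing the guard of \<open>y\<close> lowers the cost of \<open>Y\<close> at
      least as much as that of \<open>Z \<union> Y\<close>, so the minimality survives the change of
      weights.\<close>
    have "y \<in> bd (Z \<union> Y) \<Longrightarrow> y \<in> bd Y" using Y(2) by (auto simp: bd_def)
    moreover have "Z \<union> Y \<subseteq> V" using sub by auto
    ultimately show ?thesis using min cost_upd[of "Z \<union> Y" vw y] cost_upd[OF sub(2), of vw y]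
      by (auto split: if_splits)
  qed
  ultimately show "need (Z \<inter> Y) p y \<le> b" using n by (simp add: need_def)
qed

text \<open>Steps to vertices outside \<open>Y\<close> are dropped; the others stay within the
  budget by \<open>step_Int\<close>. Minimality of \<open>Y\<close> is assumed inside the final
  union and hence holds inside the unions with all earlier sets.\<close>

lemma reach_Int:
  assumes "reach b Z0 Z" "conn Z0" "conn Y" "Z0 \<inter> Y \<noteq> {}"
    and "\<And>D. conn D \<Longrightarrow> Y \<subseteq> D \<Longrightarrow> D \<subseteq> Z \<union> Y \<Longrightarrow> cost vw Y \<le> cost vw D"
  shows "reach b (Z0 \<inter> Y) (Z \<inter> Y)"
  using assms
proof (induction rule: reach.induct)
  case reach_refl
  then show ?case by (intro reach.reach_refl)
next
  case (reach_step Z p y)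
  have IH: "reach b (Z0 \<inter> Y) (Z \<inter> Y)" using reach_step by blast
  show ?case
  proof (cases "y \<in> Y")
    case True
    have Z: "conn Z" using reach_step reach_conn by blast
    have ne: "Z \<inter> Y \<noteq> {}" using reach_sup[OF reach_step(1)] reach_step by blast
    have m: "cost vw Y \<le> cost vw (Z \<union> Y)" by (rule reach_step.prems) (use conn_Un Z reach_step ne in auto)
    note s = step_Int[OF Z reach_step(2,3,4) reach_step.prems(2) True ne reach_step(5) m]
    have "reach b (Z0 \<inter> Y) (insert y (Z \<inter> Y))"
      using reach.reach_step[OF IH _ reach_step(3) _ s(2)] s(1) reach_step by auto
    then show ?thesis using True by simp
  qed (use IH in simp)
qed

text \<open>The starting vertex may lie outside \<open>Y\<close>. The restricted search then starts
  at the first vertex of \<open>Y\<close> that is reached, which costs nothing because starting sets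
  are not charged.\<close>

lemma reach_Int_single:
  assumes "reach b {r} Z" "r \<in> V" "conn Y"
    and "\<And>D. conn D \<Longrightarrow> Y \<subseteq> D \<Longrightarrow> D \<subseteq> Z \<union> Y \<Longrightarrow> cost vw Y \<le> cost vw D"
  shows "Z \<inter> Y = {} \<or> (\<exists>r'\<in>V. reach b {r'} (Z \<inter> Y))"
  using assms
proof (induction rule: reach.induct)
  case reach_refl
  then show ?case by (cases "r \<in> Y") (auto intro: reach.reach_refl)
next
  case (reach_step Z p y)
  have IH: "Z \<inter> Y = {} \<or> (\<exists>r'\<in>V. reach b {r'} (Z \<inter> Y))" using reach_step by blast
  have Z: "conn Z" using reach_step reach_conn conn_single by blast
  show ?case
  proof (cases "y \<in> Y")
    case True
    show ?thesis
    proof (cases "Z \<inter> Y = {}")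
      case True
      then have "insert y Z \<inter> Y = {y}" using \<open>y \<in> Y\<close> by auto
      moreover have "y \<in> V" using edgeD reach_step by blast
      ultimately show ?thesis by (metis reach.reach_refl)
    next
      case ne: False
      then obtain r' where r': "r' \<in> V" "reach b {r'} (Z \<inter> Y)" using IH by blast
      have m: "cost vw Y \<le> cost vw (Z \<union> Y)" by (rule reach_step.prems) (use conn_Un Z reach_step ne in auto)
      note s = step_Int[OF Z reach_step(2,3,4) reach_step.prems(2) True ne reach_step(5) m]
      have "reach b {r'} (insert y (Z \<inter> Y))"
        using reach.reach_step[OF r'(2) _ reach_step(3) _ s(2)] s(1) reach_step by auto
      then show ?thesis using True r' by auto
    qed
  qed (use IH in simp)
qed

text \<open>As \<open>X\<close> is cheapest above \<open>X0\<close>, it costs at most as much as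
  \<open>X \<inter> Y\<close> for each \<open>Y\<close> reached from \<open>X0\<close>, and
  submodularity makes \<open>X \<union> Y\<close> at most as expensive as \<open>Y\<close>. For a
  single step the same argument runs with the weight of the new vertex set to 0, which affects
  neither \<open>X\<close> nor the intersection.\<close>

lemma reach_Un:
  assumes "reach b X0 Y" "conn X0" "conn X" "X0 \<subseteq> X" "low X0 X"
  shows "reach b X (X \<union> Y)" "cost vw (X \<union> Y) \<le> cost vw Y"
proof -
  have low': "cost vw X \<le> cost vw (X \<inter> Y')" if "reach b X0 Y'" for Y'
  proof -
    have "conn Y'" "X0 \<subseteq> Y'" using that reach_conn reach_sup assms by blast+
    moreover have "X \<inter> Y' \<noteq> {}" using calculation assms conn_ne by blast
    ultimately show ?thesis using assms conn_Int unfolding low_def by (metis Int_lower1 le_inf_iff)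
  qed
  have "conn Y" using assms reach_conn by blast
  then show "cost vw (X \<union> Y) \<le> cost vw Y"
    using cost_submod[of X Y vw] low'[OF assms(1)] conn_sub assms(3) by (smt (verit) add.commute add_le_cancel_left le_trans add_le_mono)
  show "reach b X (X \<union> Y)" using assms(1)
  proof (induction rule: reach.induct)
    case reach_refl
    then show ?case using assms by (simp add: Un_absorb2 reach.reach_refl)
  next
    case (reach_step Y p y)
    show ?case
    proof (cases "y \<in> X")
      case True
      then show ?thesis using reach_step by (simp add: insert_absorb)
    next
      case False
      let ?w = "vw(y := 0)"
      have Y: "conn Y" using reach_step assms reach_conn by blast
      have iY: "insert y Y \<subseteq> V" using conn_insert[OF Y reach_step(2,3)] conn_sub by blast
      have "cost ?w (X \<inter> insert y Y) + cost ?w (X \<union> insert y Y) \<le> cost ?w X + cost ?w (insert y Y)"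
        by (rule cost_submod) (use iY assms conn_sub in auto)
      moreover have "X \<inter> insert y Y = X \<inter> Y" using False by auto
      moreover have "cost ?w X = cost vw X" "cost ?w (X \<inter> Y) = cost vw (X \<inter> Y)"
        using False by (auto intro!: cost_upd_out)
      ultimately have "cost ?w (insert y (X \<union> Y)) \<le> cost ?w (insert y Y)"
        using low'[OF reach_step(1)] by simp
      then have "need (X \<union> Y) p y \<le> b" using reach_step(5) by (simp add: need_def)
      then have "reach b X (insert y (X \<union> Y))"
        using reach.reach_step[OF reach_step.IH _ reach_step(3)] reach_step False by auto
      then show ?thesis by simp
    qed
  qed
qed

text \<open>A cheapest connected set between \<open>X\<close> and \<open>Z\<close> is itself
  reachable, by cutting the search for \<open>Z\<close> down to it. The starting vertex may
  change.\<close>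

lemma low_exists:
  assumes X: "conn X" and Z: "X \<subseteq> Z" "r \<in> V" "reach b {r} Z"
  shows "\<exists>Z' r'. X \<subseteq> Z' \<and> r' \<in> V \<and> reach b {r'} Z' \<and> low X Z'"
proof -
  have cZ: "conn Z" using Z reach_conn conn_single by blast
  obtain Y where Y: "conn Y" "X \<subseteq> Y" "Y \<subseteq> Z"
    and min: "\<And>D. conn D \<Longrightarrow> X \<subseteq> D \<Longrightarrow> D \<subseteq> Z \<Longrightarrow> cost vw Y \<le> cost vw D"
    using ex_has_least_nat[of "\<lambda>D. conn D \<and> X \<subseteq> D \<and> D \<subseteq> Z" Z "cost vw"] cZ Z by blast
  have "Z \<inter> Y = {} \<or> (\<exists>r'\<in>V. reach b {r'} (Z \<inter> Y))"
    by (rule reach_Int_single[OF Z(3,2) Y(1)]) (use Y min in blast)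
  moreover have "Z \<inter> Y = Y" "Y \<noteq> {}" using Y conn_ne by auto
  ultimately show ?thesis using Y min unfolding low_def by (metis order_trans)
qed

end

section \<open>Branches at a boundary vertex\<close>

context wtree begin

definition branch :: "'a \<Rightarrow> 'a set \<Rightarrow> 'a set" where
  "branch u R = {y. \<exists>c\<in>R. (c, y) \<in> (arc (V - {u}))\<^sup>*}"

text \<open>The situation in which only the branches of \<open>u\<close> through \<open>R\<close>
  are contaminated. For \<open>u \<in> V\<close> and \<open>R \<subseteq> nb u\<close> its boundary
  is at most \<open>{u}\<close>, so it is a standard starting set for the jumps at \<open>u\<close>,
  independent of any current set.\<close>

definition core :: "'a \<Rightarrow> 'a set \<Rightarrow> 'a set" where
  "core u R = V - branch u R"

lemma branch_sub:
  assumes "R \<subseteq> nb u" shows "branch u R \<subseteq> V - {u}"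
proof
  fix y assume "y \<in> branch u R"
  then obtain c where c: "c \<in> R" "(c, y) \<in> (arc (V - {u}))\<^sup>*" by (auto simp: branch_def)
  then have "{c, u} \<in> E" using assms by (auto simp: nb_def)
  then have "c \<in> V - {u}" using edgeD by auto
  then show "y \<in> V - {u}" using arc_in c by blast
qed

lemma branch_R: "R \<subseteq> branch u R"
  by (auto simp: branch_def)

lemma branch_closed:
  assumes "R \<subseteq> nb u" "y \<in> branch u R" "{y, z} \<in> E" "z \<noteq> u"
  shows "z \<in> branch u R"
proof -
  have "(y, z) \<in> arc (V - {u})" using assms branch_sub edgeD[OF assms(3)] by (auto simp: arc_def)
  then show ?thesis using assms(2) unfolding branch_def by (auto intro: rtrancl.rtrancl_into_rtrancl)
qed

text \<open>A path inside \<open>X\<close> from \<open>u\<close> to a common vertex, continued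
  without \<open>u\<close> to some \<open>c \<in> R\<close>, would bypass the edge
  \<open>{u, c}\<close>.\<close>

lemma branch_disj:
  assumes X: "conn X" "u \<in> X" and R: "R \<subseteq> nb u" "R \<inter> X = {}"
  shows "branch u R \<inter> X = {}"
proof (rule ccontr)
  assume "branch u R \<inter> X \<noteq> {}"
  then obtain y c where y: "y \<in> X" "c \<in> R" "(c, y) \<in> (arc (V - {u}))\<^sup>*" by (auto simp: branch_def)
  have uc: "{u, c} \<in> E" "c \<notin> X" using y R by (auto simp: nb_def insert_commute)
  let ?R = "{(a, b). {a, b} \<in> E \<and> {a, b} \<noteq> {u, c}}"
  have "arc X \<subseteq> ?R" using uc by (auto simp: arc_def doubleton_eq_iff)
  moreover have "(u, y) \<in> (arc X)\<^sup>*" using X y by (auto simp: conn_def)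
  ultimately have 1: "(u, y) \<in> ?R\<^sup>*" using rtrancl_mono by blast
  have "arc (V - {u}) \<subseteq> ?R" by (auto simp: arc_def doubleton_eq_iff)
  moreover have "(y, c) \<in> (arc (V - {u}))\<^sup>*" using y arc_sym by blast
  ultimately have "(y, c) \<in> ?R\<^sup>*" using rtrancl_mono by blast
  with 1 have "(u, c) \<in> ?R\<^sup>*" by (rule rtrancl_trans)
  then show False using no_bypass[of u c ?R] uc by blast
qed

text \<open>A walk from \<open>X\<close> to \<open>y\<close> enters a branch whenever it leaves
  \<open>X\<close>, and it can leave this branch only through its root, which lies in
  \<open>X\<close>.\<close>

lemma branch_cover:
  assumes X: "conn X" and y: "y \<in> V" "y \<notin> X"
  shows "\<exists>u\<in>bd X. y \<in> branch u (nb u - X)"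
proof -
  obtain x where x: "x \<in> X" using X conn_ne by blast
  have "(x, y) \<in> (arc V)\<^sup>*" using conn_V y x conn_sub[OF X] by (auto simp: conn_def)
  then have "y \<notin> X \<longrightarrow> (\<exists>u\<in>bd X. y \<in> branch u (nb u - X))"
  proof (induction rule: rtrancl_induct)
    case base
    then show ?case using x by simp
  next
    case (step y z)
    then have yz: "{y, z} \<in> E" "y \<in> V" "z \<in> V" by (auto simp: arc_def)
    show ?case
    proof
      assume z: "z \<notin> X"
      show "\<exists>u\<in>bd X. z \<in> branch u (nb u - X)"
      proof (cases "y \<in> X")
        case True
        have "z \<in> nb y" using yz by (simp add: nb_iff(2))
        then have "y \<in> bd X" "z \<in> nb y - X" using True z by (auto simp: bd_def)
        then show ?thesis using branch_R by blast
      next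
        case False
        then obtain u where u: "u \<in> bd X" "y \<in> branch u (nb u - X)" using step by blast
        have "z \<noteq> u" using u z bd_sub by blast
        then show ?thesis using branch_closed[OF _ u(2) yz(1)] u by blast
      qed
    qed
  qed
  then show ?thesis using y by simp
qed

lemma branch_nb:
  assumes "conn X" "u \<in> X" "y \<in> branch u (nb u - X)" "{y, z} \<in> E"
  shows "z \<in> insert u (branch u (nb u - X))"
  using branch_closed[OF _ assms(3,4)] by auto

text \<open>From a common vertex there is a walk to a neighbour \<open>c'\<close> of
  \<open>u'\<close> that avoids \<open>u'\<close>. It stays in both branches and so misses
  \<open>u\<close> as well; the last edge then puts \<open>u'\<close> into the branches of
  \<open>u\<close>, although it lies in \<open>X\<close>.\<close>

lemma branch_unique:
  assumes X: "conn X" and u: "u \<in> X" "u' \<in> X" "u \<noteq> u'"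
  shows "branch u (nb u - X) \<inter> branch u' (nb u' - X) = {}"
proof (rule ccontr)
  assume "\<not> ?thesis"
  then obtain y where y: "y \<in> branch u (nb u - X)" "y \<in> branch u' (nb u' - X)" by blast
  then obtain c' where c': "c' \<in> nb u' - X" "(c', y) \<in> (arc (V - {u'}))\<^sup>*"
    unfolding branch_def by blast
  have disj: "branch u (nb u - X) \<inter> X = {}" "branch u' (nb u' - X) \<inter> X = {}"
    using branch_disj[OF X u(1), of "nb u - X"] branch_disj[OF X u(2), of "nb u' - X"] by auto
  have "(y, c') \<in> (arc (V - {u'}))\<^sup>*" using c' arc_sym by blast
  then have "c' \<in> branch u (nb u - X) \<and> c' \<in> branch u' (nb u' - X)"
  proof (induction rule: rtrancl_induct)
    case base
    then show ?case using y by simp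
  next
    case (step a b)
    have ab: "{a, b} \<in> E" "b \<noteq> u'" using step(2) by (auto simp: arc_def)
    have 1: "b \<in> branch u' (nb u' - X)" using step.IH ab branch_closed[of "nb u' - X" u' a b] by auto
    then have "b \<noteq> u" using disj u by blast
    then show ?case using 1 step.IH ab branch_closed[of "nb u - X" u a b] by auto
  qed
  moreover have "{c', u'} \<in> E" using c' by (auto simp: nb_def)
  ultimately have "u' \<in> branch u (nb u - X)" using branch_closed[of "nb u - X" u c' u'] u by blast
  then show False using disj u by blast
qed

lemma conn_core:
  assumes R: "R \<subseteq> nb u" "u \<in> V"
  shows "conn (core u R)"
proof (rule conn_star[of u])
  show "u \<in> core u R" "core u R \<subseteq> V" using branch_sub R by (auto simp: core_def)
  fix y assume y: "y \<in> core u R"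
  then have "(y, u) \<in> (arc V)\<^sup>*" using conn_V R by (auto simp: conn_def core_def)
  then have "y \<in> core u R \<longrightarrow> (y, u) \<in> (arc (core u R))\<^sup>*"
  proof (induction rule: converse_rtrancl_induct)
    case (step y z)
    have yz: "{z, y} \<in> E" "y \<in> V" "z \<in> V" using step(1) by (auto simp: arc_def insert_commute)
    show ?case
    proof
      assume y: "y \<in> core u R"
      show "(y, u) \<in> (arc (core u R))\<^sup>*"
      proof (cases "z \<in> core u R")
        case True
        then have "(y, z) \<in> arc (core u R)" using y yz by (auto simp: arc_def insert_commute)
        then show ?thesis using step.IH True by (meson converse_rtrancl_into_rtrancl)
      next
        case False
        then have "z \<in> branch u R" using yz by (auto simp: core_def)
        then have "y = u" using branch_closed[OF R(1) _ yz(1)] y by (auto simp: core_def)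
        then show ?thesis by simp
      qed
    qed
  qed simp
  then show "(u, y) \<in> (arc (core u R))\<^sup>*" using y arc_sym by blast
qed

lemma core_self: "R \<subseteq> nb u \<Longrightarrow> u \<in> V \<Longrightarrow> u \<in> core u R"
  using branch_sub by (auto simp: core_def)

lemma nb_core:
  assumes R: "R \<subseteq> nb u" "u \<in> V"
  shows "nb u - core u R = R"
proof
  show "R \<subseteq> nb u - core u R" using R branch_R by (auto simp: core_def)
  have cs: "conn {u}" using R conn_single by blast
  show "nb u - core u R \<subseteq> R"
  proof
    fix c assume c: "c \<in> nb u - core u R"
    then have c': "c \<in> branch u R" "{u, c} \<in> E" using nb_sub[of u] by (auto simp: core_def nb_iff(2) subset_iff)
    show "c \<in> R"
    proof (rule ccontr)
      assume "c \<notin> R"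
      have "conn {u, c}" using conn_insert[OF cs, of u c] c' by (simp add: insert_commute)
      moreover have "R \<inter> {u, c} = {}"
      proof -
        have "u \<notin> R" using R edgeD(3) by (auto simp: nb_def)
        then show ?thesis using \<open>c \<notin> R\<close> by auto
      qed
      ultimately have "branch u R \<inter> {u, c} = {}" using branch_disj[of "{u, c}" u R] R by blast
      then show False using c' by blast
    qed
  qed
qed

lemma bd_core:
  assumes R: "R \<subseteq> nb u" "u \<in> V"
  shows "bd (core u R) = (if R = {} then {} else {u})"
proof -
  have 1: "bd (core u R) \<subseteq> {u}"
  proof
    fix x assume x: "x \<in> bd (core u R)"
    then obtain z where z: "{x, z} \<in> E" "z \<notin> core u R" "x \<in> core u R" by (auto simp: bd_def nb_iff(2) subset_iff)
    then have "z \<in> branch u R" using edgeD by (auto simp: core_def)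
    then show "x \<in> {u}" using branch_closed[OF R(1), of z x] z by (auto simp: core_def insert_commute)
  qed
  have "u \<in> bd (core u R) \<longleftrightarrow> R \<noteq> {}"
    using nb_core[OF R] core_self[OF R] by (auto simp: bd_def)
  then show ?thesis using 1 by auto
qed

lemma cost_core:
  assumes R: "R \<subseteq> nb u" "u \<in> V"
  shows "cost w (core u R) = (if R = {} then 0 else w u)"
  using bd_core[OF R] by (simp add: cost_def)

lemma core_sup:
  assumes "conn X" "u \<in> X" shows "X \<subseteq> core u (nb u - X)"
  using branch_disj[OF assms, of "nb u - X"] conn_sub[OF assms(1)] by (auto simp: core_def)

text \<open>\<open>D \<union> core u (nb u - X)\<close> is \<open>D\<close> with all branches filled
  except those at \<open>u\<close>. Its boundary is the part of \<open>bd D\<close> inside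
  \<open>insert u (branch u (nb u - X))\<close>, and these parts, for \<open>u \<in> bd X\<close>,
  partition \<open>bd D\<close>.\<close>

lemma cost_split:
  assumes X: "conn X" and D: "X \<subseteq> D" "D \<subseteq> V"
  shows "cost w D = (\<Sum>u\<in>bd X. cost w (D \<union> core u (nb u - X)))"
proof -
  let ?B = "\<lambda>u. branch u (nb u - X)"
  have fX: "finite (bd X)" using fin_bd conn_sub X by blast
  have bdu: "bd (D \<union> core u (nb u - X)) = bd D \<inter> insert u (?B u)" if u: "u \<in> bd X" for u
  proof -
    have uX: "u \<in> X" using u bd_sub by blast
    have eq: "D \<union> core u (nb u - X) = V - (?B u - D)" using D by (auto simp: core_def)
    have cl: "z = u \<or> z \<in> ?B u" if "y \<in> ?B u" "{y, z} \<in> E" for y z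
      using branch_nb[OF X uX that] by auto
    show ?thesis
    proof (intro equalityI subsetI)
      fix x assume "x \<in> bd (D \<union> core u (nb u - X))"
      then obtain z where z: "x \<in> V - (?B u - D)" "z \<in> ?B u - D" "{z, x} \<in> E"
        using nb_sub[of x] unfolding eq by (auto simp: bd_def nb_iff(1) subset_iff)
      have x: "x = u \<or> x \<in> ?B u" using cl z by blast
      then have "x \<in> D" using z uX D by auto
      then show "x \<in> bd D \<inter> insert u (?B u)" using x z by (auto simp: bd_def nb_iff)
    next
      fix x assume x: "x \<in> bd D \<inter> insert u (?B u)"
      then obtain z where z: "x \<in> D" "z \<notin> D" "{x, z} \<in> E" by (auto simp: bd_def nb_iff(2) subset_iff)
      have "z \<in> ?B u"
      proof (cases "x = u")
        case True
        then have "z \<in> nb u - X" using z D by (auto simp: nb_iff(2))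
        then show ?thesis using branch_R by blast
      next
        case False
        then have "z = u \<or> z \<in> ?B u" using cl[of x z] x z by blast
        then show ?thesis using z uX D by blast
      qed
      then show "x \<in> bd (D \<union> core u (nb u - X))" using z D unfolding eq by (auto simp: bd_def nb_iff insert_commute)
    qed
  qed
  have cov: "bd D = (\<Union>u\<in>bd X. bd D \<inter> insert u (?B u))"
  proof (intro equalityI subsetI)
    fix x assume x: "x \<in> bd D"
    show "x \<in> (\<Union>u\<in>bd X. bd D \<inter> insert u (?B u))"
    proof (cases "x \<in> X")
      case True
      then have "x \<in> bd X" using x D by (auto simp: bd_def)
      then show ?thesis using x by blast
    next
      case False
      then show ?thesis using branch_cover[OF X, of x] x D bd_sub by blast
    qed
  qed auto
  have disj: "(bd D \<inter> insert u (?B u)) \<inter> (bd D \<inter> insert u' (?B u')) = {}"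
    if "u \<in> bd X" "u' \<in> bd X" "u \<noteq> u'" for u u'
  proof -
    have uX: "u \<in> X" "u' \<in> X" using that bd_sub by blast+
    show ?thesis using branch_unique[OF X uX that(3)] branch_disj[OF X uX(1), of "nb u - X"]
      branch_disj[OF X uX(2), of "nb u' - X"] uX that by auto
  qed
  have "cost w D = sum w (\<Union>u\<in>bd X. bd D \<inter> insert u (?B u))" unfolding cost_def using cov by simp
  also have "\<dots> = (\<Sum>u\<in>bd X. sum w (bd D \<inter> insert u (?B u)))"
    by (rule sum.UNION_disjoint[OF fX]) (use disj fin_bd[OF D(2)] in auto)
  also have "\<dots> = (\<Sum>u\<in>bd X. cost w (D \<union> core u (nb u - X)))"
    unfolding cost_def by (rule sum.cong) (use bdu in auto)
  finally show ?thesis .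
qed

text \<open>If \<open>D\<close> differs from \<open>X\<close> only in the branches at
  \<open>u\<close>, all other summands of \<open>cost_split\<close> are plain guard weights for both
  sets.\<close>

lemma cost_split1:
  assumes X: "conn X" "u \<in> bd X" and D: "X \<subseteq> D" "D \<subseteq> X \<union> branch u (nb u - X)"
  shows "cost w D + w u = cost w X + cost w (D \<union> core u (nb u - X))"
proof -
  let ?c = "\<lambda>u. core u (nb u - X)"
  have uX: "u \<in> X" "u \<in> V" using X bd_sub conn_sub by blast+
  have DV: "D \<subseteq> V" using D branch_sub[of "nb u - X" u] conn_sub[OF X(1)] by blast
  have fX: "finite (bd X)" using fin_bd conn_sub X by blast
  have o: "cost w (D \<union> ?c v) = w v \<and> cost w (X \<union> ?c v) = w v" if "v \<in> bd X - {u}" for v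
  proof -
    have v: "v \<in> X" "v \<in> V" "nb v - X \<noteq> {}" "v \<noteq> u" using that X bd_sub conn_sub[OF X(1)] by (auto simp: bd_def)
    have "D \<inter> branch v (nb v - X) = {}"
      using D branch_unique[OF X(1) uX(1) v(1)] v branch_disj[OF X(1) v(1), of "nb v - X"] by blast
    then have "D \<union> ?c v = ?c v" using DV by (auto simp: core_def)
    moreover have "X \<union> ?c v = ?c v" using core_sup[OF X(1) v(1)] by auto
    ultimately show ?thesis using cost_core[of "nb v - X" v w] v by auto
  qed
  have wu: "cost w (X \<union> ?c u) = w u"
  proof -
    have "X \<union> ?c u = ?c u" using core_sup[OF X(1) uX(1)] by auto
    moreover have "nb u - X \<noteq> {}" using X by (auto simp: bd_def)
    ultimately show ?thesis using cost_core[of "nb u - X" u w] uX by auto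
  qed
  have "cost w D = cost w (D \<union> ?c u) + (\<Sum>v\<in>bd X - {u}. cost w (D \<union> ?c v))"
    using cost_split[OF X(1) D(1) DV] sum.remove[OF fX X(2)] by simp
  moreover have "cost w X = cost w (X \<union> ?c u) + (\<Sum>v\<in>bd X - {u}. cost w (X \<union> ?c v))"
    using cost_split[OF X(1) subset_refl conn_sub[OF X(1)]] sum.remove[OF fX X(2)] by simp
  moreover have "(\<Sum>v\<in>bd X - {u}. cost w (D \<union> ?c v)) = (\<Sum>v\<in>bd X - {u}. cost w (X \<union> ?c v))"
    by (rule sum.cong) (use o in auto)
  ultimately show ?thesis using wu by simp
qed

section \<open>Optimality of a set without affordable jumps\<close>

lemma cost_ge_bd:
  assumes "conn X" "u \<in> bd X" shows "w u \<le> cost w X"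
  unfolding cost_def using assms fin_bd[OF conn_sub[OF assms(1)]] by (intro member_le_sum) auto

definition jspec :: "'a \<Rightarrow> 'a set \<Rightarrow> nat \<Rightarrow> 'a set \<Rightarrow> bool" where
  "jspec v R J A \<longleftrightarrow> reach J (core v R) A \<and> cost vw A < vw v \<and>
     (\<forall>b Y. reach b (core v R) Y \<and> cost vw Y < vw v \<longrightarrow> J \<le> b) \<and>
     (\<forall>Y. reach J (core v R) Y \<longrightarrow> cost vw A \<le> cost vw Y)"

text \<open>A cheapest connected set between the core and \<open>A\<close> is reachable with the
  same budget by \<open>reach_Int\<close>. Since \<open>A\<close> has least cost for the budget
  \<open>J\<close>, that set is not cheaper than \<open>A\<close>.\<close>

lemma jspec_low:
  assumes j: "jspec v R J A" and R: "R \<subseteq> nb v" "v \<in> V"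
  shows "low (core v R) A"
proof -
  let ?K = "core v R"
  have K: "conn ?K" using conn_core R by blast
  have r: "reach J ?K A" using j by (simp add: jspec_def)
  have A: "conn A" "?K \<subseteq> A" using reach_conn reach_sup r K by blast+
  obtain Y where Y: "conn Y" "?K \<subseteq> Y" "Y \<subseteq> A"
    and min: "\<And>D. conn D \<Longrightarrow> ?K \<subseteq> D \<Longrightarrow> D \<subseteq> A \<Longrightarrow> cost vw Y \<le> cost vw D"
    using ex_has_least_nat[of "\<lambda>D. conn D \<and> ?K \<subseteq> D \<and> D \<subseteq> A" A "cost vw"] A by blast
  have "reach J (?K \<inter> Y) (A \<inter> Y)"
  proof (rule reach_Int[OF r K Y(1)])
    show "?K \<inter> Y \<noteq> {}" using Y(2) conn_ne[OF K] by blast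
    show "cost vw Y \<le> cost vw D" if "conn D" "Y \<subseteq> D" "D \<subseteq> A \<union> Y" for D
      by (rule min) (use that Y in auto)
  qed
  moreover have "?K \<inter> Y = ?K" "A \<inter> Y = Y" using Y by auto
  ultimately have "cost vw A \<le> cost vw Y" using j by (simp add: jspec_def)
  then show ?thesis using min unfolding low_def by (meson order_trans)
qed

text \<open>The search is projected to each boundary vertex \<open>u\<close> by filling all other
  branches. By induction every other branch costs at least its guard, so a step in the branches at
  \<open>u\<close> leaves at most \<open>b - (cost vw X - vw u)\<close> searchers for the projected
  search. This is less than its jump needs, so the projection never gets below \<open>vw u\<close>.
  The disjunct for an untouched branch covers budgets for which the difference is truncated.\<close>

lemma no_jump:
  assumes X: "conn X"
    and no: "\<And>u. u \<in> bd X \<Longrightarrow> \<exists>J A. jspec u (nb u - X) J A \<and> b < cost vw X - vw u + J"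
    and r: "reach b X D"
  shows "\<forall>u\<in>bd X. vw u \<le> cost vw (D \<union> core u (nb u - X)) \<and>
           (D \<union> core u (nb u - X) = core u (nb u - X) \<or>
            cost vw X - vw u \<le> b \<and> reach (b - (cost vw X - vw u)) (core u (nb u - X)) (D \<union> core u (nb u - X)))"
  using r
proof (induction rule: reach.induct)
  case reach_refl
  show ?case
  proof
    fix u assume u: "u \<in> bd X"
    then have uX: "u \<in> X" "u \<in> V" "nb u - X \<noteq> {}" using bd_sub conn_sub[OF X] by (auto simp: bd_def)
    have "X \<union> core u (nb u - X) = core u (nb u - X)" using core_sup[OF X uX(1)] by auto
    then show "vw u \<le> cost vw (X \<union> core u (nb u - X)) \<and> (X \<union> core u (nb u - X) = core u (nb u - X) \<or>
        cost vw X - vw u \<le> b \<and> reach (b - (cost vw X - vw u)) (core u (nb u - X)) (X \<union> core u (nb u - X)))"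
      using cost_core[of "nb u - X" u vw] uX by auto
  qed
next
  case (reach_step D p y)
  let ?c = "\<lambda>u. core u (nb u - X)"
  have fX: "finite (bd X)" using fin_bd conn_sub X by blast
  have XD: "X \<subseteq> D" using reach_step reach_sup by blast
  have D: "conn D" using reach_step reach_conn X by blast
  have iD: "insert y D \<subseteq> V" using conn_insert[OF D reach_step(2,3)] conn_sub by blast
  have y: "y \<in> V" "y \<notin> X" using reach_step XD edgeD by auto
  then obtain u where u: "u \<in> bd X" "y \<in> branch u (nb u - X)" using branch_cover[OF X] by blast
  have uX: "u \<in> X" "u \<in> V" using u bd_sub conn_sub[OF X] by auto
  have other: "insert y D \<union> ?c v = D \<union> ?c v" if "v \<in> bd X" "v \<noteq> u" for v
  proof -
    have "v \<in> X" using that bd_sub by blast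
    then have "y \<notin> branch v (nb v - X)" using branch_unique[OF X uX(1) _ that(2)[symmetric]] u by blast
    then show ?thesis using y by (auto simp: core_def)
  qed
  let ?w = "vw(y := 0)"
  have yv: "y \<notin> D \<union> ?c u" using reach_step u by (auto simp: core_def)
  have pc: "p \<in> D \<union> ?c u" using reach_step by auto
  have "cost ?w (insert y D) = cost ?w (insert y D \<union> ?c u) + (\<Sum>v\<in>bd X - {u}. cost ?w (insert y D \<union> ?c v))"
    using cost_split[OF X _ iD, of ?w] XD
      sum.remove[OF fX u(1), of "\<lambda>v. cost ?w (insert y D \<union> ?c v)"] by (simp add: subset_insertI2)
  moreover have "(\<Sum>v\<in>bd X - {u}. cost ?w (insert y D \<union> ?c v)) \<ge> (\<Sum>v\<in>bd X - {u}. vw v)"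
  proof (rule sum_mono)
    fix v assume v: "v \<in> bd X - {u}"
    have "v \<in> X" using v bd_sub by blast
    then have yv': "y \<notin> branch v (nb v - X)" using branch_unique[OF X uX(1)] u v by blast
    have "D \<union> ?c v \<subseteq> V" using iD by (auto simp: core_def)
    moreover have "y \<notin> bd (D \<union> ?c v)"
    proof
      assume "y \<in> bd (D \<union> ?c v)"
      then obtain z where z: "{y, z} \<in> E" "z \<notin> D \<union> ?c v" by (auto simp: bd_def nb_iff(2) subset_iff)
      then have "z \<in> branch v (nb v - X)" using edgeD by (auto simp: core_def)
      then have "y = v \<or> y \<in> branch v (nb v - X)" using branch_nb[OF X \<open>v \<in> X\<close>, of z y] z by (auto simp: insert_commute)
      then show False using yv' y \<open>v \<in> X\<close> by blast
    qed
    ultimately have "cost ?w (D \<union> ?c v) = cost vw (D \<union> ?c v)" using cost_upd[of "D \<union> ?c v" vw y] by simp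
    then show "vw v \<le> cost ?w (insert y D \<union> ?c v)" using reach_step.IH v other by auto
  qed
  moreover have cX: "cost vw X = vw u + (\<Sum>v\<in>bd X - {u}. vw v)" unfolding cost_def using sum.remove[OF fX u(1)] by simp
  moreover have "insert y D \<union> ?c u = insert y (D \<union> ?c u)" by auto
  ultimately have nd: "need (D \<union> ?c u) p y + (cost vw X - vw u) \<le> b"
    using reach_step(5) by (simp add: need_def)
  have "reach (b - (cost vw X - vw u)) (?c u) (D \<union> ?c u)"
  proof -
    have "D \<union> ?c u = ?c u \<or> reach (b - (cost vw X - vw u)) (?c u) (D \<union> ?c u)"
      using reach_step.IH u(1) by blast
    then show ?thesis
    proof
      assume "D \<union> ?c u = ?c u"
      then show ?thesis using reach.reach_refl[of "b - (cost vw X - vw u)" "?c u"] by simp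
    qed
  qed
  then have r: "reach (b - (cost vw X - vw u)) (?c u) (insert y (D \<union> ?c u))"
    by (rule reach.reach_step[OF _ pc reach_step(3) yv]) (use nd in linarith)
  obtain J A where J: "jspec u (nb u - X) J A" "b < cost vw X - vw u + J" using no u by blast
  have "\<not> cost vw (insert y (D \<union> ?c u)) < vw u"
  proof
    assume "cost vw (insert y (D \<union> ?c u)) < vw u"
    then have "J \<le> b - (cost vw X - vw u)" using J(1) r unfolding jspec_def by blast
    then show False using J(2) nd by linarith
  qed
  then have "vw u \<le> cost vw (insert y D \<union> ?c u) \<and> cost vw X - vw u \<le> b \<and>
      reach (b - (cost vw X - vw u)) (?c u) (insert y D \<union> ?c u)" using r nd by auto
  note this_u = this
  show ?case
  proof
    fix v assume v: "v \<in> bd X"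
    show "vw v \<le> cost vw (insert y D \<union> ?c v) \<and> (insert y D \<union> ?c v = ?c v \<or> cost vw X - vw v \<le> b \<and>
        reach (b - (cost vw X - vw v)) (?c v) (insert y D \<union> ?c v))"
    proof (cases "v = u")
      case True
      show ?thesis unfolding True using this_u by blast
    next
      case False
      show ?thesis unfolding other[OF v False] using reach_step.IH v by blast
    qed
  qed
qed

text \<open>\<open>reach_Un\<close> moves \<open>Y\<close> to \<open>X \<union> Y\<close> without
  raising the cost, and there \<open>cost_split\<close> bounds the cost from below, branch by
  branch, by the guards of \<open>X\<close>.\<close>

lemma saturated:
  assumes X0: "conn X0" and X: "conn X" "X0 \<subseteq> X" "low X0 X"
    and no: "\<And>u. u \<in> bd X \<Longrightarrow> \<exists>J A. jspec u (nb u - X) J A \<and> b < cost vw X - vw u + J"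
    and r: "reach b X0 Y"
  shows "cost vw X \<le> cost vw Y"
proof -
  note U = reach_Un[OF r X0 X]
  have "X \<union> Y \<subseteq> V" using conn_sub[OF X(1)] conn_sub[OF reach_conn[OF r X0]] by blast
  then have "cost vw (X \<union> Y) = (\<Sum>u\<in>bd X. cost vw ((X \<union> Y) \<union> core u (nb u - X)))"
    by (intro cost_split[OF X(1)]) auto
  also have "\<dots> \<ge> (\<Sum>u\<in>bd X. vw u)"
  proof (rule sum_mono)
    fix u assume "u \<in> bd X"
    then show "vw u \<le> cost vw (X \<union> Y \<union> core u (nb u - X))"
      using no_jump[OF X(1) no U(1)] by blast
  qed
  finally show ?thesis using U(2) unfolding cost_def by linarith
qed

text \<open>Enlarging a competitor \<open>D\<close> by \<open>X\<close> does not raise its cost,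
  since \<open>X\<close> is low. \<open>D \<union> X\<close> differs from \<open>X\<close> only in
  the branches at \<open>u\<close>, and \<open>cost_split1\<close> reduces the comparison to the
  fact that \<open>A\<close> is low.\<close>

lemma low_jump:
  assumes X0: "conn X0" and X: "conn X" "X0 \<subseteq> X" "low X0 X" and u: "u \<in> bd X"
    and A: "low (core u (nb u - X)) A" "conn A" "core u (nb u - X) \<subseteq> A" "cost vw A \<le> vw u"
    and X': "X' = X \<union> (A \<inter> branch u (nb u - X))" "conn X'"
  shows "low X0 X'" "cost vw X' + vw u = cost vw X + cost vw A"
proof -
  let ?c = "core u (nb u - X)"
  have uX: "u \<in> X" "u \<in> V" using u bd_sub conn_sub[OF X(1)] by auto
  have XA: "X' \<union> ?c = A" using X' A(3) core_sup[OF X(1) uX(1)] conn_sub[OF A(2)] by (auto simp: core_def)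
  show c: "cost vw X' + vw u = cost vw X + cost vw A"
    using cost_split1[OF X(1) u, of X' vw] X' XA by auto
  show "low X0 X'" unfolding low_def
  proof (intro allI impI)
    fix D assume D: "conn D \<and> X0 \<subseteq> D \<and> D \<subseteq> X'"
    have ne: "D \<inter> X \<noteq> {}" using D X conn_ne[OF X0] by blast
    have 1: "cost vw X \<le> cost vw (D \<inter> X)"
      using X(3) conn_Int[OF _ X(1) ne] D X(2) unfolding low_def by blast
    have "D \<subseteq> V" "X \<subseteq> V" using D X conn_sub by auto
    then have 2: "cost vw (D \<union> X) \<le> cost vw D" using cost_submod[of D X vw] 1 by linarith
    have U: "conn (D \<union> X)" using conn_Un[of D X] D X ne by blast
    have 3: "cost vw (D \<union> X) + vw u = cost vw X + cost vw (D \<union> X \<union> ?c)"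
      by (rule cost_split1[OF X(1) u]) (use D X' in auto)
    have "u \<in> ?c" using core_self[of "nb u - X" u] uX by auto
    then have "conn (D \<union> X \<union> ?c)" using uX by (intro conn_Un[OF U conn_core]) auto
    moreover have "D \<union> X \<union> ?c \<subseteq> A" using D XA X' by auto
    ultimately have "cost vw A \<le> cost vw (D \<union> X \<union> ?c)" using A(1) unfolding low_def by blast
    then show "cost vw X' \<le> cost vw D" using 2 3 c by linarith
  qed
qed

end

section \<open>Cheapest improving jumps\<close>

context wtree begin

text \<open>A witness for \<open>reach\<close> as a list. Entries already in the set are skipped,
  because the lists of records used for this purpose repeat vertices.\<close>

fun path :: "nat \<Rightarrow> 'a set \<Rightarrow> 'a list \<Rightarrow> bool" where
  "path b X [] \<longleftrightarrow> True"
| "path b X (y # ys) \<longleftrightarrow> (y \<notin> X \<longrightarrow> (\<exists>p\<in>X. {p, y} \<in> E \<and> need X p y \<le> b)) \<and> path b (insert y X) ys"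

lemma path_append: "path b X (xs @ ys) \<longleftrightarrow> path b X xs \<and> path b (X \<union> set xs) ys"
  by (induction xs arbitrary: X) auto

lemma path_mono: "path b X ys \<Longrightarrow> b \<le> b' \<Longrightarrow> path b' X ys"
  by (induction ys arbitrary: X) (auto intro: order_trans)

lemma path_reach: "path b X ys \<Longrightarrow> reach b X (X \<union> set ys)"
proof (induction ys arbitrary: X)
  case Nil
  then show ?case by (simp add: reach_refl)
next
  case (Cons y ys)
  have "reach b X (insert y X)"
  proof (cases "y \<in> X")
    case True
    then show ?thesis by (simp add: insert_absorb reach_refl)
  next
    case False
    then show ?thesis using Cons.prems by (auto intro: reach_step reach_refl)
  qed
  moreover have "reach b (insert y X) (insert y X \<union> set ys)" using Cons.IH[of "insert y X"] Cons.prems by simp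
  ultimately have "reach b X (insert y X \<union> set ys)" using reach_trans by blast
  then show ?case by simp
qed

text \<open>Steps inside the branches at \<open>u\<close> need in \<open>D\<close> what they need
  with all other branches filled, plus the guards of the other boundary vertices,
  \<open>cost vw X - vw u\<close>.\<close>

lemma path_jump:
  assumes X: "conn X" "u \<in> bd X" and p: "path J (D \<union> core u (nb u - X)) ys"
    and ys: "set ys \<subseteq> insert u (branch u (nb u - X))"
    and D: "X \<subseteq> D" "D \<subseteq> X \<union> branch u (nb u - X)"
  shows "path (cost vw X - vw u + J) D ys"
  using p ys D
proof (induction ys arbitrary: D)
  case (Cons y ys)
  let ?c = "core u (nb u - X)"
  have uX: "u \<in> X" "u \<in> V" using X bd_sub conn_sub by blast+
  have i: "insert y D \<subseteq> X \<union> branch u (nb u - X)" using Cons.prems uX by auto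
  have "path (cost vw X - vw u + J) (insert y D) ys"
    by (rule Cons.IH) (use Cons.prems i in auto)
  moreover have "\<exists>p\<in>D. {p, y} \<in> E \<and> need D p y \<le> cost vw X - vw u + J" if y: "y \<notin> D"
  proof -
    have yb: "y \<in> branch u (nb u - X)" using Cons.prems y uX by auto
    then have "y \<notin> D \<union> ?c" using y by (auto simp: core_def)
    then obtain p where p: "p \<in> D \<union> ?c" "{p, y} \<in> E" "need (D \<union> ?c) p y \<le> J"
      using Cons.prems(1) by auto
    have "p \<in> insert u (branch u (nb u - X))"
      using branch_nb[OF X(1) uX(1) yb, of p] p by (simp add: insert_commute)
    then have pD: "p \<in> D" using p uX Cons.prems by (auto simp: core_def)
    let ?w = "vw(y := 0)"
    have yX: "y \<notin> X" "y \<noteq> u" using y uX Cons.prems by auto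
    have "cost ?w (insert y D) + ?w u = cost ?w X + cost ?w (insert y D \<union> ?c)"
      by (rule cost_split1[OF X]) (use i Cons.prems in auto)
    then have "cost ?w (insert y D) + vw u = cost vw X + cost ?w (insert y (D \<union> ?c))"
      using cost_upd_out[OF yX(1), of vw] yX by simp
    then have "need D p y \<le> cost vw X - vw u + J"
      using p(3) cost_ge_bd[OF X, of vw] by (simp add: need_def)
    then show ?thesis using pD p by blast
  qed
  ultimately show ?case by simp
qed simp

section \<open>Lists of records and the boundary they represent\<close>

definition active :: "('a \<times> 'a set) list \<Rightarrow> ('a \<times> 'a set) list" where
  "active L = filter (\<lambda>(v, R). R \<noteq> {}) L"

text \<open>One list plays two roles: all its vertices in order describe a search, and its entries
  with nonempty second component are exactly the present boundary with the neighbours still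
  missing.\<close>

definition frontier :: "'a set \<Rightarrow> ('a \<times> 'a set) list \<Rightarrow> bool" where
  "frontier X L \<longleftrightarrow> distinct (active L) \<and> set (active L) = (\<lambda>u. (u, nb u - X)) ` bd X"

lemma active_simps [simp]: "active [] = []" "active (x # L) = (if snd x = {} then active L else x # active L)"
  "active (L @ L') = active L @ active L'"
  by (auto simp: active_def split: prod.splits)

lemma frontierD:
  assumes "frontier X L" "(u, R) \<in> set L" "R \<noteq> {}"
  shows "u \<in> bd X" "R = nb u - X"
proof -
  have "(u, R) \<in> set (active L)" using assms by (auto simp: active_def)
  then show "u \<in> bd X" "R = nb u - X" using assms by (auto simp: frontier_def)
qed

lemma frontier_mem:
  assumes "frontier X L" "u \<in> bd X"
  shows "(u, nb u - X) \<in> set L"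
proof -
  have "(u, nb u - X) \<in> set (active L)" using assms by (auto simp: frontier_def)
  then show ?thesis by (auto simp: active_def)
qed

text \<open>A jump in stored form. A new vertex brings two entries, one for itself and one for its
  parent with a smaller set, which explains the length.\<close>

definition segment :: "'a \<Rightarrow> 'a set \<Rightarrow> nat \<Rightarrow> nat \<Rightarrow> ('a \<times> 'a set) list \<Rightarrow> bool" where
  "segment v R J c S \<longleftrightarrow>
     (let K = core v R; A = K \<union> fst ` set S in
       set S \<subseteq> {(y, Q). y \<in> insert v (branch v R) \<and> Q \<subseteq> nb y} \<and>
       jspec v R J A \<and> path J K (map fst S) \<and> frontier A S \<and> cost vw A = c \<and>
       length S = 2 * card (A - K))"

text \<open>The old entry of \<open>u\<close> stays, with the empty set, because it belongs to the
  recorded order; if \<open>u\<close> remains on the boundary, its new entry comes with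
  \<open>S\<close>. Vertices in the branches at \<open>u\<close> miss the same neighbours in
  \<open>A\<close> as in the new set, so \<open>frontier A S\<close> carries over.\<close>

lemma frontier_jump:
  assumes X: "conn X" and L: "frontier X (L1 @ (u, R) # L2)" and R: "R \<noteq> {}"
    and S: "frontier A S" "A = core u R \<union> fst ` set S" "fst ` set S \<subseteq> insert u (branch u R)"
  shows "frontier (X \<union> fst ` set S) (L1 @ (u, {}) # L2 @ S)"
proof -
  let ?X = "X \<union> fst ` set S"
  have u: "u \<in> bd X" "R = nb u - X" using frontierD[OF L _ R] by auto
  have uX: "u \<in> X" "u \<in> V" using u bd_sub conn_sub[OF X] by auto
  have disj: "branch u R \<inter> X = {}" using branch_disj[OF X uX(1), of R] u by auto
  have nbA: "nb y - A = nb y - ?X" if "y \<in> insert u (branch u R)" for y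
  proof -
    have "z \<in> A \<longleftrightarrow> z \<in> ?X" if z: "z \<in> nb y" for z
    proof (cases "y = u")
      case True
      then show ?thesis using z S u nb_core[of R u] uX nb_sub[of u] by auto
    next
      case False
      then have "y \<in> branch u R" using \<open>y \<in> insert u (branch u R)\<close> by auto
      then have "z \<in> insert u (branch u R)" using branch_nb[OF X uX(1), of y z] z u by (auto simp: nb_iff(2))
      then show ?thesis using S uX core_self[of R u] u disj by (auto simp: core_def)
    qed
    then show ?thesis by auto
  qed
  have bdX': "bd ?X = (bd X - {u}) \<union> (bd A)"
  proof (intro equalityI subsetI)
    fix x assume x: "x \<in> bd ?X"
    show "x \<in> (bd X - {u}) \<union> bd A"
    proof (cases "x \<in> insert u (branch u R)")
      case True
      then have "x \<in> A" using x S uX core_self[of R u] u disj by (auto simp: bd_def)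
      then show ?thesis using nbA[OF True] x by (auto simp: bd_def)
    next
      case False
      then have "x \<in> X" using x S by (auto simp: bd_def)
      then show ?thesis using x False by (auto simp: bd_def)
    qed
  next
    fix x assume "x \<in> (bd X - {u}) \<union> bd A"
    then show "x \<in> bd ?X"
    proof
      assume x: "x \<in> bd X - {u}"
      then have xX: "x \<in> X" "x \<noteq> u" using bd_sub by auto
      obtain z where z: "z \<in> nb x" "z \<notin> X" using x by (auto simp: bd_def)
      have zb: "z \<in> branch x (nb x - X)" using z branch_R by blast
      then have "z \<notin> branch u R" using branch_unique[OF X uX(1) xX(1)] xX u by blast
      then have "z \<notin> ?X" using z S uX by auto
      then show ?thesis using z xX by (auto simp: bd_def)
    next
      assume x: "x \<in> bd A"
      then have xA: "x \<in> A" "\<not> nb x \<subseteq> A" by (auto simp: bd_def)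
      have "x \<in> insert u (branch u R)"
      proof (rule ccontr)
        assume nx: "x \<notin> insert u (branch u R)"
        then have "x \<in> core u R" using xA S by auto
        obtain z where z: "z \<in> nb x" "z \<notin> A" using xA by auto
        then have "z \<in> branch u R" using nb_sub S by (auto simp: core_def)
        then show False using branch_nb[OF X uX(1), of z x] z u nx by (auto simp: nb_iff(1))
      qed
      then show ?thesis using nbA[of x] xA S uX by (auto simp: bd_def core_def)
    qed
  qed
  have bdA: "bd A \<subseteq> insert u (branch u R)"
  proof
    fix x assume x: "x \<in> bd A"
    show "x \<in> insert u (branch u R)"
    proof (rule ccontr)
      assume nx: "x \<notin> insert u (branch u R)"
      obtain z where z: "z \<in> nb x" "z \<notin> A" using x by (auto simp: bd_def)
      then have "z \<in> branch u R" using nb_sub S by (auto simp: core_def)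
      then show False using branch_nb[OF X uX(1), of z x] z u nx by (auto simp: nb_iff(1))
    qed
  qed
  have d: "distinct (active L1 @ (u, R) # active L2)"
    "set (active L1 @ (u, R) # active L2) = (\<lambda>u. (u, nb u - X)) ` bd X"
    using L R by (auto simp: frontier_def)
  have rest: "set (active L1 @ active L2) = (\<lambda>u. (u, nb u - X)) ` (bd X - {u})"
  proof -
    have "set (active L1 @ active L2) = set (active L1 @ (u, R) # active L2) - {(u, R)}" using d(1) by auto
    also have "\<dots> = (\<lambda>u. (u, nb u - X)) ` bd X - {(u, R)}" unfolding d(2) ..
    also have "\<dots> = (\<lambda>u. (u, nb u - X)) ` (bd X - {u})" using u by auto
    finally show ?thesis .
  qed
  have same: "nb x - ?X = nb x - X" if x: "x \<in> bd X - {u}" for x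
  proof -
    have xX: "x \<in> X" "x \<noteq> u" using x bd_sub by auto
    have "z \<notin> fst ` set S" if "z \<in> nb x" "z \<notin> X" for z
    proof
      assume "z \<in> fst ` set S"
      then have zu: "z \<in> branch u R" using S(3) that uX by auto
      have "z \<in> branch x (nb x - X)" using that branch_R by blast
      then show False using branch_unique[OF X uX(1) xX(1)] xX zu u by blast
    qed
    then show ?thesis by auto
  qed
  have 1: "set (active L1 @ active L2) = (\<lambda>u. (u, nb u - ?X)) ` (bd X - {u})"
    unfolding rest by (rule image_cong) (use same in auto)
  have 2: "set (active S) = (\<lambda>u. (u, nb u - ?X)) ` bd A"
    using S(1) nbA bdA unfolding frontier_def by (auto intro!: image_cong simp: subset_iff)
  have "set (active L1 @ active L2) \<inter> set (active S) = {}"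
    unfolding 1 2 using bdA disj bd_sub by fastforce
  then have di: "distinct ((active L1 @ active L2) @ active S)"
    using d(1) S(1) unfolding frontier_def distinct_append[of "active L1 @ active L2"] by auto
  have "set ((active L1 @ active L2) @ active S) = (\<lambda>u. (u, nb u - ?X)) ` bd ?X"
    unfolding set_append[of "active L1 @ active L2"] 1 2 bdX' image_Un ..
  moreover have "active (L1 @ (u, {}) # L2 @ S) = (active L1 @ active L2) @ active S" by simp
  ultimately show ?thesis using di unfolding frontier_def by simp
qed

section \<open>The greedy run and its invariant\<close>

definition jneed :: "'a set \<Rightarrow> ('a \<times> 'a set \<Rightarrow> nat) \<Rightarrow> 'a \<times> 'a set \<Rightarrow> nat" where
  "jneed X J x = cost vw X - vw (fst x) + J x"

text \<open>\<open>L\<close> records the search from \<open>K\<close>, whereas optimality is claimed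
  among searches from \<open>X0\<close>. The last conjunct says that the peak \<open>p\<close> is
  unavoidable for getting below \<open>bound\<close>; only budgets of at least \<open>p0\<close>,
  the price of entering \<open>X0\<close>, compete. Cost 0 is named separately because a run from a
  starting vertex has \<open>bound = 0\<close> and aims at the whole tree. \<open>l0\<close> is 1
  for such a run, whose list begins with the entry of the root, and 0 for the others.\<close>

definition run_inv :: "'a set \<Rightarrow> 'a set \<Rightarrow> 'a set \<Rightarrow> nat \<Rightarrow> nat \<Rightarrow> nat \<Rightarrow> 'a set \<Rightarrow> nat \<Rightarrow> ('a \<times> 'a set) list \<Rightarrow> bool" where
  "run_inv U K X0 bound p0 l0 X p L \<longleftrightarrow>
     conn X \<and> X0 \<subseteq> X \<and> low X0 X \<and> X = K \<union> fst ` set L \<and> path p K (map fst L) \<and> frontier X L \<and>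
     length L + 2 * card K = l0 + 2 * card X \<and> p0 \<le> p \<and> set L \<subseteq> {(y, Q). y \<in> U \<and> Q \<subseteq> nb y} \<and>
     (\<forall>b Y. p0 \<le> b \<and> reach b X0 Y \<and> (cost vw Y < bound \<or> cost vw Y = 0) \<longrightarrow> p \<le> b)"

text \<open>The peak is raised only while the cost is at least \<open>bound\<close>. A budget too
  small for the cheapest jump affords none at all, so by \<open>saturated\<close> it never gets
  below the present cost, and in particular not below \<open>bound\<close>.\<close>

lemma run_inv_jump:
  assumes inv: "run_inv U K X0 bound p0 l0 X p L" and X0: "conn X0" and KX: "K \<subseteq> X0" and U: "V - K \<subseteq> U"
    and L: "L = L1 @ (u, R) # L2" "R \<noteq> {}"
    and S: "\<And>v Q. (v, Q) \<in> set L \<Longrightarrow> Q \<noteq> {} \<Longrightarrow> \<exists>c. segment v Q (J (v, Q)) c (Sg (v, Q))"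
      and Su: "segment u R (J (u, R)) c (Sg (u, R))"
    and min: "\<And>v Q. (v, Q) \<in> set L \<Longrightarrow> Q \<noteq> {} \<Longrightarrow> jneed X J (u, R) \<le> jneed X J (v, Q)"
    and go: "jneed X J (u, R) \<le> p \<or> bound \<le> cost vw X"
  shows "run_inv U K X0 bound p0 l0 (X \<union> fst ` set (Sg (u, R))) (max p (jneed X J (u, R)))
           (L1 @ (u, {}) # L2 @ Sg (u, R))"
    and "cost vw (X \<union> fst ` set (Sg (u, R))) = cost vw X - vw u + c"
    and "card X < card (X \<union> fst ` set (Sg (u, R)))"
proof -
  let ?S = "Sg (u, R)" and ?n = "jneed X J (u, R)"
  let ?X = "X \<union> fst ` set ?S" and ?A = "core u R \<union> fst ` set (Sg (u, R))"
  have X: "conn X" "X0 \<subseteq> X" "low X0 X" "X = K \<union> fst ` set L" "path p K (map fst L)" "frontier X L"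
    "length L + 2 * card K = l0 + 2 * card X" "p0 \<le> p" "set L \<subseteq> {(y, Q). y \<in> U \<and> Q \<subseteq> nb y}"
    and opt: "\<And>b Y. p0 \<le> b \<Longrightarrow> reach b X0 Y \<Longrightarrow> (cost vw Y < bound \<or> cost vw Y = 0) \<Longrightarrow> p \<le> b"
    using inv unfolding run_inv_def by blast+
  have u: "u \<in> bd X" "R = nb u - X" using frontierD[OF X(6), of u R] L by auto
  have uX: "u \<in> X" "u \<in> V" using u bd_sub conn_sub[OF X(1)] by auto
  have Rn: "R \<subseteq> nb u" using u by auto
  have S': "jspec u R (J (u, R)) ?A" "path (J (u, R)) (core u R) (map fst ?S)" "frontier ?A ?S"
    "cost vw ?A = c" "length ?S = 2 * card (?A - core u R)"
    "set ?S \<subseteq> {(y, Q). y \<in> insert u (branch u R) \<and> Q \<subseteq> nb y}"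
    using Su unfolding segment_def Let_def by blast+
  have fS: "fst ` set ?S \<subseteq> insert u (branch u R)" using S'(6) by auto
  have disj: "branch u R \<inter> X = {}" using branch_disj[OF X(1) uX(1), of R] u by auto
  have X'A: "?X = X \<union> (?A \<inter> branch u (nb u - X))" using fS uX u by (auto simp: core_def)
  have pj: "path ?n X (map fst ?S)"
    unfolding jneed_def fst_conv
    by (rule path_jump[OF X(1) u(1)])
       (use S'(2) u fS core_sup[OF X(1) uX(1)] in \<open>auto simp: Un_absorb1\<close>)
  have cX': "conn ?X" using reach_conn[OF path_reach[OF pj] X(1)] by simp
  have rA: "reach (J (u, R)) (core u R) ?A" "cost vw ?A < vw u" using S'(1) by (auto simp: jspec_def)
  have cA: "conn ?A" using reach_conn[OF rA(1) conn_core[OF Rn uX(2)]] .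
  have lowA: "low (core u (nb u - X)) ?A" using jspec_low[OF S'(1) Rn uX(2)] u by simp
  have cA': "core u (nb u - X) \<subseteq> ?A" "cost vw ?A \<le> vw u" using u rA by auto
  note lj = low_jump[OF X0 X(1-3) u(1) lowA cA cA' X'A cX']
  show costX': "cost vw ?X = cost vw X - vw u + c" using lj(2) S'(4) cost_ge_bd[OF X(1) u(1), of vw] by simp
  have dS: "?A - core u R = ?X - X" using fS uX u disj core_self[OF Rn uX(2)] by (auto simp: core_def)
  have fX: "finite ?X" using conn_fin cX' by blast
  have "card (?X - X) + card X = card ?X"
    using fX card_Diff_subset[of X ?X] card_mono[of ?X X] by (simp add: finite_subset)
  note cardX = this
  have "?X \<noteq> X" using costX' rA S'(4) cost_ge_bd[OF X(1) u(1), of vw] by fastforce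
  then show "card X < card ?X" using fX by (intro psubset_card_mono) auto
  have fr: "frontier ?X (L1 @ (u, {}) # L2 @ ?S)"
    by (rule frontier_jump[OF X(1) _ L(2) S'(3) _ fS]) (use X(6) L in auto)
  have opt': "max p ?n \<le> b" if b: "p0 \<le> b" "reach b X0 Y" "cost vw Y < bound \<or> cost vw Y = 0" for b Y
  proof (rule max.boundedI)
    show "p \<le> b" using opt b by blast
    show "?n \<le> b"
    proof (cases "?n \<le> p")
      case True
      then show ?thesis using \<open>p \<le> b\<close> by simp
    next
      case False
      then have bc: "bound \<le> cost vw X" using go by simp
      have "0 < cost vw X" using cost_ge_bd[OF X(1) u(1), of vw] vw_pos[OF uX(2)] by simp
      then have less: "cost vw Y < cost vw X" using b(3) bc by auto
      show ?thesis
      proof (rule ccontr)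
        assume nb: "\<not> ?n \<le> b"
        have "\<exists>J A. jspec v (nb v - X) J A \<and> b < cost vw X - vw v + J" if v: "v \<in> bd X" for v
        proof -
          have m: "(v, nb v - X) \<in> set L" using frontier_mem[OF X(6) v] .
          have ne: "nb v - X \<noteq> {}" using v by (auto simp: bd_def)
          obtain c' where "segment v (nb v - X) (J (v, nb v - X)) c' (Sg (v, nb v - X))" using S[OF m ne] by blast
          then obtain A where "jspec v (nb v - X) (J (v, nb v - X)) A" unfolding segment_def Let_def by blast
          moreover have "b < cost vw X - vw v + J (v, nb v - X)" using min[OF m ne] nb by (simp add: jneed_def)
          ultimately show ?thesis by blast
        qed
        then have "cost vw X \<le> cost vw Y" by (rule saturated[OF X0 X(1-3) _ b(2)])
        then show False using less by simp
      qed
    qed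
  qed
  have p': "path (max p ?n) K (map fst (L1 @ (u, {}) # L2 @ ?S))"
  proof -
    have "map fst (L1 @ (u, {}) # L2 @ ?S) = map fst L @ map fst ?S" using L by simp
    moreover have "path (max p ?n) K (map fst L)" using path_mono[OF X(5)] by simp
    moreover have "path (max p ?n) (K \<union> set (map fst L)) (map fst ?S)" using path_mono[OF pj] X(4) by simp
    ultimately show ?thesis by (metis path_append)
  qed
  have "?X = K \<union> fst ` set (L1 @ (u, {}) # L2 @ ?S)" using X(4) L by auto
  moreover have "length (L1 @ (u, {}) # L2 @ ?S) + 2 * card K = l0 + 2 * card ?X"
    using X(7) L S'(5) dS cardX by simp
  moreover have "set (L1 @ (u, {}) # L2 @ ?S) \<subseteq> {(y, Q). y \<in> U \<and> Q \<subseteq> nb y}"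
  proof -
    have "branch u R \<subseteq> U" using branch_sub[OF Rn] disj KX X(2) U by blast
    then show ?thesis using X(9) L S'(6) by auto
  qed
  ultimately show "run_inv U K X0 bound p0 l0 ?X (max p ?n) (L1 @ (u, {}) # L2 @ ?S)"
    unfolding run_inv_def using cX' X(2) lj(1) p' fr X(8) opt' by (intro conjI) auto
qed

lemma run_stop:
  assumes inv: "run_inv U K X0 bound p0 l0 X p L" and X0: "conn X0"
    and S: "\<And>v Q. (v, Q) \<in> set L \<Longrightarrow> Q \<noteq> {} \<Longrightarrow> \<exists>c. segment v Q (J (v, Q)) c (Sg (v, Q))"
    and stop: "\<And>v Q. (v, Q) \<in> set L \<Longrightarrow> Q \<noteq> {} \<Longrightarrow> p < jneed X J (v, Q)"
    and Y: "reach p X0 Y"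
  shows "cost vw X \<le> cost vw Y"
proof -
  have X: "conn X" "X0 \<subseteq> X" "low X0 X" "frontier X L" using inv unfolding run_inv_def by blast+
  have "\<exists>J A. jspec v (nb v - X) J A \<and> p < cost vw X - vw v + J" if v: "v \<in> bd X" for v
  proof -
    have m: "(v, nb v - X) \<in> set L" using frontier_mem[OF X(4) v] .
    have ne: "nb v - X \<noteq> {}" using v by (auto simp: bd_def)
    obtain c' where "segment v (nb v - X) (J (v, nb v - X)) c' (Sg (v, nb v - X))" using S[OF m ne] by blast
    then obtain A where "jspec v (nb v - X) (J (v, nb v - X)) A" unfolding segment_def Let_def by blast
    moreover have "p < cost vw X - vw v + J (v, nb v - X)" using stop[OF m ne] by (simp add: jneed_def)
    ultimately show ?thesis by blast
  qed
  then show ?thesis by (rule saturated[OF X0 X(1-3) _ Y])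
qed

lemma no_active_bd:
  assumes "frontier X L" "\<And>v Q. (v, Q) \<in> set L \<Longrightarrow> Q = {}"
  shows "bd X = {}"
  using frontier_mem[OF assms(1)] assms(2) by (fastforce simp: bd_def)

text \<open>The start of the run that enters \<open>c\<close> first. Nothing lies strictly between
  the start set and itself, so it is low, and only \<open>c\<close> and \<open>v\<close> can be on
  its boundary; this gives the closed formulas that the machine evaluates.\<close>

lemma start_item:
  assumes R: "R \<subseteq> nb v" "v \<in> V" and c: "c \<in> R"
  defines "K \<equiv> core v R"
  shows "run_inv (insert v (branch v R)) K (insert c K) bound (need K v c) 0 (insert c K) (need K v c)
           [(c, nb c - {v}), (v, R - {c})]" (is ?inv)
    and "cost vw (insert c K) = (if nb c - {v} = {} then 0 else vw c) + (if R - {c} = {} then 0 else vw v)" (is ?cost)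
    and "need K v c = (if R - {c} = {} then 0 else vw v) +
           max (ew {v, c}) (if nb c - {v} = {} then 0 else vw c)" (is ?need)
    and "conn (insert c K)"
proof -
  let ?X = "insert c K"
  have K: "conn K" "v \<in> K" unfolding K_def using conn_core[OF R] core_self[OF R] .
  have vc: "{v, c} \<in> E" "c \<notin> K" "c \<in> V" "c \<noteq> v"
    using c R branch_R[of R v] edgeD[of v c] by (auto simp: K_def core_def nb_iff(2))
  show cX: "conn ?X" using conn_insert[OF K vc(1)] .
  have nbc: "nb c - ?X = nb c - {v}"
  proof -
    have "z = v" if "z \<in> nb c" "z \<in> ?X" for z
    proof -
      have "{z, c} \<in> E" using that by (simp add: nb_iff(1))
      then have "z \<in> K" using that edgeD(3)[of z c] by auto
      then show ?thesis using conn_unique_nb[OF K(1) vc(2) _ \<open>{z, c} \<in> E\<close> K(2) vc(1)] by blast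
    qed
    then show ?thesis using K(2) by auto
  qed
  have nbv: "nb v - ?X = R - {c}" using nb_core[OF R] unfolding K_def by auto
  have oth: "nb x \<subseteq> ?X" if "x \<in> K" "x \<noteq> v" for x
  proof -
    have "x \<notin> bd K" using bd_core[OF R] that unfolding K_def by (auto split: if_splits)
    then show ?thesis using that by (auto simp: bd_def)
  qed
  have bdX: "bd ?X = (if nb c - {v} = {} then {} else {c}) \<union> (if R - {c} = {} then {} else {v})"
  proof -
    have "c \<in> bd ?X \<longleftrightarrow> nb c - {v} \<noteq> {}" using nbc by (auto simp: bd_def)
    moreover have "v \<in> bd ?X \<longleftrightarrow> R - {c} \<noteq> {}" using nbv K(2) by (auto simp: bd_def)
    moreover have "bd ?X \<subseteq> {c, v}" using oth by (auto simp: bd_def)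
    ultimately show ?thesis by auto
  qed
  show ?cost unfolding cost_def bdX using vc by auto
  have "cost (vw(c := 0)) ?X = (if R - {c} = {} then 0 else vw v)" unfolding cost_def bdX using vc by auto
  then show ?need unfolding need_def slide_def by (simp add: subset_singleton_iff Diff_eq_empty_iff)
  have fr: "frontier ?X [(c, nb c - {v}), (v, R - {c})]"
    unfolding frontier_def bdX using vc nbc nbv by auto
  have "low ?X ?X" unfolding low_def by (metis order.refl subset_antisym)
  moreover have "?X = K \<union> fst ` set [(c, nb c - {v}), (v, R - {c})]" using K by auto
  moreover have "path (need K v c) K (map fst [(c, nb c - {v}), (v, R - {c})])"
    using vc K by auto
  moreover have "length [(c, nb c - {v}), (v, R - {c})] + 2 * card K = 0 + 2 * card ?X"
    using vc conn_fin[OF K(1)] by simp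
  moreover have "set [(c, nb c - {v}), (v, R - {c})] \<subseteq> {(y, Q). y \<in> insert v (branch v R) \<and> Q \<subseteq> nb y}"
    using c branch_R[of R v] R by auto
  ultimately show ?inv unfolding run_inv_def using cX fr by (intro conjI) auto
qed

lemma start_root:
  assumes r: "r \<in> V"
  shows "run_inv V {r} {r} 0 0 1 {r} 0 [(r, nb r)]"
    and "cost vw {r} = (if nb r = {} then 0 else vw r)"
proof -
  have n: "nb r - {r} = nb r" using edgeD(3) by (auto simp: nb_def)
  then have bd: "bd {r} = (if nb r = {} then {} else {r})" by (auto simp: bd_def)
  show "cost vw {r} = (if nb r = {} then 0 else vw r)" unfolding cost_def bd by simp
  have "frontier {r} [(r, nb r)]" unfolding frontier_def bd using n by auto
  moreover have "low {r} {r}" unfolding low_def by (metis order.refl subset_antisym)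
  ultimately show "run_inv V {r} {r} 0 0 1 {r} 0 [(r, nb r)]"
    unfolding run_inv_def using conn_single[OF r] r by (intro conjI) auto
qed

section \<open>From runs to jumps and complete searches\<close>

text \<open>Like a segment, but optimality is claimed only among searches that enter
  \<open>c\<close> first.\<close>

definition candidate :: "'a \<Rightarrow> 'a set \<Rightarrow> 'a \<Rightarrow> nat \<Rightarrow> nat \<Rightarrow> ('a \<times> 'a set) list \<Rightarrow> bool" where
  "candidate v R c p k L \<longleftrightarrow> (let K = core v R; X = K \<union> fst ` set L in
     set L \<subseteq> {(y, Q). y \<in> insert v (branch v R) \<and> Q \<subseteq> nb y} \<and>
     path p K (map fst L) \<and> frontier X L \<and> cost vw X = k \<and> k < vw v \<and> length L = 2 * card (X - K) \<and>
     (\<forall>b Y. need K v c \<le> b \<and> reach b (insert c K) Y \<and> cost vw Y < vw v \<longrightarrow> p \<le> b) \<and>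
     (\<forall>Y. reach p (insert c K) Y \<longrightarrow> k \<le> cost vw Y))"

lemma candidate_run:
  assumes R: "R \<subseteq> nb v" "v \<in> V" and c: "c \<in> R"
    and inv: "run_inv (insert v (branch v R)) (core v R) (insert c (core v R)) (vw v) (need (core v R) v c) 0 X p L"
    and S: "\<And>v Q. (v, Q) \<in> set L \<Longrightarrow> Q \<noteq> {} \<Longrightarrow> \<exists>c. segment v Q (J (v, Q)) c (Sg (v, Q))"
    and stop: "\<And>v Q. (v, Q) \<in> set L \<Longrightarrow> Q \<noteq> {} \<Longrightarrow> p < jneed X J (v, Q)"
    and cst: "cost vw X < vw v"
  shows "candidate v R c p (cost vw X) L"
proof -
  have K: "conn (core v R)" "v \<in> core v R" using conn_core[OF R] core_self[OF R] .
  have vc: "{v, c} \<in> E" using c R by (auto simp: nb_iff(2))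
  have cX0: "conn (insert c (core v R))" using conn_insert[OF K vc] .
  note rs = run_stop[OF inv cX0 S stop]
  have X: "conn X" "insert c (core v R) \<subseteq> X" "X = core v R \<union> fst ` set L" "path p (core v R) (map fst L)" "frontier X L"
    "length L + 2 * card (core v R) = 0 + 2 * card X" "set L \<subseteq> {(y, Q). y \<in> insert v (branch v R) \<and> Q \<subseteq> nb y}"
    "\<forall>b Y. need (core v R) v c \<le> b \<and> reach b (insert c (core v R)) Y \<and> (cost vw Y < vw v \<or> cost vw Y = 0) \<longrightarrow> p \<le> b"
    using inv unfolding run_inv_def by blast+
  have "length L = 2 * card (X - core v R)"
    using X(2,6) conn_fin[OF X(1)] card_Diff_subset[of "core v R" X] conn_fin[OF K(1)] card_mono[of X "core v R"] by auto
  then show ?thesis unfolding candidate_def Let_def X(3)[symmetric] using X rs cst by blast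
qed

text \<open>\<open>v\<close> is the only boundary vertex of its core, so an extension that lowers
  the cost has to enter some \<open>c \<in> R\<close> first and is bounded by the candidate of this
  \<open>c\<close>. The lexicographically least candidate therefore bounds all extensions.\<close>

lemma segment_best:
  assumes R: "R \<subseteq> nb v" "v \<in> V" and ne: "R \<noteq> {}" and c0: "candidate v R c0 p k L"
    and best: "\<And>c. c \<in> R \<Longrightarrow> \<exists>p' k' L'. candidate v R c p' k' L' \<and> (p < p' \<or> p = p' \<and> k \<le> k')"
  shows "segment v R p k L"
proof -
  let ?K = "core v R" let ?A = "?K \<union> fst ` set L"
  have K: "conn ?K" "v \<in> ?K" using conn_core[OF R] core_self[OF R] .
  have C: "set L \<subseteq> {(y, Q). y \<in> insert v (branch v R) \<and> Q \<subseteq> nb y}" "path p ?K (map fst L)" "frontier ?A L"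
    "cost vw ?A = k" "k < vw v" "length L = 2 * card (?A - ?K)"
    using c0 unfolding candidate_def Let_def by blast+
  have first: "\<exists>c p' k' L'. candidate v R c p' k' L' \<and> (p < p' \<or> p = p' \<and> k \<le> k') \<and> p' \<le> b \<and> reach b (insert c ?K) Y"
    if Y: "reach b ?K Y" "cost vw Y < vw v" for b Y
  proof -
    have "Y \<noteq> ?K"
    proof
      assume "Y = ?K"
      then have "R = {}" using cost_core[OF R, of vw] Y by (auto split: if_splits)
      then show False using ne by simp
    qed
    then obtain q c where c: "q \<in> ?K" "{q, c} \<in> E" "c \<notin> ?K" "need ?K q c \<le> b" "reach b (insert c ?K) Y"
      using reach_first[OF Y(1)] by blast
    have "q \<in> bd ?K" using c by (auto simp: bd_def nb_iff(2))
    then have q: "q = v" using bd_core[OF R] by (auto split: if_splits)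
    have "c \<in> nb v - ?K" using c q by (auto simp: nb_iff(2))
    then have "c \<in> R" using nb_core[OF R] by simp
    then obtain p' k' L' where b: "candidate v R c p' k' L'" "p < p' \<or> p = p' \<and> k \<le> k'" using best by blast
    have "p' \<le> b" using b(1) c(4,5) Y(2) q unfolding candidate_def Let_def by blast
    then show ?thesis using b c(5) by blast
  qed
  have "p \<le> b" if "reach b ?K Y" "cost vw Y < vw v" for b Y
    using first[OF that] by auto
  moreover have "cost vw ?A \<le> cost vw Y" if Y: "reach p ?K Y" for Y
  proof (cases "cost vw Y < vw v")
    case True
    obtain c p' k' L' where b: "candidate v R c p' k' L'" "p < p' \<or> p = p' \<and> k \<le> k'" "p' \<le> p" "reach p (insert c ?K) Y"
      using first[OF Y True] by blast
    then have "k' \<le> cost vw Y" "k \<le> k'" unfolding candidate_def Let_def by auto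
    then show ?thesis using C by simp
  qed (use C in simp)
  moreover have "reach p ?K ?A" using path_reach[OF C(2)] by simp
  ultimately have "jspec v R p ?A" unfolding jspec_def using C by blast
  then show ?thesis unfolding segment_def Let_def using C by blast
qed

lemma root_done:
  assumes inv: "run_inv V {r} {r} 0 0 1 X p L" and "\<And>v Q. (v, Q) \<in> set L \<Longrightarrow> Q = {}" and r: "r \<in> V"
  shows "path p {r} (map fst L)" "{r} \<union> fst ` set L = V" "\<And>b. reach b {r} V \<Longrightarrow> p \<le> b"
proof -
  have X: "conn X" "X = {r} \<union> fst ` set L" "path p {r} (map fst L)" "frontier X L"
    "\<forall>b Y. 0 \<le> b \<and> reach b {r} Y \<and> (cost vw Y < 0 \<or> cost vw Y = 0) \<longrightarrow> p \<le> b"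
    using inv unfolding run_inv_def by blast+
  have "bd X = {}" by (rule no_active_bd[OF X(4)]) (use assms(2) in blast)
  then have "X = V" using bd_ne[OF X(1)] by blast
  then show "path p {r} (map fst L)" "{r} \<union> fst ` set L = V" using X by auto
  show "p \<le> b" if "reach b {r} V" for b using X(5) that cost_V by blast
qed

text \<open>One move of an arbitrary connected search, seen on the vertex set of the clear edges:
  recontamination leaves a connected subset, anything else is growth within the budget.\<close>

definition crus :: "nat \<Rightarrow> 'a set \<Rightarrow> 'a set \<Rightarrow> bool" where
  "crus k X X' \<longleftrightarrow> conn X' \<and> (X' \<subseteq> X \<or> reach k X X')"

text \<open>Recontamination is ignored: a monotone search keeps a set \<open>Z\<close> above the
  current \<open>X\<close>. Growth of \<open>X\<close> is transferred to \<open>Z\<close> by union,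
  and \<open>low_exists\<close> then replaces \<open>Z\<close> by a set that is low above the new
  \<open>X\<close>.\<close>

lemma monotone_search:
  assumes "(crus k)\<^sup>*\<^sup>* {r} X" "r \<in> V"
  shows "conn X \<and> (\<exists>Z r. r \<in> V \<and> X \<subseteq> Z \<and> reach k {r} Z \<and> low X Z)"
  using assms
proof (induction rule: rtranclp_induct)
  case base
  have "low {r} {r}" unfolding low_def by (metis order.refl subset_antisym)
  then show ?case using base conn_single reach_refl by blast
next
  case (step X X')
  then obtain Z r' where Z: "conn X" "r' \<in> V" "X \<subseteq> Z" "reach k {r'} Z" "low X Z" by blast
  have X': "conn X'" using step unfolding crus_def by blast
  have cZ: "conn Z" using reach_conn[OF Z(4) conn_single[OF Z(2)]] .
  have "\<exists>Z. X' \<subseteq> Z \<and> reach k {r'} Z"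
  proof (cases "X' \<subseteq> X")
    case True
    then show ?thesis using Z by blast
  next
    case False
    then have "reach k X X'" using step unfolding crus_def by blast
    then have "reach k Z (Z \<union> X')" using reach_Un(1)[OF _ Z(1) cZ Z(3,5)] by blast
    then show ?thesis using reach_trans Z(4) by (metis Un_upper2)
  qed
  then show ?case using low_exists[OF X'] Z(2) X' by metis
qed

end

section \<open>Search strategies and growing vertex sets\<close>

context wtree begin

section \<open>From strategies to growing vertex sets\<close>

definition ind :: "'a set \<Rightarrow> 'a set set" where "ind X = {e \<in> E. e \<subseteq> X}"

definition guarded :: "'a set set \<Rightarrow> ('a \<Rightarrow> nat) \<Rightarrow> bool" where
  "guarded C s \<longleftrightarrow> (\<forall>v\<in>\<Union>C. \<forall>e\<in>E - C. v \<in> e \<longrightarrow> vw v \<le> s v)"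

lemma contaminated_edge: "contaminated T C s e \<Longrightarrow> e \<in> E"
  by (induction rule: contaminated.induct) auto

text \<open>Contamination would have to enter \<open>C\<close> at a vertex shared with a
  contaminated edge, and those vertices hold enough searchers. Clearing further edges only removes
  sources.\<close>

lemma guarded_clear:
  assumes g: "guarded C s" and C: "C \<subseteq> E" and D: "C \<subseteq> D"
  shows "contaminated T D s e \<Longrightarrow> e \<notin> C"
proof (induction rule: contaminated.induct)
  case (initial e)
  then show ?case using D by auto
next
  case (spread v y u)
  have "{v, y} \<in> E - C" using spread contaminated_edge by blast
  then have "v \<in> \<Union>C \<Longrightarrow> vw v \<le> s v" using g unfolding guarded_def by blast
  then show ?case using spread(2) by auto
qed

lemma clear_guarded: "guarded {e \<in> E. \<not> contaminated T D s e} s"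
  unfolding guarded_def
proof (intro ballI impI)
  fix v e assume v: "v \<in> \<Union> {e \<in> E. \<not> contaminated T D s e}"
    and e: "e \<in> E - {e \<in> E. \<not> contaminated T D s e}" "v \<in> e"
  obtain f where f: "f \<in> E" "\<not> contaminated T D s f" "v \<in> f" using v by auto
  obtain x where x: "f = {x, v}" using edge_ends[OF f(1)] f(3) by fastforce
  obtain y where y: "e = {v, y}" using edge_ends[of e] e by fastforce
  show "vw v \<le> s v"
  proof (rule ccontr)
    assume "\<not> vw v \<le> s v"
    then have "contaminated T D s {x, v}"
      using contaminated.spread[of T D s v y x] e f x y by auto
    then show False using f x by simp
  qed
qed

lemma clear_eq:
  assumes "guarded C s" "C \<subseteq> E"
  shows "{e \<in> E. \<not> contaminated T C s e} = C"
  using guarded_clear[OF assms subset_refl] contaminated.initial[of _ T C s] assms(2) by blast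

lemma connected_edges_conn:
  assumes "connected_graph (\<Union>C) C" "C \<subseteq> E" "C \<noteq> {}"
  shows "conn (\<Union>C)"
proof -
  have "{(a, b). {a, b} \<in> C} \<subseteq> arc (\<Union>C)" using assms(2) by (auto simp: arc_def)
  then have "(x, y) \<in> (arc (\<Union>C))\<^sup>*" if "x \<in> \<Union>C" "y \<in> \<Union>C" for x y
    using assms(1) that rtrancl_mono unfolding connected_graph_def by blast
  moreover have "\<Union>C \<noteq> {}" using assms(2,3) edge_ends by blast
  ultimately show ?thesis using assms(2) edge_sub unfolding conn_def by blast
qed

text \<open>Otherwise the path between the ends inside \<open>C\<close> would bypass the edge. Hence
  a connected set of clear edges is determined by its vertices.\<close>

lemma connected_edges_full:
  assumes "connected_graph (\<Union>C) C" "C \<subseteq> E" "{a, b} \<in> E" "a \<in> \<Union>C" "b \<in> \<Union>C"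
  shows "{a, b} \<in> C"
proof (rule ccontr)
  assume n: "{a, b} \<notin> C"
  have "(a, b) \<in> {(x, y). {x, y} \<in> C}\<^sup>*" using assms unfolding connected_graph_def by blast
  then show False by (rule no_bypass) (use assms n in auto)
qed

lemma cost_upd_sum: "X \<subseteq> V \<Longrightarrow> cost (w(y := 0)) X = sum w (bd X - {y})"
  unfolding cost_def by (rule sum.mono_neutral_cong_right) (auto simp: fin_bd)

lemma sum_guard:
  assumes "guarded C s" "C \<subseteq> E" "B \<subseteq> bd (\<Union>C)"
  shows "sum vw B \<le> sum s B"
proof (rule sum_mono)
  fix x assume "x \<in> B"
  then obtain z where z: "x \<in> \<Union>C" "{x, z} \<in> E" "z \<notin> \<Union>C" using assms(3) by (auto simp: bd_def nb_iff(2) subset_iff)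
  then have "{x, z} \<in> E - C" by auto
  then show "vw x \<le> s x" using assms(1) z unfolding guarded_def by blast
qed

lemma bd_insert_new:
  assumes X: "conn X" and p: "p \<in> X" "{p, y} \<in> E" "y \<notin> X"
  shows "y \<in> bd (insert y X) \<longleftrightarrow> \<not> nb y \<subseteq> {p}"
    "p \<in> bd X" "bd (insert y X) - {y} \<subseteq> bd X"
    "\<And>x. x \<noteq> p \<Longrightarrow> x \<noteq> y \<Longrightarrow> x \<in> bd (insert y X) \<longleftrightarrow> x \<in> bd X"
proof -
  have u: "z = p" if "z \<in> nb y" "z \<in> X" for z
    using conn_unique_nb[OF X p(3) that(2) _ p(1,2)] that(1) by (auto simp: nb_iff(1))
  have ny: "y \<notin> nb y" using edgeD(3)[of y y] by (auto simp: nb_def)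
  show "y \<in> bd (insert y X) \<longleftrightarrow> \<not> nb y \<subseteq> {p}" using u ny p by (auto simp: bd_def)
  show "p \<in> bd X" using p by (auto simp: bd_def nb_iff(2) subset_iff)
  show "bd (insert y X) - {y} \<subseteq> bd X" by (auto simp: bd_def)
  fix x assume x: "x \<noteq> p" "x \<noteq> y"
  have "y \<notin> nb x" if "x \<in> X" using u[OF _ that] x by (auto simp: nb_def insert_commute)
  then show "x \<in> bd (insert y X) \<longleftrightarrow> x \<in> bd X" using x by (auto simp: bd_def)
qed

lemma sum_le_total: "B \<subseteq> V \<Longrightarrow> sum s B \<le> (sum s V :: nat)"
  using finV by (intro sum_mono2) auto

text \<open>After a slide into \<open>y\<close> one placement pays for everything: the searchers
  that slid stand on \<open>y\<close>, and the rest of the boundary is guarded elsewhere.\<close>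

lemma need_from_inside:
  assumes X: "conn X" and p: "p \<in> X" "{p, y} \<in> E" "y \<notin> X"
    and C: "guarded C s" "C \<subseteq> E" "\<Union>C = insert y X" and s: "ew {p, y} \<le> s y" "sum s V = k"
  shows "need X p y \<le> k"
proof -
  let ?X = "insert y X" and ?B = "bd (insert y X) - {y}"
  have V: "?X \<subseteq> V" using conn_sub[OF conn_insert[OF X p(1,2)]] .
  have fB: "finite ?B" using fin_bd[OF V] by simp
  have "slide p y \<le> s y"
    unfolding slide_def
    using s(1) bd_insert_new(1)[OF X p] sum_guard[OF C(1,2), of "{y}"] C(3) by auto
  moreover have "sum vw ?B \<le> sum s ?B" using sum_guard[OF C(1,2), of ?B] C(3) by auto
  moreover have "s y + sum s ?B = sum s (insert y ?B)" using fB by (subst sum.insert) auto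
  moreover have "sum s (insert y ?B) \<le> k"
    using sum_le_total[of "insert y ?B" s] bd_sub[of ?X] V s by blast
  ultimately show ?thesis unfolding need_def cost_upd_sum[OF V] by linarith
qed

text \<open>Here searchers slide from the new vertex \<open>y\<close> into \<open>X\<close>. The
  weight of the edge is present on \<open>y\<close> before the move, the guard of \<open>y\<close>
  after it; each moment bounds one part of the maximum in \<open>slide\<close>.\<close>

lemma need_from_outside:
  assumes X: "conn X" and p: "p \<in> X" "{p, y} \<in> E" "y \<notin> X"
    and C: "guarded C s" "C \<subseteq> E" "\<Union>C = X" "ew {p, y} \<le> s y" "sum s V = k"
    and C': "guarded C' s'" "C' \<subseteq> E" "\<Union>C' = insert y X" "sum s' V = k"
  shows "need X p y \<le> k"
proof -
  let ?X = "insert y X" and ?B = "bd (insert y X) - {y}"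
  have V: "?X \<subseteq> V" using conn_sub[OF conn_insert[OF X p(1,2)]] .
  have fB: "finite ?B" using fin_bd[OF V] by simp
  have "sum vw ?B \<le> sum s ?B" using sum_guard[OF C(1,2), of ?B] C(3) bd_insert_new(3)[OF X p] by auto
  moreover have "s y + sum s ?B = sum s (insert y ?B)" using fB by (subst sum.insert) auto
  moreover have "sum s (insert y ?B) \<le> k"
    using sum_le_total[of "insert y ?B" s] bd_sub[of ?X] V C by blast
  ultimately have 1: "sum vw ?B + ew {p, y} \<le> k" using C by linarith
  have 2: "sum vw ?B + vw y \<le> k" if "\<not> nb y \<subseteq> {p}"
  proof -
    have "y \<in> bd ?X" using bd_insert_new(1)[OF X p] that by simp
    then have "sum vw (insert y ?B) \<le> sum s' (insert y ?B)" using sum_guard[OF C'(1,2), of "insert y ?B"] C'(3) by auto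
    also have "\<dots> \<le> k" using sum_le_total[of "insert y ?B" s'] bd_sub[of ?X] V C' by blast
    finally show ?thesis using fB by (subst (asm) sum.insert) auto
  qed
  show ?thesis unfolding need_def cost_upd_sum[OF V] slide_def using 1 2 by (cases "nb y \<subseteq> {p}") auto
qed

definition state_inv :: "nat \<Rightarrow> 'a set set \<Rightarrow> ('a \<Rightarrow> nat) \<Rightarrow> bool" where
  "state_inv k C s \<longleftrightarrow> C \<subseteq> E \<and> connected_graph (\<Union>C) C \<and> guarded C s \<and> sum s V = k"

lemma sum_slide:
  assumes "u \<in> V" "v \<in> V" "u \<noteq> v" "(j::nat) \<le> s u"
  shows "sum (s(u := s u - j, v := s v + j)) V = sum s V"
proof -
  have f: "finite (V - {u})" using finV by simp
  have v: "v \<in> V - {u}" using assms by auto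
  have r: "sum g V = g u + (g v + sum g (V - {u} - {v}))" for g :: "'a \<Rightarrow> nat"
    using sum.remove[OF finV assms(1), of g] sum.remove[OF f v, of g] by simp
  have "sum (s(u := s u - j, v := s v + j)) (V - {u} - {v}) = sum s (V - {u} - {v})"
    by (rule sum.cong) auto
  then show ?thesis using r[of s] r[of "s(u := s u - j, v := s v + j)"] assms by simp
qed

text \<open>If the edge of the move does not become newly clear, the clear set can only shrink.
  Otherwise, with some edge clear before, exactly one end is new: two old ends would make the edge
  clear already, and two new ends would disconnect the clear edges. In this case no old edge is
  recontaminated.\<close>

lemma move_crus:
  assumes inv: "state_inv k C s" and leg: "legal_move T (C, s) (u, v, j)"
    and aft: "after_move T (C, s) (u, v, j) = (C', s')" and con: "connected_graph (\<Union>C') C'"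
  shows "state_inv k C' s'"
    and "C' \<noteq> {} \<Longrightarrow> C = {} \<Longrightarrow> \<exists>r\<in>V. crus k {r} (\<Union>C')"
    and "C' \<noteq> {} \<Longrightarrow> C \<noteq> {} \<Longrightarrow> crus k (\<Union>C) (\<Union>C')"
proof -
  let ?e = "{u, v}"
  have s': "s' = s(u := s u - j, v := s v + j)" and C': "C' = {e \<in> E. \<not> contaminated T (insert ?e C) s' e}"
    using aft by (auto simp: Let_def)
  have e: "?e \<in> E" "1 \<le> j" "j \<le> s u" "?e \<notin> C \<Longrightarrow> ew ?e \<le> j" using leg by auto
  note uv = edgeD[OF e(1)]
  have C: "C \<subseteq> E" "connected_graph (\<Union>C) C" "guarded C s" "sum s V = k" using inv by (auto simp: state_inv_def)
  have sum': "sum s' V = k" using sum_slide[of u v j s] uv e C(4) s' by simp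
  have g': "guarded C' s'" using clear_guarded[of "insert ?e C" s'] C' by simp
  have C'E: "C' \<subseteq> E" using C' by auto
  have C'sub: "C' \<subseteq> insert ?e C" using C' contaminated.initial[of _ T "insert ?e C" s'] by blast
  show inv': "state_inv k C' s'" using C'E con g' sum' by (simp add: state_inv_def)
  have sv: "s' v \<ge> j" using s' by simp
  show "\<exists>r\<in>V. crus k {r} (\<Union>C')" if ne: "C' \<noteq> {}" "C = {}"
  proof -
    have "C' = {?e}" using ne C'sub by auto
    then have U: "\<Union>C' = insert v {u}" by auto
    have "need {u} u v \<le> k"
      by (rule need_from_inside[OF conn_single[OF uv(1)] _ e(1) _ g' C'E U _ sum'])
        (use uv e(4) ne sv in auto)
    then have "reach k {u} (insert v {u})"
      using reach_step[OF reach_refl[of k "{u}"], of u v] uv e by auto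
    moreover have "conn (\<Union>C')" using connected_edges_conn[OF con C'E ne(1)] .
    ultimately show ?thesis using uv U unfolding crus_def by auto
  qed
  show "crus k (\<Union>C) (\<Union>C')" if ne: "C' \<noteq> {}" "C \<noteq> {}"
  proof -
    let ?X = "\<Union>C"
    have cX: "conn ?X" using connected_edges_conn[OF C(2,1) ne(2)] .
    have cX': "conn (\<Union>C')" using connected_edges_conn[OF con C'E ne(1)] .
    show ?thesis
    proof (cases "?e \<in> C' \<and> ?e \<notin> C")
      case False
      then have "C' \<subseteq> C" using C'sub by auto
      then show ?thesis using cX' unfolding crus_def by auto
    next
      case True
      then have ewj: "ew ?e \<le> j" using e by simp
      \<comment> \<open>With \<open>u\<close> outside, no vertex of the clear subgraph loses
        searchers, so all old edges stay clear.\<close>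
      have nu: "contaminated T (insert ?e C) s' f \<Longrightarrow> f \<notin> C" if "u \<notin> ?X" for f
      proof (rule guarded_clear[of C s'])
        have "s x \<le> s' x" if "x \<in> ?X" for x using that \<open>u \<notin> ?X\<close> unfolding s' by auto
        then show "guarded C s'" using C(3) unfolding guarded_def by (meson order_trans)
      qed (use C in auto)
      have keep: "C \<subseteq> C'" if "u \<notin> ?X" using nu[OF that] C(1) C' by auto
      consider "u \<in> ?X" "v \<in> ?X" | "u \<in> ?X" "v \<notin> ?X" | "u \<notin> ?X" "v \<in> ?X" | "u \<notin> ?X" "v \<notin> ?X" by blast
      then show ?thesis
      proof cases
        case 1
        then have "?e \<in> C" using connected_edges_full[OF C(2,1) e(1)] by blast
        then show ?thesis using True by simp
      next
        case 2
        have "contaminated T (insert ?e C) s' f \<Longrightarrow> f \<notin> C" for f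
        proof (induction rule: contaminated.induct)
          case (spread a y b)
          show ?case
          proof
            assume f: "{b, a} \<in> C"
            have "{a, y} \<in> E - C" using spread contaminated_edge by blast
            then have "vw a \<le> s a" using C(3) f unfolding guarded_def by blast
            \<comment> \<open>Only \<open>u\<close> has lost searchers, so contamination of an old
              edge must pass through \<open>u\<close>. From there it also spreads to the edge of the
              move, which is known to stay clear.\<close>
            then have "a = u" using spread(2) unfolding s' by (auto split: if_splits)
            then have "contaminated T (insert ?e C) s' {v, u}"
              using contaminated.spread[of T "insert ?e C" s' u y v] spread(1,2) e(1) by (simp add: insert_commute)
            then show False using True C' by (simp add: insert_commute)
          qed
        qed auto
        then have "C \<subseteq> C'" using C(1) C' by auto
        then have eq: "C' = insert ?e C" using True C'sub by auto
        have U: "\<Union>C' = insert v ?X" using eq 2 by auto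
        have "need ?X u v \<le> k"
          by (rule need_from_inside[OF cX 2(1) e(1) 2(2) g' C'E U _ sum']) (use ewj sv in auto)
        then have "reach k ?X (insert v ?X)" using reach_step[OF reach_refl, of u ?X v k] 2 e by auto
        then show ?thesis using U cX' unfolding crus_def by simp
      next
        case 3
        have eq: "C' = insert ?e C" using True C'sub keep[OF 3(1)] by auto
        have U: "\<Union>C' = insert u ?X" using eq 3 by auto
        have e': "{v, u} \<in> E" "ew {v, u} \<le> s u" using e ewj by (auto simp: insert_commute)
        have "need ?X v u \<le> k"
          by (rule need_from_outside[OF cX 3(2) e'(1) 3(1) C(3,1) refl e'(2) C(4) g' C'E U sum'])
        then have "reach k ?X (insert u ?X)" using reach_step[OF reach_refl, of v ?X u k] 3 e' by auto
        then show ?thesis using U cX' unfolding crus_def by simp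
      next
        case 4
        have eq: "C' = insert ?e C" using True C'sub keep[OF 4(1)] by auto
        obtain x where x: "x \<in> ?X" using conn_ne[OF cX] by auto
        have "(x, u) \<in> {(a, b). {a, b} \<in> C'}\<^sup>*" using con x eq unfolding connected_graph_def by blast
        then have "u \<in> ?X"
        proof (induction rule: rtrancl_induct)
          case (step a b)
          then have "{a, b} \<in> insert ?e C" using eq by simp
          moreover have "{a, b} \<noteq> ?e" using step.IH 4 by (auto simp: doubleton_eq_iff)
          ultimately show ?case by auto
        qed (use x in auto)
        then show ?thesis using 4 by simp
      qed
    qed
  qed
qed

lemma search_crus:
  "connected_search_from T (C, s) ms \<Longrightarrow> state_inv k C s \<Longrightarrow>
    (C \<noteq> {} \<longrightarrow> (\<exists>r\<in>V. (crus k)\<^sup>*\<^sup>* {r} (\<Union>C))) \<Longrightarrow>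
    E = {} \<or> (\<exists>r\<in>V. (crus k)\<^sup>*\<^sup>* {r} (\<Union>E))"
proof (induction ms arbitrary: C s)
  case Nil
  then show ?case by auto
next
  case (Cons m ms)
  obtain u v j where m: "m = (u, v, j)" by (cases m)
  obtain C' s' where a: "after_move T (C, s) (u, v, j) = (C', s')" by fastforce
  have L: "legal_move T (C, s) (u, v, j)" "connected_graph (\<Union>C') C'" "connected_search_from T (C', s') ms"
    using Cons.prems(1) a m by auto
  note mc = move_crus[OF Cons.prems(2) L(1) a L(2)]
  show ?case
  proof (rule Cons.IH[OF L(3) mc(1)], rule impI)
    assume ne: "C' \<noteq> {}"
    show "\<exists>r\<in>V. (crus k)\<^sup>*\<^sup>* {r} (\<Union>C')"
    proof (cases "C = {}")
      case True
      then show ?thesis using mc(2)[OF ne] by blast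
    next
      case False
      then show ?thesis using mc(3)[OF ne] Cons.prems(3) by (meson rtranclp.rtrancl_into_rtrancl)
    qed
  qed
qed

lemma V_Union: "E \<noteq> {} \<Longrightarrow> \<Union>E = V"
proof (intro equalityI subsetI)
  fix v assume E: "E \<noteq> {}" and v: "v \<in> V"
  have "V \<noteq> {v}"
  proof
    assume "V = {v}"
    moreover obtain e where "e \<in> E" using E by auto
    ultimately show False using edge_ends[of e] edge_sub[of e] by auto
  qed
  then show "v \<in> \<Union>E" using conn_nb[OF conn_V v] by auto
qed (use edge_sub in auto)

lemma strategy_reach:
  assumes "connected_search_strategy T k r ms"
  shows "\<exists>r\<in>V. reach k {r} V"
proof -
  let ?s = "(\<lambda>_. 0)(r := k)"
  have r: "r \<in> V" and c: "connected_search_from T ({}, ?s) ms"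
    using assms by (auto simp: connected_search_strategy_def)
  have "sum ?s V = k" using r finV sum.delta[of V r "\<lambda>_. k"] by (simp add: fun_upd_def)
  then have "state_inv k {} ?s" by (auto simp: state_inv_def connected_graph_def guarded_def)
  then have "E = {} \<or> (\<exists>r\<in>V. (crus k)\<^sup>*\<^sup>* {r} (\<Union>E))" using search_crus[OF c] by blast
  then show ?thesis
  proof
    \<comment> \<open>Without edges the clear set says nothing; connectedness leaves only the
      starting vertex.\<close>
    assume E: "E = {}"
    have "V = {r}"
    proof (rule ccontr)
      assume "V \<noteq> {r}"
      then show False using conn_nb[OF conn_V r] E by auto
    qed
    then show ?thesis using reach_refl[of k "{r}"] r by auto
  next
    assume "\<exists>r\<in>V. (crus k)\<^sup>*\<^sup>* {r} (\<Union>E)"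
    then obtain r' where r': "r' \<in> V" "(crus k)\<^sup>*\<^sup>* {r'} (\<Union>E)" by blast
    show ?thesis
    proof (cases "E = {}")
      case False
      then obtain Z r'' where Z: "r'' \<in> V" "V \<subseteq> Z" "reach k {r''} Z"
        using monotone_search[OF r'(2,1)] V_Union by auto
      then have "Z = V" using conn_sub[OF reach_conn[OF Z(3) conn_single[OF Z(1)]]] by auto
      then show ?thesis using Z by auto
    next
      case True
      then show ?thesis using monotone_search[OF r'(2,1)] conn_ne by auto
    qed
  qed
qed

section \<open>From growing vertex sets to strategies\<close>

fun walk :: "nat \<Rightarrow> 'a list \<Rightarrow> 'a move list" where
  "walk f (x # y # xs) = (x, y, f) # walk f (y # xs)"
| "walk f xs = []"

text \<open>A legal move slides at least one searcher, so without idle searchers there must be no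
  walk.\<close>

definition haul :: "nat \<Rightarrow> 'a list \<Rightarrow> 'a move list" where
  "haul f xs = (if f = 0 then [] else walk f xs)"

definition extend_moves :: "nat \<Rightarrow> 'a set \<Rightarrow> 'a list \<Rightarrow> 'a \<Rightarrow> 'a \<Rightarrow> 'a move list" where
  "extend_moves k X ps p y = haul (k - cost vw X) (rev ps) @
     (p, y, k - cost (vw(y := 0)) (insert y X)) # haul (k - cost vw (insert y X)) (y # ps)"

definition link :: "'a set \<Rightarrow> 'a \<Rightarrow> 'a" where
  "link X y = (THE p. p \<in> X \<and> {p, y} \<in> E)"

fun emit :: "nat \<Rightarrow> 'a set \<Rightarrow> ('a \<Rightarrow> 'a list) \<Rightarrow> 'a list \<Rightarrow> 'a move list" where
  "emit k X up [] = []"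
| "emit k X up (y # ys) = (if y \<in> X then emit k X up ys else
     extend_moves k X (up (link X y)) (link X y) y @
     emit k (insert y X) (up(y := y # up (link X y))) ys)"

text \<open>Distinctness bounds the length of the printed walks and lets loops along parent pointers
  stop exactly at \<open>r\<close>.\<close>

definition up_ok :: "'a \<Rightarrow> 'a set \<Rightarrow> ('a \<Rightarrow> 'a list) \<Rightarrow> bool" where
  "up_ok r X up \<longleftrightarrow> (\<forall>x\<in>X. up x \<noteq> [] \<and> hd (up x) = x \<and> last (up x) = r \<and> set (up x) \<subseteq> X \<and>
     distinct (up x) \<and> successively (\<lambda>a b. {a, b} \<in> E) (up x))"

definition post :: "'a set \<Rightarrow> 'a \<Rightarrow> nat" where
  "post X x = (if x \<in> bd X then vw x else 0)"

lemma link_eq: "conn X \<Longrightarrow> y \<notin> X \<Longrightarrow> p \<in> X \<Longrightarrow> {p, y} \<in> E \<Longrightarrow> link X y = p"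
  unfolding link_def using conn_unique_nb by blast

lemma ind_guard:
  assumes "X \<subseteq> V" "\<And>x. x \<in> bd X \<Longrightarrow> vw x \<le> s x" shows "guarded (ind X) s"
  unfolding guarded_def
proof (intro ballI impI)
  fix v e assume v: "v \<in> \<Union>(ind X)" "e \<in> E - ind X" "v \<in> e"
  obtain z where z: "e = {v, z}" using edge_ends[of e] v by fastforce
  then have "v \<in> bd X" using v by (auto simp: ind_def bd_def nb_iff(2))
  then show "vw v \<le> s v" using assms by blast
qed

lemma ind_connected: "conn X \<Longrightarrow> connected_graph (\<Union>(ind X)) (ind X)"
proof -
  assume X: "conn X"
  have "arc X \<subseteq> {(a, b). {a, b} \<in> ind X}" by (auto simp: arc_def ind_def)
  moreover have "\<Union>(ind X) \<subseteq> X" by (auto simp: ind_def)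
  ultimately show ?thesis using X rtrancl_mono unfolding connected_graph_def conn_def by blast
qed

lemma search_move:
  assumes X': "conn X'" "insert {x, y} (ind X) = ind X'" and e: "{x, y} \<in> E" "1 \<le> j" "j \<le> s x"
    and w: "{x, y} \<in> ind X \<or> ew {x, y} \<le> j" and s': "s' = s(x := s x - j, y := s y + j)"
    and g: "\<And>z. z \<in> bd X' \<Longrightarrow> vw z \<le> s' z"
    and ms: "connected_search_from T (ind X', s') ms"
  shows "connected_search_from T (ind X, s) ((x, y, j) # ms)"
proof -
  have "guarded (ind X') s'" by (rule ind_guard[OF conn_sub[OF X'(1)] g])
  then have "{e \<in> E. \<not> contaminated T (ind X') s' e} = ind X'" by (rule clear_eq) (auto simp: ind_def)
  then have "after_move T (ind X, s) (x, y, j) = (ind X', s')" using X'(2) s' by (simp add: Let_def)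
  then show ?thesis using e w ms ind_connected[OF X'(1)] by auto
qed

text \<open>\<open>g\<close> contains the guards and stays in place; only the \<open>f\<close>
  additional searchers move, so inside a clear set nothing changes.\<close>

lemma walk_clear:
  assumes X: "conn X" and f: "0 < f" and g: "\<And>x. x \<in> bd X \<Longrightarrow> vw x \<le> g x"
  shows "xs \<noteq> [] \<Longrightarrow> set xs \<subseteq> X \<Longrightarrow> successively (\<lambda>a b. {a, b} \<in> E) xs \<Longrightarrow>
    connected_search_from T (ind X, g(last xs := g (last xs) + f)) ms \<Longrightarrow>
    connected_search_from T (ind X, g(hd xs := g (hd xs) + f)) (walk f xs @ ms)"
proof (induction xs rule: induct_list012)
  case (3 x y xs)
  have xy: "{x, y} \<in> E" "x \<in> X" "y \<in> X" "x \<noteq> y" using 3 edgeD(3)[of x y] by auto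
  have i: "{x, y} \<in> ind X" using xy by (auto simp: ind_def)
  have "connected_search_from T (ind X, g(x := g x + f)) ((x, y, f) # walk f (y # xs) @ ms)"
  proof (rule search_move[OF X _ xy(1)])
    show "insert {x, y} (ind X) = ind X" using i by auto
    show "g(y := g y + f) = (g(x := g x + f))(x := (g(x := g x + f)) x - f, y := (g(x := g x + f)) y + f)"
      using xy(4) by auto
    show "connected_search_from T (ind X, g(y := g y + f)) (walk f (y # xs) @ ms)"
    proof -
      have "connected_search_from T (ind X, g(hd (y # xs) := g (hd (y # xs)) + f)) (walk f (y # xs) @ ms)"
        by (rule "3.IH"(2)) (use "3.prems" in \<open>auto simp del: fun_upd_apply\<close>)
      then show ?thesis by (simp only: list.sel)
    qed
    show "vw z \<le> (g(y := g y + f)) z" if "z \<in> bd X" for z using g[OF that] by auto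
  qed (use f i in auto)
  then show ?case by (simp only: list.sel walk.simps append_Cons)
qed auto

lemma haul_clear:
  assumes X: "conn X" and g: "\<And>x. x \<in> bd X \<Longrightarrow> vw x \<le> g x" and xs: "xs \<noteq> []" "set xs \<subseteq> X" "successively (\<lambda>a b. {a, b} \<in> E) xs"
    and ms: "connected_search_from T (ind X, g(last xs := g (last xs) + f)) ms"
  shows "connected_search_from T (ind X, g(hd xs := g (hd xs) + f)) (haul f xs @ ms)"
  using walk_clear[OF X _ g xs ms] ms unfolding haul_def by (cases "f = 0") auto

text \<open>The guards, with all idle searchers at \<open>r\<close>. The nested difference is right
  also for \<open>{r}\<close> with a weight above \<open>k\<close>, where it places exactly
  \<open>k\<close> searchers.\<close>

definition muster :: "nat \<Rightarrow> 'a set \<Rightarrow> 'a \<Rightarrow> 'a \<Rightarrow> nat" where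
  "muster k X r = (post X)(r := k - (cost vw X - post X r))"

lemma post_le_cost: "conn X \<Longrightarrow> post X x \<le> cost vw X"
  unfolding post_def using cost_ge_bd by auto

lemma muster_eq:
  assumes "conn X" "cost vw X \<le> k"
  shows "muster k X r = (post X)(r := post X r + (k - cost vw X))"
proof -
  have "k - (cost vw X - post X r) = post X r + (k - cost vw X)"
    using post_le_cost[OF assms(1), of r] assms(2) by linarith
  then show ?thesis by (simp add: muster_def)
qed

text \<open>The boundary changes only at \<open>y\<close> and \<open>p\<close>; \<open>p\<close>
  leaves it exactly when \<open>y\<close> was its last missing neighbour.\<close>

lemma cost_insert:
  assumes X: "conn X" and p: "p \<in> X" "{p, y} \<in> E" "y \<notin> X"
  shows "cost vw (insert y X) = cost (vw(y := 0)) (insert y X) + post (insert y X) y"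
    and "cost (vw(y := 0)) (insert y X) + vw p = cost vw X + post (insert y X) p"
proof -
  have V: "insert y X \<subseteq> V" using conn_sub[OF conn_insert[OF X p(1,2)]] .
  show "cost vw (insert y X) = cost (vw(y := 0)) (insert y X) + post (insert y X) y"
    using cost_upd[OF V, of vw y] by (simp add: post_def)
  note b = bd_insert_new[OF X p]
  have f: "finite (bd X)" using fin_bd conn_sub[OF X] by blast
  have pe: "p \<noteq> y" using p by auto
  have "bd (insert y X) - {y} = (bd X - {p}) \<union> (if p \<in> bd (insert y X) then {p} else {})"
    (is "?l = ?r")
  proof (rule set_eqI)
    fix x show "x \<in> ?l \<longleftrightarrow> x \<in> ?r"
      using b(4)[of x] pe p(3) bd_sub[of X] by (cases "x = p"; cases "x = y") auto
  qed
  then have "cost (vw(y := 0)) (insert y X) = sum vw (bd X - {p}) + post (insert y X) p"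
    unfolding cost_upd_sum[OF V] post_def using f by (simp add: sum.union_disjoint)
  moreover have "cost vw X = vw p + sum vw (bd X - {p})" unfolding cost_def using sum.remove[OF f b(2)] .
  ultimately show "cost (vw(y := 0)) (insert y X) + vw p = cost vw X + post (insert y X) p" by simp
qed

text \<open>The guards of \<open>X\<close> and the idle searchers are treated separately along the
  three phases of \<open>extend_moves\<close>. The alternative \<open>X = {r}\<close> admits a
  starting vertex heavier than \<open>k\<close>: before an edge is clear nothing has to be
  guarded.\<close>

lemma extend_clear:
  assumes X: "conn X" and p: "p \<in> X" "{p, y} \<in> E" "y \<notin> X" and n: "need X p y \<le> k"
    and up: "ps \<noteq> []" "hd ps = p" "last ps = r" "set ps \<subseteq> X" "successively (\<lambda>a b. {a, b} \<in> E) ps"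
    and k: "X = {r} \<or> cost vw X \<le> k"
    and ms: "connected_search_from T (ind (insert y X), muster k (insert y X) r) ms"
  shows "connected_search_from T (ind X, muster k X r) (extend_moves k X ps p y @ ms)"
proof -
  let ?X = "insert y X" and ?w = "vw(y := 0)"
  let ?g = "cost ?w ?X"
  let ?j = "k - ?g"
  have cX: "conn ?X" using conn_insert[OF X p(1,2)] .
  have pe: "p \<noteq> y" using p by auto
  note b = bd_insert_new[OF X p] and ci = cost_insert[OF X p]
  have sl: "?g + slide p y \<le> k" using n by (simp add: need_def)
  have yle: "post ?X y \<le> slide p y" using b(1) by (auto simp: post_def slide_def)
  have ck: "cost vw ?X \<le> k" using ci(1) sl yle by linarith
  have ewj: "ew {p, y} \<le> ?j" using sl unfolding slide_def by linarith
  have vp: "vw p \<le> cost vw X" using cost_ge_bd[OF X b(2)] .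
  have rest3: "connected_search_from T (ind ?X, (post ?X)(y := ?j)) (haul (k - cost vw ?X) (y # ps) @ ms)"
  proof -
    have "connected_search_from T (ind ?X, (post ?X)(hd (y # ps) := post ?X (hd (y # ps)) + (k - cost vw ?X)))
       (haul (k - cost vw ?X) (y # ps) @ ms)"
    proof (rule haul_clear[OF cX])
      show "successively (\<lambda>a b. {a, b} \<in> E) (y # ps)"
        using up p(2) by (cases ps) (auto simp: insert_commute)
      show "connected_search_from T (ind ?X, (post ?X)(last (y # ps) := post ?X (last (y # ps)) + (k - cost vw ?X))) ms"
        using ms muster_eq[OF cX ck] up by simp
    qed (use up in \<open>auto simp: post_def\<close>)
    moreover have "post ?X y + (k - cost vw ?X) = ?j" using ci(1) ck by simp
    ultimately show ?thesis by simp
  qed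
  have i: "insert {p, y} (ind X) = ind ?X"
  proof (intro equalityI subsetI)
    fix e assume e: "e \<in> ind ?X"
    then have eE: "e \<in> E" "e \<subseteq> ?X" by (auto simp: ind_def)
    show "e \<in> insert {p, y} (ind X)"
    proof (cases "y \<in> e")
      case True
      then obtain z where z: "e = {z, y}" using edge_ends[OF eE(1)] by fastforce
      then have "z \<in> X" using eE edgeD(3)[of z y] by auto
      then have "z = p" using conn_unique_nb[OF X p(3) _ _ p(1,2)] z eE by auto
      then show ?thesis using z by simp
    next
      case False
      then show ?thesis using eE by (auto simp: ind_def)
    qed
  qed (use p in \<open>auto simp: ind_def\<close>)
  have ge: "?g = cost vw X - vw p + post ?X p" using ci(2) vp by linarith
  let ?s1 = "(post X)(p := k - (cost vw X - vw p))"
  have rest2: "connected_search_from T (ind X, ?s1) ((p, y, ?j) # haul (k - cost vw ?X) (y # ps) @ ms)"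
  proof (rule search_move[OF cX i p(2)])
    show "1 \<le> ?j" using ewj ew_pos[OF p(2)] by linarith
    show "?j \<le> ?s1 p" using ge by simp
    show "{p, y} \<in> ind X \<or> ew {p, y} \<le> ?j" using ewj by simp
    show "(post ?X)(y := ?j) = ?s1(p := ?s1 p - ?j, y := ?s1 y + ?j)"
    proof
      fix x
      have "?s1 p - ?j = post ?X p" using ge sl by simp
      moreover have "post X y = 0" using p(3) bd_sub by (auto simp: post_def)
      moreover have "post ?X x = post X x" if "x \<noteq> p" "x \<noteq> y" using b(4)[OF that] by (simp add: post_def)
      ultimately show "((post ?X)(y := ?j)) x = (?s1(p := ?s1 p - ?j, y := ?s1 y + ?j)) x" using pe by auto
    qed
    show "vw z \<le> ((post ?X)(y := ?j)) z" if "z \<in> bd ?X" for z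
    proof (cases "z = y")
      case True
      then have "post ?X y = vw y" using that by (simp add: post_def)
      then show ?thesis using True yle sl by simp
    qed (use that in \<open>auto simp: post_def\<close>)
    show "connected_search_from T (ind ?X, (post ?X)(y := ?j)) (haul (k - cost vw ?X) (y # ps) @ ms)" by (rule rest3)
  qed
  have "connected_search_from T (ind X, muster k X r)
     (haul (k - cost vw X) (rev ps) @ (p, y, ?j) # haul (k - cost vw ?X) (y # ps) @ ms)"
  proof (cases "cost vw X \<le> k")
    case True
    have pv: "post X p = vw p" using b(2) by (simp add: post_def)
    have "connected_search_from T (ind X, (post X)(hd (rev ps) := post X (hd (rev ps)) + (k - cost vw X)))
       (haul (k - cost vw X) (rev ps) @ (p, y, ?j) # haul (k - cost vw ?X) (y # ps) @ ms)"
    proof (rule haul_clear[OF X])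
      show "successively (\<lambda>a b. {a, b} \<in> E) (rev ps)" using up(5) by (simp add: insert_commute)
      have "k - (cost vw X - vw p) = vw p + (k - cost vw X)" using True vp by simp
      then show "connected_search_from T (ind X, (post X)(last (rev ps) := post X (last (rev ps)) + (k - cost vw X)))
         ((p, y, ?j) # haul (k - cost vw ?X) (y # ps) @ ms)"
        using rest2 up(1,2) pv by (simp add: last_rev)
    qed (use up in \<open>auto simp: post_def\<close>)
    then show ?thesis using muster_eq[OF X True] up(1,3) by (simp add: hd_rev)
  next
    \<comment> \<open>The starting vertex is heavier than \<open>k\<close>: there are no idle
      searchers to walk, and all \<open>k\<close> are already at \<open>p\<close>.\<close>
    case False
    then have "X = {r}" using k by simp
    then have "p = r" "haul (k - cost vw X) (rev ps) = []" using p False by (auto simp: haul_def)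
    then show ?thesis using rest2 b(2) by (simp add: muster_def post_def)
  qed
  then show ?thesis by (simp add: extend_moves_def)
qed

lemma up_ok_insert:
  assumes "up_ok r X up" "p \<in> X" "{p, y} \<in> E" "y \<notin> X"
  shows "up_ok r (insert y X) (up(y := y # up p))"
  unfolding up_ok_def
proof
  fix x assume x: "x \<in> insert y X"
  have o: "up x \<noteq> [] \<and> hd (up x) = x \<and> last (up x) = r \<and> set (up x) \<subseteq> X \<and> distinct (up x) \<and>
    successively (\<lambda>a b. {a, b} \<in> E) (up x)" if "x \<in> X" for x
    using assms(1) that unfolding up_ok_def by blast
  show "(up(y := y # up p)) x \<noteq> [] \<and> hd ((up(y := y # up p)) x) = x \<and> last ((up(y := y # up p)) x) = r \<and>
     set ((up(y := y # up p)) x) \<subseteq> insert y X \<and> distinct ((up(y := y # up p)) x) \<and>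
     successively (\<lambda>a b. {a, b} \<in> E) ((up(y := y # up p)) x)"
  proof (cases "x = y")
    case True
    have "successively (\<lambda>a b. {a, b} \<in> E) (y # up p)"
      using o[OF assms(2)] assms(3) by (cases "up p") (auto simp: insert_commute)
    then show ?thesis using True o[OF assms(2)] assms(4) by auto
  next
    case False
    then show ?thesis using o[of x] x by auto
  qed
qed

lemma emit_clear:
  "path k X ys \<Longrightarrow> conn X \<Longrightarrow> up_ok r X up \<Longrightarrow> X \<union> set ys = V \<Longrightarrow> X = {r} \<or> cost vw X \<le> k \<Longrightarrow>
    connected_search_from T (ind X, muster k X r) (emit k X up ys)"
proof (induction ys arbitrary: X up)
  case Nil
  then have "X = V" by auto
  then have "ind X = E" using edge_sub by (auto simp: ind_def)
  then show ?case by simp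
next
  case (Cons y ys)
  show ?case
  proof (cases "y \<in> X")
    case True
    then show ?thesis using Cons.IH[of X up] Cons.prems by (auto simp: insert_absorb)
  next
    case False
    then obtain p where p: "p \<in> X" "{p, y} \<in> E" "need X p y \<le> k" using Cons.prems(1) by auto
    have lk: "link X y = p" using link_eq[OF Cons.prems(2) False p(1,2)] .
    have upp: "up p \<noteq> []" "hd (up p) = p" "last (up p) = r" "set (up p) \<subseteq> X" "successively (\<lambda>a b. {a, b} \<in> E) (up p)"
      using Cons.prems(3) p(1) unfolding up_ok_def by blast+
    have "post (insert y X) y \<le> slide p y"
      using bd_insert_new(1)[OF Cons.prems(2) p(1,2) False] by (auto simp: post_def slide_def)
    then have "cost vw (insert y X) \<le> k"
      using cost_insert(1)[OF Cons.prems(2) p(1,2) False] p(3) unfolding need_def by linarith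
    then have "connected_search_from T (ind (insert y X), muster k (insert y X) r)
        (emit k (insert y X) (up(y := y # up p)) ys)"
      using Cons.prems conn_insert[OF Cons.prems(2) p(1,2)] up_ok_insert[OF Cons.prems(3) p(1,2) False]
      by (intro Cons.IH) (auto simp del: fun_upd_apply)
    from extend_clear[OF Cons.prems(2) p(1,2) False p(3) upp Cons.prems(5) this]
    show ?thesis using False lk by simp
  qed
qed

lemma emit_strategy:
  assumes r: "r \<in> V" and p: "path k {r} ys" "{r} \<union> set ys = V"
  shows "connected_search_strategy T k r (emit k {r} (\<lambda>x. [x]) ys)"
proof -
  have "ind {r} = {}" using edge_card edge_ends by (fastforce simp: ind_def)
  moreover have "muster k {r} r = (\<lambda>_. 0)(r := k)"
  proof -
    have b: "bd {r} = {} \<or> bd {r} = {r}" using bd_sub[of "{r}"] by auto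
    have "cost vw {r} = post {r} r" using b unfolding cost_def post_def by auto
    then show ?thesis using b by (auto simp: muster_def post_def)
  qed
  moreover have "up_ok r {r} (\<lambda>x. [x])" by (auto simp: up_ok_def)
  ultimately show ?thesis using emit_clear[OF p(1) conn_single[OF r] _ p(2), of r "\<lambda>x. [x]"] r
    unfolding connected_search_strategy_def by simp
qed

lemma optimal_strategy:
  assumes r: "r \<in> V" and p: "path k {r} ys" "{r} \<union> set ys = V"
    and opt: "\<And>r' b. r' \<in> V \<Longrightarrow> reach b {r'} V \<Longrightarrow> k \<le> b"
  shows "connected_search_number T = k"
  unfolding connected_search_number_def
  by (rule Least_equality) (use emit_strategy[OF r p] strategy_reach opt in blast)+

end

section \<open>Weakest preconditions with time bounds\<close>

text \<open>Total correctness with the number of steps in the postcondition. Execution is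
  deterministic, so the existential describes the only run.\<close>

definition wp :: "program \<Rightarrow> ram_state \<Rightarrow> (nat \<Rightarrow> ram_state \<Rightarrow> bool) \<Rightarrow> bool" where
  "wp P \<sigma> Q \<longleftrightarrow> (\<exists>t \<sigma>'. exec P \<sigma> t \<sigma>' \<and> Q t \<sigma>')"

definition set_mem :: "nat \<Rightarrow> nat \<Rightarrow> ram_state \<Rightarrow> ram_state" where
  "set_mem i a \<sigma> = \<sigma>\<lparr>mem := (mem \<sigma>)(i := a)\<rparr>"

definition put :: "nat \<Rightarrow> ram_state \<Rightarrow> ram_state" where
  "put a \<sigma> = \<sigma>\<lparr>out := out \<sigma> @ [a]\<rparr>"

lemma state_simps [simp]:
  "regs (set_reg x a \<sigma>) = (regs \<sigma>)(x := a)" "mem (set_reg x a \<sigma>) = mem \<sigma>" "out (set_reg x a \<sigma>) = out \<sigma>"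
  "regs (set_mem i a \<sigma>) = regs \<sigma>" "mem (set_mem i a \<sigma>) = (mem \<sigma>)(i := a)" "out (set_mem i a \<sigma>) = out \<sigma>"
  "regs (put a \<sigma>) = regs \<sigma>" "mem (put a \<sigma>) = mem \<sigma>" "out (put a \<sigma>) = out \<sigma> @ [a]"
  "set_reg x a (set_reg x b \<sigma>) = set_reg x a \<sigma>"
  by (simp_all add: set_reg_def set_mem_def put_def)

lemma wp_mono: "wp P \<sigma> Q \<Longrightarrow> (\<And>t \<sigma>'. Q t \<sigma>' \<Longrightarrow> Q' t \<sigma>') \<Longrightarrow> wp P \<sigma> Q'"
  by (auto simp: wp_def)

lemma wp_det: "exec P \<sigma> t \<sigma>' \<Longrightarrow> wp P \<sigma> Q \<longleftrightarrow> Q t \<sigma>'"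
  unfolding wp_def using exec_deterministic by blast

lemma wp_Skip [simp]: "wp Skip \<sigma> Q \<longleftrightarrow> Q 1 \<sigma>"
  by (rule wp_det[OF exec.Skip])
lemma wp_Const [simp]: "wp (Const x a) \<sigma> Q \<longleftrightarrow> Q 1 (set_reg x a \<sigma>)"
  by (rule wp_det[OF exec.Const])
lemma wp_Copy [simp]: "wp (Copy x y) \<sigma> Q \<longleftrightarrow> Q 1 (set_reg x (regs \<sigma> y) \<sigma>)"
  by (rule wp_det[OF exec.Copy])
lemma wp_Add [simp]: "wp (Add x y z) \<sigma> Q \<longleftrightarrow> Q 1 (set_reg x (regs \<sigma> y + regs \<sigma> z) \<sigma>)"
  by (rule wp_det[OF exec.Add])
lemma wp_Sub [simp]: "wp (Sub x y z) \<sigma> Q \<longleftrightarrow> Q 1 (set_reg x (regs \<sigma> y - regs \<sigma> z) \<sigma>)"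
  by (rule wp_det[OF exec.Sub])
lemma wp_Load [simp]: "wp (Load x y) \<sigma> Q \<longleftrightarrow> Q 1 (set_reg x (mem \<sigma> (regs \<sigma> y)) \<sigma>)"
  by (rule wp_det[OF exec.Load])
lemma wp_Store [simp]: "wp (Store x y) \<sigma> Q \<longleftrightarrow> Q 1 (set_mem (regs \<sigma> x) (regs \<sigma> y) \<sigma>)"
  unfolding set_mem_def by (rule wp_det[OF exec.Store])
lemma wp_Write [simp]: "wp (Write x) \<sigma> Q \<longleftrightarrow> Q 1 (put (regs \<sigma> x) \<sigma>)"
  unfolding put_def by (rule wp_det[OF exec.Write])

lemma wp_Seq [simp]: "wp (Seq P P') \<sigma> Q \<longleftrightarrow> wp P \<sigma> (\<lambda>t \<sigma>'. wp P' \<sigma>' (\<lambda>t' \<sigma>''. Q (t + t') \<sigma>''))"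
  unfolding wp_def by (blast intro: exec.intros elim: exec_elims)

text \<open>Keeps the simplifier out of the postcondition, where the rest of a program waits for a
  state that is not computed yet.\<close>

lemma wp_cong [cong]: "P = P' \<Longrightarrow> \<sigma> = \<sigma>' \<Longrightarrow> wp P \<sigma> Q = wp P' \<sigma>' Q"
  by simp

lemma wp_Cond [simp]: "wp (Cond b P P') \<sigma> Q \<longleftrightarrow>
    (holds b \<sigma> \<longrightarrow> wp P \<sigma> (\<lambda>t. Q (Suc t))) \<and> (\<not> holds b \<sigma> \<longrightarrow> wp P' \<sigma> (\<lambda>t. Q (Suc t)))"
  unfolding wp_def
  by (cases "holds b \<sigma>") (auto intro: exec.CondTrue exec.CondFalse elim!: exec_elims(10))

text \<open>\<open>f\<close> bounds the time the loop still needs: \<open>Suc t\<close> pays for one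
  test and the body, \<open>1 \<le> f\<close> for the last test. Termination follows because
  \<open>f\<close> drops in every round.\<close>

lemma wp_While:
  assumes "I \<sigma>"
    and "\<And>\<sigma>. I \<sigma> \<Longrightarrow> 1 \<le> f \<sigma>"
    and "\<And>\<sigma>. I \<sigma> \<Longrightarrow> holds b \<sigma> \<Longrightarrow> wp P \<sigma> (\<lambda>t \<sigma>'. I \<sigma>' \<and> Suc t + f \<sigma>' \<le> f \<sigma>)"
  shows "wp (While b P) \<sigma> (\<lambda>t \<sigma>'. t \<le> f \<sigma> \<and> I \<sigma>' \<and> \<not> holds b \<sigma>')"
  using assms(1)
proof (induction "f \<sigma>" arbitrary: \<sigma> rule: less_induct)
  case less
  show ?case
  proof (cases "holds b \<sigma>")
    case False
    then have "exec (While b P) \<sigma> 1 \<sigma>" by (rule exec.WhileFalse)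
    then show ?thesis using less.prems False assms(2) unfolding wp_def by blast
  next
    case True
    then obtain t \<sigma>' where 1: "exec P \<sigma> t \<sigma>'" "I \<sigma>'" "Suc t + f \<sigma>' \<le> f \<sigma>"
      using assms(3)[OF less.prems] unfolding wp_def by blast
    then obtain t' \<sigma>'' where 2: "exec (While b P) \<sigma>' t' \<sigma>''" "t' \<le> f \<sigma>'" "I \<sigma>''" "\<not> holds b \<sigma>''"
      using less.hyps[of \<sigma>'] unfolding wp_def by auto
    have "exec (While b P) \<sigma> (Suc (t + t')) \<sigma>''" using True 1(1) 2(1) by (rule exec.WhileTrue)
    then show ?thesis using 1 2 unfolding wp_def by (intro exI[of _ "Suc (t + t')"] exI[of _ \<sigma>'']) auto
  qed
qed

section \<open>Registers, memory and output that a program leaves alone\<close>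

fun writes :: "program \<Rightarrow> reg set" where
  "writes (Const x a) = {x}" | "writes (Copy x y) = {x}" | "writes (Add x y z) = {x}"
| "writes (Sub x y z) = {x}" | "writes (Load x y) = {x}" | "writes (Seq P P') = writes P \<union> writes P'"
| "writes (Cond b P P') = writes P \<union> writes P'" | "writes (While b P) = writes P" | "writes _ = {}"

fun prints :: "program \<Rightarrow> bool" where
  "prints (Write x) = True" | "prints (Seq P P') = (prints P \<or> prints P')"
| "prints (Cond b P P') = (prints P \<or> prints P')" | "prints (While b P) = prints P" | "prints _ = False"

fun stores :: "program \<Rightarrow> bool" where
  "stores (Store x y) = True" | "stores (Seq P P') = (stores P \<or> stores P')"
| "stores (Cond b P P') = (stores P \<or> stores P')" | "stores (While b P) = stores P" | "stores _ = False"

lemma exec_frame: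
  assumes "exec P \<sigma> t \<sigma>'"
  shows "(\<forall>x. x \<notin> writes P \<longrightarrow> regs \<sigma>' x = regs \<sigma> x) \<and> (\<not> prints P \<longrightarrow> out \<sigma>' = out \<sigma>) \<and>
         (\<not> stores P \<longrightarrow> mem \<sigma>' = mem \<sigma>)"
  using assms by (induction rule: exec.induct) auto

text \<open>Specifications of subprograms mention only what changes; the rest is recovered from the
  program text.\<close>

lemma wp_frame:
  assumes "wp P \<sigma> Q"
    and "\<And>t \<sigma>'. Q t \<sigma>' \<Longrightarrow> (\<And>x. x \<notin> writes P \<Longrightarrow> regs \<sigma>' x = regs \<sigma> x) \<Longrightarrow>
      (\<not> prints P \<Longrightarrow> out \<sigma>' = out \<sigma>) \<Longrightarrow> (\<not> stores P \<Longrightarrow> mem \<sigma>' = mem \<sigma>) \<Longrightarrow> Q' t \<sigma>'"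
  shows "wp P \<sigma> Q'"
  using assms exec_frame unfolding wp_def by metis

abbreviation seq (infixr ";;" 60) where "P ;; Q \<equiv> Seq P Q"

text \<open>Scratch register, overwritten by the macros below.\<close>

abbreviation (input) "rT \<equiv> (0::nat)"

definition LoadF :: "reg \<Rightarrow> reg \<Rightarrow> nat \<Rightarrow> program" where
  "LoadF x a f = (Const x f ;; Add x a x ;; Load x x)"
definition StoreF :: "reg \<Rightarrow> nat \<Rightarrow> reg \<Rightarrow> program" where
  "StoreF a f y = (Const rT f ;; Add rT a rT ;; Store rT y)"
definition Inc :: "reg \<Rightarrow> nat \<Rightarrow> program" where
  "Inc x c = (Const rT c ;; Add x x rT)"

lemma wp_LoadF [simp]: "x \<noteq> a \<Longrightarrow> wp (LoadF x a f) \<sigma> Q \<longleftrightarrow> Q 3 (set_reg x (mem \<sigma> (regs \<sigma> a + f)) \<sigma>)"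
  by (simp add: LoadF_def numeral_eq_Suc)
lemma wp_StoreF [simp]: "a \<noteq> rT \<Longrightarrow> y \<noteq> rT \<Longrightarrow> wp (StoreF a f y) \<sigma> Q \<longleftrightarrow>
    Q 3 (set_mem (regs \<sigma> a + f) (regs \<sigma> y) (set_reg rT (regs \<sigma> a + f) \<sigma>))"
  by (simp add: StoreF_def numeral_eq_Suc)
lemma wp_Inc [simp]: "x \<noteq> rT \<Longrightarrow> wp (Inc x c) \<sigma> Q \<longleftrightarrow> Q 2 (set_reg x (regs \<sigma> x + c) (set_reg rT c \<sigma>))"
  by (simp add: Inc_def numeral_eq_Suc)
lemma macro_effects [simp]:
  "writes (LoadF x a f) = {x}" "\<not> prints (LoadF x a f)" "\<not> stores (LoadF x a f)"
  "writes (StoreF a f y) = {rT}" "\<not> prints (StoreF a f y)" "stores (StoreF a f y)"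
  "writes (Inc x c) = {rT, x}" "\<not> prints (Inc x c)" "\<not> stores (Inc x c)"
  by (auto simp: LoadF_def StoreF_def Inc_def)

abbreviation (input) "rN \<equiv> (1::nat)"
abbreviation (input) "rB \<equiv> (2::nat)"
abbreviation (input) "rE \<equiv> (3::nat)"
abbreviation (input) "rH \<equiv> (4::nat)"
abbreviation (input) "rLen \<equiv> (5::nat)"
abbreviation (input) "rCost \<equiv> (6::nat)"
abbreviation (input) "rPeak \<equiv> (7::nat)"
abbreviation (input) "rBound \<equiv> (8::nat)"
abbreviation (input) "rI \<equiv> (9::nat)"
abbreviation (input) "rEnd \<equiv> (10::nat)"
abbreviation (input) "rX \<equiv> (11::nat)"
abbreviation (input) "rW \<equiv> (12::nat)"
abbreviation (input) "rND \<equiv> (13::nat)"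
abbreviation (input) "rMn \<equiv> (14::nat)"
abbreviation (input) "rBest \<equiv> (15::nat)"
abbreviation (input) "rGo \<equiv> (16::nat)"
abbreviation (input) "rQ \<equiv> (17::nat)"
abbreviation (input) "rQE \<equiv> (18::nat)"
text \<open>Never written, hence constantly 0.\<close>

abbreviation (input) "rZ \<equiv> (19::nat)"
abbreviation (input) "rY \<equiv> (31::nat)"

section \<open>Searching a list for the cheapest jump\<close>

definition scan_body :: program where
  "scan_body = (Load rX rI ;; LoadF rW rX 0 ;;
     Cond (Equal rW rZ) Skip
       (LoadF rND rX 4 ;; Sub rY rCost rW ;; Add rND rND rY ;;
        Cond (Equal rBest rZ) (Copy rBest rI ;; Copy rMn rND)
          (Cond (Less rND rMn) (Copy rBest rI ;; Copy rMn rND) Skip)) ;;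
     Inc rI 1)"

definition scan :: program where
  "scan = (Copy rI rH ;; Add rEnd rH rLen ;; Const rBest 0 ;; While (Less rI rEnd) scan_body)"

definition entry_need :: "nat \<Rightarrow> (nat \<Rightarrow> nat) \<Rightarrow> nat \<Rightarrow> nat" where
  "entry_need c M a = M (a + 4) + (c - M a)"

text \<open>A guard weight of 0 marks an inactive entry. \<open>best = 0\<close> says that no active
  entry has been met, which is unambiguous because lists start at positive addresses.\<close>

definition scanned :: "(nat \<Rightarrow> nat) \<Rightarrow> nat \<Rightarrow> nat \<Rightarrow> nat \<Rightarrow> nat \<Rightarrow> nat \<Rightarrow> bool" where
  "scanned M h c k best mn \<longleftrightarrow>
     (best = 0 \<and> (\<forall>i<k. M (M (h + i)) = 0)) \<or>
     (\<exists>b<k. best = h + b \<and> M (M (h + b)) \<noteq> 0 \<and> mn = entry_need c M (M (h + b)) \<and>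
        (\<forall>i<k. M (M (h + i)) \<noteq> 0 \<longrightarrow> mn \<le> entry_need c M (M (h + i))))"

lemma scanned_keep:
  assumes "scanned M h c k best mn"
    and "M (M (h + k)) = 0 \<or> 0 < best \<and> mn \<le> entry_need c M (M (h + k))"
  shows "scanned M h c (Suc k) best mn"
  using assms(1) unfolding scanned_def
proof (elim disjE)
  assume "best = 0 \<and> (\<forall>i<k. M (M (h + i)) = 0)"
  then have "best = 0 \<and> (\<forall>i<Suc k. M (M (h + i)) = 0)" using assms(2) by (auto simp: less_Suc_eq)
  then show "best = 0 \<and> (\<forall>i<Suc k. M (M (h + i)) = 0) \<or>
    (\<exists>b<Suc k. best = h + b \<and> M (M (h + b)) \<noteq> 0 \<and> mn = entry_need c M (M (h + b)) \<and>
        (\<forall>i<Suc k. M (M (h + i)) \<noteq> 0 \<longrightarrow> mn \<le> entry_need c M (M (h + i))))" ..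
next
  assume "\<exists>b<k. best = h + b \<and> M (M (h + b)) \<noteq> 0 \<and> mn = entry_need c M (M (h + b)) \<and>
        (\<forall>i<k. M (M (h + i)) \<noteq> 0 \<longrightarrow> mn \<le> entry_need c M (M (h + i)))"
  then obtain b where b: "b < k" "best = h + b" "M (M (h + b)) \<noteq> 0" "mn = entry_need c M (M (h + b))"
    "\<forall>i<k. M (M (h + i)) \<noteq> 0 \<longrightarrow> mn \<le> entry_need c M (M (h + i))" by blast
  have "mn \<le> entry_need c M (M (h + i))" if "i < Suc k" "M (M (h + i)) \<noteq> 0" for i
    using that assms(2) b(5) by (cases "i = k") auto
  then show "best = 0 \<and> (\<forall>i<Suc k. M (M (h + i)) = 0) \<or>
    (\<exists>b<Suc k. best = h + b \<and> M (M (h + b)) \<noteq> 0 \<and> mn = entry_need c M (M (h + b)) \<and>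
        (\<forall>i<Suc k. M (M (h + i)) \<noteq> 0 \<longrightarrow> mn \<le> entry_need c M (M (h + i))))"
    using b(1-4) less_SucI by blast
qed

lemma scanned_new:
  assumes "scanned M h c k best mn" "0 < h"
    and "M (M (h + k)) \<noteq> 0" "best = 0 \<or> entry_need c M (M (h + k)) < mn"
  shows "scanned M h c (Suc k) (h + k) (entry_need c M (M (h + k)))"
proof -
  have "entry_need c M (M (h + k)) \<le> entry_need c M (M (h + i))" if "i < Suc k" "M (M (h + i)) \<noteq> 0" for i
  proof (cases "i = k")
    case False
    then have i: "i < k" using that by simp
    then have "best \<noteq> 0" using assms(1,2) that(2) unfolding scanned_def by auto
    then have "entry_need c M (M (h + k)) < mn" "mn \<le> entry_need c M (M (h + i))"
      using assms(1,4) that(2) i unfolding scanned_def by blast+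
    then show ?thesis by linarith
  qed simp
  then show ?thesis using assms(3) unfolding scanned_def by blast
qed

lemma wp_scan:
  assumes "regs \<sigma> rZ = 0" "0 < regs \<sigma> rH"
  shows "wp scan \<sigma> (\<lambda>t \<sigma>'. t \<le> 20 * regs \<sigma> rLen + 4 \<and> regs \<sigma>' rEnd = regs \<sigma> rH + regs \<sigma> rLen \<and>
     scanned (mem \<sigma>) (regs \<sigma> rH) (regs \<sigma> rCost) (regs \<sigma> rLen) (regs \<sigma>' rBest) (regs \<sigma>' rMn))"
proof -
  let ?M = "mem \<sigma>" and ?h = "regs \<sigma> rH" and ?c = "regs \<sigma> rCost" and ?l = "regs \<sigma> rLen"
  let ?\<sigma> = "set_reg rBest 0 (set_reg rEnd (?h + ?l) (set_reg rI ?h \<sigma>))"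
  let ?I = "\<lambda>s. mem s = ?M \<and> regs s rZ = 0 \<and> regs s rCost = ?c \<and> regs s rEnd = ?h + ?l \<and>
      (\<exists>k\<le>?l. regs s rI = ?h + k \<and> scanned ?M ?h ?c k (regs s rBest) (regs s rMn))"
  have "wp (While (Less rI rEnd) scan_body) ?\<sigma> (\<lambda>t s. t \<le> 20 * (regs ?\<sigma> rEnd - regs ?\<sigma> rI) + 1 \<and> ?I s \<and> \<not> holds (Less rI rEnd) s)"
  proof (rule wp_While[where f = "\<lambda>s. 20 * (regs s rEnd - regs s rI) + 1"])
    show "?I ?\<sigma>" using assms by (auto simp: scanned_def intro!: exI[of _ 0])
  next
    fix s assume I: "?I s" and b: "holds (Less rI rEnd) s"
    then obtain k where k: "k < ?l" "regs s rI = ?h + k" "scanned ?M ?h ?c k (regs s rBest) (regs s rMn)" by auto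
    show "wp scan_body s (\<lambda>t s'. ?I s' \<and> Suc t + (20 * (regs s' rEnd - regs s' rI) + 1) \<le> 20 * (regs s rEnd - regs s rI) + 1)"
    proof -
      note n = scanned_new[OF k(3) assms(2)] scanned_keep[OF k(3)]
      have e: "mem \<sigma> (mem \<sigma> (?h + k) + 4) + (?c - mem \<sigma> (mem \<sigma> (?h + k))) = entry_need ?c ?M (?M (?h + k))"
        by (simp add: entry_need_def)
      show ?thesis
        using I k n unfolding scan_body_def
        by (simp add: e) (intro conjI impI exI[of _ "Suc k"], simp_all)
    qed
  qed simp
  then show ?thesis using assms unfolding scan_def
    by simp (rule wp_mono, assumption, auto)
qed

section \<open>Memory layout\<close>

definition slots :: "nat \<Rightarrow> nat set" where "slots m = {j. bit m j}"

lemma slots_0 [simp]: "slots 0 = {}"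
  by (simp add: slots_def)

lemma slots_inj: "slots m = slots m' \<Longrightarrow> m = m'"
  by (auto simp: slots_def intro: bit_eqI)

lemma slots_ne: "m \<noteq> 0 \<Longrightarrow> slots m \<noteq> {}"
  using slots_inj[of m 0] by auto

lemma slots_lt: "m < 2 ^ d \<Longrightarrow> slots m \<subseteq> {..<d}"
proof
  fix j assume m: "m < 2 ^ d" and j: "j \<in> slots m"
  show "j \<in> {..<d}"
  proof (rule ccontr)
    assume "j \<notin> {..<d}"
    then have "m < 2 ^ j" using m by (metis lessThan_iff less_le_trans not_less one_le_numeral power_increasing)
    then show False using j by (simp add: slots_def bit_nat_iff bit_iff_odd)
  qed
qed

lemma slots_full: "slots (2 ^ d - 1) = {..<d}"
proof -
  have "2 ^ d - 1 = (mask d :: nat)" by (simp add: mask_eq_exp_minus_1)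
  then show ?thesis by (auto simp: slots_def bit_mask_iff)
qed

text \<open>Subtracting a power of two that is present clears exactly this bit. On record addresses
  the removal of a neighbour is therefore a single subtraction.\<close>

lemma slots_remove:
  assumes "j \<in> slots m" shows "slots (m - 2 ^ j) = slots m - {j}" "2 ^ j \<le> m"
proof -
  have b: "bit m j" using assms by (simp add: slots_def)
  have "2 ^ j \<le> m" using b unfolding bit_iff_odd by (metis div_less even_zero not_less)
  moreover have "unset_bit j m + 2 ^ j = or (unset_bit j m) (2 ^ j)"
    by (rule disjunctive_add_eq_or) (auto simp: bit_eq_iff bit_and_iff bit_unset_bit_iff bit_exp_iff)
  moreover have "or (unset_bit j m) (2 ^ j) = m"
    by (rule bit_eqI) (use b in \<open>auto simp: bit_unset_bit_iff bit_or_iff bit_exp_iff\<close>)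
  ultimately have "2 ^ j \<le> m" "m - 2 ^ j = unset_bit j m" by linarith+
  then show "slots (m - 2 ^ j) = slots m - {j}" "2 ^ j \<le> m" by (auto simp: slots_def bit_unset_bit_iff)
qed

lemma slots_high: "2 ^ j \<le> m \<Longrightarrow> m < 2 ^ Suc j \<Longrightarrow> j \<in> slots m"
proof -
  assume a: "2 ^ j \<le> m" "m < 2 ^ Suc j"
  have "m div 2 ^ j = 1" using a by (auto intro: div_nat_eqI)
  then show ?thesis by (simp add: slots_def bit_iff_odd)
qed

fun adjl :: "(nat \<times> nat) list \<Rightarrow> nat \<Rightarrow> nat list" where
  "adjl [] v = []"
| "adjl ((a, b) # es) v = (if a = v then b # adjl es v else if b = v then a # adjl es v else adjl es v)"

lemma adjl_append: "adjl (xs @ ys) v = adjl xs v @ adjl ys v"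
  by (induction xs v rule: adjl.induct) auto

lemma set_adjl: "set (adjl es v) = {u. \<exists>(a, b)\<in>set es. {u, v} = {a, b}}"
  by (induction es v rule: adjl.induct) (auto simp: doubleton_eq_iff)

lemma distinct_adjl:
  "distinct (map (\<lambda>(u, v). {u, v}) es) \<Longrightarrow> distinct (adjl es v)"
proof (induction es v rule: adjl.induct)
  case (2 a b es v)
  have "b \<notin> set (adjl es a)" "a \<notin> set (adjl es b)" using "2.prems" by (auto simp: set_adjl insert_commute)
  then show ?case using 2 by auto
qed simp

locale tree_input = wtree T for T :: "nat wgraph" +
  fixes es :: "(nat \<times> nat) list" and D :: nat
  assumes listing: "edge_listing T es" and deg: "max_degree T \<le> D"
begin

definition "n = card V"

definition d :: "nat \<Rightarrow> nat" where "d v = length (adjl es v)"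
definition nbr :: "nat \<Rightarrow> nat \<Rightarrow> nat" where "nbr v j = adjl es v ! j"
definition nbrs :: "nat \<Rightarrow> nat \<Rightarrow> nat set" where "nbrs v m = nbr v ` slots m"

lemma V_eq: "V = {..<n}"
  using listing by (auto simp: edge_listing_def n_def)

lemma es_edges: "(\<lambda>(u, v). {u, v}) ` set es = E" and es_distinct: "distinct (map (\<lambda>(u, v). {u, v}) es)"
  using listing by (auto simp: edge_listing_def)

lemma adjl_nb: "set (adjl es v) = nb v"
  unfolding set_adjl nb_def es_edges[symmetric] by auto

lemma adjl_distinct: "distinct (adjl es v)"
  using distinct_adjl es_distinct by blast

lemma d_card: "d v = card (nb v)"
  unfolding d_def adjl_nb[symmetric] using adjl_distinct distinct_card by metis

lemma d_le: assumes "v \<in> V" shows "d v \<le> D"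
proof -
  have "inj_on (\<lambda>u. {u, v}) (nb v)" by (auto simp: inj_on_def doubleton_eq_iff)
  moreover have "(\<lambda>u. {u, v}) ` nb v = {e \<in> E. v \<in> e}"
  proof (intro equalityI subsetI)
    fix e assume e: "e \<in> {e \<in> E. v \<in> e}"
    then obtain u where "e = {u, v}" using edge_ends[of e] by fastforce
    then show "e \<in> (\<lambda>u. {u, v}) ` nb v" using e by (auto simp: nb_def)
  qed (auto simp: nb_def)
  ultimately have "card (nb v) = degree T v" unfolding degree_def using card_image by fastforce
  also have "\<dots> \<le> max_degree T" unfolding max_degree_def using assms finV by (intro Max_ge) auto
  finally show ?thesis using deg d_card by simp
qed

lemma nbr_bij: "bij_betw (nbr v) {..<d v} (nb v)"
  unfolding nbr_def d_def adjl_nb[symmetric] by (rule bij_betw_nth[OF adjl_distinct]) auto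

lemma nbr_in: "j < d v \<Longrightarrow> nbr v j \<in> nb v"
  using nbr_bij bij_betwE by blast

lemma nbrs_sub: "m < 2 ^ d v \<Longrightarrow> nbrs v m \<subseteq> nb v"
  unfolding nbrs_def using slots_lt nbr_in by blast

lemma nbrs_0 [simp]: "nbrs v 0 = {}"
  by (simp add: nbrs_def)

lemma nbrs_ne: "m \<noteq> 0 \<Longrightarrow> nbrs v m \<noteq> {}"
  using slots_ne by (simp add: nbrs_def)

lemma nbrs_full: "nbrs v (2 ^ d v - 1) = nb v"
  unfolding nbrs_def slots_full using nbr_bij by (simp add: bij_betw_def)

lemma nbrs_remove:
  assumes "m < 2 ^ d v" "j \<in> slots m"
  shows "nbrs v (m - 2 ^ j) = nbrs v m - {nbr v j}" "nbr v j \<in> nbrs v m" "j < d v"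
proof -
  have s: "slots m \<subseteq> {..<d v}" using slots_lt assms by blast
  have "inj_on (nbr v) (slots m)" using nbr_bij s inj_on_subset unfolding bij_betw_def by blast
  then show "nbrs v (m - 2 ^ j) = nbrs v m - {nbr v j}"
    unfolding nbrs_def slots_remove(1)[OF assms(2)] using assms(2) by (simp add: inj_on_image_set_diff)
  show "nbr v j \<in> nbrs v m" using assms by (auto simp: nbrs_def)
  show "j < d v" using s assms by auto
qed

lemma nbrs_inj:
  assumes "m < 2 ^ d v" "m' < 2 ^ d v" "nbrs v m = nbrs v m'" shows "m = m'"
proof -
  have "inj_on (nbr v) {..<d v}" using nbr_bij unfolding bij_betw_def by blast
  then have "slots m = slots m'" using assms slots_lt inj_on_image_eq_iff unfolding nbrs_def by metis
  then show ?thesis by (rule slots_inj)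
qed

section \<open>Addresses and contents of records\<close>

definition valid :: "nat \<times> nat \<Rightarrow> bool" where
  "valid x \<longleftrightarrow> fst x < n \<and> snd x < 2 ^ d (fst x)"

definition item :: "nat \<times> nat \<Rightarrow> nat \<times> nat set" where
  "item x = (fst x, nbrs (fst x) (snd x))"

definition base :: nat where "base = 2 + n + 3 * length es"

text \<open>A record has 32 cells, and every vertex owns \<open>2 ^ D\<close> records whatever its
  degree. Adding or removing the \<open>j\<close>-th neighbour changes the address by
  \<open>32 * 2 ^ j\<close>, so the machine finds all addresses by addition and subtraction.\<close>

definition ad :: "nat \<Rightarrow> nat \<Rightarrow> nat" where "ad v m = base + 32 * (v * 2 ^ D + m)"

abbreviation adp :: "nat \<times> nat \<Rightarrow> nat" where "adp x \<equiv> ad (fst x) (snd x)"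

definition heap0 :: nat where "heap0 = ad n 0"

lemma valid_lt: "valid (v, m) \<Longrightarrow> v < n \<and> m < 2 ^ D"
proof -
  assume v: "valid (v, m)"
  then have "(2::nat) ^ d v \<le> 2 ^ D" using d_le[of v] V_eq by (auto simp: valid_def)
  moreover have "m < 2 ^ d v" "v < n" using v by (auto simp: valid_def)
  ultimately show ?thesis by linarith
qed

text \<open>With masks below \<open>2 ^ D\<close> and fields below 32, vertex, mask and field are
  the digits of the address in a mixed radix.\<close>

lemma ad_eq:
  assumes "m < 2 ^ D" "m' < 2 ^ D" "f < 32" "f' < 32"
  shows "ad v m + f = ad v' m' + f' \<longleftrightarrow> v = v' \<and> m = m' \<and> f = f'"
proof
  assume "ad v m + f = ad v' m' + f'"
  then have e: "32 * (v * 2 ^ D + m) + f = 32 * (v' * 2 ^ D + m') + f'" by (simp add: ad_def)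
  have f: "f = f'" using arg_cong[OF e, of "\<lambda>x. x mod 32"] assms by (simp only: mod_mult_self4 mod_less)
  then have e2: "v * 2 ^ D + m = v' * 2 ^ D + m'" using e by simp
  have "v = v'" using arg_cong[OF e2, of "\<lambda>x. x div 2 ^ D"] assms by simp
  then show "v = v' \<and> m = m' \<and> f = f'" using f e2 by simp
qed simp

lemma ad_less: "v < n \<Longrightarrow> m < 2 ^ D \<Longrightarrow> f < 32 \<Longrightarrow> ad v m + f < heap0"
proof -
  assume a: "v < n" "m < 2 ^ D" "f < 32"
  have "v * 2 ^ D + m + 1 \<le> Suc v * 2 ^ D" using a by simp
  also have "\<dots> \<le> n * 2 ^ D" using a by (intro mult_le_mono1) simp
  finally show ?thesis using a by (simp add: ad_def heap0_def)
qed

lemma item_inj: "inj_on item {x. valid x}"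
  unfolding inj_on_def item_def valid_def using nbrs_inj by (auto intro: prod_eqI)

definition holds_list :: "(nat \<Rightarrow> nat) \<Rightarrow> nat \<Rightarrow> (nat \<times> nat) list \<Rightarrow> bool" where
  "holds_list M h LL \<longleftrightarrow> (\<forall>i<length LL. M (h + i) = adp (LL ! i))"

text \<open>
  The record at \<open>ad v m\<close> describes the vertex \<open>v\<close> with the neighbours selected by the bits of \<open>m\<close>
  still contaminated. Fields of every record: 0 guard weight (0 if \<open>m = 0\<close>), 3 not yet computed,
  4 and 5 searchers and final cost of the jump, 6 and 7 address and length of its list of records,
  17 the record with \<open>m = 0\<close>, 18 offset of the highest bit of \<open>m\<close>. If \<open>m\<close> is a single bit: 8 the record
  of that neighbour with everything but \<open>v\<close> contaminated, 9 weight of the edge, 13 the neighbour.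
  If \<open>m = 0\<close>: 10 number of the vertex, 11 size of its records, 12 weight, 14 degree, 15 visited;
  while printing, 14 counts unvisited neighbours and 13 holds the parent.
\<close>

definition static :: "(nat \<Rightarrow> nat) \<Rightarrow> bool" where
  "static M \<longleftrightarrow>
    (\<forall>v m. v < n \<and> m < 2 ^ d v \<longrightarrow> M (ad v m) = (if m = 0 then 0 else vw v) \<and> M (ad v m + 17) = ad v 0 \<and>
       (0 < m \<longrightarrow> (\<exists>j. 2 ^ j \<le> m \<and> m < 2 ^ Suc j \<and> M (ad v m + 18) = 32 * 2 ^ j))) \<and>
    (\<forall>v j. v < n \<and> j < d v \<longrightarrow> M (ad v (2 ^ j) + 9) = ew {v, nbr v j} \<and> M (ad v (2 ^ j) + 13) = ad (nbr v j) 0 \<and>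
       (\<exists>m. m < 2 ^ d (nbr v j) \<and> M (ad v (2 ^ j) + 8) = ad (nbr v j) m \<and> nbrs (nbr v j) m = nb (nbr v j) - {v})) \<and>
    (\<forall>v<n. M (ad v 0 + 10) = v \<and> M (ad v 0 + 11) = 32 * 2 ^ d v \<and> M (ad v 0 + 12) = vw v \<and>
       M (ad v 0 + 14) = d v \<and> M (ad v 0 + 15) = 0)"

text \<open>The records that a list may contain. One with mask 0 stands for a vertex without missing
  neighbours and has no jump to be computed.\<close>

definition okset :: "(nat \<times> nat) set \<Rightarrow> (nat \<times> nat) set" where
  "okset S = {x. valid x \<and> (snd x = 0 \<or> x \<in> S)}"

definition entry_ok :: "(nat \<Rightarrow> nat) \<Rightarrow> nat \<Rightarrow> (nat \<times> nat) set \<Rightarrow> nat \<times> nat \<Rightarrow> (nat \<times> nat) list \<Rightarrow> bool" where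
  "entry_ok M h S x LL \<longleftrightarrow>
     segment (fst x) (nbrs (fst x) (snd x)) (M (adp x + 4)) (M (adp x + 5)) (map item LL) \<and>
     M (adp x + 7) = length LL \<and> heap0 \<le> M (adp x + 6) \<and> M (adp x + 6) + length LL \<le> h \<and>
     holds_list M (M (adp x + 6)) LL \<and> set LL \<subseteq> okset S"

text \<open>\<open>h\<close> is the first free cell of the heap; all stored lists lie between
  \<open>heap0\<close> and \<open>h\<close>.\<close>

definition table :: "(nat \<Rightarrow> nat) \<Rightarrow> nat \<Rightarrow> (nat \<times> nat) set \<Rightarrow> bool" where
  "table M h S \<longleftrightarrow> heap0 \<le> h \<and> (\<forall>x\<in>S. valid x \<and> snd x \<noteq> 0 \<and> (\<exists>LL. entry_ok M h S x LL))"

lemma valid_ad: "valid x \<Longrightarrow> f < 32 \<Longrightarrow> adp x + f < heap0"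
  using ad_less valid_lt[of "fst x" "snd x"] by auto

lemma static_agree:
  assumes "static M" "\<And>i. i < heap0 \<Longrightarrow> M' i = M i" shows "static M'"
proof -
  have a: "M' (ad v m + f) = M (ad v m + f)" if "v < n" "m < 2 ^ d v" "f < 32" for v m f
    using assms(2) valid_ad[of "(v, m)" f] that by (simp add: valid_def)
  have a0: "M' (ad v m) = M (ad v m)" if "v < n" "m < 2 ^ d v" for v m
    using a[OF that, of 0] by simp
  show ?thesis using assms(1) unfolding static_def by (simp add: a a0 cong: conj_cong)
qed

text \<open>Records and stored lists lie below \<open>h\<close>, so work above \<open>h\<close>
  cannot damage them.\<close>

lemma table_agree:
  assumes "table M h S" "\<And>i. i < h \<Longrightarrow> M' i = M i" "h \<le> h'" shows "table M' h' S"
proof -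
  have h: "heap0 \<le> h" using assms by (simp add: table_def)
  have "entry_ok M' h' S x LL" if x: "x \<in> S" "entry_ok M h S x LL" for x LL
  proof -
    have v: "valid x" using assms x by (auto simp: table_def)
    have a: "M' (adp x + f) = M (adp x + f)" if "f < 32" for f
      using assms(2) valid_ad[OF v that] h by simp
    have l: "M (adp x + 6) + length LL \<le> h" using x by (simp add: entry_ok_def)
    have "M' (M (adp x + 6) + i) = M (M (adp x + 6) + i)" if "i < length LL" for i
      using assms(2)[of "M (adp x + 6) + i"] l that by simp
    then show ?thesis using x(2) assms(3) unfolding entry_ok_def holds_list_def by (simp add: a)
  qed
  then show ?thesis using assms unfolding table_def by (meson order_trans)
qed

end

section \<open>Performing jumps\<close>

definition copy_seg :: program where
  "copy_seg = While (Less rQ rQE) (Load rW rQ ;; Store rEnd rW ;; Inc rQ 1 ;; Inc rEnd 1)"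

definition do_jump :: program where
  "do_jump = (Load rX rBest ;; LoadF rW rX 17 ;; Store rBest rW ;;
     LoadF rW rX 0 ;; Sub rCost rCost rW ;; LoadF rW rX 5 ;; Add rCost rCost rW ;;
     Cond (Less rPeak rMn) (Copy rPeak rMn) Skip ;;
     LoadF rQ rX 6 ;; LoadF rW rX 7 ;; Add rQE rQ rW ;; Add rLen rLen rW ;; copy_seg)"

text \<open>A jump is performed if it fits under the present peak or if the cost is still at least
  \<open>rBound\<close>. With \<open>rBound = 0\<close> the loop ends only when no active entry is
  left.\<close>

definition run_jumps :: program where
  "run_jumps = (Const rGo 1 ;; While (NotEqual rGo rZ)
     (scan ;; Const rGo 0 ;;
      Cond (Equal rBest rZ) Skip
        (Cond (LessEq rMn rPeak) (Const rGo 1) (Cond (LessEq rBound rCost) (Const rGo 1) Skip)) ;;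
      Cond (Equal rGo rZ) Skip do_jump))"

definition paste :: "(nat \<Rightarrow> nat) \<Rightarrow> nat \<Rightarrow> nat \<Rightarrow> nat \<Rightarrow> nat \<Rightarrow> nat" where
  "paste M q e l i = (if e \<le> i \<and> i < e + l then M (q + (i - e)) else M i)"

lemma wp_copy:
  assumes "regs \<sigma> rQE = regs \<sigma> rQ + l" "regs \<sigma> rQ + l \<le> regs \<sigma> rEnd"
  shows "wp copy_seg \<sigma> (\<lambda>t \<sigma>'. t \<le> 8 * l + 1 \<and> mem \<sigma>' = paste (mem \<sigma>) (regs \<sigma> rQ) (regs \<sigma> rEnd) l)"
proof -
  let ?M = "mem \<sigma>" and ?q = "regs \<sigma> rQ" and ?e = "regs \<sigma> rEnd"
  let ?I = "\<lambda>s. regs s rQE = ?q + l \<and> (\<exists>k\<le>l. regs s rQ = ?q + k \<and> regs s rEnd = ?e + k \<and> mem s = paste ?M ?q ?e k)"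
  have "wp copy_seg \<sigma> (\<lambda>t s. t \<le> 8 * (regs \<sigma> rQE - regs \<sigma> rQ) + 1 \<and> ?I s \<and> \<not> holds (Less rQ rQE) s)"
    unfolding copy_seg_def
  proof (rule wp_While[where f = "\<lambda>s. 8 * (regs s rQE - regs s rQ) + 1"])
    show "?I \<sigma>" using assms by (auto simp: paste_def intro!: exI[of _ 0])
  next
    fix s assume I: "?I s" and b: "holds (Less rQ rQE) s"
    then obtain k where k: "k < l" "regs s rQ = ?q + k" "regs s rEnd = ?e + k" "mem s = paste ?M ?q ?e k" by auto
    \<comment> \<open>The source ends at or before the start of the target, so the cell read next
      has not been overwritten.\<close>
    have "(paste ?M ?q ?e k)(?e + k := paste ?M ?q ?e k (?q + k)) = paste ?M ?q ?e (Suc k)"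
      using k(1) assms(2) by (auto simp: paste_def fun_eq_iff)
    then show "wp (Load rW rQ ;; Store rEnd rW ;; Inc rQ 1 ;; Inc rEnd 1) s
       (\<lambda>t s'. ?I s' \<and> Suc t + (8 * (regs s' rQE - regs s' rQ) + 1) \<le> 8 * (regs s rQE - regs s rQ) + 1)"
      using I k by simp
  qed simp
  then show ?thesis using assms by (elim wp_mono) (auto simp: paste_def)
qed

lemma wp_do_jump:
  assumes b: "regs \<sigma> rBest = h + b" "a = mem \<sigma> (h + b)" "\<And>f. f < 32 \<Longrightarrow> a + f < h"
    and q: "q = mem \<sigma> (a + 6)" "l = mem \<sigma> (a + 7)" "q + l \<le> h"
    and e: "regs \<sigma> rEnd = h + regs \<sigma> rLen" "b < regs \<sigma> rLen"
  shows "wp do_jump \<sigma> (\<lambda>t \<sigma>'. t \<le> 8 * l + 40 \<and>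
     mem \<sigma>' = paste ((mem \<sigma>)(h + b := mem \<sigma> (a + 17))) q (h + regs \<sigma> rLen) l \<and>
     regs \<sigma>' rLen = regs \<sigma> rLen + l \<and> regs \<sigma>' rCost = regs \<sigma> rCost - mem \<sigma> a + mem \<sigma> (a + 5) \<and>
     regs \<sigma>' rPeak = max (regs \<sigma> rPeak) (regs \<sigma> rMn))"
proof -
  let ?M = "(mem \<sigma>)(h + b := mem \<sigma> (a + 17))"
  have m: "?M (a + f) = mem \<sigma> (a + f)" if "f < 32" for f using b(3)[OF that] by simp
  have m0: "?M a = mem \<sigma> a" using m[of 0] by simp
  note ms = m[of 5, simplified] m[of 6, simplified] m[of 7, simplified] m0[simplified]
  have cp: "wp copy_seg s (\<lambda>t s'. t \<le> 8 * l + 1 \<and> mem s' = paste ?M q (h + regs \<sigma> rLen) l \<and>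
      regs s' rLen = regs s rLen \<and> regs s' rCost = regs s rCost \<and> regs s' rPeak = regs s rPeak)"
    if "mem s = ?M" "regs s rQ = q" "regs s rQE = q + l" "regs s rEnd = h + regs \<sigma> rLen" for s
    by (rule wp_frame[OF wp_copy[of s l]]) (use that q in \<open>auto simp: copy_seg_def\<close>)
  show ?thesis
    unfolding do_jump_def
    using b(1,2) q e ms
    by (auto intro!: wp_mono[OF cp])
qed

lemma scan_effects: "writes scan = {rT, rI, rEnd, rX, rW, rND, rMn, rBest, rY}" "\<not> prints scan" "\<not> stores scan"
  by (auto simp: scan_def scan_body_def)

lemma do_jump_effects: "writes do_jump = {rT, rEnd, rX, rW, rCost, rPeak, rQ, rQE, rLen}" "\<not> prints do_jump"
  by (auto simp: do_jump_def copy_seg_def)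

lemma run_jumps_effects:
  "writes run_jumps = {rT, rI, rEnd, rX, rW, rND, rMn, rBest, rY, rGo, rCost, rPeak, rQ, rQE, rLen}" "\<not> prints run_jumps"
  by (auto simp: run_jumps_def scan_effects do_jump_effects)

context tree_input
begin

definition stopped :: "nat \<Rightarrow> nat set \<Rightarrow> nat \<Rightarrow> (nat \<times> nat set) list \<Rightarrow> bool" where
  "stopped bound X p L \<longleftrightarrow> (cost vw X < bound \<or> (\<forall>v Q. (v, Q) \<in> set L \<longrightarrow> Q = {})) \<and>
     (\<exists>J Sg. (\<forall>v Q. (v, Q) \<in> set L \<longrightarrow> Q \<noteq> {} \<longrightarrow> (\<exists>c. segment v Q (J (v, Q)) c (Sg (v, Q)))) \<and>
        (\<forall>v Q. (v, Q) \<in> set L \<longrightarrow> Q \<noteq> {} \<longrightarrow> p < jneed X J (v, Q)))"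

text \<open>The registers follow \<open>run_inv_jump\<close>, with needs and segments read off the
  table. Every jump lengthens the list, whose length stays below \<open>2 * n\<close>, so there are
  O(n) rounds of O(n) steps. All writing happens at or above \<open>h\<close>.\<close>

lemma wp_run_jumps:
  assumes st: "static (mem \<sigma>)" and tb: "table (mem \<sigma>) h S"
    and r: "regs \<sigma> rZ = 0" "regs \<sigma> rH = h" "regs \<sigma> rLen = length LL" "regs \<sigma> rCost = cost vw X"
      "regs \<sigma> rPeak = p" "regs \<sigma> rBound = bound"
    and L: "holds_list (mem \<sigma>) h LL" "set LL \<subseteq> okset S" "LL \<noteq> []"
    and inv: "run_inv U K X0 bound p0 l0 X p (map item LL)"
    and K: "conn X0" "K \<subseteq> X0" "V - K \<subseteq> U" "l0 \<le> 1" "K \<noteq> {}"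
  shows "wp run_jumps \<sigma> (\<lambda>t \<sigma>'. t \<le> 200 * (n + 1) * (n + 1) + 2 \<and>
     (\<exists>X' p' LL'. run_inv U K X0 bound p0 l0 X' p' (map item LL') \<and> stopped bound X' p' (map item LL') \<and>
        holds_list (mem \<sigma>') h LL' \<and> set LL' \<subseteq> okset S \<and> regs \<sigma>' rLen = length LL' \<and>
        regs \<sigma>' rCost = cost vw X' \<and> regs \<sigma>' rPeak = p' \<and> (\<forall>i<h. mem \<sigma>' i = mem \<sigma> i) \<and>
        LL' \<noteq> [] \<and> fst (hd LL') = fst (hd LL)))"
proof -
  define r0 where "r0 = fst (hd LL)"
  let ?M = "mem \<sigma>"
  have h: "heap0 \<le> h" using tb by (simp add: table_def)
  have h0: "0 < h" using h by (simp add: heap0_def ad_def base_def)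
  have "\<forall>x\<in>S. \<exists>LL. entry_ok ?M h S x LL" using tb by (simp add: table_def)
  then obtain LLf where LLf: "\<And>x. x \<in> S \<Longrightarrow> entry_ok ?M h S x (LLf x)" using bchoice by metis
  \<comment> \<open>\<open>item\<close> is injective on valid records, so a record can be recovered
    from its abstract entry; this turns the contents of the table into functions of abstract
    entries.\<close>
  let ?dec = "inv_into {x. valid x} item"
  let ?J = "\<lambda>it. ?M (adp (?dec it) + 4)" and ?Sg = "\<lambda>it. map item (LLf (?dec it))"
  have dec: "?dec (item x) = x" if "valid x" for x
    using inv_into_f_f[OF item_inj] that by blast
  have fields: "N (adp x + f) = ?M (adp x + f)" if "\<forall>i<h. N i = ?M i" "valid x" "f < 32" for N x f
    using valid_ad[OF that(2,3)] h that(1) by simp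
  have Wf: "?M (adp x) = (if snd x = 0 then 0 else vw (fst x))" "?M (adp x + 17) = ad (fst x) 0" if "valid x" for x
    using st that unfolding static_def valid_def by blast+
  have act: "x \<in> S \<and> valid x \<and> nbrs (fst x) (snd x) \<noteq> {}" if "x \<in> okset S" "snd x \<noteq> 0" for x
    using that nbrs_ne by (auto simp: okset_def)
  have segs: "segment (fst x) (nbrs (fst x) (snd x)) (?J (item x)) (?M (adp x + 5)) (?Sg (item x))"
    if "x \<in> S" for x
  proof -
    have "valid x" using tb that by (auto simp: table_def)
    then show ?thesis using LLf[OF that] dec unfolding entry_ok_def by simp
  qed
  have items: "\<exists>x\<in>set LL. item x = (v, Q) \<and> snd x \<noteq> 0" if vQ: "(v, Q) \<in> set (map item LL)" "Q \<noteq> {}" for LL v Q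
  proof -
    obtain x where x: "x \<in> set LL" "item x = (v, Q)" using vQ(1) by fastforce
    then have "snd x \<noteq> 0" using vQ(2) by (auto simp: item_def)
    then show ?thesis using x by blast
  qed
  define I where "I = (\<lambda>s::ram_state. regs s rZ = 0 \<and> regs s rH = h \<and> regs s rBound = bound \<and> (\<forall>i<h. mem s i = ?M i) \<and>
    (\<exists>X p LL. run_inv U K X0 bound p0 l0 X p (map item LL) \<and> (regs s rGo = 0 \<longrightarrow> stopped bound X p (map item LL)) \<and>
      holds_list (mem s) h LL \<and> set LL \<subseteq> okset S \<and> regs s rLen = length LL \<and>
      regs s rCost = cost vw X \<and> regs s rPeak = p \<and> LL \<noteq> [] \<and> fst (hd LL) = r0))"
  \<comment> \<open>A round, consisting of a scan and a copy, is charged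
    \<open>100 * (n + 1)\<close> steps. A list has at most \<open>2 * n - 1\<close> entries, so
    counting down from \<open>2 * n + 2\<close> leaves a reserve for the last round, which performs
    no jump.\<close>
  define f where "f = (\<lambda>s::ram_state. if regs s rGo = 0 then 1 else 100 * (n + 1) * (2 * n + 2 - regs s rLen) + (1::nat))"
  have len: "length L + 1 \<le> 2 * n" if "run_inv U K X0 bound p0 l0 X p L" for X p L
  proof -
    have "conn X" "length L + 2 * card K = l0 + 2 * card X" "K \<subseteq> X" using that K(2) unfolding run_inv_def by blast+
    moreover have "card X \<le> n" using card_mono[OF finV conn_sub[OF \<open>conn X\<close>]] by (simp add: n_def)
    moreover have "0 < card K" using K(5) \<open>K \<subseteq> X\<close> conn_fin[OF \<open>conn X\<close>] finite_subset by (auto simp: card_gt_0_iff)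
    ultimately show ?thesis using K(4) by linarith
  qed
  let ?body = "scan ;; Const rGo 0 ;;
      Cond (Equal rBest rZ) Skip
        (Cond (LessEq rMn rPeak) (Const rGo 1) (Cond (LessEq rBound rCost) (Const rGo 1) Skip)) ;;
      Cond (Equal rGo rZ) Skip do_jump"
  have step: "wp ?body s (\<lambda>t s'. I s' \<and> Suc t + f s' \<le> f s)" if Is: "I s" and go: "regs s rGo \<noteq> 0" for s
  proof -
    obtain X p LL where s: "regs s rZ = 0" "regs s rH = h" "regs s rBound = bound" "\<forall>i<h. mem s i = ?M i"
      "run_inv U K X0 bound p0 l0 X p (map item LL)"
      "holds_list (mem s) h LL" "set LL \<subseteq> okset S" "regs s rLen = length LL"
      "regs s rCost = cost vw X" "regs s rPeak = p" "LL \<noteq> []" "fst (hd LL) = r0" using Is unfolding I_def by blast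
    let ?N = "mem s" and ?c = "cost vw X" and ?l = "length LL"
    have l: "?l + 1 \<le> 2 * n" using len[OF s(5)] by simp
    have fs: "f s = 100 * (n + 1) * (2 * n + 2 - ?l) + 1" using go s(8) by (simp add: f_def)
    have fs1: "100 * (n + 1) + 1 \<le> f s"
    proof -
      have "100 * (n + 1) * 1 \<le> 100 * (n + 1) * (2 * n + 2 - ?l)" using l by (intro mult_le_mono2) linarith
      then show ?thesis using fs by simp
    qed
    have va: "valid (LL ! i)" "LL ! i \<in> okset S" if "i < ?l" for i using s(7) nth_mem[OF that] by (auto simp: okset_def)
    have Ni: "?N (h + i) = adp (LL ! i)" if "i < ?l" for i using s(6) that by (simp add: holds_list_def)
    have NW: "?N (?N (h + i)) = (if snd (LL ! i) = 0 then 0 else vw (fst (LL ! i)))" if "i < ?l" for i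
      using Ni[OF that] fields[OF s(4) va(1)[OF that], of 0] Wf(1)[OF va(1)[OF that]] by simp
    have Nn: "entry_need ?c ?N (?N (h + i)) = jneed X ?J (item (LL ! i))" if "i < ?l" "snd (LL ! i) \<noteq> 0" for i
      using NW[OF that(1)] that(2) Ni[OF that(1)] fields[OF s(4) va(1)[OF that(1)], of 4] dec[OF va(1)[OF that(1)]]
      by (simp add: entry_need_def jneed_def item_def)
    have Sx: "\<exists>c. segment v Q (?J (v, Q)) c (?Sg (v, Q))" if vQ: "(v, Q) \<in> set (map item LL)" "Q \<noteq> {}" for v Q
    proof -
      obtain x where x: "x \<in> set LL" "item x = (v, Q)" "snd x \<noteq> 0" using items[OF vQ] by blast
      then have "x \<in> S" using act s(7) by blast
      then show ?thesis using segs[of x] x(2) by (auto simp: item_def)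
    qed
    show ?thesis
      unfolding wp_Seq
    proof (rule wp_frame[OF wp_scan])
      show "regs s rZ = 0" "0 < regs s rH" using s h0 by auto
      fix t1 :: nat and s1 :: ram_state
      assume t1: "t1 \<le> 20 * regs s rLen + 4 \<and> regs s1 rEnd = regs s rH + regs s rLen \<and>
         scanned (mem s) (regs s rH) (regs s rCost) (regs s rLen) (regs s1 rBest) (regs s1 rMn)"
        and fr: "\<And>x. x \<notin> writes scan \<Longrightarrow> regs s1 x = regs s x" "\<not> stores scan \<Longrightarrow> mem s1 = mem s"
      have s1: "regs s1 rZ = 0" "regs s1 rH = h" "regs s1 rBound = bound" "mem s1 = ?N"
        "regs s1 rLen = ?l" "regs s1 rCost = ?c" "regs s1 rPeak = p" "regs s1 rEnd = h + ?l"
        using fr s t1 by (auto simp: scan_effects)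
      have sc: "scanned ?N h ?c ?l (regs s1 rBest) (regs s1 rMn)" using t1 s by simp
      have stopI: "I (set_reg rGo 0 s1) \<and> f (set_reg rGo 0 s1) = 1"
        if "stopped bound X p (map item LL)"
      proof -
        have "f (set_reg rGo 0 s1) = 1" by (simp add: f_def)
        moreover have "I (set_reg rGo 0 s1)" unfolding I_def
          using s s1 that by (auto intro!: exI[of _ X] exI[of _ p] exI[of _ LL])
        ultimately show ?thesis by simp
      qed
      have tb1: "t1 \<le> 40 * n + 4" using t1 s(8) l by simp
      show "wp (Const rGo 0) s1 (\<lambda>t \<sigma>'. wp (Cond (Equal rBest rZ) Skip
             (Cond (LessEq rMn rPeak) (Const rGo 1) (Cond (LessEq rBound rCost) (Const rGo 1) Skip)))
            \<sigma>' (\<lambda>t' \<sigma>''. wp (Cond (Equal rGo rZ) Skip do_jump) \<sigma>'' (\<lambda>t'a \<sigma>''. I \<sigma>'' \<and> Suc (t1 + (t + (t' + t'a))) + f \<sigma>'' \<le> f s)))"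
      proof (cases "regs s1 rBest = 0")
        case True
        \<comment> \<open>An entry with nonzero mask carries the weight of its vertex, which is
          positive; a stored weight of 0 therefore means an empty mask.\<close>
        have none: "\<forall>i<?l. snd (LL ! i) = 0"
        proof (intro allI impI)
          fix i assume i: "i < ?l"
          have "?N (?N (h + i)) = 0" using sc True h0 i unfolding scanned_def by auto
          moreover have "0 < vw (fst (LL ! i))" using vw_pos[of "fst (LL ! i)"] va(1)[OF i] V_eq by (auto simp: valid_def)
          ultimately show "snd (LL ! i) = 0" using NW[OF i] by (auto split: if_splits)
        qed
        have no: "Q = {}" if "(v, Q) \<in> set (map item LL)" for v Q
          using items[of v Q LL] that none by (metis in_set_conv_nth)
        have "stopped bound X p (map item LL)"
          unfolding stopped_def using no by blast
        note st = stopI[OF this]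
        have "t1 + 7 \<le> f s" using tb1 fs1 by simp
        then show ?thesis by (simp add: True s1(1) st)
      next
        case False
        then obtain b where b: "b < ?l" "regs s1 rBest = h + b" "?N (?N (h + b)) \<noteq> 0"
          "regs s1 rMn = entry_need ?c ?N (?N (h + b))"
          "\<forall>i<?l. ?N (?N (h + i)) \<noteq> 0 \<longrightarrow> regs s1 rMn \<le> entry_need ?c ?N (?N (h + i))"
          using sc[unfolded scanned_def] by (elim disjE exE conjE) simp_all
        let ?x = "LL ! b"
        have x: "snd ?x \<noteq> 0" "valid ?x" "?x \<in> S" "nbrs (fst ?x) (snd ?x) \<noteq> {}" "?x \<in> set LL"
          using NW[OF b(1)] b(3) va[OF b(1)] act[of ?x] b(1) by (auto split: if_splits)
        have mn: "regs s1 rMn = jneed X ?J (item ?x)" using b(4) Nn[OF b(1) x(1)] by simp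
        have min: "regs s1 rMn \<le> jneed X ?J (v, Q)" if vQ: "(v, Q) \<in> set (map item LL)" "Q \<noteq> {}" for v Q
        proof -
          obtain y where y: "y \<in> set LL" "item y = (v, Q)" "snd y \<noteq> 0" using items[OF vQ] by blast
          then obtain i where i: "i < ?l" "LL ! i = y" by (auto simp: in_set_conv_nth)
          then have "?N (?N (h + i)) \<noteq> 0" using NW[OF i(1)] y vw_pos[of "fst y"] va(1)[OF i(1)] V_eq by (auto simp: valid_def)
          then show ?thesis using b(5) i Nn[OF i(1)] y by auto
        qed
        show ?thesis
        proof (cases "regs s1 rMn \<le> p \<or> bound \<le> ?c")
          case no: False
          have "stopped bound X p (map item LL)" unfolding stopped_def
          proof (intro conjI exI[of _ ?J] exI[of _ ?Sg] allI impI)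
            show "cost vw X < bound \<or> (\<forall>v Q. (v, Q) \<in> set (map item LL) \<longrightarrow> Q = {})" using no by auto
            fix v Q assume vQ: "(v, Q) \<in> set (map item LL)" "Q \<noteq> {}"
            show "\<exists>c. segment v Q (?J (v, Q)) c (?Sg (v, Q))" using Sx[OF vQ] .
            show "p < jneed X ?J (v, Q)" using min[OF vQ] no by linarith
          qed
          note st = stopI[OF this]
          have no': "\<not> regs s1 rMn \<le> p" "\<not> bound \<le> ?c" using no by auto
          have "t1 + 9 \<le> f s" using tb1 fs1 by simp
          then show ?thesis by (simp add: False s1(1,3,6,7) no' st)
        next
          case yes: True
          let ?s2 = "set_reg rGo 1 s1"
          let ?L1 = "take b LL" and ?L2 = "drop (Suc b) LL"
          let ?LL = "LL[b := (fst ?x, 0)] @ LLf ?x"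
          let ?X = "X \<union> fst ` set (?Sg (item ?x))" and ?p = "max p (jneed X ?J (item ?x))"
          have split: "map item LL = map item ?L1 @ item ?x # map item ?L2"
            using id_take_nth_drop[OF b(1)] by (metis list.simps(9) map_append)
          have itx: "item ?x = (fst ?x, nbrs (fst ?x) (snd ?x))" by (simp add: item_def)
          have splitL: "map item ?LL = map item ?L1 @ (fst ?x, {}) # map item ?L2 @ ?Sg (item ?x)"
            using b(1) dec[OF x(2)] by (simp add: upd_conv_take_nth_drop item_def)
          note sg = segs[OF x(3)]
          let ?R = "nbrs (fst ?x) (snd ?x)"
          note rj = run_inv_jump[where J = ?J and Sg = ?Sg, OF s(5) K(1,2,3) split[unfolded itx] x(4) _ sg[unfolded itx]]
          have minx: "jneed X ?J (fst ?x, ?R) \<le> jneed X ?J (v, Q)" if vQ: "(v, Q) \<in> set (map item LL)" "Q \<noteq> {}" for v Q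
            using min[OF vQ] mn itx by simp
          have gox: "jneed X ?J (fst ?x, ?R) \<le> p \<or> bound \<le> ?c" using yes mn itx by simp
          have RJ: "run_inv U K X0 bound p0 l0 ?X ?p (map item ?LL)"
            unfolding splitL itx by (rule rj(1)[OF _ minx gox]) (use Sx in blast)+
          have cX: "cost vw ?X = ?c - vw (fst ?x) + ?M (adp ?x + 5)"
            unfolding itx by (rule rj(2)[OF _ minx gox]) (use Sx in blast)+
          have eo: "?M (adp ?x + 7) = length (LLf ?x)" "?M (adp ?x + 6) + length (LLf ?x) \<le> h"
            "holds_list ?M (?M (adp ?x + 6)) (LLf ?x)" "set (LLf ?x) \<subseteq> okset S"
            using LLf[OF x(3)] unfolding entry_ok_def by blast+
          have lX: "length ?LL + 1 \<le> 2 * n" using len[OF RJ] by simp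
          have lLL: "length ?LL = ?l + length (LLf ?x)" by simp
          \<comment> \<open>The set grows strictly, so the appended list is nonempty; this is what
            pays for the round.\<close>
          have lpos: "0 < length (LLf ?x)"
          proof -
            have "card X < card ?X" unfolding itx by (rule rj(3)[OF _ minx gox]) (use Sx in blast)+
            then have "?Sg (item ?x) \<noteq> []" by auto
            then show ?thesis using dec[OF x(2)] by simp
          qed
          have fx: "adp ?x + g < h" if "g < 32" for g using valid_ad[OF x(2) that] h by simp
          have fN: "?N (adp ?x + g) = ?M (adp ?x + g)" if "g < 32" for g using fields[OF s(4) x(2) that] .
          have fN0: "?N (adp ?x) = vw (fst ?x)" using fN[of 0] Wf(1)[OF x(2)] x(1) by simp
          have wj: "wp do_jump ?s2 (\<lambda>t \<sigma>'. t \<le> 8 * length (LLf ?x) + 40 \<and>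
             mem \<sigma>' = paste ((mem ?s2)(h + b := mem ?s2 (adp ?x + 17))) (?M (adp ?x + 6)) (h + regs ?s2 rLen) (length (LLf ?x)) \<and>
             regs \<sigma>' rLen = regs ?s2 rLen + length (LLf ?x) \<and> regs \<sigma>' rCost = regs ?s2 rCost - mem ?s2 (adp ?x) + mem ?s2 (adp ?x + 5) \<and>
             regs \<sigma>' rPeak = max (regs ?s2 rPeak) (regs ?s2 rMn))"
            by (rule wp_do_jump) (use b(1,2) s1 Ni[OF b(1)] fx fN[of 6] fN[of 7] eo in auto)
          have "wp do_jump ?s2 (\<lambda>t' s3. I s3 \<and> Suc (t1 + (1 + (Suc (Suc (Suc 1)) + Suc t'))) + f s3 \<le> f s)"
          proof (rule wp_frame[OF wj])
            fix t' :: nat and s3 :: ram_state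
            assume A: "t' \<le> 8 * length (LLf ?x) + 40 \<and>
             mem s3 = paste ((mem ?s2)(h + b := mem ?s2 (adp ?x + 17))) (?M (adp ?x + 6)) (h + regs ?s2 rLen) (length (LLf ?x)) \<and>
             regs s3 rLen = regs ?s2 rLen + length (LLf ?x) \<and> regs s3 rCost = regs ?s2 rCost - mem ?s2 (adp ?x) + mem ?s2 (adp ?x + 5) \<and>
             regs s3 rPeak = max (regs ?s2 rPeak) (regs ?s2 rMn)"
            and fr3: "\<And>x. x \<notin> writes do_jump \<Longrightarrow> regs s3 x = regs ?s2 x"
            have g3: "regs s3 rZ = 0" "regs s3 rH = h" "regs s3 rBound = bound" "regs s3 rGo = 1"
              using fr3 s1 by (auto simp: do_jump_effects)
            have m3: "mem s3 = paste (?N(h + b := ad (fst ?x) 0)) (?M (adp ?x + 6)) (h + ?l) (length (LLf ?x))"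
              using A s1 fN[of 17] Wf(2)[OF x(2)] by simp
            have "mem s3 i = ?M i" if "i < h" for i
              unfolding m3 using that s(4) by (simp add: paste_def)
            moreover have "holds_list (mem s3) h ?LL"
              unfolding holds_list_def
            proof (intro allI impI)
              fix i assume i: "i < length ?LL"
              show "mem s3 (h + i) = adp (?LL ! i)"
              proof (cases "i < ?l")
                case True
                then show ?thesis unfolding m3 using Ni[OF True] b(1) by (auto simp: paste_def nth_append)
              next
                case False
                let ?i = "i - ?l"
                have il: "?i < length (LLf ?x)" using i False by simp
                have "?M (adp ?x + 6) + ?i < h" using eo(2) il by linarith
                then have "mem s3 (h + i) = ?M (?M (adp ?x + 6) + ?i)"
                  unfolding m3 using False i s(4) by (simp add: paste_def)
                moreover have "?M (?M (adp ?x + 6) + ?i) = adp (LLf ?x ! ?i)"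
                  using eo(3) il unfolding holds_list_def by blast
                ultimately show ?thesis using False by (simp add: nth_append)
              qed
            qed
            moreover have "set ?LL \<subseteq> okset S"
            proof -
              have "(fst ?x, 0) \<in> okset S" using x(2) by (simp add: okset_def valid_def)
              then show ?thesis using s(7) eo(4) set_update_subset_insert[of LL b "(fst ?x, 0)"] by auto
            qed
            moreover have "regs s3 rLen = length ?LL" using A s1 by simp
            moreover have "regs s3 rCost = cost vw ?X" using A s1 cX fN0 fN[of 5] by simp
            moreover have "regs s3 rPeak = ?p" using A s1 mn by simp
            moreover have "?LL \<noteq> []" "fst (hd ?LL) = r0"
              using s(11,12) by (cases LL; cases b; simp)+
            moreover have "regs s3 rGo \<noteq> 0" using g3 by simp
            ultimately have I3: "I s3" unfolding I_def using g3(1-3) RJ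
              by (intro conjI allI impI exI[of _ ?X] exI[of _ ?p] exI[of _ ?LL]) (assumption | (erule notE, assumption) | simp)+
            have "f s3 = 100 * (n + 1) * (2 * n + 2 - length ?LL) + 1" using g3 \<open>regs s3 rLen = length ?LL\<close> by (simp add: f_def)
            also have "\<dots> + 100 * (n + 1) \<le> f s"
            proof -
              have "100 * (n + 1) * (2 * n + 2 - length ?LL) + 100 * (n + 1) = 100 * (n + 1) * (2 * n + 2 - length ?LL + 1)" by simp
              also have "\<dots> \<le> 100 * (n + 1) * (2 * n + 2 - ?l)" using lX lpos lLL by (intro mult_le_mono2) linarith
              finally show ?thesis using fs by simp
            qed
            finally have "f s3 + 100 * (n + 1) \<le> f s" .
            moreover have "t' \<le> 16 * n + 40" using A lX by simp
            ultimately show "I s3 \<and> Suc (t1 + (1 + (Suc (Suc (Suc 1)) + Suc t'))) + f s3 \<le> f s" using I3 tb1 by simp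
          qed
          note jj = this
          have mono: "wp do_jump ?s2 (\<lambda>t' s3. I s3 \<and> Suc (t1 + (1 + (k + Suc t'))) + f s3 \<le> f s)" if "k \<le> Suc (Suc (Suc 1))" for k
            by (rule wp_mono[OF jj]) (use that in auto)
          have m3: "wp do_jump ?s2 (\<lambda>t' s3. I s3 \<and> Suc (t1 + (1 + (Suc (Suc 1) + Suc t'))) + f s3 \<le> f s)"
            and m4: "wp do_jump ?s2 (\<lambda>t' s3. I s3 \<and> Suc (t1 + (1 + (Suc (Suc (Suc 1)) + Suc t'))) + f s3 \<le> f s)"
            using mono[of "Suc (Suc 1)"] jj by auto
          show ?thesis
          proof (cases "regs s1 rMn \<le> p")
            case True
            show ?thesis using m3 by (simp add: False s1(1,3,6,7) True)
          next
            case nm: False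
            then have "bound \<le> ?c" using yes by simp
            then show ?thesis using m4 by (simp add: False s1(1,3,6,7) nm)
          qed
        qed
      qed
    qed
  qed
  have I0: "I (set_reg rGo 1 \<sigma>)" unfolding I_def r0_def using r L inv by auto
  have f0: "f (set_reg rGo 1 \<sigma>) \<le> 200 * (n + 1) * (n + 1) + 1"
  proof -
    have "100 * (n + 1) * (2 * n + 2 - regs \<sigma> rLen) \<le> 100 * (n + 1) * (2 * n + 2)" by (intro mult_le_mono2) simp
    then show ?thesis by (simp add: f_def algebra_simps)
  qed
  have "wp (While (NotEqual rGo rZ) ?body) (set_reg rGo 1 \<sigma>)
    (\<lambda>t s. t \<le> f (set_reg rGo 1 \<sigma>) \<and> I s \<and> \<not> holds (NotEqual rGo rZ) s)"
  proof (rule wp_While[where I = I and f = f])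
    show "I (set_reg rGo 1 \<sigma>)" by (rule I0)
    show "1 \<le> f s" for s by (simp add: f_def)
    show "wp ?body s (\<lambda>t s'. I s' \<and> Suc t + f s' \<le> f s)" if "I s" "holds (NotEqual rGo rZ) s" for s
      using step[OF that(1)] that by (simp add: I_def)
  qed
  then have "wp run_jumps \<sigma> (\<lambda>t s. t \<le> f (set_reg rGo 1 \<sigma>) + 1 \<and> I s \<and> \<not> holds (NotEqual rGo rZ) s)"
    unfolding run_jumps_def wp_Seq[of "Const rGo 1"] wp_Const by (elim wp_mono) auto
  then show ?thesis
  proof (rule wp_mono)
    fix t :: nat and s :: ram_state assume "t \<le> f (set_reg rGo 1 \<sigma>) + 1 \<and> I s \<and> \<not> holds (NotEqual rGo rZ) s"
    then show "t \<le> 200 * (n + 1) * (n + 1) + 2 \<and>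
     (\<exists>X' p' LL'. run_inv U K X0 bound p0 l0 X' p' (map item LL') \<and> stopped bound X' p' (map item LL') \<and>
        holds_list (mem s) h LL' \<and> set LL' \<subseteq> okset S \<and> regs s rLen = length LL' \<and>
        regs s rCost = cost vw X' \<and> regs s rPeak = p' \<and> (\<forall>i<h. mem s i = mem \<sigma> i) \<and>
        LL' \<noteq> [] \<and> fst (hd LL') = fst (hd LL))"
      using f0 unfolding I_def r0_def by auto
  qed
qed

end

section \<open>Computing one table entry\<close>

abbreviation (input) "rSet \<equiv> (20::nat)"
abbreviation (input) "rBP \<equiv> (21::nat)"
abbreviation (input) "rBC \<equiv> (22::nat)"
abbreviation (input) "rBPtr \<equiv> (23::nat)"
abbreviation (input) "rBLen \<equiv> (24::nat)"
abbreviation (input) "rA \<equiv> (25::nat)"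
abbreviation (input) "rV \<equiv> (26::nat)"
abbreviation (input) "rRem \<equiv> (27::nat)"
abbreviation (input) "rHB \<equiv> (28::nat)"
abbreviation (input) "rC \<equiv> (29::nat)"
abbreviation (input) "rS \<equiv> (30::nat)"
abbreviation (input) "rFound \<equiv> (32::nat)"
abbreviation (input) "rOK \<equiv> (33::nat)"
abbreviation (input) "rP \<equiv> (34::nat)"

text \<open>Moving \<open>rH\<close> past the current list is all it takes to keep it; the list of a
  rejected candidate is overwritten by the next run.\<close>

definition keep_best :: program where
  "keep_best = (Copy rBP rPeak ;; Copy rBC rCost ;; Copy rBPtr rH ;; Copy rBLen rLen ;; Const rSet 1 ;; Add rH rH rLen)"

definition select :: program where
  "select = Cond (Equal rSet rZ) keep_best
     (Cond (Less rPeak rBP) keep_best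
       (Cond (Equal rPeak rBP) (Cond (Less rCost rBC) keep_best Skip) Skip))"

text \<open>Field 18 yields the highest bit of the remaining mask. Added to the address of mask 0 it
  gives the single-bit record with the data of the edge, subtracted from \<open>rA\<close> the
  record without this neighbour. Cost and peak are the formulas of
  \<open>start_item\<close>.\<close>

definition try_init :: program where
  "try_init = (LoadF rHB rRem 18 ;; Add rC rV rHB ;; LoadF rY rC 9 ;; LoadF rX rC 8 ;; Store rH rX ;;
     Sub rS rA rHB ;; StoreF rH 1 rS ;; Const rLen 2 ;; LoadF rW rX 0 ;; LoadF rND rS 0 ;;
     Add rCost rW rND ;; Cond (Less rY rW) (Add rPeak rW rND) (Add rPeak rY rND))"

definition try_child :: program where
  "try_child = (try_init ;; run_jumps ;; select ;; Sub rRem rRem rHB)"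

definition process :: program where
  "process = (Const rSet 0 ;; LoadF rV rA 17 ;; LoadF rBound rA 0 ;; Copy rRem rA ;;
     While (NotEqual rRem rV) try_child ;;
     StoreF rA 4 rBP ;; StoreF rA 5 rBC ;; StoreF rA 6 rBPtr ;; StoreF rA 7 rBLen ;; StoreF rA 3 rZ)"

definition better :: "ram_state \<Rightarrow> bool" where
  "better \<sigma> \<longleftrightarrow> regs \<sigma> rSet = 0 \<or> regs \<sigma> rPeak < regs \<sigma> rBP \<or> regs \<sigma> rPeak = regs \<sigma> rBP \<and> regs \<sigma> rCost < regs \<sigma> rBC"

lemma wp_select:
  assumes "regs \<sigma> rZ = 0"
  shows "wp select \<sigma> (\<lambda>t \<sigma>'. t \<le> 10 \<and> mem \<sigma>' = mem \<sigma> \<and>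
     (if better \<sigma> then regs \<sigma>' rSet = 1 \<and> regs \<sigma>' rBP = regs \<sigma> rPeak \<and> regs \<sigma>' rBC = regs \<sigma> rCost \<and>
         regs \<sigma>' rBPtr = regs \<sigma> rH \<and> regs \<sigma>' rBLen = regs \<sigma> rLen \<and> regs \<sigma>' rH = regs \<sigma> rH + regs \<sigma> rLen
      else \<sigma>' = \<sigma>))"
  using assms unfolding select_def keep_best_def better_def by auto

lemma select_effects: "writes select = {rSet, rBP, rBC, rBPtr, rBLen, rH}" "\<not> prints select" "\<not> stores select"
  by (auto simp: select_def keep_best_def)

lemma try_init_effects: "writes try_init = {rT, rHB, rC, rY, rX, rS, rLen, rW, rND, rCost, rPeak}" "\<not> prints try_init"
  by (auto simp: try_init_def)

lemma try_child_effects: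
  "writes try_child = {rHB, rC, rS, rRem, rLen, rSet, rBP, rBC, rBPtr, rBLen, rH} \<union> writes run_jumps" "\<not> prints try_child"
  by (auto simp: try_child_def try_init_effects select_effects run_jumps_effects)

context tree_input
begin

definition chm :: "nat \<Rightarrow> nat \<Rightarrow> nat" where
  "chm v j = (THE m. m < 2 ^ d (nbr v j) \<and> nbrs (nbr v j) m = nb (nbr v j) - {v})"

lemma static_ch:
  assumes st: "static M" and v: "v < n" "j < d v"
  shows "M (ad v (2 ^ j) + 8) = ad (nbr v j) (chm v j)" "valid (nbr v j, chm v j)"
    "nbrs (nbr v j) (chm v j) = nb (nbr v j) - {v}"
proof -
  let ?c = "nbr v j"
  obtain m where m: "m < 2 ^ d ?c" "M (ad v (2 ^ j) + 8) = ad ?c m" "nbrs ?c m = nb ?c - {v}"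
    using st v unfolding static_def by blast
  have "chm v j = m" unfolding chm_def
  proof (rule the_equality)
    show "m' = m" if "m' < 2 ^ d ?c \<and> nbrs ?c m' = nb ?c - {v}" for m' using nbrs_inj[of m' ?c m] that m by simp
  qed (use m in simp)
  moreover have "?c < n" using nbr_in[OF v(2)] nb_sub[of v] V_eq by auto
  ultimately show "M (ad v (2 ^ j) + 8) = ad ?c (chm v j)" "valid (?c, chm v j)" "nbrs ?c (chm v j) = nb ?c - {v}"
    using m by (auto simp: valid_def)
qed

text \<open>The run for each first neighbour starts with these two records, and stored lists contain
  only usable records, so every jump a run may meet is available.\<close>

definition ready :: "(nat \<times> nat) set \<Rightarrow> nat \<times> nat \<Rightarrow> bool" where
  "ready S x \<longleftrightarrow> (\<forall>j\<in>slots (snd x). (nbr (fst x) j, chm (fst x) j) \<in> okset S \<and> (fst x, snd x - 2 ^ j) \<in> okset S)"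

lemma ad_add: "ad v m + 32 * k = ad v (m + k)"
  by (simp add: ad_def)

lemma ad_sub: "k \<le> m \<Longrightarrow> ad v m - 32 * k = ad v (m - k)"
  by (simp add: ad_def algebra_simps)

lemma static_W: "static M \<Longrightarrow> valid x \<Longrightarrow> M (adp x) = (if snd x = 0 then 0 else vw (fst x))"
  and static_V0: "static M \<Longrightarrow> valid x \<Longrightarrow> M (adp x + 17) = ad (fst x) 0"
  unfolding static_def valid_def by blast+

lemma static_HB:
  assumes "static M" "v < n" "m < 2 ^ d v" "m \<noteq> 0"
  shows "\<exists>j. j \<in> slots m \<and> M (ad v m + 18) = 32 * 2 ^ j"
proof -
  obtain j where "2 ^ j \<le> m" "m < 2 ^ Suc j" "M (ad v m + 18) = 32 * 2 ^ j"
    using assms unfolding static_def by (metis gr0I)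
  then show ?thesis using slots_high by blast
qed

lemma card_slots: "m < 2 ^ d v \<Longrightarrow> finite (slots m) \<and> card (slots m) \<le> d v"
  using slots_lt[of m "d v"] finite_subset card_mono[of "{..<d v}" "slots m"] by auto

text \<open>The neighbours in \<open>m\<close> but no longer in \<open>rem\<close> have been tried.
  The stored result is least among theirs, by peak and then by cost.\<close>

definition best_inv :: "nat \<Rightarrow> nat \<Rightarrow> nat \<Rightarrow> (nat \<times> nat) set \<Rightarrow> ram_state \<Rightarrow> bool" where
  "best_inv v m rem S s \<longleftrightarrow>
     (slots rem = slots m \<and> regs s rSet = 0) \<or>
     (regs s rSet = 1 \<and> (\<exists>c LL. candidate v (nbrs v m) c (regs s rBP) (regs s rBC) (map item LL) \<and>
        holds_list (mem s) (regs s rBPtr) LL \<and> heap0 \<le> regs s rBPtr \<and> regs s rBPtr + length LL \<le> regs s rH \<and>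
        regs s rBLen = length LL \<and> set LL \<subseteq> okset S) \<and>
      (\<forall>j\<in>slots m - slots rem. \<exists>p' k' L'. candidate v (nbrs v m) (nbr v j) p' k' L' \<and>
         (regs s rBP < p' \<or> regs s rBP = p' \<and> regs s rBC \<le> k')))"

text \<open>The time is that of one run of jumps; the constant also covers setting up its list,
  comparing the result with the best one and removing the neighbour.\<close>

lemma wp_try_child:
  assumes st: "static (mem s)" and tb: "table (mem s) (regs s rH) S" and r: "regs s rZ = 0"
    "regs s rA = ad v m" "regs s rV = ad v 0" "regs s rBound = vw v" "regs s rRem = ad v rem"
    and v: "valid (v, m)" "slots rem \<subseteq> slots m" "rem < 2 ^ d v" "rem \<noteq> 0" and rd: "ready S (v, m)"
    and best: "best_inv v m rem S s"
  shows "wp try_child s (\<lambda>t s'. t \<le> 200 * (n + 1) * (n + 1) + 60 \<and> static (mem s') \<and> table (mem s') (regs s' rH) S \<and>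
    regs s rH \<le> regs s' rH \<and> (\<forall>i<regs s rH. mem s' i = mem s i) \<and>
    (\<exists>j\<in>slots rem. regs s' rRem = ad v (rem - 2 ^ j) \<and> best_inv v m (rem - 2 ^ j) S s'))"
proof -
  let ?h = "regs s rH" and ?R = "nbrs v m" and ?M = "mem s"
  have vn: "v < n" "v \<in> V" "m < 2 ^ d v" using v(1) V_eq by (auto simp: valid_def)
  have h: "heap0 \<le> ?h" using tb by (simp add: table_def)
  obtain j where j: "j \<in> slots rem" "?M (ad v rem + 18) = 32 * 2 ^ j"
    using static_HB[OF st vn(1) v(3,4)] by blast
  have jm: "j \<in> slots m" using j v by blast
  note nr = nbrs_remove[OF vn(3) jm] and ch = static_ch[OF st vn(1) nbrs_remove(3)[OF vn(3) jm]]
  let ?c = "nbr v j"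
  have ew: "?M (ad v (2 ^ j) + 9) = ew {v, ?c}" using st vn(1) nr(3) unfolding static_def by blast
  have sub: "(v, m - 2 ^ j) \<in> okset S" "(?c, chm v j) \<in> okset S" using rd jm unfolding ready_def by auto
  have vs: "valid (v, m - 2 ^ j)" using sub by (simp add: okset_def)
  let ?s0 = "?M(?h := ad ?c (chm v j), Suc ?h := ad v (m - 2 ^ j))"
  have f0: "?s0 (ad y k + g) = ?M (ad y k + g)" if "valid (y, k)" "g < 32" for y k g
    using valid_ad[OF that] h by simp
  have Wc: "?M (ad ?c (chm v j)) = (if nb ?c - {v} = {} then 0 else vw ?c)"
  proof -
    have "chm v j = 0 \<longleftrightarrow> nb ?c - {v} = {}" using ch(3) nbrs_ne[of "chm v j" ?c] nbrs_0[of ?c] by metis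
    then show ?thesis using static_W[OF st ch(2)] unfolding fst_conv snd_conv by presburger
  qed
  have Wv: "?M (ad v (m - 2 ^ j)) = (if ?R - {?c} = {} then 0 else vw v)"
  proof -
    have "m - 2 ^ j = 0 \<longleftrightarrow> ?R - {?c} = {}" using nr(1) nbrs_ne[of "m - 2 ^ j" v] nbrs_0[of v] by metis
    then show ?thesis using static_W[OF st vs] unfolding fst_conv snd_conv by presburger
  qed
  note si = start_item[OF nbrs_sub[OF vn(3)] vn(2) nr(2)]
  let ?K = "core v ?R" let ?LL = "[(?c, chm v j), (v, m - 2 ^ j)]"
  have mapL: "map item ?LL = [(?c, nb ?c - {v}), (v, ?R - {?c})]"
    using ch(3) nr(1) by (simp add: item_def)
  have st0: "static ?s0" by (rule static_agree[OF st]) (use h in auto)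
  have tb0: "table ?s0 ?h S" by (rule table_agree[OF tb]) auto
  have run: "wp run_jumps s1 (\<lambda>t \<sigma>'. t \<le> 200 * (n + 1) * (n + 1) + 2 \<and>
     (\<exists>X' p' LL'. run_inv (insert v (branch v ?R)) ?K (insert ?c ?K) (vw v) (need ?K v ?c) 0 X' p' (map item LL') \<and>
        stopped (vw v) X' p' (map item LL') \<and>
        holds_list (mem \<sigma>') ?h LL' \<and> set LL' \<subseteq> okset S \<and> regs \<sigma>' rLen = length LL' \<and>
        regs \<sigma>' rCost = cost vw X' \<and> regs \<sigma>' rPeak = p' \<and> (\<forall>i<?h. mem \<sigma>' i = mem s1 i) \<and>
        LL' \<noteq> [] \<and> fst (hd LL') = fst (hd ?LL)))"
    if s1: "mem s1 = ?s0" "regs s1 rZ = 0" "regs s1 rH = ?h" "regs s1 rLen = 2" "regs s1 rBound = vw v"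
      "regs s1 rCost = ?M (ad ?c (chm v j)) + ?M (ad v (m - 2 ^ j))"
      "regs s1 rPeak = max (ew {v, ?c}) (?M (ad ?c (chm v j))) + ?M (ad v (m - 2 ^ j))" for s1
  proof (rule wp_run_jumps)
    show "static (mem s1)" "table (mem s1) ?h S" using st0 tb0 s1 by auto
    show "regs s1 rZ = 0" "regs s1 rH = ?h" "regs s1 rLen = length ?LL" "regs s1 rBound = vw v" using s1 by auto
    show "regs s1 rCost = cost vw (insert ?c ?K)" using s1(6) si(2) Wc Wv by simp
    show "regs s1 rPeak = need ?K v ?c" using s1(7) si(3) Wc Wv by simp
    show "holds_list (mem s1) ?h ?LL" using s1(1) by (auto simp: holds_list_def less_Suc_eq)
    show "set ?LL \<subseteq> okset S" using sub by auto
    show "run_inv (insert v (branch v ?R)) ?K (insert ?c ?K) (vw v) (need ?K v ?c) 0 (insert ?c ?K) (need ?K v ?c) (map item ?LL)"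
      unfolding mapL by (rule si(1))
    show "conn (insert ?c ?K)" by (rule si(4))
    show "V - ?K \<subseteq> insert v (branch v ?R)" by (auto simp: core_def)
    show "?K \<noteq> {}" using core_self[OF nbrs_sub[OF vn(3)] vn(2)] by auto
  qed auto
  have rest: "wp run_jumps s1 (\<lambda>t \<sigma>'. wp (select ;; Sub rRem rRem rHB) \<sigma>' (\<lambda>t' s'. t + t' + 40 \<le> 200 * (n + 1) * (n + 1) + 60 \<and>
     static (mem s') \<and> table (mem s') (regs s' rH) S \<and> regs s rH \<le> regs s' rH \<and> (\<forall>i<regs s rH. mem s' i = mem s i) \<and>
    (\<exists>j\<in>slots rem. regs s' rRem = ad v (rem - 2 ^ j) \<and> best_inv v m (rem - 2 ^ j) S s')))"
    if s1: "mem s1 = ?s0" "regs s1 rZ = 0" "regs s1 rH = ?h" "regs s1 rLen = 2" "regs s1 rBound = vw v"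
      "regs s1 rCost = ?M (ad ?c (chm v j)) + ?M (ad v (m - 2 ^ j))"
      "regs s1 rPeak = max (ew {v, ?c}) (?M (ad ?c (chm v j))) + ?M (ad v (m - 2 ^ j))"
      and o1: "regs s1 rSet = regs s rSet" "regs s1 rBP = regs s rBP" "regs s1 rBC = regs s rBC" "regs s1 rBPtr = regs s rBPtr"
      "regs s1 rBLen = regs s rBLen" "regs s1 rRem = ad v rem" "regs s1 rHB = 32 * 2 ^ j" for s1
  proof (rule wp_frame[OF run[OF s1]])
    fix t :: nat and s2 :: ram_state
    assume A: "t \<le> 200 * (n + 1) * (n + 1) + 2 \<and>
     (\<exists>X' p' LL'. run_inv (insert v (branch v ?R)) ?K (insert ?c ?K) (vw v) (need ?K v ?c) 0 X' p' (map item LL') \<and>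
        stopped (vw v) X' p' (map item LL') \<and>
        holds_list (mem s2) ?h LL' \<and> set LL' \<subseteq> okset S \<and> regs s2 rLen = length LL' \<and>
        regs s2 rCost = cost vw X' \<and> regs s2 rPeak = p' \<and> (\<forall>i<?h. mem s2 i = mem s1 i) \<and>
        LL' \<noteq> [] \<and> fst (hd LL') = fst (hd ?LL))"
    and fr: "\<And>x. x \<notin> writes run_jumps \<Longrightarrow> regs s2 x = regs s1 x"
    obtain X p LL where B: "run_inv (insert v (branch v ?R)) ?K (insert ?c ?K) (vw v) (need ?K v ?c) 0 X p (map item LL)"
        "stopped (vw v) X p (map item LL)"
        "holds_list (mem s2) ?h LL" "set LL \<subseteq> okset S" "regs s2 rLen = length LL"
        "regs s2 rCost = cost vw X" "regs s2 rPeak = p" "\<forall>i<?h. mem s2 i = mem s1 i" using A by blast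
    have tm: "t \<le> 200 * (n + 1) * (n + 1) + 2" using A by blast
    have s2: "regs s2 rZ = 0" "regs s2 rH = ?h" "regs s2 rSet = regs s rSet" "regs s2 rBP = regs s rBP" "regs s2 rBC = regs s rBC"
      "regs s2 rBPtr = regs s rBPtr" "regs s2 rBLen = regs s rBLen" "regs s2 rRem = ad v rem" "regs s2 rHB = 32 * 2 ^ j"
      using fr s1 o1 by (auto simp: run_jumps_effects)
    have ag: "mem s2 i = ?M i" if "i < ?h" for i using B(8) that s1(1) by simp
    \<comment> \<open>If the run ended for lack of active entries, the boundary is empty and the
      cost is 0, below the positive weight of \<open>v\<close>. So a run always yields a
      candidate.\<close>
    have cst: "cost vw X < vw v"
    proof -
      have "cost vw X < vw v \<or> (\<forall>y Q. (y, Q) \<in> set (map item LL) \<longrightarrow> Q = {})" using B(2) unfolding stopped_def by blast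
      then show ?thesis
      proof
        assume no: "\<forall>y Q. (y, Q) \<in> set (map item LL) \<longrightarrow> Q = {}"
        have "frontier X (map item LL)" using B(1) unfolding run_inv_def by blast
        then have "bd X = {}" by (rule no_active_bd) (use no in blast)
        then show ?thesis using vw_pos[OF vn(2)] by (simp add: cost_def)
      qed
    qed
    have cand: "candidate v ?R ?c p (cost vw X) (map item LL)"
    proof -
      obtain J Sg where J: "\<forall>y Q. (y, Q) \<in> set (map item LL) \<longrightarrow> Q \<noteq> {} \<longrightarrow> (\<exists>c. segment y Q (J (y, Q)) c (Sg (y, Q)))"
        "\<forall>y Q. (y, Q) \<in> set (map item LL) \<longrightarrow> Q \<noteq> {} \<longrightarrow> p < jneed X J (y, Q)" using B(2) unfolding stopped_def by blast
      show ?thesis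
        by (rule candidate_run[where J = J and Sg = Sg, OF nbrs_sub[OF vn(3)] vn(2) nr(2) B(1) _ _ cst]) (use J in blast)+
    qed
    have st2: "static (mem s2)" by (rule static_agree[OF st]) (use ag h in auto)
    have tb2: "table (mem s2) ?h S" by (rule table_agree[OF tb]) (use ag in auto)
    have rem': "ad v rem - 32 * 2 ^ j = ad v (rem - 2 ^ j)" using ad_sub slots_remove(2)[OF j(1)] by simp
    have srem: "slots (rem - 2 ^ j) = slots rem - {j}" using slots_remove(1)[OF j(1)] .
    show "wp (select ;; Sub rRem rRem rHB) s2 (\<lambda>t' s'. t + t' + 40 \<le> 200 * (n + 1) * (n + 1) + 60 \<and>
     static (mem s') \<and> table (mem s') (regs s' rH) S \<and> regs s rH \<le> regs s' rH \<and> (\<forall>i<regs s rH. mem s' i = mem s i) \<and>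
    (\<exists>j\<in>slots rem. regs s' rRem = ad v (rem - 2 ^ j) \<and> best_inv v m (rem - 2 ^ j) S s'))"
      unfolding wp_Seq
    proof (rule wp_frame[OF wp_select[OF s2(1)]])
      fix t3 :: nat and s3 :: ram_state
      assume C: "t3 \<le> 10 \<and> mem s3 = mem s2 \<and>
       (if better s2 then regs s3 rSet = 1 \<and> regs s3 rBP = regs s2 rPeak \<and> regs s3 rBC = regs s2 rCost \<and>
         regs s3 rBPtr = regs s2 rH \<and> regs s3 rBLen = regs s2 rLen \<and> regs s3 rH = regs s2 rH + regs s2 rLen
        else s3 = s2)" and fr3: "\<And>x. x \<notin> writes select \<Longrightarrow> regs s3 x = regs s2 x"
      have r3: "regs s3 rRem = ad v rem" "regs s3 rHB = 32 * 2 ^ j" using fr3 s2 by (auto simp: select_effects)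
      let ?s4 = "set_reg rRem (ad v (rem - 2 ^ j)) s3"
      have hh: "?h \<le> regs s3 rH" using C s2 by (auto split: if_splits)
      have "best_inv v m (rem - 2 ^ j) S ?s4"
      proof (cases "better s2")
        case True
        have b: "regs s3 rSet = 1" "regs s3 rBP = p" "regs s3 rBC = cost vw X" "regs s3 rBPtr = ?h" "regs s3 rBLen = length LL"
          "regs s3 rH = ?h + length LL" "mem s3 = mem s2" using C True B s2 by auto
        have "\<exists>p' k' L'. candidate v ?R (nbr v i) p' k' L' \<and> (p < p' \<or> p = p' \<and> cost vw X \<le> k')" if i: "i \<in> slots m - slots (rem - 2 ^ j)" for i
        proof (cases "i = j")
          case True
          then show ?thesis using cand by blast
        next
          case False
          then have i': "i \<in> slots m - slots rem" using i srem by auto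
          then have "regs s rSet \<noteq> 0" using best unfolding best_inv_def by auto
          then obtain p' k' L' where o: "candidate v ?R (nbr v i) p' k' L'" "regs s rBP < p' \<or> regs s rBP = p' \<and> regs s rBC \<le> k'"
            using best i' unfolding best_inv_def by metis
          have "p < regs s rBP \<or> p = regs s rBP \<and> cost vw X < regs s rBC"
            using True s2 B \<open>regs s rSet \<noteq> 0\<close> unfolding better_def by auto
          then have "p < p' \<or> p = p' \<and> cost vw X \<le> k'" using o(2) by auto
          then show ?thesis using o(1) by blast
        qed
        then show ?thesis unfolding best_inv_def using b cand B(3,4) h
          by (intro disjI2 conjI exI[of _ ?c] exI[of _ LL]) auto
      next
        case False
        then have e: "s3 = s2" using C by simp
        have ns: "regs s rSet \<noteq> 0" "\<not> (p < regs s rBP)" "\<not> (p = regs s rBP \<and> cost vw X < regs s rBC)"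
          using False s2 B unfolding better_def by auto
        then obtain c LL0 where o: "regs s rSet = 1" "candidate v ?R c (regs s rBP) (regs s rBC) (map item LL0)"
          "holds_list ?M (regs s rBPtr) LL0" "heap0 \<le> regs s rBPtr" "regs s rBPtr + length LL0 \<le> ?h"
          "regs s rBLen = length LL0" "set LL0 \<subseteq> okset S"
          and oo: "\<forall>i\<in>slots m - slots rem. \<exists>p' k' L'. candidate v ?R (nbr v i) p' k' L' \<and>
             (regs s rBP < p' \<or> regs s rBP = p' \<and> regs s rBC \<le> k')"
        proof -
          have "regs s rSet = 1 \<and> (\<exists>c LL. candidate v ?R c (regs s rBP) (regs s rBC) (map item LL) \<and>
            holds_list ?M (regs s rBPtr) LL \<and> heap0 \<le> regs s rBPtr \<and> regs s rBPtr + length LL \<le> ?h \<and>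
            regs s rBLen = length LL \<and> set LL \<subseteq> okset S) \<and>
           (\<forall>j\<in>slots m - slots rem. \<exists>p' k' L'. candidate v ?R (nbr v j) p' k' L' \<and>
             (regs s rBP < p' \<or> regs s rBP = p' \<and> regs s rBC \<le> k'))"
            using best ns(1) unfolding best_inv_def by simp
          then show thesis using that by (elim conjE exE) metis
        qed
        have hl: "holds_list (mem s2) (regs s rBPtr) LL0" using o(3,5) ag unfolding holds_list_def by auto
        have "\<exists>p' k' L'. candidate v ?R (nbr v i) p' k' L' \<and> (regs s rBP < p' \<or> regs s rBP = p' \<and> regs s rBC \<le> k')"
          if i: "i \<in> slots m - slots (rem - 2 ^ j)" for i
        proof (cases "i = j")
          case True
          have "regs s rBP < p \<or> regs s rBP = p \<and> regs s rBC \<le> cost vw X" using ns by linarith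
          then show ?thesis using cand True by blast
        next
          case False
          then show ?thesis using oo i srem by auto
        qed
        then show ?thesis unfolding best_inv_def e using o hl s2
          by (intro disjI2 conjI exI[of _ c] exI[of _ LL0]) auto
      qed
      moreover have "static (mem s3)" "table (mem s3) (regs s3 rH) S"
        using st2 C table_agree[OF tb2, of "mem s3" "regs s3 rH"] hh by auto
      moreover have "\<forall>i<?h. mem s3 i = ?M i" using C ag by simp
      moreover have "t + (t3 + 1) + 40 \<le> 200 * (n + 1) * (n + 1) + 60" using tm C by linarith
      ultimately show "wp (Sub rRem rRem rHB) s3 (\<lambda>t' s'. t + (t3 + t') + 40 \<le> 200 * (n + 1) * (n + 1) + 60 \<and>
        static (mem s') \<and> table (mem s') (regs s' rH) S \<and> regs s rH \<le> regs s' rH \<and> (\<forall>i<regs s rH. mem s' i = mem s i) \<and>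
        (\<exists>j\<in>slots rem. regs s' rRem = ad v (rem - 2 ^ j) \<and> best_inv v m (rem - 2 ^ j) S s'))"
        using r3 rem' hh j(1) by auto
    qed
  qed
  have a1: "ad v 0 + 32 * 2 ^ j = ad v (2 ^ j)" using ad_add[of v 0] by simp
  have a2: "ad v m - 32 * 2 ^ j = ad v (m - 2 ^ j)" using ad_sub slots_remove(2)[OF jm] by simp
  have ne: "ad ?c (chm v j) \<noteq> ?h" "ad ?c (chm v j) \<noteq> Suc ?h" "ad v (m - 2 ^ j) \<noteq> ?h" "ad v (m - 2 ^ j) \<noteq> Suc ?h"
    using valid_ad[OF ch(2), of 0] valid_ad[OF vs, of 0] h by auto
  have ini: "wp try_init s (\<lambda>t s1. t \<le> 40 \<and> mem s1 = ?s0 \<and> regs s1 rLen = 2 \<and> regs s1 rHB = 32 * 2 ^ j \<and>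
      regs s1 rCost = ?M (ad ?c (chm v j)) + ?M (ad v (m - 2 ^ j)) \<and>
      regs s1 rPeak = max (ew {v, ?c}) (?M (ad ?c (chm v j))) + ?M (ad v (m - 2 ^ j)))"
    unfolding try_init_def by (simp add: r j(2) a1 a2 ch(1) ew ne)
  show ?thesis
    unfolding try_child_def wp_Seq[of try_init] wp_Seq[of run_jumps]
  proof (rule wp_frame[OF ini])
    fix t0 :: nat and s1 :: ram_state
    assume A: "t0 \<le> 40 \<and> mem s1 = ?s0 \<and> regs s1 rLen = 2 \<and> regs s1 rHB = 32 * 2 ^ j \<and>
      regs s1 rCost = ?M (ad ?c (chm v j)) + ?M (ad v (m - 2 ^ j)) \<and>
      regs s1 rPeak = max (ew {v, ?c}) (?M (ad ?c (chm v j))) + ?M (ad v (m - 2 ^ j))"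
      and fr: "\<And>x. x \<notin> writes try_init \<Longrightarrow> regs s1 x = regs s x"
    have "wp run_jumps s1 (\<lambda>t \<sigma>'. wp (select ;; Sub rRem rRem rHB) \<sigma>' (\<lambda>t' s'. t + t' + 40 \<le> 200 * (n + 1) * (n + 1) + 60 \<and>
       static (mem s') \<and> table (mem s') (regs s' rH) S \<and> regs s rH \<le> regs s' rH \<and> (\<forall>i<regs s rH. mem s' i = mem s i) \<and>
       (\<exists>j\<in>slots rem. regs s' rRem = ad v (rem - 2 ^ j) \<and> best_inv v m (rem - 2 ^ j) S s')))"
      by (rule rest) (use A fr r in \<open>auto simp: try_init_effects\<close>)
    then show "wp run_jumps s1 (\<lambda>t \<sigma>'. wp (select ;; Sub rRem rRem rHB) \<sigma>' (\<lambda>t' s'. t0 + (t + t') \<le> 200 * (n + 1) * (n + 1) + 60 \<and>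
       static (mem s') \<and> table (mem s') (regs s' rH) S \<and> regs s rH \<le> regs s' rH \<and> (\<forall>i<regs s rH. mem s' i = mem s i) \<and>
       (\<exists>j\<in>slots rem. regs s' rRem = ad v (rem - 2 ^ j) \<and> best_inv v m (rem - 2 ^ j) S s')))"
      by (elim wp_mono) (use A in auto)
  qed
qed

text \<open>The list already lies in the heap, so recording the jump only writes five fields of one
  record; all other records and all lists keep their contents.\<close>

lemma process_table:
  assumes tb: "table M h S" and x: "valid x" "snd x \<noteq> 0" "x \<notin> S"
    and seg: "segment (fst x) (nbrs (fst x) (snd x)) p k (map item LL)" "holds_list M q LL" "heap0 \<le> q" "q + length LL \<le> h" "set LL \<subseteq> okset S"
    and M': "M' = M(adp x + 4 := p, adp x + 5 := k, adp x + 6 := q, adp x + 7 := length LL, adp x + 3 := 0)"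
  shows "table M' h (insert x S)"
proof -
  have hp: "M' i = M i" if "heap0 \<le> i" for i
    using valid_ad[OF x(1), of 4] valid_ad[OF x(1), of 5] valid_ad[OF x(1), of 6] valid_ad[OF x(1), of 7] valid_ad[OF x(1), of 3] that
    unfolding M' by auto
  have ok: "okset S \<subseteq> okset (insert x S)" by (auto simp: okset_def)
  have x1: "entry_ok M' h (insert x S) x LL"
  proof -
    have "M' (adp x + 4) = p" "M' (adp x + 5) = k" "M' (adp x + 6) = q" "M' (adp x + 7) = length LL"
      unfolding M' by auto
    moreover have "holds_list M' q LL" using seg(2,3) hp unfolding holds_list_def by simp
    ultimately show ?thesis using seg ok unfolding entry_ok_def by auto
  qed
  have "entry_ok M' h (insert x S) y LL'" if y: "y \<in> S" "entry_ok M h S y LL'" for y LL'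
  proof -
    have vy: "valid y" "y \<noteq> x" using tb y x by (auto simp: table_def)
    have a: "M' (adp y + f) = M (adp y + f)" if "f < 32" for f
    proof -
      have "adp y + f \<noteq> adp x + g" if "g < 32" for g
        using ad_eq[of "snd y" "snd x" f g "fst y" "fst x"] valid_lt[of "fst y" "snd y"] valid_lt[of "fst x" "snd x"]
          vy x(1) that \<open>f < 32\<close> by (auto simp: prod_eq_iff)
      then show ?thesis unfolding M' by simp
    qed
    have "holds_list M' (M (adp y + 6)) LL'" using y(2) hp unfolding entry_ok_def holds_list_def by simp
    then show ?thesis using y(2) ok unfolding entry_ok_def by (auto simp: a)
  qed
  then show ?thesis using tb x x1 unfolding table_def by blast
qed

text \<open>Fields 3 to 7 are not among those that \<open>static\<close> describes.\<close>

lemma process_static: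
  assumes st: "static M" and x: "valid x" and M': "\<And>i. i \<notin> {adp x + 3..adp x + 7} \<Longrightarrow> M' i = M i"
  shows "static M'"
proof -
  have a: "M' (ad v m + f) = M (ad v m + f)" if "v < n" "m < 2 ^ d v" "f < 32" "f < 3 \<or> 7 < f" for v m f
  proof (rule M')
    have v: "m < 2 ^ D" "snd x < 2 ^ D" using valid_lt[of v m] valid_lt[of "fst x" "snd x"] that x by (auto simp: valid_def)
    show "ad v m + f \<notin> {adp x + 3..adp x + 7}"
    proof
      assume "ad v m + f \<in> {adp x + 3..adp x + 7}"
      then have e: "ad v m + f = adp x + (ad v m + f - adp x)" "3 \<le> ad v m + f - adp x" "ad v m + f - adp x \<le> 7" by auto
      then have "f = ad v m + f - adp x" using ad_eq[OF v(1,2) that(3), of "ad v m + f - adp x" v "fst x"] by simp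
      then show False using e that(4) by linarith
    qed
  qed
  have a0: "M' (ad v m) = M (ad v m)" if "v < n" "m < 2 ^ d v" for v m using a[OF that, of 0] by simp
  show ?thesis using st unfolding static_def by (simp add: a a0 cong: conj_cong)
qed

lemma ad_inj: "ad v m = ad v m' \<longleftrightarrow> m = m'"
  by (simp add: ad_def)

lemma wp_process:
  assumes st: "static (mem s)" and tb: "table (mem s) (regs s rH) S" and r: "regs s rZ = 0" "regs s rA = ad v m"
    and v: "valid (v, m)" "m \<noteq> 0" "(v, m) \<notin> S" and rd: "ready S (v, m)"
  shows "wp process s (\<lambda>t s'. t \<le> D * (200 * (n + 1) * (n + 1) + 61) + 40 \<and> static (mem s') \<and>
     table (mem s') (regs s' rH) (insert (v, m) S) \<and> regs s rH \<le> regs s' rH \<and>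
     (\<forall>i<heap0. i \<notin> {ad v m + 3..ad v m + 7} \<longrightarrow> mem s' i = mem s i) \<and> mem s' (ad v m + 3) = 0)"
proof -
  let ?C = "200 * (n + 1) * (n + 1) + 61" and ?h = "regs s rH"
  have vn: "v < n" "v \<in> V" "m < 2 ^ d v" using v(1) V_eq by (auto simp: valid_def)
  have h: "heap0 \<le> ?h" using tb by (simp add: table_def)
  let ?s0 = "set_reg rRem (ad v m) (set_reg rBound (vw v) (set_reg rV (ad v 0) (set_reg rSet 0 s)))"
  define I where "I = (\<lambda>q::ram_state. regs q rZ = 0 \<and> regs q rA = ad v m \<and> regs q rV = ad v 0 \<and> regs q rBound = vw v \<and>
     static (mem q) \<and> table (mem q) (regs q rH) S \<and> ?h \<le> regs q rH \<and> (\<forall>i<?h. mem q i = mem s i) \<and>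
     (\<exists>rem. regs q rRem = ad v rem \<and> rem < 2 ^ d v \<and> slots rem \<subseteq> slots m \<and> best_inv v m rem S q))"
  \<comment> \<open>The remaining mask is decoded from the address in \<open>rRem\<close>; each of
    its bits pays for one neighbour.\<close>
  define f where "f = (\<lambda>q::ram_state. card (slots ((regs q rRem - ad v 0) div 32)) * ?C + (1::nat))"
  have rm: "(ad v rem - ad v 0) div 32 = rem" for rem by (simp add: ad_def)
  have loop: "wp (While (NotEqual rRem rV) try_child) ?s0 (\<lambda>t q. t \<le> f ?s0 \<and> I q \<and> \<not> holds (NotEqual rRem rV) q)"
  proof (rule wp_While[where I = I and f = f])
    show "I ?s0" unfolding I_def using r st tb vn by (auto simp: best_inv_def intro!: exI[of _ m])
    show "1 \<le> f q" for q by (simp add: f_def)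
    fix q :: ram_state assume Iq: "I q" and b: "holds (NotEqual rRem rV) q"
    obtain rem where q: "regs q rZ = 0" "regs q rA = ad v m" "regs q rV = ad v 0" "regs q rBound = vw v"
     "static (mem q)" "table (mem q) (regs q rH) S" "?h \<le> regs q rH" "\<forall>i<?h. mem q i = mem s i"
     "regs q rRem = ad v rem" "rem < 2 ^ d v" "slots rem \<subseteq> slots m" "best_inv v m rem S q"
      using Iq unfolding I_def by blast
    have "rem \<noteq> 0" using b q(3,9) by (auto simp: ad_inj)
    note tc = wp_try_child[OF q(5,6,1,2,3,4,9) v(1) q(11,10) this rd q(12)]
    show "wp try_child q (\<lambda>t q'. I q' \<and> Suc t + f q' \<le> f q)"
    proof (rule wp_frame[OF tc])
      fix t :: nat and q' :: ram_state
      assume A: "t \<le> 200 * (n + 1) * (n + 1) + 60 \<and> static (mem q') \<and> table (mem q') (regs q' rH) S \<and>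
        regs q rH \<le> regs q' rH \<and> (\<forall>i<regs q rH. mem q' i = mem q i) \<and>
        (\<exists>j\<in>slots rem. regs q' rRem = ad v (rem - 2 ^ j) \<and> best_inv v m (rem - 2 ^ j) S q')"
        and fr: "\<And>x. x \<notin> writes try_child \<Longrightarrow> regs q' x = regs q x"
      obtain j where j: "j \<in> slots rem" "regs q' rRem = ad v (rem - 2 ^ j)" "best_inv v m (rem - 2 ^ j) S q'" using A by blast
      have c: "slots (rem - 2 ^ j) = slots rem - {j}" using slots_remove(1)[OF j(1)] .
      have "regs q' rZ = 0" "regs q' rA = ad v m" "regs q' rV = ad v 0" "regs q' rBound = vw v"
        using fr q by (auto simp: try_child_effects run_jumps_effects)
      moreover have "rem - 2 ^ j < 2 ^ d v" using q(10) by linarith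
      moreover have "\<forall>i<?h. mem q' i = mem s i" using A q(7,8) by auto
      moreover have "slots (rem - 2 ^ j) \<subseteq> slots m" using c q(11) by auto
      ultimately have "I q'" unfolding I_def using A j q(7) by (intro conjI exI[of _ "rem - 2 ^ j"]) auto
      moreover have cc: "Suc (card (slots rem - {j})) = card (slots rem)"
        using card_Suc_Diff1[OF conjunct1[OF card_slots[OF q(10)]] j(1)] .
      have "card (slots rem) * ?C = ?C + card (slots rem - {j}) * ?C" unfolding cc[symmetric] by (rule mult_Suc)
      then have "f q' + ?C = f q" unfolding f_def j(2) q(9) rm c by linarith
      ultimately show "I q' \<and> Suc t + f q' \<le> f q" using A by linarith
    qed
  qed
  have f0: "f ?s0 \<le> D * ?C + 1"
  proof -
    have "card (slots m) \<le> D" using card_slots[OF vn(3)] d_le[OF vn(2)] by linarith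
    then have "card (slots m) * ?C \<le> D * ?C" by (rule mult_le_mono1)
    then show ?thesis unfolding f_def by (simp add: rm)
  qed
  let ?fin = "StoreF rA 4 rBP ;; StoreF rA 5 rBC ;; StoreF rA 6 rBPtr ;; StoreF rA 7 rBLen ;; StoreF rA 3 rZ"
  have fin: "wp (While (NotEqual rRem rV) try_child) ?s0 (\<lambda>t q. wp ?fin q (\<lambda>t' s'. t + t' \<le> D * ?C + 20 \<and> static (mem s') \<and>
     table (mem s') (regs s' rH) (insert (v, m) S) \<and> ?h \<le> regs s' rH \<and>
     (\<forall>i<heap0. i \<notin> {ad v m + 3..ad v m + 7} \<longrightarrow> mem s' i = mem s i) \<and> mem s' (ad v m + 3) = 0))"
  proof (rule wp_mono[OF loop])
    fix t :: nat and q :: ram_state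
    assume A: "t \<le> f ?s0 \<and> I q \<and> \<not> holds (NotEqual rRem rV) q"
    then obtain rem where q: "regs q rZ = 0" "regs q rA = ad v m" "regs q rV = ad v 0"
     "static (mem q)" "table (mem q) (regs q rH) S" "?h \<le> regs q rH" "\<forall>i<?h. mem q i = mem s i"
     "regs q rRem = ad v rem" "best_inv v m rem S q"
      unfolding I_def by blast
    have "rem = 0" using A q by (simp add: ad_inj)
    then have b1: "regs q rSet = 1 \<and> (\<exists>c LL. candidate v (nbrs v m) c (regs q rBP) (regs q rBC) (map item LL) \<and>
        holds_list (mem q) (regs q rBPtr) LL \<and> heap0 \<le> regs q rBPtr \<and> regs q rBPtr + length LL \<le> regs q rH \<and>
        regs q rBLen = length LL \<and> set LL \<subseteq> okset S) \<and>
      (\<forall>j\<in>slots m. \<exists>p' k' L'. candidate v (nbrs v m) (nbr v j) p' k' L' \<and>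
         (regs q rBP < p' \<or> regs q rBP = p' \<and> regs q rBC \<le> k'))"
      using q(9) slots_ne[OF v(2)] unfolding best_inv_def by auto
    then obtain c LL where b: "candidate v (nbrs v m) c (regs q rBP) (regs q rBC) (map item LL)"
        "holds_list (mem q) (regs q rBPtr) LL" "heap0 \<le> regs q rBPtr" "regs q rBPtr + length LL \<le> regs q rH"
        "regs q rBLen = length LL" "set LL \<subseteq> okset S" by (elim conjE exE) metis
    have seg: "segment v (nbrs v m) (regs q rBP) (regs q rBC) (map item LL)"
    proof (rule segment_best[OF nbrs_sub[OF vn(3)] vn(2) nbrs_ne[OF v(2)] b(1)])
      fix c assume "c \<in> nbrs v m"
      then obtain j where j: "j \<in> slots m" "c = nbr v j" by (auto simp: nbrs_def)
      show "\<exists>p' k' L'. candidate v (nbrs v m) c p' k' L' \<and> (regs q rBP < p' \<or> regs q rBP = p' \<and> regs q rBC \<le> k')"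
        unfolding j(2) using b1 j(1) by (elim conjE) (drule bspec)
    qed
    let ?M = "(mem q)(ad v m + 4 := regs q rBP, ad v m + 5 := regs q rBC, ad v m + 6 := regs q rBPtr,
       ad v m + 7 := regs q rBLen, ad v m + 3 := 0)"
    have T: "table ?M (regs q rH) (insert (v, m) S)"
      by (rule process_table[OF q(5) v(1) _ v(3), of "regs q rBP" "regs q rBC" LL "regs q rBPtr"]) (use seg b v(2) in auto)
    have Mi: "?M i = mem q i" if "i \<notin> {ad v m + 3..ad v m + 7}" for i using that by auto
    have St: "static ?M" by (rule process_static[OF q(4) v(1)]) (use Mi in auto)
    have ag: "\<forall>i<heap0. i \<notin> {ad v m + 3..ad v m + 7} \<longrightarrow> ?M i = mem s i" using Mi q(7) h by auto
    have z: "?M (ad v m + 3) = 0" by simp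
    have "wp ?fin q (\<lambda>t' s'. t' \<le> 16 \<and> mem s' = ?M \<and> regs s' rH = regs q rH)"
      by (simp add: q(1,2))
    then show "wp ?fin q (\<lambda>t' s'. t + t' \<le> D * ?C + 20 \<and> static (mem s') \<and>
     table (mem s') (regs s' rH) (insert (v, m) S) \<and> ?h \<le> regs s' rH \<and>
     (\<forall>i<heap0. i \<notin> {ad v m + 3..ad v m + 7} \<longrightarrow> mem s' i = mem s i) \<and> mem s' (ad v m + 3) = 0)"
    proof (rule wp_mono)
      fix t' :: nat and s' :: ram_state assume B: "t' \<le> 16 \<and> mem s' = ?M \<and> regs s' rH = regs q rH"
      have "t + t' \<le> D * ?C + 20" using A B f0 by linarith
      then show "t + t' \<le> D * ?C + 20 \<and> static (mem s') \<and>
       table (mem s') (regs s' rH) (insert (v, m) S) \<and> ?h \<le> regs s' rH \<and>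
       (\<forall>i<heap0. i \<notin> {ad v m + 3..ad v m + 7} \<longrightarrow> mem s' i = mem s i) \<and> mem s' (ad v m + 3) = 0"
        using B T St ag z q(6) by metis
    qed
  qed
  have W: "mem s (ad v m) = vw v" "mem s (ad v m + 17) = ad v 0" using static_W[OF st v(1)] static_V0[OF st v(1)] v(2) by auto
  have "wp (While (NotEqual rRem rV) try_child ;; ?fin) ?s0 (\<lambda>t s'. 8 + t \<le> D * ?C + 40 \<and> static (mem s') \<and>
     table (mem s') (regs s' rH) (insert (v, m) S) \<and> ?h \<le> regs s' rH \<and>
     (\<forall>i<heap0. i \<notin> {ad v m + 3..ad v m + 7} \<longrightarrow> mem s' i = mem s i) \<and> mem s' (ad v m + 3) = 0)"
    unfolding wp_Seq[of "While _ _"]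
    by (rule wp_mono[OF fin], erule wp_mono) auto
  then show ?thesis unfolding process_def
    by (simp add: r W del: wp_Seq add: wp_Seq[of "Const _ _"] wp_Seq[of "LoadF _ _ _"] wp_Seq[of "Copy _ _"])
       (erule wp_mono, elim conjE, intro conjI, linarith, assumption+)
qed

end

section \<open>Filling the table\<close>

definition check_body :: program where
  "check_body = (LoadF rHB rRem 18 ;; Add rC rV rHB ;; LoadF rX rC 8 ;; LoadF rW rX 3 ;;
     Cond (Equal rW rZ) Skip (Const rOK 0) ;; Sub rS rP rHB ;; LoadF rW rS 3 ;;
     Cond (Equal rW rZ) Skip (Const rOK 0) ;; Sub rRem rRem rHB)"

definition check :: program where
  "check = (LoadF rV rP 17 ;; Copy rRem rP ;; Const rOK 1 ;; While (NotEqual rRem rV) check_body ;;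
     Cond (Equal rOK rZ) Skip (Copy rFound rP))"

definition find_ready :: program where
  "find_ready = (Const rFound 0 ;; Copy rP rB ;; While (Less rP rE)
     (LoadF rW rP 3 ;; Cond (Equal rW rZ) Skip check ;; Inc rP 32))"

text \<open>The order of the computations is not prepared in advance: every round looks through all
  records for one whose parts are available. For fixed degree this takes O(n) steps, less than the
  computation that follows.\<close>

definition compute :: program where
  "compute = (Const rFound 1 ;; While (NotEqual rFound rZ)
     (find_ready ;; Cond (Equal rFound rZ) Skip (Copy rA rFound ;; process)))"

lemma check_effects: "writes check = {rV, rRem, rOK, rHB, rC, rX, rW, rS, rFound}" "\<not> stores check"
  by (auto simp: check_def check_body_def)

lemma find_effects: "writes find_ready = {rT, rV, rRem, rOK, rHB, rC, rX, rW, rS, rFound, rP}" "\<not> stores find_ready" "\<not> prints find_ready"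
  by (auto simp: find_ready_def check_def check_body_def)

lemma process_effects: "writes process = {rT, rSet, rV, rBound, rRem, rHB, rC, rS, rLen, rBP, rBC, rBPtr, rBLen, rH} \<union> writes run_jumps"
   "\<not> prints process"
  by (auto simp: process_def try_child_effects run_jumps_effects)

lemma compute_effects: "writes compute = {rA} \<union> writes find_ready \<union> writes process" "\<not> prints compute"
  by (auto simp: compute_def find_effects process_effects)

context tree_input
begin

definition todo :: "(nat \<Rightarrow> nat) \<Rightarrow> (nat \<times> nat) set \<Rightarrow> bool" where
  "todo M S \<longleftrightarrow> (\<forall>v<n. \<forall>m<2 ^ D. M (ad v m + 3) = (if valid (v, m) \<and> m \<noteq> 0 \<and> (v, m) \<notin> S then 1 else 0))"

definition items :: "(nat \<times> nat) set" where "items = {x. valid x \<and> snd x \<noteq> 0}"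

lemma todo_ok: "todo M S \<Longrightarrow> valid x \<Longrightarrow> M (adp x + 3) = 0 \<longleftrightarrow> x \<in> okset S"
  using valid_lt[of "fst x" "snd x"] unfolding todo_def okset_def by auto

lemma wp_check:
  assumes st: "static (mem s)" and td: "todo (mem s) S" and r: "regs s rZ = 0" "regs s rP = ad v m"
    and v: "valid (v, m)"
  shows "wp check s (\<lambda>t s'. t \<le> 30 * D + 12 \<and> regs s' rFound = (if ready S (v, m) then ad v m else regs s rFound))"
proof -
  let ?M = "mem s"
  have vn: "v < n" "v \<in> V" "m < 2 ^ d v" using v V_eq by (auto simp: valid_def)
  define good where "good j \<longleftrightarrow> (nbr v j, chm v j) \<in> okset S \<and> (v, m - 2 ^ j) \<in> okset S" for j
  let ?s0 = "set_reg rOK 1 (set_reg rRem (ad v m) (set_reg rV (ad v 0) s))"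
  define I where "I = (\<lambda>q::ram_state. regs q rZ = 0 \<and> regs q rP = ad v m \<and> regs q rV = ad v 0 \<and> mem q = ?M \<and> regs q rFound = regs s rFound \<and>
     (\<exists>rem. regs q rRem = ad v rem \<and> rem < 2 ^ d v \<and> slots rem \<subseteq> slots m \<and>
        regs q rOK = (if \<forall>j\<in>slots m - slots rem. good j then 1 else 0)))"
  define f where "f = (\<lambda>q::ram_state. card (slots ((regs q rRem - ad v 0) div 32)) * 30 + (1::nat))"
  have rm: "(ad v rem - ad v 0) div 32 = rem" for rem by (simp add: ad_def)
  have loop: "wp (While (NotEqual rRem rV) check_body) ?s0 (\<lambda>t q. t \<le> f ?s0 \<and> I q \<and> \<not> holds (NotEqual rRem rV) q)"
  proof (rule wp_While[where I = I and f = f])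
    show "I ?s0" unfolding I_def using r vn by (auto intro!: exI[of _ m])
    show "1 \<le> f q" for q by (simp add: f_def)
    fix q :: ram_state assume Iq: "I q" and b: "holds (NotEqual rRem rV) q"
    obtain rem where q: "regs q rZ = 0" "regs q rP = ad v m" "regs q rV = ad v 0" "mem q = ?M" "regs q rFound = regs s rFound"
      "regs q rRem = ad v rem" "rem < 2 ^ d v" "slots rem \<subseteq> slots m"
      "regs q rOK = (if \<forall>j\<in>slots m - slots rem. good j then 1 else 0)"
      using Iq unfolding I_def by blast
    have rem0: "rem \<noteq> 0" using b q(3,6) by (auto simp: ad_inj)
    obtain j where j: "j \<in> slots rem" "?M (ad v rem + 18) = 32 * 2 ^ j"
      using static_HB[OF st vn(1) q(7) rem0] by blast
    have jm: "j \<in> slots m" using j q(8) by blast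
    note ch = static_ch[OF st vn(1) nbrs_remove(3)[OF vn(3) jm]]
    have vs: "valid (v, m - 2 ^ j)" using vn by (auto simp: valid_def)
    have c: "slots (rem - 2 ^ j) = slots rem - {j}" using slots_remove(1)[OF j(1)] .
    have a1: "ad v 0 + 32 * 2 ^ j = ad v (2 ^ j)" using ad_add[of v 0] by simp
    have a2: "ad v m - 32 * 2 ^ j = ad v (m - 2 ^ j)" using ad_sub slots_remove(2)[OF jm] by simp
    have a3: "ad v rem - 32 * 2 ^ j = ad v (rem - 2 ^ j)" using ad_sub slots_remove(2)[OF j(1)] by simp
    have g: "good j \<longleftrightarrow> ?M (ad (nbr v j) (chm v j) + 3) = 0 \<and> ?M (ad v (m - 2 ^ j) + 3) = 0"
      unfolding good_def using todo_ok[OF td ch(2)] todo_ok[OF td vs] by simp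
    have all: "(\<forall>i\<in>slots m - slots (rem - 2 ^ j). good i) \<longleftrightarrow> (\<forall>i\<in>slots m - slots rem. good i) \<and> good j"
      unfolding c using jm j(1) by auto
    have ex: "wp check_body q (\<lambda>t q'. t \<le> 28 \<and> regs q' rRem = ad v (rem - 2 ^ j) \<and> regs q' rFound = regs q rFound \<and>
       regs q' rOK = (if ?M (ad (nbr v j) (chm v j) + 3) = 0 \<and> ?M (ad v (m - 2 ^ j) + 3) = 0 then regs q rOK else 0))"
      unfolding check_body_def by (simp add: q(1-6) j(2) a1 a2 a3 ch(1))
    show "wp check_body q (\<lambda>t q'. I q' \<and> Suc t + f q' \<le> f q)"
    proof (rule wp_frame[OF ex])
      fix t :: nat and q' :: ram_state
      assume A: "t \<le> 28 \<and> regs q' rRem = ad v (rem - 2 ^ j) \<and> regs q' rFound = regs q rFound \<and>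
       regs q' rOK = (if ?M (ad (nbr v j) (chm v j) + 3) = 0 \<and> ?M (ad v (m - 2 ^ j) + 3) = 0 then regs q rOK else 0)"
        and fr: "\<And>x. x \<notin> writes check_body \<Longrightarrow> regs q' x = regs q x" "\<not> stores check_body \<Longrightarrow> mem q' = mem q"
      have "regs q' rZ = 0" "regs q' rP = ad v m" "regs q' rV = ad v 0" "mem q' = ?M"
        using fr q by (auto simp: check_body_def)
      moreover have "rem - 2 ^ j < 2 ^ d v" using q(7) by linarith
      moreover have "slots (rem - 2 ^ j) \<subseteq> slots m" using c q(8) by auto
      moreover have "regs q' rOK = (if \<forall>i\<in>slots m - slots (rem - 2 ^ j). good i then 1 else 0)"
        using A q(9) unfolding all g by (auto split: if_splits)
      ultimately have "I q'" unfolding I_def using A q(5) by (intro conjI exI[of _ "rem - 2 ^ j"]) auto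
      moreover have cc: "Suc (card (slots rem - {j})) = card (slots rem)"
        using card_Suc_Diff1[OF conjunct1[OF card_slots[OF q(7)]] j(1)] .
      have "f q' + 30 = f q" unfolding f_def conjunct1[OF conjunct2[OF A]] q(6) rm c cc[symmetric] by simp
      ultimately show "I q' \<and> Suc t + f q' \<le> f q" using A by linarith
    qed
  qed
  have f0: "f ?s0 \<le> 30 * D + 1"
    unfolding f_def using card_slots[OF vn(3)] d_le[OF vn(2)] by (simp add: rm)
  have rd: "ready S (v, m) \<longleftrightarrow> (\<forall>j\<in>slots m. good j)" unfolding ready_def good_def by simp
  have "wp (While (NotEqual rRem rV) check_body) ?s0 (\<lambda>t q. wp (Cond (Equal rOK rZ) Skip (Copy rFound rP)) q
     (\<lambda>t' s'. 5 + (t + t') \<le> 30 * D + 12 \<and> regs s' rFound = (if ready S (v, m) then ad v m else regs s rFound)))"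
  proof (rule wp_mono[OF loop])
    fix t :: nat and q :: ram_state
    assume A: "t \<le> f ?s0 \<and> I q \<and> \<not> holds (NotEqual rRem rV) q"
    then obtain rem where q: "regs q rZ = 0" "regs q rP = ad v m" "regs q rV = ad v 0" "regs q rFound = regs s rFound"
      "regs q rRem = ad v rem" "regs q rOK = (if \<forall>j\<in>slots m - slots rem. good j then 1 else 0)"
      unfolding I_def by blast
    have "rem = 0" using A q(3,5) by (simp add: ad_inj)
    then have ok: "regs q rOK = (if ready S (v, m) then 1 else 0)" using q(6) rd by simp
    have "t + 7 \<le> 30 * D + 12" using A f0 by linarith
    then show "wp (Cond (Equal rOK rZ) Skip (Copy rFound rP)) q
     (\<lambda>t' s'. 5 + (t + t') \<le> 30 * D + 12 \<and> regs s' rFound = (if ready S (v, m) then ad v m else regs s rFound))"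
      using ok q by auto
  qed
  then show ?thesis unfolding check_def
    using static_V0[OF st v] r
    by (simp del: wp_Seq split del: if_split add: wp_Seq[of "LoadF _ _ _"] wp_Seq[of "Const _ _"] wp_Seq[of "Copy _ _"] wp_Seq[of "While _ _"])
       (erule wp_mono, erule wp_mono, elim conjE, intro conjI, linarith, assumption)
qed

lemma ad_index: "ad 0 (v * 2 ^ D + m) = ad v m"
  by (simp add: ad_def)

definition ready_todo :: "(nat \<times> nat) set \<Rightarrow> nat \<times> nat \<Rightarrow> bool" where
  "ready_todo S x \<longleftrightarrow> x \<in> items \<and> x \<notin> S \<and> ready S x"

text \<open>All \<open>2 ^ D\<close> masks of a vertex are visited; those beyond its degree are
  never marked in field 3 and are passed over.\<close>

lemma wp_find:
  assumes st: "static (mem s)" and td: "todo (mem s) S" and r: "regs s rZ = 0" "regs s rB = base" "regs s rE = heap0"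
  shows "wp find_ready s (\<lambda>t s'. t \<le> n * 2 ^ D * (30 * D + 20) + 3 \<and>
     (regs s' rFound = 0 \<and> (\<forall>x. \<not> ready_todo S x) \<or> (\<exists>x. regs s' rFound = adp x \<and> ready_todo S x)))"
proof -
  let ?M = "mem s" and ?body = "LoadF rW rP 3 ;; Cond (Equal rW rZ) Skip check ;; Inc rP 32"
  let ?s0 = "set_reg rP base (set_reg rFound 0 s)" and ?C = "30 * D + 20"
  let ?N = "n * 2 ^ D"
  have h0: "heap0 = ad 0 ?N" by (simp add: heap0_def ad_def)
  define I where "I = (\<lambda>q::ram_state. regs q rZ = 0 \<and> mem q = ?M \<and> regs q rE = heap0 \<and>
     (\<exists>k\<le>?N. regs q rP = ad 0 k \<and>
       (regs q rFound = 0 \<and> (\<forall>v m. v * 2 ^ D + m < k \<and> m < 2 ^ D \<longrightarrow> \<not> ready_todo S (v, m)) \<or> (\<exists>x. regs q rFound = adp x \<and> ready_todo S x))))"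
  define f where "f = (\<lambda>q::ram_state. ((heap0 - regs q rP) div 32) * ?C + (1::nat))"
  have fk: "(ad 0 ?N - ad 0 k) div 32 = ?N - k" for k by (simp add: ad_def diff_mult_distrib2[symmetric])
  have loop: "wp (While (Less rP rE) ?body) ?s0 (\<lambda>t q. t \<le> f ?s0 \<and> I q \<and> \<not> holds (Less rP rE) q)"
  proof (rule wp_While[where I = I and f = f])
    show "I ?s0" unfolding I_def using r by (auto simp: ad_def intro!: exI[of _ 0])
    show "1 \<le> f q" for q by (simp add: f_def)
    fix q :: ram_state assume Iq: "I q" and b: "holds (Less rP rE) q"
    obtain k where q: "regs q rZ = 0" "mem q = ?M" "regs q rE = heap0" "k \<le> ?N" "regs q rP = ad 0 k"
      and fd: "regs q rFound = 0 \<and> (\<forall>v m. v * 2 ^ D + m < k \<and> m < 2 ^ D \<longrightarrow> \<not> ready_todo S (v, m)) \<or> (\<exists>x. regs q rFound = adp x \<and> ready_todo S x)"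
      using Iq unfolding I_def by blast
    have k: "k < ?N" using b q(3,5) unfolding h0 by (simp add: ad_def)
    let ?v = "k div 2 ^ D" and ?m = "k mod 2 ^ D"
    have vm: "?v < n" "?m < 2 ^ D" "k = ?v * 2 ^ D + ?m"
      using k less_mult_imp_div_less[of k n "2 ^ D"] by (simp_all only: div_mult_mod_eq) simp
    have ak: "ad 0 k = ad ?v ?m" using ad_index[of ?v ?m] vm(3) by simp
    have nxt: "v * 2 ^ D + m < Suc k \<and> m < 2 ^ D \<longleftrightarrow> v * 2 ^ D + m < k \<and> m < 2 ^ D \<or> (v, m) = (?v, ?m)" for v m
    proof -
      have "v * 2 ^ D + m = k \<and> m < 2 ^ D \<longleftrightarrow> (v, m) = (?v, ?m)" using vm by auto
      then show ?thesis by auto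
    qed
    have fin: "I q' \<and> Suc t + f q' \<le> f q"
      if t: "t \<le> 30 * D + 19" and q': "regs q' rZ = 0" "mem q' = ?M" "regs q' rE = heap0" "regs q' rP = ad 0 (Suc k)"
        "regs q' rFound = regs q rFound \<and> \<not> ready_todo S (?v, ?m) \<or> regs q' rFound = ad ?v ?m \<and> ready_todo S (?v, ?m)" for t :: nat and q' :: ram_state
    proof
      show "I q'" unfolding I_def
      proof (intro conjI exI[of _ "Suc k"])
        show "regs q' rFound = 0 \<and> (\<forall>v m. v * 2 ^ D + m < Suc k \<and> m < 2 ^ D \<longrightarrow> \<not> ready_todo S (v, m)) \<or> (\<exists>x. regs q' rFound = adp x \<and> ready_todo S x)"
        proof (cases "ready_todo S (?v, ?m)")
          case True
          then have "regs q' rFound = adp (?v, ?m)" using q'(5) by simp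
          then show ?thesis using True by blast
        next
          case False
          then have e: "regs q' rFound = regs q rFound" using q'(5) by simp
          show ?thesis using fd unfolding e nxt using False by auto
        qed
      qed (use q' k in auto)
      have "?N - k = Suc (?N - Suc k)" using k by simp
      then have "f q = ?C + f q'" unfolding f_def q(5) q'(4) h0 fk by simp
      then show "Suc t + f q' \<le> f q" using t by simp
    qed
    have nx: "ad 0 k + 32 = ad 0 (Suc k)" by (simp add: ad_def)
    have tdk: "?M (ad ?v ?m + 3) = (if (?v, ?m) \<in> items \<and> (?v, ?m) \<notin> S then 1 else 0)"
      using td vm unfolding todo_def items_def by auto
    show "wp ?body q (\<lambda>t q'. I q' \<and> Suc t + f q' \<le> f q)"
    proof (cases "(?v, ?m) \<in> items \<and> (?v, ?m) \<notin> S")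
      case False
      then have "?M (ad 0 k + 3) = 0" "\<not> ready_todo S (?v, ?m)" using tdk ak by (auto simp: ready_todo_def)
      moreover have "I (set_reg rP (ad 0 (Suc k)) (set_reg rT 32 (set_reg rW 0 q))) \<and>
          Suc 7 + f (set_reg rP (ad 0 (Suc k)) (set_reg rT 32 (set_reg rW 0 q))) \<le> f q"
        by (rule fin) (use q \<open>\<not> ready_todo S (?v, ?m)\<close> in auto)
      ultimately show ?thesis using q nx by simp
    next
      case True
      then have va: "valid (?v, ?m)" by (auto simp: items_def)
      let ?q1 = "set_reg rW 1 q"
      have M1: "?M (ad 0 k + 3) = 1" using tdk True ak by simp
      have "wp check ?q1 (\<lambda>t s'. t \<le> 30 * D + 12 \<and> regs s' rFound = (if ready S (?v, ?m) then ad ?v ?m else regs ?q1 rFound))"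
        by (rule wp_check) (use st td q ak va in auto)
      then have "wp check ?q1 (\<lambda>t s'. wp (Inc rP 32) s' (\<lambda>t' q'. I q' \<and> Suc (3 + (Suc t + t')) + f q' \<le> f q))"
      proof (rule wp_frame)
        fix t :: nat and s' :: ram_state
        assume A: "t \<le> 30 * D + 12 \<and> regs s' rFound = (if ready S (?v, ?m) then ad ?v ?m else regs ?q1 rFound)"
          and fr: "\<And>x. x \<notin> writes check \<Longrightarrow> regs s' x = regs ?q1 x" "\<not> stores check \<Longrightarrow> mem s' = mem ?q1"
        have s': "regs s' rZ = 0" "mem s' = ?M" "regs s' rE = heap0" "regs s' rP = ad 0 k"
          using fr q by (auto simp: check_effects)
        have "I (set_reg rP (ad 0 (Suc k)) (set_reg rT 32 s')) \<and> Suc (3 + (Suc t + 2)) + f (set_reg rP (ad 0 (Suc k)) (set_reg rT 32 s')) \<le> f q"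
          by (rule fin) (use s' A True in \<open>auto simp: ready_todo_def\<close>)
        then show "wp (Inc rP 32) s' (\<lambda>t' q'. I q' \<and> Suc (3 + (Suc t + t')) + f q' \<le> f q)" using s' nx by simp
      qed
      then show ?thesis using q M1 by (simp del: wp_Seq wp_Inc add: wp_Seq[of "LoadF _ _ _"] wp_Seq[of "Cond _ _ _"])
    qed
  qed
  have f0: "f ?s0 = ?N * ?C + 1"
  proof -
    have "base = ad 0 0" by (simp add: ad_def)
    then show ?thesis unfolding f_def h0 using fk[of 0] by simp
  qed
  have "wp (While (Less rP rE) ?body) ?s0 (\<lambda>t s'. 2 + t \<le> ?N * ?C + 3 \<and>
     (regs s' rFound = 0 \<and> (\<forall>x. \<not> ready_todo S x) \<or> (\<exists>x. regs s' rFound = adp x \<and> ready_todo S x)))"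
  proof (rule wp_mono[OF loop])
    fix t :: nat and q :: ram_state
    assume A: "t \<le> f ?s0 \<and> I q \<and> \<not> holds (Less rP rE) q"
    then obtain k where q: "regs q rE = heap0" "k \<le> ?N" "regs q rP = ad 0 k"
      and fd: "regs q rFound = 0 \<and> (\<forall>v m. v * 2 ^ D + m < k \<and> m < 2 ^ D \<longrightarrow> \<not> ready_todo S (v, m)) \<or> (\<exists>x. regs q rFound = adp x \<and> ready_todo S x)"
      unfolding I_def by blast
    have k: "k = ?N" using A q unfolding h0 by (simp add: ad_def)
    have "\<not> ready_todo S x" if no: "\<forall>v m. v * 2 ^ D + m < k \<and> m < 2 ^ D \<longrightarrow> \<not> ready_todo S (v, m)" for x
    proof
      assume x: "ready_todo S x"
      then have "valid (fst x, snd x)" by (auto simp: ready_todo_def items_def)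
      then have v: "fst x < n" "snd x < 2 ^ D" using valid_lt[of "fst x" "snd x"] by blast+
      then have "fst x * 2 ^ D + snd x < Suc (fst x) * 2 ^ D" by simp
      also have "\<dots> \<le> k" unfolding k using v by (intro mult_le_mono1) simp
      finally show False using no v x by (metis prod.collapse)
    qed
    then show "2 + t \<le> ?N * ?C + 3 \<and>
     (regs q rFound = 0 \<and> (\<forall>x. \<not> ready_todo S x) \<or> (\<exists>x. regs q rFound = adp x \<and> ready_todo S x))"
      using A f0 fd by auto
  qed
  then show ?thesis unfolding find_ready_def
    using r
    by (simp del: wp_Seq add: wp_Seq[of "Const _ _"] wp_Seq[of "Copy _ _"])
       (erule wp_mono, elim conjE, intro conjI, linarith, assumption)
qed

text \<open>Entering \<open>c\<close> takes at least \<open>c\<close> out of the contaminated part,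
  and what remains contaminated behind \<open>c\<close> and at \<open>v\<close> lies inside the old
  branches.\<close>

lemma branch_smaller:
  assumes R: "R \<subseteq> nb v" "v \<in> V" and c: "c \<in> R"
  shows "card (branch c (nb c - {v})) < card (branch v R)" "card (branch v (R - {c})) < card (branch v R)"
proof -
  let ?X = "insert c (core v R)"
  note si = start_item[OF R c]
  have cX: "conn ?X" by (rule si(4))
  have fr: "frontier ?X [(c, nb c - {v}), (v, R - {c})]" using si(1) unfolding run_inv_def by blast
  have vX: "v \<in> ?X" "c \<in> ?X" using core_self[OF R] by auto
  have fin: "finite (branch v R)" using branch_sub[OF R(1)] finV finite_subset by blast
  have cb: "c \<in> branch v R" using c branch_R by blast
  have sub: "branch y Q \<subseteq> branch v R - {c}" if y: "(y, Q) \<in> {(c, nb c - {v}), (v, R - {c})}" "y \<in> ?X" "Q \<subseteq> nb y" for y Q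
  proof (cases "Q = {}")
    case True
    then show ?thesis by (simp add: branch_def)
  next
    case False
    have Qe: "Q = nb y - ?X" using frontierD(2)[OF fr _ False, of y] y by auto
    have "branch y Q \<inter> ?X = {}" using branch_disj[OF cX y(2,3)] Qe by auto
    moreover have "branch y Q \<subseteq> V" using branch_sub[OF y(3)] by auto
    ultimately show ?thesis by (auto simp: core_def)
  qed
  have "card (branch v R - {c}) < card (branch v R)" using fin cb by (rule card_Diff1_less)
  moreover have "card (branch c (nb c - {v})) \<le> card (branch v R - {c})"
    using sub[of c "nb c - {v}"] vX fin by (intro card_mono) auto
  moreover have "card (branch v (R - {c})) \<le> card (branch v R - {c})"
    using sub[of v "R - {c}"] vX R fin by (intro card_mono) auto
  ultimately show "card (branch c (nb c - {v})) < card (branch v R)" "card (branch v (R - {c})) < card (branch v R)" by linarith+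
qed

text \<open>An uncomputed record with the smallest contaminated part is ready, since the records it
  depends on have smaller parts.\<close>

lemma exists_ready:
  assumes st: "static M" and x: "x \<in> items" "x \<notin> S"
  shows "\<exists>y. ready_todo S y"
proof (rule ccontr)
  assume no: "\<not> ?thesis"
  define mu where "mu y = card (branch (fst y) (nbrs (fst y) (snd y)))" for y :: "nat \<times> nat"
  obtain y where y: "y \<in> items" "y \<notin> S" "\<And>z. z \<in> items \<Longrightarrow> z \<notin> S \<Longrightarrow> mu y \<le> mu z"
    using ex_has_least_nat[of "\<lambda>z. z \<in> items \<and> z \<notin> S" x mu] x by blast
  let ?v = "fst y" and ?m = "snd y"
  have vn: "?v < n" "?v \<in> V" "?m < 2 ^ d ?v" using y(1) V_eq by (auto simp: items_def valid_def)
  have "ready S y" unfolding ready_def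
  proof
    fix j assume j: "j \<in> slots ?m"
    note nr = nbrs_remove[OF vn(3) j] and ch = static_ch[OF st vn(1) nbrs_remove(3)[OF vn(3) j]]
    note bs = branch_smaller[OF nbrs_sub[OF vn(3)] vn(2) nr(2)]
    have "mu (nbr ?v j, chm ?v j) < mu y" unfolding mu_def using bs(1) ch(3) by simp
    then have 1: "(nbr ?v j, chm ?v j) \<in> okset S" using y(3)[of "(nbr ?v j, chm ?v j)"] ch(2)
      unfolding okset_def items_def by force
    have "valid (?v, ?m - 2 ^ j)" using vn by (auto simp: valid_def)
    moreover have "mu (?v, ?m - 2 ^ j) < mu y" unfolding mu_def using bs(2) nr(1) by simp
    ultimately have "(?v, ?m - 2 ^ j) \<in> okset S" using y(3)[of "(?v, ?m - 2 ^ j)"]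
      unfolding okset_def items_def by force
    with 1 show "(nbr ?v j, chm ?v j) \<in> okset S \<and> (?v, ?m - 2 ^ j) \<in> okset S" ..
  qed
  then show False using no y unfolding ready_todo_def by blast
qed

lemma items_card: "finite items" "card items \<le> n * 2 ^ D"
proof -
  have s: "items \<subseteq> {..<n} \<times> {..<2 ^ D}" using valid_lt by (fastforce simp: items_def)
  show "finite items" using s finite_subset by blast
  show "card items \<le> n * 2 ^ D" using card_mono[OF _ s] by (simp add: card_cartesian_product)
qed

definition step_time :: nat where
  "step_time = n * 2 ^ D * (30 * D + 20) + D * (200 * (n + 1) * (n + 1) + 61) + 60"

text \<open>Every round settles a record until none is left, and a last round finds nothing; hence
  the factor \<open>n * 2 ^ D + 1\<close>.\<close>

lemma wp_compute:
  assumes st: "static (mem s)" and td: "todo (mem s) {}" and r: "regs s rZ = 0" "regs s rB = base" "regs s rE = heap0" "regs s rH = heap0"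
  shows "wp compute s (\<lambda>t s'. t \<le> (n * 2 ^ D + 1) * step_time + 2 \<and> static (mem s') \<and> table (mem s') (regs s' rH) items)"
proof -
  let ?body = "find_ready ;; Cond (Equal rFound rZ) Skip (Copy rA rFound ;; process)"
  define I where "I = (\<lambda>q::ram_state. regs q rZ = 0 \<and> regs q rB = base \<and> regs q rE = heap0 \<and> static (mem q) \<and>
     (\<exists>S. table (mem q) (regs q rH) S \<and> todo (mem q) S \<and> (regs q rFound = 0 \<longrightarrow> items \<subseteq> S)))"
  define left where "left M = {x \<in> items. M (adp x + 3) \<noteq> (0::nat)}" for M
  define f where "f = (\<lambda>q::ram_state. if regs q rFound = 0 then 1 else (card (left (mem q)) + 1) * step_time + (1::nat))"
  have left_eq: "left M = items - S" if "todo M S" for M S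
  proof (rule set_eqI)
    fix x show "x \<in> left M \<longleftrightarrow> x \<in> items - S"
      using todo_ok[OF that, of x] unfolding left_def by (auto simp: items_def okset_def)
  qed
  have loop: "wp (While (NotEqual rFound rZ) ?body) (set_reg rFound 1 s) (\<lambda>t q. t \<le> f (set_reg rFound 1 s) \<and> I q \<and> \<not> holds (NotEqual rFound rZ) q)"
  proof (rule wp_While[where I = I and f = f])
    have "table (mem s) heap0 {}" by (simp add: table_def)
    then show "I (set_reg rFound 1 s)" unfolding I_def using r st td by auto
    show "1 \<le> f q" for q by (simp add: f_def)
    fix q :: ram_state assume Iq: "I q" and b: "holds (NotEqual rFound rZ) q"
    obtain S where q: "regs q rZ = 0" "regs q rB = base" "regs q rE = heap0" "static (mem q)"
      "table (mem q) (regs q rH) S" "todo (mem q) S" using Iq unfolding I_def by blast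
    have fq: "f q = (card (items - S) + 1) * step_time + 1" using b q(1) left_eq[OF q(6)] by (simp add: f_def)
    show "wp ?body q (\<lambda>t q'. I q' \<and> Suc t + f q' \<le> f q)"
      unfolding wp_Seq[of find_ready]
    proof (rule wp_frame[OF wp_find[OF q(4,6,1,2,3)]])
      fix t1 :: nat and s1 :: ram_state
      assume A: "t1 \<le> n * 2 ^ D * (30 * D + 20) + 3 \<and>
         (regs s1 rFound = 0 \<and> (\<forall>x. \<not> ready_todo S x) \<or> (\<exists>x. regs s1 rFound = adp x \<and> ready_todo S x))"
        and fr: "\<And>x. x \<notin> writes find_ready \<Longrightarrow> regs s1 x = regs q x" "\<not> stores find_ready \<Longrightarrow> mem s1 = mem q"
      have s1: "regs s1 rZ = 0" "regs s1 rB = base" "regs s1 rE = heap0" "mem s1 = mem q" "regs s1 rH = regs q rH"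
        using fr q by (auto simp: find_effects)
      show "wp (Cond (Equal rFound rZ) Skip (Copy rA rFound ;; process)) s1 (\<lambda>t' q'. I q' \<and> Suc (t1 + t') + f q' \<le> f q)"
      proof (cases "regs s1 rFound = 0")
        case True
        have "\<not> (\<exists>x. regs s1 rFound = adp x \<and> ready_todo S x)"
          using True by (auto simp: ad_def base_def)
        then have "\<forall>x. \<not> ready_todo S x" using A by blast
        then have "items \<subseteq> S" using exists_ready[OF q(4)] by blast
        then have "I s1" unfolding I_def using s1 q by auto
        moreover have "f s1 = 1" using True by (simp add: f_def)
        moreover have "t1 + 4 \<le> f q" using A unfolding fq step_time_def by (simp add: algebra_simps)
        ultimately show ?thesis using True s1 by simp
      next
        case False
        then obtain v m where x: "regs s1 rFound = ad v m" "ready_todo S (v, m)" using A by fastforce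
        have xv: "valid (v, m)" "m \<noteq> 0" "(v, m) \<notin> S" "ready S (v, m)" "(v, m) \<in> items" using x(2) by (auto simp: ready_todo_def items_def)
        let ?s2 = "set_reg rA (ad v m) s1"
        have "wp process ?s2 (\<lambda>t s'. t \<le> D * (200 * (n + 1) * (n + 1) + 61) + 40 \<and> static (mem s') \<and>
             table (mem s') (regs s' rH) (insert (v, m) S) \<and> regs ?s2 rH \<le> regs s' rH \<and>
             (\<forall>i<heap0. i \<notin> {ad v m + 3..ad v m + 7} \<longrightarrow> mem s' i = mem ?s2 i) \<and> mem s' (ad v m + 3) = 0)"
          by (rule wp_process) (use q s1 xv in auto)
        then have "wp process ?s2 (\<lambda>t' q'. I q' \<and> Suc (t1 + Suc (1 + t')) + f q' \<le> f q)"
        proof (rule wp_frame)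
          fix t2 :: nat and q' :: ram_state
          assume B: "t2 \<le> D * (200 * (n + 1) * (n + 1) + 61) + 40 \<and> static (mem q') \<and>
             table (mem q') (regs q' rH) (insert (v, m) S) \<and> regs ?s2 rH \<le> regs q' rH \<and>
             (\<forall>i<heap0. i \<notin> {ad v m + 3..ad v m + 7} \<longrightarrow> mem q' i = mem ?s2 i) \<and> mem q' (ad v m + 3) = 0"
           and fr: "\<And>x. x \<notin> writes process \<Longrightarrow> regs q' x = regs ?s2 x"
          have g: "regs q' rZ = 0" "regs q' rB = base" "regs q' rE = heap0" "regs q' rFound = ad v m"
            using fr s1 x(1) by (auto simp: process_effects run_jumps_effects)
          have td': "todo (mem q') (insert (v, m) S)" unfolding todo_def
          proof (intro allI impI)
            fix v' m' :: nat assume vm: "v' < n" "m' < 2 ^ D"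
            show "mem q' (ad v' m' + 3) = (if valid (v', m') \<and> m' \<noteq> 0 \<and> (v', m') \<notin> insert (v, m) S then 1 else 0)"
            proof (cases "(v', m') = (v, m)")
              case True
              then show ?thesis using B by simp
            next
              case False
              have "ad v' m' + 3 \<notin> {ad v m + 3..ad v m + 7}"
              proof
                assume "ad v' m' + 3 \<in> {ad v m + 3..ad v m + 7}"
                then have e: "ad v' m' + 3 = ad v m + (ad v' m' + 3 - ad v m)" "ad v' m' + 3 - ad v m \<le> 7" by auto
                then show False using ad_eq[OF vm(2), of m 3 "ad v' m' + 3 - ad v m" v' v] valid_lt[OF xv(1)] False by auto
              qed
              then have "mem q' (ad v' m' + 3) = mem q (ad v' m' + 3)" using B s1 ad_less[OF vm, of 3] by simp
              then show ?thesis using q(6) vm False unfolding todo_def by auto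
            qed
          qed
          have Iq': "I q'" unfolding I_def using g B td' xv by (auto simp: ad_def base_def)
          have fq': "f q' = (card (items - insert (v, m) S) + 1) * step_time + 1"
            using g left_eq[OF td'] by (simp add: f_def ad_def base_def)
          have cs: "Suc (card (items - insert (v, m) S)) = card (items - S)"
          proof -
            have "items - insert (v, m) S = (items - S) - {(v, m)}" by auto
            then show ?thesis using card_Suc_Diff1[of "items - S" "(v, m)"] items_card(1) xv by simp
          qed
          have "f q = f q' + step_time" unfolding fq fq' cs[symmetric] by simp
          moreover have "Suc (t1 + Suc (1 + t2)) \<le> step_time" using A B unfolding step_time_def by linarith
          ultimately show "I q' \<and> Suc (t1 + Suc (1 + t2)) + f q' \<le> f q" using Iq' by linarith
        qed
        then show ?thesis using False s1 x(1) by simp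
      qed
    qed
  qed
  have f0: "f (set_reg rFound 1 s) \<le> (n * 2 ^ D + 1) * step_time + 1"
  proof -
    have "card (left (mem s)) \<le> n * 2 ^ D"
      using items_card card_mono[of items "left (mem s)"] by (auto simp: left_def)
    then have "(card (left (mem s)) + 1) * step_time \<le> (n * 2 ^ D + 1) * step_time" by (intro mult_le_mono1) simp
    then show ?thesis by (simp add: f_def)
  qed
  have "wp (While (NotEqual rFound rZ) ?body) (set_reg rFound 1 s)
     (\<lambda>t s'. 1 + t \<le> (n * 2 ^ D + 1) * step_time + 2 \<and> static (mem s') \<and> table (mem s') (regs s' rH) items)"
  proof (rule wp_mono[OF loop])
    fix t :: nat and q :: ram_state
    assume A: "t \<le> f (set_reg rFound 1 s) \<and> I q \<and> \<not> holds (NotEqual rFound rZ) q"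
    have Iq: "I q" and nb: "regs q rFound = regs q rZ" using A by auto
    have q0: "regs q rZ = 0" "static (mem q)"
      and ex: "\<exists>S. table (mem q) (regs q rH) S \<and> todo (mem q) S \<and> (regs q rFound = 0 \<longrightarrow> items \<subseteq> S)"
      using Iq unfolding I_def by simp_all
    obtain S where S: "table (mem q) (regs q rH) S \<and> todo (mem q) S \<and> (regs q rFound = 0 \<longrightarrow> items \<subseteq> S)"
      using ex by (rule exE)
    note q = q0 S[THEN conjunct1]
    have "items \<subseteq> S" using nb q0 S by simp
    moreover have "S \<subseteq> items" using q(3) by (auto simp: table_def items_def)
    ultimately show "1 + t \<le> (n * 2 ^ D + 1) * step_time + 2 \<and> static (mem q) \<and> table (mem q) (regs q rH) items"
      using A f0 q by auto
  qed
  then show ?thesis unfolding compute_def wp_Seq[of "Const rFound 1"] wp_Const .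
qed

end

section \<open>Choosing the starting vertex\<close>

text \<open>Field 11 is one record beyond the masks in use, so 32 less is the offset of the full
  mask. The initial list is this record alone.\<close>

definition root_init :: program where
  "root_init = (LoadF rW rP 11 ;; Add rX rP rW ;; Const rT 32 ;; Sub rX rX rT ;; Store rH rX ;;
     Const rLen 1 ;; LoadF rCost rX 0 ;; Const rPeak 0)"

text \<open>\<open>w\<close> is the distance between the records of consecutive vertices. Every run
  ends with cost 0, so \<open>select\<close> effectively compares peaks.\<close>

definition roots :: "nat \<Rightarrow> program" where
  "roots w = (Const rSet 0 ;; Const rBound 0 ;; Copy rP rB ;; While (Less rP rE)
     (root_init ;; run_jumps ;; select ;; Inc rP w))"

lemma root_init_effects: "writes root_init = {rT, rW, rX, rLen, rCost, rPeak}" "\<not> prints root_init"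
  by (auto simp: root_init_def)

lemma roots_effects: "writes (roots w) = {rT, rBound, rSet, rP, rW, rX, rLen, rCost, rPeak, rBP, rBC, rBPtr, rBLen, rH} \<union> writes run_jumps"
   "\<not> prints (roots w)"
  by (auto simp: roots_def root_init_effects run_jumps_effects select_effects)

context tree_input
begin

definition rooted :: "nat \<Rightarrow> nat \<Rightarrow> (nat \<times> nat) list \<Rightarrow> bool" where
  "rooted r p LL \<longleftrightarrow> r < n \<and> path p {r} (map fst LL) \<and> {r} \<union> fst ` set LL = V \<and> LL \<noteq> [] \<and> fst (hd LL) = r \<and>
     set LL \<subseteq> {x. valid x} \<and> length LL \<le> 2 * n"

definition root_inv :: "nat \<Rightarrow> ram_state \<Rightarrow> bool" where
  "root_inv k s \<longleftrightarrow> (k = 0 \<and> regs s rSet = 0) \<or>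
     (regs s rSet = 1 \<and> regs s rBC = 0 \<and> (\<exists>r LL. rooted r (regs s rBP) LL \<and> holds_list (mem s) (regs s rBPtr) LL \<and>
        heap0 \<le> regs s rBPtr \<and> regs s rBPtr + length LL \<le> regs s rH \<and> regs s rBLen = length LL) \<and>
      (\<forall>r'<k. \<forall>b. reach b {r'} V \<longrightarrow> regs s rBP \<le> b))"

lemma wp_root_body:
  assumes st: "static (mem s)" and tb: "table (mem s) (regs s rH) items" and r: "regs s rZ = 0" "regs s rBound = 0"
    "regs s rP = ad k 0" and k: "k < n" and inv: "root_inv k s"
  shows "wp (root_init ;; run_jumps ;; select ;; Inc rP (32 * 2 ^ D)) s (\<lambda>t s'. t \<le> 200 * (n + 1) * (n + 1) + 40 \<and> static (mem s') \<and>
     table (mem s') (regs s' rH) items \<and> regs s' rP = ad (Suc k) 0 \<and> root_inv (Suc k) s')"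
proof -
  define mk :: nat where "mk = 2 ^ d k - 1"
  let ?h = "regs s rH" and ?M = "mem s" and ?x = "(k, mk)"
  have kV: "k \<in> V" using k V_eq by simp
  have vx: "valid ?x" using k by (simp add: valid_def mk_def)
  have h: "heap0 \<le> ?h" using tb by (simp add: table_def)
  have pw: "?M (ad k 0 + 11) = 32 * 2 ^ d k" using st k unfolding static_def by blast
  have ax: "ad k 0 + 32 * 2 ^ d k - 32 = ad k mk"
  proof -
    have "32 * (2::nat) ^ d k - 32 = 32 * mk" by (simp add: diff_mult_distrib2 mk_def)
    moreover have "32 \<le> 32 * (2::nat) ^ d k" by simp
    ultimately have "ad k 0 + 32 * 2 ^ d k - 32 = ad k 0 + 32 * mk" by linarith
    then show ?thesis using ad_add[of k 0] by simp
  qed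
  have Wx: "?M (ad k mk) = (if nb k = {} then 0 else vw k)"
  proof -
    have "mk = (0::nat) \<longleftrightarrow> nb k = {}" using nbrs_full[of k] nbrs_ne[of mk k] nbrs_0[of k] unfolding mk_def by metis
    then show ?thesis using static_W[OF st vx] unfolding fst_conv snd_conv by presburger
  qed
  have ne: "ad k mk \<noteq> ?h" using valid_ad[OF vx, of 0] h by simp
  have ini: "wp root_init s (\<lambda>t s1. t \<le> 15 \<and> mem s1 = ?M(?h := adp ?x) \<and> regs s1 rLen = 1 \<and>
      regs s1 rCost = (if nb k = {} then 0 else vw k) \<and> regs s1 rPeak = 0)"
    unfolding root_init_def by (simp add: r pw ax ne Wx split del: if_split)
  note sr = start_root[OF kV]
  have mapL: "map item [?x] = [(k, nb k)]" using nbrs_full[of k] unfolding mk_def[symmetric] by (simp add: item_def)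
  have okI: "okset items = {x. valid x}" by (auto simp: okset_def items_def)
  show ?thesis
    unfolding wp_Seq[of root_init] wp_Seq[of run_jumps] wp_Seq[of select]
  proof (rule wp_frame[OF ini])
    fix t0 :: nat and s1 :: ram_state
    assume A: "t0 \<le> 15 \<and> mem s1 = ?M(?h := adp ?x) \<and> regs s1 rLen = 1 \<and>
      regs s1 rCost = (if nb k = {} then 0 else vw k) \<and> regs s1 rPeak = 0"
      and fr: "\<And>x. x \<notin> writes root_init \<Longrightarrow> regs s1 x = regs s x"
    have s1: "regs s1 rZ = 0" "regs s1 rBound = 0" "regs s1 rH = ?h" "regs s1 rP = ad k 0"
      "regs s1 rSet = regs s rSet" "regs s1 rBP = regs s rBP" "regs s1 rBC = regs s rBC" "regs s1 rBPtr = regs s rBPtr"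
      "regs s1 rBLen = regs s rBLen" using fr r by (auto simp: root_init_effects)
    have "wp run_jumps s1 (\<lambda>t \<sigma>'. t \<le> 200 * (n + 1) * (n + 1) + 2 \<and>
     (\<exists>X' p' LL'. run_inv V {k} {k} 0 0 1 X' p' (map item LL') \<and> stopped 0 X' p' (map item LL') \<and>
        holds_list (mem \<sigma>') ?h LL' \<and> set LL' \<subseteq> okset items \<and> regs \<sigma>' rLen = length LL' \<and>
        regs \<sigma>' rCost = cost vw X' \<and> regs \<sigma>' rPeak = p' \<and> (\<forall>i<?h. mem \<sigma>' i = mem s1 i) \<and> LL' \<noteq> [] \<and> fst (hd LL') = fst (hd [?x])))"
    proof (rule wp_run_jumps)
      show "static (mem s1)" by (rule static_agree[OF st]) (use A h in auto)
      show "table (mem s1) ?h items" by (rule table_agree[OF tb]) (use A in auto)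
      show "regs s1 rCost = cost vw {k}" using A sr(2) by simp
      show "run_inv V {k} {k} 0 0 1 {k} 0 (map item [?x])" unfolding mapL by (rule sr(1))
      show "conn {k}" using conn_single[OF kV] .
      show "set [?x] \<subseteq> okset items" using vx okI by simp
      show "holds_list (mem s1) ?h [?x]" using A by (simp add: holds_list_def)
    qed (use s1 A in auto)
    then show "wp run_jumps s1 (\<lambda>t \<sigma>'. wp select \<sigma>' (\<lambda>t' \<sigma>''. wp (Inc rP (32 * 2 ^ D)) \<sigma>'' (\<lambda>t'' s'. t0 + (t + (t' + t'')) \<le> 200 * (n + 1) * (n + 1) + 40 \<and>
       static (mem s') \<and> table (mem s') (regs s' rH) items \<and> regs s' rP = ad (Suc k) 0 \<and> root_inv (Suc k) s')))"
    proof (rule wp_frame)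
      fix t :: nat and s2 :: ram_state
      assume B0: "t \<le> 200 * (n + 1) * (n + 1) + 2 \<and>
       (\<exists>X' p' LL'. run_inv V {k} {k} 0 0 1 X' p' (map item LL') \<and> stopped 0 X' p' (map item LL') \<and>
        holds_list (mem s2) ?h LL' \<and> set LL' \<subseteq> okset items \<and> regs s2 rLen = length LL' \<and>
        regs s2 rCost = cost vw X' \<and> regs s2 rPeak = p' \<and> (\<forall>i<?h. mem s2 i = mem s1 i) \<and> LL' \<noteq> [] \<and> fst (hd LL') = fst (hd [?x]))"
        and fr2: "\<And>x. x \<notin> writes run_jumps \<Longrightarrow> regs s2 x = regs s1 x"
      obtain X p LL where B: "run_inv V {k} {k} 0 0 1 X p (map item LL)" "stopped 0 X p (map item LL)"
        "holds_list (mem s2) ?h LL" "set LL \<subseteq> okset items" "regs s2 rLen = length LL"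
        "regs s2 rCost = cost vw X" "regs s2 rPeak = p" "\<forall>i<?h. mem s2 i = mem s1 i" "LL \<noteq> []" "fst (hd LL) = k"
        using B0[THEN conjunct2] by (elim exE conjE) simp
      have s2: "regs s2 rZ = 0" "regs s2 rH = ?h" "regs s2 rP = ad k 0"
        "regs s2 rSet = regs s rSet" "regs s2 rBP = regs s rBP" "regs s2 rBC = regs s rBC" "regs s2 rBPtr = regs s rBPtr"
        "regs s2 rBLen = regs s rBLen" using fr2 s1 by (auto simp: run_jumps_effects)
      have ag: "mem s2 i = ?M i" if "i < ?h" for i using B(8) that A by simp
      have no: "Q = {}" if "(v, Q) \<in> set (map item LL)" for v Q using B(2) that unfolding stopped_def by blast
      have rd: "path p {k} (map fst (map item LL))" "{k} \<union> fst ` set (map item LL) = V"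
        by (rule root_done[OF B(1) _ kV], use no in blast)+
      have opt: "p \<le> b" if "reach b {k} V" for b
        by (rule root_done(3)[OF B(1) _ kV that]) (use no in blast)
      have XV: "X = V" and len: "length LL \<le> 2 * n"
      proof -
        have X: "X = {k} \<union> fst ` set (map item LL)" "conn X" "length (map item LL) + 2 * card {k} = 1 + 2 * card X"
          using B(1) unfolding run_inv_def by blast+
        show "X = V" using X(1) rd(2) by simp
        have "card X \<le> n" using card_mono[OF finV conn_sub[OF X(2)]] by (simp add: n_def)
        then show "length LL \<le> 2 * n" using X(3) by simp
      qed
      have c0: "regs s2 rCost = 0" using B(6) XV cost_V by simp
      have mf: "map fst (map item LL) = map fst LL" "fst ` set (map item LL) = fst ` set LL" by (auto simp: item_def image_image)
      have rt: "rooted k p LL" unfolding rooted_def using k rd(1,2)[unfolded mf] B(4,9,10) len okI by auto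
      show "wp select s2 (\<lambda>t' \<sigma>''. wp (Inc rP (32 * 2 ^ D)) \<sigma>'' (\<lambda>t'' s'. t0 + (t + (t' + t'')) \<le> 200 * (n + 1) * (n + 1) + 40 \<and>
         static (mem s') \<and> table (mem s') (regs s' rH) items \<and> regs s' rP = ad (Suc k) 0 \<and> root_inv (Suc k) s'))"
      proof (rule wp_frame[OF wp_select[OF s2(1)]])
        fix t3 :: nat and s3 :: ram_state
        assume C: "t3 \<le> 10 \<and> mem s3 = mem s2 \<and>
         (if better s2 then regs s3 rSet = 1 \<and> regs s3 rBP = regs s2 rPeak \<and> regs s3 rBC = regs s2 rCost \<and>
           regs s3 rBPtr = regs s2 rH \<and> regs s3 rBLen = regs s2 rLen \<and> regs s3 rH = regs s2 rH + regs s2 rLen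
          else s3 = s2)" and fr3: "\<And>x. x \<notin> writes select \<Longrightarrow> regs s3 x = regs s2 x"
        have r3: "regs s3 rP = ad k 0" using fr3 s2 by (auto simp: select_effects)
        have hh: "?h \<le> regs s3 rH" using C s2 by (auto split: if_splits)
        let ?s4 = "set_reg rP (ad (Suc k) 0) (set_reg rT (32 * 2 ^ D) s3)"
        have "root_inv (Suc k) ?s4"
        proof (cases "better s2")
          case True
          have b: "regs s3 rSet = 1" "regs s3 rBP = p" "regs s3 rBC = 0" "regs s3 rBPtr = ?h" "regs s3 rBLen = length LL"
            "regs s3 rH = ?h + length LL" "mem s3 = mem s2" using C True B s2 c0 by auto
          have "p \<le> b" if r': "r' < Suc k" "reach b {r'} V" for r' b
          proof (cases "r' = k")
            case True
            then show ?thesis using opt r' by simp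
          next
            case False
            then have rk: "r' < k" using r' by simp
            then have "regs s rSet = 1" "regs s rBC = 0" "regs s rBP \<le> b" using inv r'(2) unfolding root_inv_def by auto
            moreover have "p \<le> regs s rBP" using True s2 B(7) c0 calculation unfolding better_def by auto
            ultimately show ?thesis by simp
          qed
          then show ?thesis unfolding root_inv_def using b rt B(3) h
            by (intro disjI2 conjI exI[of _ k] exI[of _ LL]) auto
        next
          case False
          then have e: "s3 = s2" using C by simp
          have ns: "regs s rSet \<noteq> 0" "regs s rBP \<le> p" using False s2 B(7) unfolding better_def by auto
          have i: "regs s rSet = 1" "regs s rBC = 0" and ex: "\<exists>r LL. rooted r (regs s rBP) LL \<and> holds_list ?M (regs s rBPtr) LL \<and>
              heap0 \<le> regs s rBPtr \<and> regs s rBPtr + length LL \<le> ?h \<and> regs s rBLen = length LL"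
            and al: "\<forall>r'<k. \<forall>b. reach b {r'} V \<longrightarrow> regs s rBP \<le> b" using inv ns(1) unfolding root_inv_def by simp_all
          obtain r' where "\<exists>LL. rooted r' (regs s rBP) LL \<and> holds_list ?M (regs s rBPtr) LL \<and>
              heap0 \<le> regs s rBPtr \<and> regs s rBPtr + length LL \<le> ?h \<and> regs s rBLen = length LL" using ex by (rule exE)
          then obtain LL0 where o: "rooted r' (regs s rBP) LL0 \<and> holds_list ?M (regs s rBPtr) LL0 \<and>
              heap0 \<le> regs s rBPtr \<and> regs s rBPtr + length LL0 \<le> ?h \<and> regs s rBLen = length LL0" by (rule exE)
          have hl: "holds_list (mem s2) (regs s rBPtr) LL0" using o ag unfolding holds_list_def by auto
          have "regs s rBP \<le> b" if "r' < Suc k" "reach b {r'} V" for r' b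
            using al that opt[of b] ns(2) by (cases "r' = k") (auto simp: less_Suc_eq)
          then show ?thesis unfolding root_inv_def e using o hl s2 i
            by (intro disjI2 conjI exI[of _ r'] exI[of _ LL0]) auto
        qed
        moreover have "static (mem s3)" by (rule static_agree[OF st]) (use C ag h in auto)
        moreover have "table (mem s3) (regs s3 rH) items" by (rule table_agree[OF tb]) (use C ag hh in auto)
        moreover have "t0 + (t + (t3 + 2)) \<le> 200 * (n + 1) * (n + 1) + 40" using A B0 C by linarith
        moreover have "ad k 0 + 32 * 2 ^ D = ad (Suc k) 0" by (simp add: ad_def)
        ultimately show "wp (Inc rP (32 * 2 ^ D)) s3 (\<lambda>t'' s'. t0 + (t + (t3 + t'')) \<le> 200 * (n + 1) * (n + 1) + 40 \<and>
          static (mem s') \<and> table (mem s') (regs s' rH) items \<and> regs s' rP = ad (Suc k) 0 \<and> root_inv (Suc k) s')"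
          using r3 by simp
      qed
    qed
  qed
qed

lemma wp_roots:
  assumes st: "static (mem s)" and tb: "table (mem s) (regs s rH) items" and r: "regs s rZ = 0" "regs s rB = base" "regs s rE = heap0"
  shows "wp (roots (32 * 2 ^ D)) s (\<lambda>t s'. t \<le> n * (200 * (n + 1) * (n + 1) + 41) + 4 \<and> static (mem s') \<and> heap0 \<le> regs s' rH \<and> root_inv n s')"
proof -
  let ?body = "root_init ;; run_jumps ;; select ;; Inc rP (32 * 2 ^ D)" and ?C = "200 * (n + 1) * (n + 1) + 41"
  let ?s0 = "set_reg rP base (set_reg rBound 0 (set_reg rSet 0 s))"
  define I where "I = (\<lambda>q::ram_state. regs q rZ = 0 \<and> regs q rBound = 0 \<and> regs q rE = heap0 \<and> static (mem q) \<and> table (mem q) (regs q rH) items \<and>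
     (\<exists>k\<le>n. regs q rP = ad k 0 \<and> root_inv k q))"
  define f where "f = (\<lambda>q::ram_state. ((heap0 - regs q rP) div (32 * 2 ^ D)) * ?C + (1::nat))"
  have fk: "(heap0 - ad k 0) div (32 * 2 ^ D) = n - k" for k
  proof -
    have "heap0 - ad k 0 = (n - k) * (32 * 2 ^ D)" by (simp add: heap0_def ad_def diff_mult_distrib diff_mult_distrib2)
    then show ?thesis by simp
  qed
  have loop: "wp (While (Less rP rE) ?body) ?s0 (\<lambda>t q. t \<le> f ?s0 \<and> I q \<and> \<not> holds (Less rP rE) q)"
  proof (rule wp_While[where I = I and f = f])
    show "I ?s0" unfolding I_def using r st tb by (auto simp: ad_def root_inv_def intro!: exI[of _ 0])
    show "1 \<le> f q" for q by (simp add: f_def)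
    fix q :: ram_state assume Iq: "I q" and b: "holds (Less rP rE) q"
    obtain k where q: "regs q rZ = 0" "regs q rBound = 0" "regs q rE = heap0" "static (mem q)" "table (mem q) (regs q rH) items"
      "k \<le> n" "regs q rP = ad k 0" "root_inv k q" using Iq unfolding I_def by blast
    have k: "k < n" using b q(3,6,7) by (cases "k = n") (auto simp: heap0_def)
    show "wp ?body q (\<lambda>t q'. I q' \<and> Suc t + f q' \<le> f q)"
    proof (rule wp_frame[OF wp_root_body[OF q(4,5,1,2,7) k q(8)]])
      fix t :: nat and q' :: ram_state
      assume A: "t \<le> 200 * (n + 1) * (n + 1) + 40 \<and> static (mem q') \<and> table (mem q') (regs q' rH) items \<and>
         regs q' rP = ad (Suc k) 0 \<and> root_inv (Suc k) q'"
        and fr: "\<And>x. x \<notin> writes ?body \<Longrightarrow> regs q' x = regs q x"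
      have "regs q' rZ = 0" "regs q' rBound = 0" "regs q' rE = heap0"
        using fr q by (auto simp: root_init_effects run_jumps_effects select_effects)
      then have "I q'" unfolding I_def using A k by (intro conjI exI[of _ "Suc k"]) auto
      moreover have "n - k = Suc (n - Suc k)" using k by simp
      then have "f q = ?C + f q'" unfolding f_def q(7) using A by (simp only: fk mult_Suc add.assoc)
      ultimately show "I q' \<and> Suc t + f q' \<le> f q" using A by linarith
    qed
  qed
  have f0: "f ?s0 = n * ?C + 1"
  proof -
    have "base = ad 0 0" by (simp add: ad_def)
    then show ?thesis unfolding f_def using fk[of 0] by simp
  qed
  have "wp (While (Less rP rE) ?body) ?s0 (\<lambda>t s'. 3 + t \<le> n * ?C + 4 \<and> static (mem s') \<and> heap0 \<le> regs s' rH \<and> root_inv n s')"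
  proof (rule wp_mono[OF loop])
    fix t :: nat and q :: ram_state
    assume A: "t \<le> f ?s0 \<and> I q \<and> \<not> holds (Less rP rE) q"
    have Iq: "I q" using A by blast
    obtain k where q: "regs q rE = heap0" "static (mem q)" "table (mem q) (regs q rH) items" "k \<le> n" "regs q rP = ad k 0" "root_inv k q"
      using Iq unfolding I_def by blast
    have "k = n" using A q(1,4,5) by (auto simp: heap0_def ad_def)
    then show "3 + t \<le> n * ?C + 4 \<and> static (mem q) \<and> heap0 \<le> regs q rH \<and> root_inv n q" using A f0 q by (auto simp: table_def)
  qed
  then show ?thesis unfolding roots_def using r
    by (simp del: wp_Seq add: wp_Seq[of "Const _ _"] wp_Seq[of "Copy _ _"])
       (erule wp_mono, elim conjE, intro conjI, linarith, assumption+)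
qed

end

section \<open>Printing the strategy\<close>

abbreviation (input) "rR \<equiv> (40::nat)"
abbreviation (input) "rCc \<equiv> (41::nat)"
abbreviation (input) "rIt \<equiv> (42::nat)"
abbreviation (input) "rItE \<equiv> (43::nat)"
abbreviation (input) "rU \<equiv> (44::nat)"
abbreviation (input) "rPar \<equiv> (45::nat)"
abbreviation (input) "rBit \<equiv> (46::nat)"
abbreviation (input) "rLim \<equiv> (47::nat)"
abbreviation (input) "rSp \<equiv> (48::nat)"
abbreviation (input) "rG \<equiv> (49::nat)"
abbreviation (input) "rF \<equiv> (50::nat)"
abbreviation (input) "rJ \<equiv> (51::nat)"
abbreviation (input) "rAt \<equiv> (52::nat)"
abbreviation (input) "rNx \<equiv> (53::nat)"

text \<open>\<open>rBit\<close> doubles from 32 and thereby runs through the offsets of the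
  single-bit records. Exactly one neighbour of the new vertex has been visited.\<close>

definition find_parent :: program where
  "find_parent = (Const rBit 32 ;; LoadF rLim rU 11 ;; While (Less rBit rLim)
     (Add rX rU rBit ;; LoadF rY rX 13 ;; LoadF rW rY 15 ;; Cond (Equal rW rZ) Skip (Copy rPar rY) ;; Add rBit rBit rBit))"

definition push_path :: program where
  "push_path = (Copy rSp rH ;; Copy rAt rPar ;; While (NotEqual rAt rR)
     (Store rSp rAt ;; Inc rSp 1 ;; LoadF rW rAt 13 ;; Copy rAt rW))"

definition go_down :: program where
  "go_down = (Copy rAt rR ;; While (Less rH rSp)
     (Const rT 1 ;; Sub rSp rSp rT ;; Load rNx rSp ;; LoadF rW rAt 10 ;; Write rW ;; LoadF rW rNx 10 ;; Write rW ;;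
      Write rF ;; Copy rAt rNx))"

definition go_up :: program where
  "go_up = (Copy rAt rU ;; While (NotEqual rAt rR)
     (LoadF rNx rAt 13 ;; LoadF rW rAt 10 ;; Write rW ;; LoadF rW rNx 10 ;; Write rW ;; Write rF ;; Copy rAt rNx))"

text \<open>\<open>rG\<close> becomes the cost that stays behind during the slide: the weight of the
  parent drops out if its count of missing neighbours has reached 0.\<close>

definition settle :: program where
  "settle = (StoreF rU 13 rPar ;; Const rY 1 ;; StoreF rU 15 rY ;;
     LoadF rW rPar 14 ;; Sub rW rW rY ;; StoreF rPar 14 rW ;;
     Copy rG rCc ;; Cond (Equal rW rZ) (LoadF rX rPar 12 ;; Sub rG rG rX) Skip ;; Sub rF rBP rCc)"

definition slide_in :: program where
  "slide_in = (LoadF rW rPar 10 ;; Write rW ;; LoadF rW rU 10 ;; Write rW ;; Sub rJ rBP rG ;; Write rJ ;;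
     Copy rCc rG ;; LoadF rW rU 14 ;; Const rY 1 ;; Sub rW rW rY ;; StoreF rU 14 rW ;;
     Cond (Equal rW rZ) Skip (LoadF rX rU 12 ;; Add rCc rCc rX) ;; Sub rF rBP rCc)"

definition add_vertex :: program where
  "add_vertex = (find_parent ;; settle ;; push_path ;; Cond (Equal rF rZ) Skip go_down ;; slide_in ;;
     Cond (Equal rF rZ) Skip go_up)"

definition print_strategy :: program where
  "print_strategy = (Write rBP ;; Load rX rBPtr ;; LoadF rR rX 17 ;; LoadF rW rR 10 ;; Write rW ;; Const rY 1 ;; StoreF rR 15 rY ;;
     LoadF rCc rR 12 ;; Copy rIt rBPtr ;; Add rItE rBPtr rBLen ;; While (Less rIt rItE)
       (Load rX rIt ;; LoadF rU rX 17 ;; LoadF rW rU 15 ;; Cond (Equal rW rZ) add_vertex Skip ;; Inc rIt 1))"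

definition enc_moves :: "nat move list \<Rightarrow> nat list" where
  "enc_moves ms = concat (map (\<lambda>(u, v, j). [u, v, j]) ms)"

lemma enc_moves_simps [simp]:
  "enc_moves [] = []" "enc_moves ((u, v, j) # ms) = u # v # j # enc_moves ms" "enc_moves (xs @ ys) = enc_moves xs @ enc_moves ys"
  by (auto simp: enc_moves_def)

lemma add_vertex_effects: "writes add_vertex = {rT, rW, rX, rY, rCc, rPar, rBit, rLim, rSp, rG, rF, rJ, rAt, rNx}"
  by (auto simp: add_vertex_def find_parent_def settle_def push_path_def go_down_def slide_in_def go_up_def)

context tree_input
begin

lemma walk_snoc: "ys \<noteq> [] \<Longrightarrow> walk f (ys @ [z]) = walk f ys @ [(last ys, z, f)]"
  by (induction f ys rule: walk.induct) auto

definition chain :: "(nat \<Rightarrow> nat) \<Rightarrow> nat list \<Rightarrow> bool" where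
  "chain M xs \<longleftrightarrow> (\<forall>i. Suc i < length xs \<longrightarrow> M (ad (xs ! i) 0 + 13) = ad (xs ! Suc i) 0)"

definition out_inv :: "nat \<Rightarrow> (nat \<Rightarrow> nat) \<Rightarrow> nat set \<Rightarrow> (nat \<Rightarrow> nat list) \<Rightarrow> bool" where
  "out_inv r M X up \<longleftrightarrow>
    (\<forall>v<n. M (ad v 0 + 10) = v \<and> M (ad v 0 + 11) = 32 * 2 ^ d v \<and> M (ad v 0 + 12) = vw v \<and>
       M (ad v 0 + 14) = (if v \<in> X then card (nb v - X) else d v) \<and> M (ad v 0 + 15) = (if v \<in> X then 1 else 0)) \<and>
    (\<forall>v j. v < n \<and> j < d v \<longrightarrow> M (ad v (2 ^ j) + 13) = ad (nbr v j) 0) \<and>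
    (\<forall>x. valid x \<longrightarrow> M (adp x + 17) = ad (fst x) 0) \<and> (\<forall>v\<in>X. chain M (up v))"

lemma ad_inj0: "ad v 0 = ad v' 0 \<longleftrightarrow> v = v'"
  using ad_eq[of 0 0 0 0 v v'] by simp

lemma ad_sep:
  assumes "v \<noteq> v'" shows "ad v 0 + 32 \<le> ad v' 0 \<or> ad v' 0 + 32 \<le> ad v 0"
proof -
  have "ad a 0 + 32 \<le> ad b 0" if "a < b" for a b
  proof -
    have "a * 2 ^ D + 1 \<le> (a + 1) * 2 ^ D" by simp
    also have "\<dots> \<le> b * 2 ^ D" using that by (intro mult_le_mono1) simp
    finally show ?thesis by (simp add: ad_def)
  qed
  then show ?thesis using assms by (metis linorder_neqE_nat)
qed

lemma wp_find_parent:
  assumes o: "out_inv r (mem s) X up" and r: "regs s rZ = 0" "regs s rU = ad y 0"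
    and X: "conn X" "y < n" "y \<notin> X" "p \<in> X" "{p, y} \<in> E"
  shows "wp find_parent s (\<lambda>t s'. t \<le> 15 * D + 5 \<and> regs s' rPar = ad p 0)"
proof -
  let ?M = "mem s"
  have yV: "y \<in> V" using X V_eq by simp
  have lim: "?M (ad y 0 + 11) = 32 * 2 ^ d y" using o X(2) unfolding out_inv_def by blast
  have uq: "nbr y j \<in> X \<longleftrightarrow> nbr y j = p" if "j < d y" for j
    using conn_unique_nb[OF X(1,3) _ _ X(4,5), of "nbr y j"] nbr_in[OF that] X(4) by (auto simp: nb_iff(1))
  have "p \<in> nb y" using X(5) by (simp add: nb_iff(1))
  then obtain jp where jp: "jp < d y" "nbr y jp = p" using nbr_bij[of y] unfolding bij_betw_def by (metis imageE lessThan_iff)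
  have vis: "?M (ad (nbr y j) 0 + 15) = (if nbr y j = p then 1 else 0)" if "j < d y" for j
  proof -
    have "nbr y j < n" using nbr_in[OF that] nb_sub V_eq by auto
    then show ?thesis using o uq[OF that] unfolding out_inv_def by simp
  qed
  let ?body = "Add rX rU rBit ;; LoadF rY rX 13 ;; LoadF rW rY 15 ;; Cond (Equal rW rZ) Skip (Copy rPar rY) ;; Add rBit rBit rBit"
  let ?s0 = "set_reg rLim (32 * 2 ^ d y) (set_reg rBit 32 s)"
  define I where "I = (\<lambda>q::ram_state. regs q rZ = 0 \<and> regs q rU = ad y 0 \<and> mem q = ?M \<and> regs q rLim = 32 * 2 ^ d y \<and>
     (\<exists>j\<le>d y. regs q rBit = 32 * 2 ^ j \<and> (jp < j \<longrightarrow> regs q rPar = ad p 0)))"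
  \<comment> \<open>\<open>rBit\<close> holds 32 times a power of two, so the remaining rounds are
    counted by exponents.\<close>
  define f where "f = (\<lambda>q::ram_state. 15 * card {j. j < d y \<and> regs q rBit \<le> 32 * 2 ^ j} + (1::nat))"
  have fj: "card {i. i < d y \<and> 32 * 2 ^ j \<le> 32 * (2::nat) ^ i} = d y - j" for j
  proof -
    have "{i. i < d y \<and> 32 * 2 ^ j \<le> 32 * (2::nat) ^ i} = {j..<d y}" by auto
    then show ?thesis by simp
  qed
  have loop: "wp (While (Less rBit rLim) ?body) ?s0 (\<lambda>t q. t \<le> f ?s0 \<and> I q \<and> \<not> holds (Less rBit rLim) q)"
  proof (rule wp_While[where I = I and f = f])
    show "I ?s0" unfolding I_def using r by (auto intro!: exI[of _ 0])
    show "1 \<le> f q" for q by (simp add: f_def)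
    fix q :: ram_state assume Iq: "I q" and b: "holds (Less rBit rLim) q"
    obtain j where q: "regs q rZ = 0" "regs q rU = ad y 0" "mem q = ?M" "regs q rLim = 32 * 2 ^ d y"
      "j \<le> d y" "regs q rBit = 32 * 2 ^ j" "jp < j \<longrightarrow> regs q rPar = ad p 0" using Iq unfolding I_def by blast
    have j: "j < d y" using b q(4,6) by simp
    have a1: "ad y 0 + 32 * 2 ^ j = ad y (2 ^ j)" using ad_add[of y 0] by simp
    have a2: "?M (ad y (2 ^ j) + 13) = ad (nbr y j) 0" using o X(2) j unfolding out_inv_def by blast
    have "wp ?body q (\<lambda>t q'. t \<le> 13 \<and> regs q' rBit = 32 * 2 ^ Suc j \<and> regs q' rPar = (if nbr y j = p then ad p 0 else regs q rPar))"
      by (simp add: q a1 a2 vis[OF j])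
    then show "wp ?body q (\<lambda>t q'. I q' \<and> Suc t + f q' \<le> f q)"
    proof (rule wp_frame)
      fix t :: nat and q' :: ram_state
      assume A: "t \<le> 13 \<and> regs q' rBit = 32 * 2 ^ Suc j \<and> regs q' rPar = (if nbr y j = p then ad p 0 else regs q rPar)"
       and fr: "\<And>x. x \<notin> writes ?body \<Longrightarrow> regs q' x = regs q x" "\<not> stores ?body \<Longrightarrow> mem q' = mem q"
      have g: "regs q' rZ = 0" "regs q' rU = ad y 0" "mem q' = ?M" "regs q' rLim = 32 * 2 ^ d y" using fr q by auto
      have "jp < Suc j \<longrightarrow> regs q' rPar = ad p 0" using A q(7) jp(2) by (auto simp: less_Suc_eq)
      then have "I q'" unfolding I_def using g A j by (intro conjI exI[of _ "Suc j"]) auto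
      moreover have "f q' + 15 = f q"
      proof -
        have e: "regs q' rBit = 32 * 2 ^ Suc j" using A by blast
        show ?thesis unfolding f_def e q(6) fj using j by simp
      qed
      ultimately show "I q' \<and> Suc t + f q' \<le> f q" using A by linarith
    qed
  qed
  have f0: "f ?s0 \<le> 15 * D + 1" unfolding f_def using fj[of 0] d_le[OF yV] by simp
  have "wp (While (Less rBit rLim) ?body) ?s0 (\<lambda>t s'. 4 + t \<le> 15 * D + 5 \<and> regs s' rPar = ad p 0)"
  proof (rule wp_mono[OF loop])
    fix t :: nat and q :: ram_state
    assume A: "t \<le> f ?s0 \<and> I q \<and> \<not> holds (Less rBit rLim) q"
    have Iq: "I q" using A by blast
    obtain j where q: "regs q rLim = 32 * 2 ^ d y" "regs q rBit = 32 * 2 ^ j" "j \<le> d y" "jp < j \<longrightarrow> regs q rPar = ad p 0"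
      using Iq unfolding I_def by blast
    have "\<not> j < d y" using A q(1,2) by simp
    then show "4 + t \<le> 15 * D + 5 \<and> regs q rPar = ad p 0" using A q(3,4) jp f0 by simp
  qed
  then show ?thesis unfolding find_parent_def
    using r lim
    by (simp del: wp_Seq add: wp_Seq[of "Const _ _"] wp_Seq[of "LoadF _ _ _"])
       (erule wp_mono, elim conjE, intro conjI, linarith, assumption)
qed

lemma wp_push:
  assumes r: "regs s rPar = ad p 0" "regs s rR = ad r 0" "regs s rH = h" "heap0 \<le> h"
    and xs: "xs \<noteq> []" "hd xs = p" "last xs = r" "distinct xs" "set xs \<subseteq> V" "chain (mem s) xs"
  shows "wp push_path s (\<lambda>t s'. t \<le> 9 * length xs + 5 \<and> regs s' rSp = h + (length xs - 1) \<and>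
     (\<forall>i<h. mem s' i = mem s i) \<and> (\<forall>i<length xs - 1. mem s' (h + i) = ad (xs ! i) 0))"
proof -
  let ?M = "mem s" and ?l = "length xs - 1"
  let ?body = "Store rSp rAt ;; Inc rSp 1 ;; LoadF rW rAt 13 ;; Copy rAt rW"
  let ?s0 = "set_reg rAt (ad p 0) (set_reg rSp h s)"
  define I where "I = (\<lambda>q::ram_state. regs q rR = ad r 0 \<and> (\<forall>i<h. mem q i = ?M i) \<and>
     (\<exists>k\<le>?l. regs q rSp = h + k \<and> regs q rAt = ad (xs ! k) 0 \<and> (\<forall>i<k. mem q (h + i) = ad (xs ! i) 0)))"
  define f where "f = (\<lambda>q::ram_state. 9 * (h + ?l - regs q rSp) + (1::nat))"
  have lst: "xs ! ?l = r" using xs(1,3) by (simp add: last_conv_nth)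
  have loop: "wp (While (NotEqual rAt rR) ?body) ?s0 (\<lambda>t q. t \<le> f ?s0 \<and> I q \<and> \<not> holds (NotEqual rAt rR) q)"
  proof (rule wp_While[where I = I and f = f])
    show "I ?s0" unfolding I_def using r xs by (auto simp: hd_conv_nth intro!: exI[of _ 0])
    show "1 \<le> f q" for q by (simp add: f_def)
    fix q :: ram_state assume Iq: "I q" and b: "holds (NotEqual rAt rR) q"
    obtain k where q: "regs q rR = ad r 0" "\<forall>i<h. mem q i = ?M i" "k \<le> ?l" "regs q rSp = h + k" "regs q rAt = ad (xs ! k) 0"
      "\<forall>i<k. mem q (h + i) = ad (xs ! i) 0" using Iq unfolding I_def by blast
    have k: "k < ?l" using b q(1,3,5) lst by (cases "k = ?l") auto
    have kl: "k < length xs" "Suc k < length xs" using k by auto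
    have kn: "xs ! k < n" using xs(5) nth_mem[OF kl(1)] V_eq by auto
    have lt: "ad (xs ! k) 0 + 13 < h" using valid_ad[of "(xs ! k, 0)" 13] kn r(4) by (simp add: valid_def)
    have "?M (ad (xs ! k) 0 + 13) = ad (xs ! Suc k) 0" using xs(6) kl unfolding chain_def by blast
    then have nx: "mem q (ad (xs ! k) 0 + 13) = ad (xs ! Suc k) 0" using q(2) lt by simp
    have ne: "ad (xs ! k) 0 + 13 \<noteq> h + k" using lt by simp
    have "wp ?body q (\<lambda>t q'. t = 7 \<and> regs q' rSp = h + Suc k \<and> regs q' rAt = ad (xs ! Suc k) 0 \<and> mem q' = (mem q)(h + k := ad (xs ! k) 0))"
      by (simp add: q nx ne)
    then show "wp ?body q (\<lambda>t q'. I q' \<and> Suc t + f q' \<le> f q)"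
    proof (rule wp_frame)
      fix t :: nat and q' :: ram_state
      assume A: "t = 7 \<and> regs q' rSp = h + Suc k \<and> regs q' rAt = ad (xs ! Suc k) 0 \<and> mem q' = (mem q)(h + k := ad (xs ! k) 0)"
        and fr: "\<And>x. x \<notin> writes ?body \<Longrightarrow> regs q' x = regs q x"
      have "regs q' rR = ad r 0" using fr q by auto
      then have "I q'" unfolding I_def using A k q(2,6) by (intro conjI exI[of _ "Suc k"]) (auto simp: less_Suc_eq)
      moreover have "f q' + 9 = f q" unfolding f_def using A q(4) k by simp
      ultimately show "I q' \<and> Suc t + f q' \<le> f q" using A by linarith
    qed
  qed
  have "wp (While (NotEqual rAt rR) ?body) ?s0 (\<lambda>t s'. 2 + t \<le> 9 * length xs + 5 \<and> regs s' rSp = h + (length xs - 1) \<and>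
     (\<forall>i<h. mem s' i = mem s i) \<and> (\<forall>i<length xs - 1. mem s' (h + i) = ad (xs ! i) 0))"
  proof (rule wp_mono[OF loop])
    fix t :: nat and q :: ram_state
    assume A: "t \<le> f ?s0 \<and> I q \<and> \<not> holds (NotEqual rAt rR) q"
    have Iq: "I q" using A by blast
    obtain k where q: "regs q rR = ad r 0" "\<forall>i<h. mem q i = ?M i" "k \<le> ?l" "regs q rSp = h + k" "regs q rAt = ad (xs ! k) 0"
      "\<forall>i<k. mem q (h + i) = ad (xs ! i) 0" using Iq unfolding I_def by blast
    have "xs ! k = xs ! ?l" using A q(1,5) lst ad_inj0 by simp
    then have "k = ?l" using xs(1,4) q(3) nth_eq_iff_index_eq[of xs k ?l] by (simp add: le_less_trans)
    then show "2 + t \<le> 9 * length xs + 5 \<and> regs q rSp = h + (length xs - 1) \<and>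
     (\<forall>i<h. mem q i = mem s i) \<and> (\<forall>i<length xs - 1. mem q (h + i) = ad (xs ! i) 0)" using A q by (auto simp: f_def)
  qed
  then show ?thesis unfolding push_path_def
    using r
    by (simp del: wp_Seq add: wp_Seq[of "Copy _ _"])
       (erule wp_mono, elim conjE, intro conjI, linarith, assumption+)
qed

lemma wp_down:
  assumes r: "regs s rR = ad r 0" "regs s rH = h" "regs s rSp = h + (length xs - 1)" "regs s rF = f0"
    and xs: "xs \<noteq> []" "last xs = r" "set xs \<subseteq> V" "\<forall>i<length xs - 1. mem s (h + i) = ad (xs ! i) 0"
    and num: "\<forall>v<n. mem s (ad v 0 + 10) = v"
  shows "wp go_down s (\<lambda>t s'. t \<le> 16 * length xs + 4 \<and> out s' = out s @ enc_moves (walk f0 (rev xs)))"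
proof -
  let ?M = "mem s" and ?l = "length xs - 1"
  let ?body = "Const rT 1 ;; Sub rSp rSp rT ;; Load rNx rSp ;; LoadF rW rAt 10 ;; Write rW ;; LoadF rW rNx 10 ;; Write rW ;;
      Write rF ;; Copy rAt rNx"
  let ?s0 = "set_reg rAt (ad r 0) s"
  define I where "I = (\<lambda>q::ram_state. regs q rH = h \<and> regs q rF = f0 \<and> mem q = ?M \<and>
     (\<exists>k\<le>?l. regs q rSp = h + k \<and> regs q rAt = ad (xs ! k) 0 \<and> out q = out s @ enc_moves (walk f0 (rev (drop k xs)))))"
  define f where "f = (\<lambda>q::ram_state. 16 * (regs q rSp - h) + (1::nat))"
  have lst: "xs ! ?l = r" using xs(1,2) by (simp add: last_conv_nth)
  have loop: "wp (While (Less rH rSp) ?body) ?s0 (\<lambda>t q. t \<le> f ?s0 \<and> I q \<and> \<not> holds (Less rH rSp) q)"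
  proof (rule wp_While[where I = I and f = f])
    have "drop ?l xs = [r]" using xs(1) lst Cons_nth_drop_Suc[of ?l xs] by simp
    then show "I ?s0" unfolding I_def using r lst by (auto intro!: exI[of _ ?l])
    show "1 \<le> f q" for q by (simp add: f_def)
    fix q :: ram_state assume Iq: "I q" and b: "holds (Less rH rSp) q"
    obtain k where q: "regs q rH = h" "regs q rF = f0" "mem q = ?M" "k \<le> ?l" "regs q rSp = h + k" "regs q rAt = ad (xs ! k) 0"
      "out q = out s @ enc_moves (walk f0 (rev (drop k xs)))" using Iq unfolding I_def by blast
    obtain k' where k: "k = Suc k'" "k' < ?l" using b q(1,4,5) by (cases k) auto
    have kl: "k' < length xs" "k < length xs" using k by auto
    have kn: "xs ! k < n" "xs ! k' < n" using xs(3) nth_mem[OF kl(1)] nth_mem[OF kl(2)] V_eq by auto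
    have nx: "?M (h + k') = ad (xs ! k') 0" using xs(4) k by blast
    have w: "walk f0 (rev (drop k' xs)) = walk f0 (rev (drop k xs)) @ [(xs ! k, xs ! k', f0)]"
    proof -
      have "drop k' xs = xs ! k' # drop k xs" using Cons_nth_drop_Suc[OF kl(1)] k(1) by simp
      moreover have "last (rev (drop k xs)) = xs ! k" using kl(2) by (simp add: last_rev hd_drop_conv_nth)
      ultimately show ?thesis using kl(2) by (simp add: walk_snoc)
    qed
    have "wp ?body q (\<lambda>t q'. t \<le> 14 \<and> regs q' rSp = h + k' \<and> regs q' rAt = ad (xs ! k') 0 \<and> out q' = out q @ [xs ! k, xs ! k', f0])"
      using num kn by (simp add: q(1-6) nx k(1))
    then show "wp ?body q (\<lambda>t q'. I q' \<and> Suc t + f q' \<le> f q)"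
    proof (rule wp_frame)
      fix t :: nat and q' :: ram_state
      assume A: "t \<le> 14 \<and> regs q' rSp = h + k' \<and> regs q' rAt = ad (xs ! k') 0 \<and> out q' = out q @ [xs ! k, xs ! k', f0]"
        and fr: "\<And>x. x \<notin> writes ?body \<Longrightarrow> regs q' x = regs q x" "\<not> stores ?body \<Longrightarrow> mem q' = mem q"
      have "regs q' rH = h" "regs q' rF = f0" "mem q' = ?M" using fr q by auto
      then have "I q'" unfolding I_def using A k w q(7) by (intro conjI exI[of _ k']) auto
      moreover have "f q' + 16 = f q" unfolding f_def using A q(5) k by simp
      ultimately show "I q' \<and> Suc t + f q' \<le> f q" using A by linarith
    qed
  qed
  have "wp (While (Less rH rSp) ?body) ?s0 (\<lambda>t s'. 1 + t \<le> 16 * length xs + 4 \<and> out s' = out s @ enc_moves (walk f0 (rev xs)))"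
  proof (rule wp_mono[OF loop])
    fix t :: nat and q :: ram_state
    assume A: "t \<le> f ?s0 \<and> I q \<and> \<not> holds (Less rH rSp) q"
    have Iq: "I q" using A by blast
    obtain k where q: "regs q rH = h" "regs q rSp = h + k" "out q = out s @ enc_moves (walk f0 (rev (drop k xs)))" using Iq unfolding I_def by blast
    have "k = 0" using A q by simp
    have "t \<le> 16 * ?l + 1" using A r(3) by (simp add: f_def)
    then have "1 + t \<le> 16 * length xs + 4" using diff_le_self[of "length xs" 1] by linarith
    then show "1 + t \<le> 16 * length xs + 4 \<and> out q = out s @ enc_moves (walk f0 (rev xs))" using q \<open>k = 0\<close> by simp
  qed
  then show ?thesis unfolding go_down_def
    using r
    by (simp del: wp_Seq add: wp_Seq[of "Copy _ _"])
qed

lemma wp_up: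
  assumes r: "regs s rR = ad r 0" "regs s rU = ad y 0" "regs s rF = f0"
    and xs: "xs \<noteq> []" "hd xs = y" "last xs = r" "distinct xs" "set xs \<subseteq> V" "chain (mem s) xs"
    and num: "\<forall>v<n. mem s (ad v 0 + 10) = v"
  shows "wp go_up s (\<lambda>t s'. t \<le> 16 * length xs + 4 \<and> out s' = out s @ enc_moves (walk f0 xs))"
proof -
  let ?M = "mem s" and ?l = "length xs - 1"
  let ?body = "LoadF rNx rAt 13 ;; LoadF rW rAt 10 ;; Write rW ;; LoadF rW rNx 10 ;; Write rW ;; Write rF ;; Copy rAt rNx"
  let ?s0 = "set_reg rAt (ad y 0) s"
  define I where "I = (\<lambda>k. \<lambda>q::ram_state. k \<le> ?l \<and> regs q rR = ad r 0 \<and> regs q rF = f0 \<and> mem q = ?M \<and>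
     regs q rAt = ad (xs ! k) 0 \<and> out q = out s @ enc_moves (walk f0 (take (Suc k) xs)))"
  have lst: "xs ! ?l = r" using xs(1,3) by (simp add: last_conv_nth)
  \<comment> \<open>No register tells the position on the path, so the loop is handled by induction
    on the remaining length instead of by \<open>wp_While\<close>.\<close>
  have loop: "I k q \<Longrightarrow> wp (While (NotEqual rAt rR) ?body) q (\<lambda>t q'. t \<le> 16 * (?l - k) + 1 \<and> I ?l q')" for k q
  proof (induction "?l - k" arbitrary: k q)
    case 0
    have "k \<le> ?l" using 0(2) unfolding I_def by blast
    then have "k = ?l" using 0(1) by linarith
    then have "\<not> holds (NotEqual rAt rR) q" using 0(2) lst unfolding I_def by simp
    then have "wp (While (NotEqual rAt rR) ?body) q Q \<longleftrightarrow> Q 1 q" for Q by (rule wp_det[OF exec.WhileFalse])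
    then show ?case using 0 \<open>k = ?l\<close> by simp
  next
    case (Suc j)
    have q: "k \<le> ?l" "regs q rR = ad r 0" "regs q rF = f0" "mem q = ?M" "regs q rAt = ad (xs ! k) 0"
      "out q = out s @ enc_moves (walk f0 (take (Suc k) xs))" using Suc.prems unfolding I_def by blast+
    have k: "k < ?l" using Suc.hyps(2) by simp
    have kl: "k < length xs" "Suc k < length xs" using k by auto
    have kn: "xs ! k < n" "xs ! Suc k < n" using xs(5) nth_mem[OF kl(1)] nth_mem[OF kl(2)] V_eq by auto
    have nx: "?M (ad (xs ! k) 0 + 13) = ad (xs ! Suc k) 0" using xs(6) kl unfolding chain_def by blast
    have w: "walk f0 (take (Suc (Suc k)) xs) = walk f0 (take (Suc k) xs) @ [(xs ! k, xs ! Suc k, f0)]"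
    proof -
      have "take (Suc (Suc k)) xs = take (Suc k) xs @ [xs ! Suc k]" using take_Suc_conv_app_nth[OF kl(2)] .
      moreover have "last (take (Suc k) xs) = xs ! k" using kl(1) by (simp add: take_Suc_conv_app_nth)
      moreover have "take (Suc k) xs \<noteq> []" using xs(1) by auto
      ultimately show ?thesis by (simp add: walk_snoc)
    qed
    have neq: "xs ! k \<noteq> r" using lst k nth_eq_iff_index_eq[OF xs(4) kl(1), of ?l] xs(1) by auto
    then have t: "holds (NotEqual rAt rR) q" using q by (simp add: ad_inj0)
    have "wp ?body q (\<lambda>t q'. t \<le> 14 \<and> I (Suc k) q')"
      unfolding I_def using num kn k w by (simp add: q(2-6) nx)
    then obtain t1 q1 where 1: "exec ?body q t1 q1" "t1 \<le> 14" "I (Suc k) q1" unfolding wp_def by blast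
    have "wp (While (NotEqual rAt rR) ?body) q1 (\<lambda>t q'. t \<le> 16 * (?l - Suc k) + 1 \<and> I ?l q')"
      by (rule Suc.hyps(1)[OF _ 1(3)]) (use Suc.hyps(2) in simp)
    then obtain t2 q2 where 2: "exec (While (NotEqual rAt rR) ?body) q1 t2 q2" "t2 \<le> 16 * (?l - Suc k) + 1" "I ?l q2"
      unfolding wp_def by blast
    have "exec (While (NotEqual rAt rR) ?body) q (Suc (t1 + t2)) q2" by (rule exec.WhileTrue[OF t 1(1) 2(1)])
    moreover have "Suc (t1 + t2) \<le> 16 * (?l - k) + 1" using 1 2 k by simp
    ultimately show ?case using 2(3) unfolding wp_def by blast
  qed
  have "take (Suc 0) xs = [y]" using xs(1,2) by (cases xs) auto
  then have "I 0 ?s0" unfolding I_def using r xs by (auto simp: hd_conv_nth)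
  note lp = loop[OF this]
  have "wp (While (NotEqual rAt rR) ?body) ?s0 (\<lambda>t s'. 1 + t \<le> 16 * length xs + 4 \<and> out s' = out s @ enc_moves (walk f0 xs))"
    by (rule wp_mono[OF lp]) (use xs(1) in \<open>auto simp: I_def\<close>)
  then show ?thesis unfolding go_up_def
    using r
    by (simp del: wp_Seq add: wp_Seq[of "Copy _ _"])
qed

lemma card_nb_insert:
  assumes X: "conn X" and p: "p \<in> X" "{p, y} \<in> E" "y \<notin> X"
  shows "card (nb p - insert y X) = card (nb p - X) - 1" "card (nb y - insert y X) = d y - 1"
    "\<And>v. v \<in> X \<Longrightarrow> v \<noteq> p \<Longrightarrow> nb v - insert y X = nb v - X"
proof -
  have fin: "finite (nb v)" for v using nb_sub finV finite_subset by blast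
  have yp: "y \<in> nb p - X" using p by (simp add: nb_iff(2))
  have "nb p - insert y X = (nb p - X) - {y}" by auto
  then show "card (nb p - insert y X) = card (nb p - X) - 1" using fin[of p] yp by simp
  have uq: "z = p" if "z \<in> nb y" "z \<in> X" for z
    using conn_unique_nb[OF X p(3) that(2) _ p(1,2)] that(1) by (simp add: nb_iff(1))
  have ny: "y \<notin> nb y" using edgeD(3)[of y y] by (auto simp: nb_def)
  have "nb y - insert y X = nb y - {p}" using uq ny p by auto
  moreover have "p \<in> nb y" using p by (simp add: nb_iff(1))
  ultimately show "card (nb y - insert y X) = d y - 1" using fin[of y] by (simp add: d_card)
  show "nb v - insert y X = nb v - X" if v: "v \<in> X" "v \<noteq> p" for v
  proof -
    have "y \<notin> nb v" using uq[of v] v by (auto simp: nb_def insert_commute)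
    then show ?thesis by auto
  qed
qed

lemma post_card: "v \<in> X \<Longrightarrow> post X v = (if card (nb v - X) = 0 then 0 else vw v)"
proof -
  assume v: "v \<in> X"
  have "finite (nb v)" using nb_sub finV finite_subset by blast
  then have "card (nb v - X) = 0 \<longleftrightarrow> nb v \<subseteq> X" by (auto simp: card_eq_0_iff)
  then show ?thesis using v by (simp add: post_def bd_def)
qed

text \<open>Besides the slide only two walks along paths without repetition are printed. The factor
  41 of \<open>n\<close> is 9 for the stack and 16 for either walk.\<close>

lemma wp_add_vertex:
  assumes o: "out_inv r (mem s) X up" and rg: "regs s rZ = 0" "regs s rU = ad y 0" "regs s rR = ad r 0" "regs s rBP = k"
      "regs s rCc = cost vw X" "regs s rH = h" "heap0 \<le> h"
    and X: "conn X" "y < n" "y \<notin> X" "p \<in> X" "{p, y} \<in> E" and u: "up_ok r X up" and nd: "need X p y \<le> k"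
  shows "wp add_vertex s (\<lambda>t s'. t \<le> 15 * D + 41 * n + 130 \<and> out_inv r (mem s') (insert y X) (up(y := y # up p)) \<and>
     regs s' rCc = cost vw (insert y X) \<and> (\<forall>i. heap0 \<le> i \<and> i < h \<longrightarrow> mem s' i = mem s i) \<and>
     out s' = out s @ enc_moves (extend_moves k X (up p) p y))"
proof -
  let ?M = "mem s" and ?X = "insert y X" and ?xs = "up p"
  have pV: "p \<in> V" "p < n" using X(1,4) conn_sub V_eq by auto
  have yV: "y \<in> V" using X(2) V_eq by simp
  have pe: "p \<noteq> y" using X by auto
  have D0: "(0::nat) < 2 ^ D" by simp
  have upp: "?xs \<noteq> []" "hd ?xs = p" "last ?xs = r" "set ?xs \<subseteq> X" "distinct ?xs"
    using u X(4) unfolding up_ok_def by blast+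
  have xsV: "set ?xs \<subseteq> V" using upp(4) conn_sub[OF X(1)] by blast
  have lxs: "length ?xs \<le> n" using distinct_card[OF upp(5)] card_mono[OF finV xsV] by (simp add: n_def)
  have ch: "chain ?M ?xs" using o X(4) unfolding out_inv_def by blast
  note ci = cost_insert[OF X(1,4,5,3)] and cn = card_nb_insert[OF X(1,4,5,3)]
  have b2: "p \<in> bd X" using bd_insert_new(2)[OF X(1,4,5,3)] .
  have vp: "vw p \<le> cost vw X" using cost_ge_bd[OF X(1) b2] .
  define g where "g = cost (vw(y := 0)) ?X"
  have gE: "g = (if card (nb p - X) - 1 = 0 then cost vw X - vw p else cost vw X)"
    using ci(2) vp post_card[of p ?X] X(4) cn(1) unfolding g_def by (auto split: if_splits)
  have cE: "cost vw ?X = g + (if d y - 1 = 0 then 0 else vw y)"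
    using ci(1) post_card[of y ?X] cn(2) unfolding g_def by simp
  have ofl: "?M (ad p 0 + 14) = card (nb p - X)" "?M (ad p 0 + 12) = vw p" "?M (ad y 0 + 14) = d y" "?M (ad y 0 + 12) = vw y"
     "?M (ad p 0 + 10) = p" "?M (ad y 0 + 10) = y"
    using o X(2,3,4) pV unfolding out_inv_def by auto
  define M1 where "M1 = ?M(ad y 0 + 13 := ad p 0, ad y 0 + 15 := 1, ad p 0 + 14 := card (nb p - X) - 1)"

  have st: "wp settle q (\<lambda>t q'. t \<le> 30 \<and> mem q' = M1 \<and> regs q' rG = g \<and> regs q' rF = k - cost vw X)"
    if q: "mem q = ?M" "regs q rU = ad y 0" "regs q rPar = ad p 0" "regs q rZ = 0" "regs q rCc = cost vw X" "regs q rBP = k" for q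
  proof -
    have "ad p 0 + 32 \<le> ad y 0 \<or> ad y 0 + 32 \<le> ad p 0" using pe ad_sep by blast
    then show ?thesis unfolding settle_def by (elim disjE) (simp_all add: q ofl M1_def gE)
  qed
  define M2 where "M2 = M1(ad y 0 + 14 := d y - 1)"
  have M1f: "M1 (ad v m + f) = ?M (ad v m + f)" if "m < 2 ^ D" "f < 32" "\<not> (v = y \<and> m = 0 \<and> (f = 13 \<or> f = 15))" "\<not> (v = p \<and> m = 0 \<and> f = 14)" for v m f
    unfolding M1_def using that ad_eq[OF that(1) D0 that(2), of 13 v y] ad_eq[OF that(1) D0 that(2), of 15 v y]
      ad_eq[OF that(1) D0 that(2), of 14 v p] by auto
  have M1p: "M1 (ad p 0 + 14) = card (nb p - X) - 1" "M1 (ad y 0 + 13) = ad p 0" "M1 (ad y 0 + 15) = 1" "M1 (ad y 0 + 14) = d y"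
     "M1 (ad p 0 + 10) = p" "M1 (ad y 0 + 10) = y" "M1 (ad y 0 + 12) = vw y"
  proof -
    have sp: "ad p 0 + 32 \<le> ad y 0 \<or> ad y 0 + 32 \<le> ad p 0" using pe ad_sep by blast
    show "M1 (ad p 0 + 14) = card (nb p - X) - 1" "M1 (ad y 0 + 13) = ad p 0" "M1 (ad y 0 + 15) = 1" "M1 (ad y 0 + 14) = d y"
     "M1 (ad p 0 + 10) = p" "M1 (ad y 0 + 10) = y" "M1 (ad y 0 + 12) = vw y"
      unfolding M1_def using ofl sp by (elim disjE; simp)+
  qed
  have M1h: "M1 i = ?M i" if "heap0 \<le> i" for i
    unfolding M1_def using that ad_less[OF X(2) D0, of 13] ad_less[OF X(2) D0, of 15] ad_less[OF pV(2) D0, of 14] by auto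
  have chM1: "chain M1 ?xs" unfolding chain_def
  proof (intro allI impI)
    fix i assume i: "Suc i < length ?xs"
    then have "?xs ! i \<in> X" using upp(4) nth_mem[of i ?xs] by auto
    then have "?xs ! i \<noteq> y" using X(3) by auto
    then show "M1 (ad (?xs ! i) 0 + 13) = ad (?xs ! Suc i) 0" using M1f[OF D0, of 13 "?xs ! i"] ch i unfolding chain_def by simp
  qed
  have num1: "\<forall>v<n. M1 (ad v 0 + 10) = v" using M1f[OF D0, of 10] o unfolding out_inv_def by simp
  have M2f: "M2 (ad v m + f) = M1 (ad v m + f)" if "m < 2 ^ D" "f < 32" "\<not> (v = y \<and> m = 0 \<and> f = 14)" for v m f
    unfolding M2_def using that ad_eq[OF that(1) D0 that(2), of 14 v y] by auto
  \<comment> \<open>Stated for every memory that agrees with \<open>M2\<close> below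
    \<open>heap0\<close>, because the stack has changed cells above the heap.\<close>
  have oi2: "out_inv r N ?X (up(y := y # ?xs))" if N: "\<And>i. i < heap0 \<Longrightarrow> N i = M2 i" for N
  proof -
    have Nf: "N (ad v m + f) = M2 (ad v m + f)" if "v < n" "m < 2 ^ D" "f < 32" for v m f using N ad_less[OF that] by blast
    have g1: "\<forall>v<n. N (ad v 0 + 10) = v \<and> N (ad v 0 + 11) = 32 * 2 ^ d v \<and> N (ad v 0 + 12) = vw v \<and>
       N (ad v 0 + 14) = (if v \<in> ?X then card (nb v - ?X) else d v) \<and> N (ad v 0 + 15) = (if v \<in> ?X then 1 else 0)"
    proof (intro allI impI)
      fix v assume v: "v < n"
      have ov: "?M (ad v 0 + 10) = v" "?M (ad v 0 + 11) = 32 * 2 ^ d v" "?M (ad v 0 + 12) = vw v"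
        "?M (ad v 0 + 14) = (if v \<in> X then card (nb v - X) else d v)" "?M (ad v 0 + 15) = (if v \<in> X then 1 else 0)"
        using o v unfolding out_inv_def by blast+
      have a: "N (ad v 0 + f) = ?M (ad v 0 + f)" if "f = 10 \<or> f = 11 \<or> f = 12" for f
        using that Nf[OF v D0, of f] M2f[OF D0, of f v] M1f[OF D0, of f v] by auto
      have b: "N (ad v 0 + 14) = (if v \<in> ?X then card (nb v - ?X) else d v)"
      proof -
        consider "v = y" | "v = p" | "v \<noteq> y" "v \<noteq> p" by blast
        then show ?thesis
        proof cases
          case 1
          have "N (ad v 0 + 14) = d y - 1" using Nf[OF v D0, of 14] 1 by (simp add: M2_def)
          then show ?thesis using cn(2) 1 by simp
        next
          case 2
          have "N (ad v 0 + 14) = card (nb p - X) - 1" using Nf[OF v D0, of 14] M2f[OF D0, of 14 v] M1p(1) 2 pe by simp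
          then show ?thesis using cn(1) 2 X(4) by simp
        next
          case 3
          have "N (ad v 0 + 14) = ?M (ad v 0 + 14)" using Nf[OF v D0, of 14] M2f[OF D0, of 14 v] M1f[OF D0, of 14 v] 3 by simp
          then show ?thesis using ov(4) cn(3)[of v] 3 by auto
        qed
      qed
      have c: "N (ad v 0 + 15) = (if v \<in> ?X then 1 else 0)"
      proof (cases "v = y")
        case True
        then show ?thesis using Nf[OF v D0, of 15] M2f[OF D0, of 15 v] M1p(3) by simp
      next
        case False
        then show ?thesis using Nf[OF v D0, of 15] M2f[OF D0, of 15 v] M1f[OF D0, of 15 v] ov(5) by simp
      qed
      show "N (ad v 0 + 10) = v \<and> N (ad v 0 + 11) = 32 * 2 ^ d v \<and> N (ad v 0 + 12) = vw v \<and>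
       N (ad v 0 + 14) = (if v \<in> ?X then card (nb v - ?X) else d v) \<and> N (ad v 0 + 15) = (if v \<in> ?X then 1 else 0)"
        using a b c ov(1-3) by simp
    qed
    have g2: "N (ad v (2 ^ j) + 13) = ad (nbr v j) 0" if v: "v < n" "j < d v" for v j
    proof -
      have j: "(2::nat) ^ j < 2 ^ D" using v d_le[of v] V_eq by simp
      have "?M (ad v (2 ^ j) + 13) = ad (nbr v j) 0" using o v unfolding out_inv_def by blast
      then show ?thesis using Nf[OF v(1) j, of 13] M2f[OF j, of 13 v] M1f[OF j, of 13 v] by simp
    qed
    have g3: "N (adp x + 17) = ad (fst x) 0" if x: "valid x" for x
    proof -
      have j: "fst x < n" "snd x < 2 ^ D" using valid_lt[of "fst x" "snd x"] x by auto
      have "?M (adp x + 17) = ad (fst x) 0" using o x unfolding out_inv_def by blast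
      then show ?thesis using Nf[OF j, of 17] M2f[OF j(2), of 17 "fst x"] M1f[OF j(2), of 17 "fst x"] by simp
    qed
    have par: "N (ad v 0 + 13) = M1 (ad v 0 + 13)" if "v < n" for v using Nf[OF that D0, of 13] M2f[OF D0, of 13 v] by simp
    have g4: "chain N ((up(y := y # ?xs)) v)" if v: "v \<in> ?X" for v
    proof (cases "v = y")
      case True
      have "N (ad ((y # ?xs) ! i) 0 + 13) = ad ((y # ?xs) ! Suc i) 0" if i: "Suc i < length (y # ?xs)" for i
      proof (cases i)
        case 0
        then show ?thesis using par[OF X(2)] M1p(2) upp(1,2) by (simp add: hd_conv_nth)
      next
        case (Suc i')
        then have "i' < length ?xs" using i by simp
        then have "?xs ! i' \<in> V" using xsV nth_mem by blast
        then have "?xs ! i' < n" using V_eq by simp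
        then show ?thesis using par chM1 i Suc unfolding chain_def by simp
      qed
      then show ?thesis using True unfolding chain_def by simp
    next
      case False
      then have vX: "v \<in> X" using v by simp
      have uv: "set (up v) \<subseteq> X" "chain ?M (up v)" using u o vX unfolding up_ok_def out_inv_def by blast+
      have "N (ad (up v ! i) 0 + 13) = ad (up v ! Suc i) 0" if i: "Suc i < length (up v)" for i
      proof -
        have m: "up v ! i \<in> X" using uv(1) nth_mem[of i "up v"] i by auto
        then have "up v ! i < n" "up v ! i \<noteq> y" using conn_sub[OF X(1)] V_eq X(3) by auto
        then show ?thesis using par M1f[OF D0, of 13 "up v ! i"] uv(2) i unfolding chain_def by simp
      qed
      then show ?thesis using False unfolding chain_def by simp
    qed
    show ?thesis unfolding out_inv_def using g1 g2 g3 g4 by blast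
  qed
  have hy: "heap0 \<le> h" using rg(7) .
  let ?f1 = "k - cost vw X" and ?f2 = "k - cost vw ?X"
  have down: "wp (Cond (Equal rF rZ) Skip go_down) q (\<lambda>t q'. t \<le> 16 * n + 5 \<and> out q' = out q @ enc_moves (haul ?f1 (rev ?xs)))"
    if q: "regs q rZ = 0" "regs q rF = ?f1" "regs q rR = ad r 0" "regs q rH = h" "regs q rSp = h + (length ?xs - 1)"
      "\<forall>i<length ?xs - 1. mem q (h + i) = ad (?xs ! i) 0" "\<forall>i<h. mem q i = M1 i" for q
  proof (cases "?f1 = 0")
    case True
    then show ?thesis using q by (simp add: haul_def)
  next
    case False
    have "wp go_down q (\<lambda>t s'. t \<le> 16 * length ?xs + 4 \<and> out s' = out q @ enc_moves (walk ?f1 (rev ?xs)))"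
    proof (rule wp_down[OF q(3,4,5,2) upp(1,3) xsV q(6)])
      show "\<forall>v<n. mem q (ad v 0 + 10) = v"
      proof (intro allI impI)
        fix v assume v: "v < n"
        then show "mem q (ad v 0 + 10) = v" using q(7) ad_less[OF v D0, of 10] hy num1 by simp
      qed
    qed
    then have "wp go_down q (\<lambda>t s'. Suc t \<le> 16 * n + 5 \<and> out s' = out q @ enc_moves (haul ?f1 (rev ?xs)))"
      by (rule wp_mono) (use lxs False in \<open>auto simp: haul_def\<close>)
    then show ?thesis using q False by simp
  qed
  have slid: "wp slide_in q (\<lambda>t q'. t \<le> 40 \<and> mem q' = (mem q)(ad y 0 + 14 := d y - 1) \<and> regs q' rCc = cost vw ?X \<and> regs q' rF = ?f2 \<and>
      out q' = out q @ [p, y, k - g])"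
    if q: "\<forall>i<h. mem q i = M1 i" "regs q rU = ad y 0" "regs q rPar = ad p 0" "regs q rZ = 0" "regs q rG = g" "regs q rBP = k" for q
  proof -
    have m: "mem q (ad y 0 + f) = M1 (ad y 0 + f)" "mem q (ad p 0 + f) = M1 (ad p 0 + f)" if "f < 32" for f
      using q(1) ad_less[OF X(2) D0 that] ad_less[OF pV(2) D0 that] hy by auto
    show ?thesis unfolding slide_in_def using m[of 10] m[of 12] m[of 14] M1p by (simp add: q(2-6) cE)
  qed
  have upw: "wp (Cond (Equal rF rZ) Skip go_up) q (\<lambda>t q'. t \<le> 16 * n + 30 \<and> out q' = out q @ enc_moves (haul ?f2 (y # ?xs)))"
    if q: "regs q rZ = 0" "regs q rF = ?f2" "regs q rR = ad r 0" "regs q rU = ad y 0" "\<forall>i<heap0. mem q i = M2 i" for q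
  proof (cases "?f2 = 0")
    case True
    then show ?thesis using q by (simp add: haul_def)
  next
    case False
    have oi: "out_inv r (mem q) ?X (up(y := y # ?xs))" by (rule oi2) (use q(5) in blast)
    have "wp go_up q (\<lambda>t s'. t \<le> 16 * length (y # ?xs) + 4 \<and> out s' = out q @ enc_moves (walk ?f2 (y # ?xs)))"
    proof (rule wp_up[OF q(3,4,2)])
      have "chain (mem q) ((up(y := y # ?xs)) y)" using oi unfolding out_inv_def by blast
      then show "chain (mem q) (y # ?xs)" by simp
      show "\<forall>v<n. mem q (ad v 0 + 10) = v" using oi unfolding out_inv_def by blast
    qed (use upp xsV yV X(3) in auto)
    then have "wp go_up q (\<lambda>t s'. Suc t \<le> 16 * n + 30 \<and> out s' = out q @ enc_moves (haul ?f2 (y # ?xs)))"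
      by (rule wp_mono) (use lxs False in \<open>auto simp: haul_def\<close>)
    then show ?thesis using q False by simp
  qed
  show ?thesis unfolding add_vertex_def wp_Seq[of find_parent] wp_Seq[of settle] wp_Seq[of push_path] wp_Seq[of "Cond _ _ _"] wp_Seq[of slide_in]
  proof (rule wp_frame[OF wp_find_parent[OF o rg(1,2) X]])
    fix t1 :: nat and s1 :: ram_state
    assume A1: "t1 \<le> 15 * D + 5 \<and> regs s1 rPar = ad p 0"
      and F1: "\<And>x. x \<notin> writes find_parent \<Longrightarrow> regs s1 x = regs s x" "\<not> prints find_parent \<Longrightarrow> out s1 = out s" "\<not> stores find_parent \<Longrightarrow> mem s1 = ?M"
    have s1: "mem s1 = ?M" "regs s1 rU = ad y 0" "regs s1 rPar = ad p 0" "regs s1 rZ = 0" "regs s1 rCc = cost vw X" "regs s1 rBP = k"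
       "regs s1 rR = ad r 0" "regs s1 rH = h" "out s1 = out s" using A1 F1 rg by (auto simp: find_parent_def)
    show "wp settle s1 (\<lambda>t \<sigma>'. wp push_path \<sigma>' (\<lambda>t' \<sigma>''. wp (Cond (Equal rF rZ) Skip go_down) \<sigma>'' (\<lambda>t'' \<sigma>3. wp slide_in \<sigma>3 (\<lambda>t3 \<sigma>4.
       wp (Cond (Equal rF rZ) Skip go_up) \<sigma>4 (\<lambda>t4 s'. t1 + (t + (t' + (t'' + (t3 + t4)))) \<le> 15 * D + 41 * n + 130 \<and>
       out_inv r (mem s') (insert y X) (up(y := y # up p)) \<and>
     regs s' rCc = cost vw (insert y X) \<and> (\<forall>i. heap0 \<le> i \<and> i < h \<longrightarrow> mem s' i = mem s i) \<and>
     out s' = out s @ enc_moves (extend_moves k X (up p) p y))))))"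
    proof (rule wp_frame[OF st[OF s1(1-6)]])
      fix t2 :: nat and s2 :: ram_state
      assume A2: "t2 \<le> 30 \<and> mem s2 = M1 \<and> regs s2 rG = g \<and> regs s2 rF = ?f1"
       and F2: "\<And>x. x \<notin> writes settle \<Longrightarrow> regs s2 x = regs s1 x" "\<not> prints settle \<Longrightarrow> out s2 = out s1"
      have s2: "mem s2 = M1" "regs s2 rU = ad y 0" "regs s2 rPar = ad p 0" "regs s2 rZ = 0" "regs s2 rBP = k"
       "regs s2 rR = ad r 0" "regs s2 rH = h" "out s2 = out s" "regs s2 rG = g" "regs s2 rF = ?f1" using A2 F2 s1 by (auto simp: settle_def)
      have ch2: "chain (mem s2) ?xs" using s2(1) chM1 by simp
      show "wp push_path s2 (\<lambda>t' \<sigma>''. wp (Cond (Equal rF rZ) Skip go_down) \<sigma>'' (\<lambda>t'' \<sigma>3. wp slide_in \<sigma>3 (\<lambda>t3 \<sigma>4.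
         wp (Cond (Equal rF rZ) Skip go_up) \<sigma>4 (\<lambda>t4 s'. t1 + (t2 + (t' + (t'' + (t3 + t4)))) \<le> 15 * D + 41 * n + 130 \<and>
         out_inv r (mem s') (insert y X) (up(y := y # up p)) \<and>
         regs s' rCc = cost vw (insert y X) \<and> (\<forall>i. heap0 \<le> i \<and> i < h \<longrightarrow> mem s' i = mem s i) \<and>
         out s' = out s @ enc_moves (extend_moves k X (up p) p y)))))"
      proof (rule wp_frame[OF wp_push[OF s2(3,6,7) hy upp(1,2,3,5) xsV ch2]])
        fix t3 :: nat and s3 :: ram_state
        assume A3: "t3 \<le> 9 * length ?xs + 5 \<and> regs s3 rSp = h + (length ?xs - 1) \<and>
          (\<forall>i<h. mem s3 i = mem s2 i) \<and> (\<forall>i<length ?xs - 1. mem s3 (h + i) = ad (?xs ! i) 0)"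
         and F3: "\<And>x. x \<notin> writes push_path \<Longrightarrow> regs s3 x = regs s2 x" "\<not> prints push_path \<Longrightarrow> out s3 = out s2"
        have s3: "regs s3 rU = ad y 0" "regs s3 rPar = ad p 0" "regs s3 rZ = 0" "regs s3 rBP = k"
          "regs s3 rR = ad r 0" "regs s3 rH = h" "out s3 = out s" "regs s3 rG = g" "regs s3 rF = ?f1" using F3 s2 by (auto simp: push_path_def)
        have m3: "\<forall>i<h. mem s3 i = M1 i" using A3 s2(1) by simp
        show "wp (Cond (Equal rF rZ) Skip go_down) s3 (\<lambda>t'' \<sigma>3. wp slide_in \<sigma>3 (\<lambda>t' \<sigma>4.
         wp (Cond (Equal rF rZ) Skip go_up) \<sigma>4 (\<lambda>t4 s'. t1 + (t2 + (t3 + (t'' + (t' + t4)))) \<le> 15 * D + 41 * n + 130 \<and>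
         out_inv r (mem s') (insert y X) (up(y := y # up p)) \<and>
         regs s' rCc = cost vw (insert y X) \<and> (\<forall>i. heap0 \<le> i \<and> i < h \<longrightarrow> mem s' i = mem s i) \<and>
         out s' = out s @ enc_moves (extend_moves k X (up p) p y))))"
        proof (rule wp_frame[OF down[of s3]])
          show "regs s3 rZ = 0" "regs s3 rF = ?f1" "regs s3 rR = ad r 0" "regs s3 rH = h" using s3 by auto
          show "regs s3 rSp = h + (length ?xs - 1)" "\<forall>i<length ?xs - 1. mem s3 (h + i) = ad (?xs ! i) 0" "\<forall>i<h. mem s3 i = M1 i"
            using A3 m3 by blast+
          fix t4 :: nat and s4 :: ram_state
          assume A4: "t4 \<le> 16 * n + 5 \<and> out s4 = out s3 @ enc_moves (haul ?f1 (rev ?xs))"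
           and F4: "\<And>x. x \<notin> writes (Cond (Equal rF rZ) Skip go_down) \<Longrightarrow> regs s4 x = regs s3 x"
             "\<not> stores (Cond (Equal rF rZ) Skip go_down) \<Longrightarrow> mem s4 = mem s3"
          have s4: "regs s4 rU = ad y 0" "regs s4 rPar = ad p 0" "regs s4 rZ = 0" "regs s4 rBP = k"
            "regs s4 rR = ad r 0" "regs s4 rH = h" "regs s4 rG = g" "mem s4 = mem s3" using F4 s3 by (auto simp: go_down_def)
          have m4: "\<forall>i<h. mem s4 i = M1 i" using s4(8) m3 by simp
          show "wp slide_in s4 (\<lambda>t' \<sigma>4. wp (Cond (Equal rF rZ) Skip go_up) \<sigma>4 (\<lambda>t5 s'. t1 + (t2 + (t3 + (t4 + (t' + t5)))) \<le> 15 * D + 41 * n + 130 \<and>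
             out_inv r (mem s') (insert y X) (up(y := y # up p)) \<and>
             regs s' rCc = cost vw (insert y X) \<and> (\<forall>i. heap0 \<le> i \<and> i < h \<longrightarrow> mem s' i = mem s i) \<and>
             out s' = out s @ enc_moves (extend_moves k X (up p) p y)))"
          proof (rule wp_frame[OF slid[OF m4 s4(1,2,3,7,4)]])
            fix t5 :: nat and s5 :: ram_state
            assume A5: "t5 \<le> 40 \<and> mem s5 = (mem s4)(ad y 0 + 14 := d y - 1) \<and> regs s5 rCc = cost vw ?X \<and> regs s5 rF = ?f2 \<and>
              out s5 = out s4 @ [p, y, k - g]"
             and F5: "\<And>x. x \<notin> writes slide_in \<Longrightarrow> regs s5 x = regs s4 x"
            have s5: "regs s5 rU = ad y 0" "regs s5 rZ = 0" "regs s5 rR = ad r 0" using F5 s4 by (auto simp: slide_in_def)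
            have m5: "\<forall>i<h. mem s5 i = M2 i" using A5 m4 unfolding M2_def by simp
            then have m5': "\<forall>i<heap0. mem s5 i = M2 i" using hy by simp
            have f5: "regs s5 rF = ?f2" using A5 by blast
            show "wp (Cond (Equal rF rZ) Skip go_up) s5 (\<lambda>t6 s'. t1 + (t2 + (t3 + (t4 + (t5 + t6)))) \<le> 15 * D + 41 * n + 130 \<and>
             out_inv r (mem s') (insert y X) (up(y := y # up p)) \<and>
             regs s' rCc = cost vw (insert y X) \<and> (\<forall>i. heap0 \<le> i \<and> i < h \<longrightarrow> mem s' i = mem s i) \<and>
             out s' = out s @ enc_moves (extend_moves k X (up p) p y))"
            proof (rule wp_frame[OF upw[OF s5(2) f5 s5(3,1) m5']])
              fix t6 :: nat and s6 :: ram_state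
              assume A6: "t6 \<le> 16 * n + 30 \<and> out s6 = out s5 @ enc_moves (haul ?f2 (y # ?xs))"
               and F6: "\<And>x. x \<notin> writes (Cond (Equal rF rZ) Skip go_up) \<Longrightarrow> regs s6 x = regs s5 x"
                 "\<not> stores (Cond (Equal rF rZ) Skip go_up) \<Longrightarrow> mem s6 = mem s5"
              have s6: "mem s6 = mem s5" "regs s6 rCc = cost vw ?X" using F6 A5 by (auto simp: go_up_def)
              have "t1 + (t2 + (t3 + (t4 + (t5 + t6)))) \<le> 15 * D + 41 * n + 130" using A1 A2 A3 A4 A5 A6 lxs by linarith
              moreover have "out_inv r (mem s6) ?X (up(y := y # ?xs))" by (rule oi2) (use s6(1) m5' in simp)
              moreover have "mem s6 i = ?M i" if i: "heap0 \<le> i" "i < h" for i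
              proof -
                have "i \<noteq> ad y 0 + 14" using ad_less[OF X(2) D0, of 14] i(1) by simp
                then show ?thesis using s6(1) m5 i M1h[OF i(1)] unfolding M2_def by simp
              qed
              moreover have "out s6 = out s @ enc_moves (extend_moves k X ?xs p y)"
                using A4 A5 A6 s3(7) by (simp add: extend_moves_def g_def)
              ultimately show "t1 + (t2 + (t3 + (t4 + (t5 + t6)))) \<le> 15 * D + 41 * n + 130 \<and>
               out_inv r (mem s6) (insert y X) (up(y := y # up p)) \<and>
               regs s6 rCc = cost vw (insert y X) \<and> (\<forall>i. heap0 \<le> i \<and> i < h \<longrightarrow> mem s6 i = mem s i) \<and>
               out s6 = out s @ enc_moves (extend_moves k X (up p) p y)" using s6(2) by blast
            qed
          qed
        qed
      qed
    qed
  qed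
qed

lemma static_out_inv:
  assumes st: "static M" and r: "r < n"
  shows "out_inv r (M(ad r 0 + 15 := 1)) {r} (\<lambda>x. [x])"
proof -
  let ?N = "M(ad r 0 + 15 := 1)"
  have D0: "(0::nat) < 2 ^ D" by simp
  have N: "?N (ad v m + f) = M (ad v m + f)" if "m < 2 ^ D" "f < 32" "\<not> (v = r \<and> m = 0 \<and> f = 15)" for v m f
    using ad_eq[OF that(1) D0 that(2), of 15 v r] that by auto
  have nr: "nb r - {r} = nb r" using edgeD(3) by (auto simp: nb_def)
  have "?N (ad v 0 + 10) = v \<and> ?N (ad v 0 + 11) = 32 * 2 ^ d v \<and> ?N (ad v 0 + 12) = vw v \<and>
       ?N (ad v 0 + 14) = (if v \<in> {r} then card (nb v - {r}) else d v) \<and> ?N (ad v 0 + 15) = (if v \<in> {r} then 1 else 0)" if v: "v < n" for v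
  proof -
    have sv: "M (ad v 0 + 10) = v" "M (ad v 0 + 11) = 32 * 2 ^ d v" "M (ad v 0 + 12) = vw v" "M (ad v 0 + 14) = d v" "M (ad v 0 + 15) = 0"
      using st v unfolding static_def by blast+
    have 1: "?N (ad v 0 + 15) = (if v \<in> {r} then 1 else 0)" using N[OF D0, of 15 v] sv(5) by (cases "v = r") auto
    have 2: "card (nb r - {r}) = d r" using nr d_card by simp
    have 3: "?N (ad v 0 + 10) = v" "?N (ad v 0 + 11) = 32 * 2 ^ d v" "?N (ad v 0 + 12) = vw v" "?N (ad v 0 + 14) = d v"
      using N[OF D0, of 10 v] N[OF D0, of 11 v] N[OF D0, of 12 v] N[OF D0, of 14 v] sv by (simp_all del: fun_upd_apply)
    show ?thesis unfolding 1 3 using 2 by auto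
  qed
  moreover have "?N (ad v (2 ^ j) + 13) = ad (nbr v j) 0" if v: "v < n" "j < d v" for v j
  proof -
    have j: "(2::nat) ^ j < 2 ^ D" using v d_le[of v] V_eq by simp
    have "M (ad v (2 ^ j) + 13) = ad (nbr v j) 0" using st v unfolding static_def by blast
    then show ?thesis using N[OF j, of 13 v] by simp
  qed
  moreover have "?N (adp x + 17) = ad (fst x) 0" if x: "valid x" for x
    using N[of "snd x" 17 "fst x"] static_V0[OF st x] valid_lt[of "fst x" "snd x"] x by auto
  ultimately show ?thesis unfolding out_inv_def chain_def by simp
qed

lemma wp_print:
  assumes st: "static (mem s)" and rg: "regs s rZ = 0" "regs s rBP = k" "regs s rBPtr = q" "regs s rBLen = length LL" "regs s rH = h"
    and LL: "rooted r k LL" "holds_list (mem s) q LL" "heap0 \<le> q" "q + length LL \<le> h" and o: "out s = []"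
  shows "wp print_strategy s (\<lambda>t s'. t \<le> 2 * n * (15 * D + 41 * n + 145) + 30 \<and>
     out s' = encode_strategy k r (emit k {r} (\<lambda>x. [x]) (map fst LL)))"
proof -
  let ?M = "mem s" and ?l = "length LL" and ?ys = "map fst LL" and ?C = "15 * D + 41 * n + 145"
  have r: "r < n" "path k {r} ?ys" "{r} \<union> fst ` set LL = V" "LL \<noteq> []" "fst (hd LL) = r" "set LL \<subseteq> {x. valid x}" "?l \<le> 2 * n"
    using LL(1) unfolding rooted_def by blast+
  have rV: "r \<in> V" using r(1) V_eq by simp
  have D0: "(0::nat) < 2 ^ D" by simp
  let ?N = "?M(ad r 0 + 15 := 1)"
  define tg where "tg = encode_strategy k r (emit k {r} (\<lambda>x. [x]) ?ys)"
  have tg: "tg = [k, r] @ enc_moves (emit k {r} (\<lambda>x. [x]) ?ys)" by (simp add: tg_def encode_strategy_def enc_moves_def)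
  let ?body = "Load rX rIt ;; LoadF rU rX 17 ;; LoadF rW rU 15 ;; Cond (Equal rW rZ) add_vertex Skip ;; Inc rIt 1"
  \<comment> \<open>The output equation splits the target into what is printed and what the rest of
    the list will print. The cost register is specified only for \<open>X \<noteq> V\<close>: for a
    tree with one vertex it starts with the weight of \<open>r\<close> although the cost is
    0.\<close>
  define good where "good i X up qs \<longleftrightarrow> i \<le> ?l \<and> regs qs rIt = q + i \<and> out_inv r (mem qs) X up \<and> conn X \<and> up_ok r X up \<and>
     path k X (drop i ?ys) \<and> X \<union> set (drop i ?ys) = V \<and> (X \<noteq> V \<longrightarrow> regs qs rCc = cost vw X) \<and>
     out qs @ enc_moves (emit k X up (drop i ?ys)) = tg" for i X up and qs :: ram_state
  define I where "I = (\<lambda>qs::ram_state. regs qs rZ = 0 \<and> regs qs rR = ad r 0 \<and> regs qs rBP = k \<and> regs qs rH = h \<and> regs qs rItE = q + ?l \<and>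
     (\<forall>i. heap0 \<le> i \<and> i < h \<longrightarrow> mem qs i = ?M i) \<and> (\<exists>i X up. good i X up qs))"
  define f where "f = (\<lambda>qs::ram_state. (q + ?l - regs qs rIt) * ?C + (1::nat))"
  have loop: "wp (While (Less rIt rItE) ?body) s0 (\<lambda>t qs. t \<le> f s0 \<and> I qs \<and> \<not> holds (Less rIt rItE) qs)" if "I s0" for s0
  proof (rule wp_While[where I = I and f = f])
    show "I s0" by (rule that)
    show "1 \<le> f qs" for qs by (simp add: f_def)
    fix qs :: ram_state assume Iq: "I qs" and b: "holds (Less rIt rItE) qs"
    have qs: "regs qs rZ = 0" "regs qs rR = ad r 0" "regs qs rBP = k" "regs qs rH = h" "regs qs rItE = q + ?l"
      "\<forall>i. heap0 \<le> i \<and> i < h \<longrightarrow> mem qs i = ?M i" and ex: "\<exists>i X up. good i X up qs" using Iq unfolding I_def by blast+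
    obtain i X up where gd: "good i X up qs" using ex by (elim exE)
    have g: "i \<le> ?l" "regs qs rIt = q + i" "out_inv r (mem qs) X up" "conn X" "up_ok r X up"
      "path k X (drop i ?ys)" "X \<union> set (drop i ?ys) = V" "X \<noteq> V \<longrightarrow> regs qs rCc = cost vw X"
      "out qs @ enc_moves (emit k X up (drop i ?ys)) = tg" using gd unfolding good_def by blast+
    have i: "i < ?l" using b qs(5) g(1,2) by simp
    let ?y = "fst (LL ! i)"
    have dr: "drop i ?ys = ?y # drop (Suc i) ?ys" using i Cons_nth_drop_Suc[of i ?ys] by simp
    have vy: "valid (LL ! i)" using r(6) nth_mem[OF i] by auto
    have yn: "?y < n" using vy by (simp add: valid_def)
    have m1: "mem qs (q + i) = adp (LL ! i)" using qs(6) LL(2,3,4) i unfolding holds_list_def by simp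
    have m2: "mem qs (adp (LL ! i) + 17) = ad ?y 0" using g(3) vy unfolding out_inv_def by blast
    have m3: "mem qs (ad ?y 0 + 15) = (if ?y \<in> X then 1 else 0)" using g(3) yn unfolding out_inv_def by blast
    have fin: "I q' \<and> Suc t + f q' \<le> f qs" if t: "t \<le> 15 * D + 41 * n + 143" and q': "regs q' rZ = 0" "regs q' rR = ad r 0" "regs q' rBP = k"
       "regs q' rH = h" "regs q' rItE = q + ?l" "\<forall>i. heap0 \<le> i \<and> i < h \<longrightarrow> mem q' i = ?M i" "good (Suc i) X' up' q'" for t q' X' up'
    proof
      show "I q'" unfolding I_def using q' by blast
      have e: "regs q' rIt = q + Suc i" using q'(7) unfolding good_def by blast
      have "q + ?l - (q + i) = Suc (q + ?l - (q + Suc i))" using i by simp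
      then have "f qs = ?C + f q'" unfolding f_def e g(2) by (simp only: mult_Suc add.assoc)
      then show "Suc t + f q' \<le> f qs" using t by simp
    qed
    show "wp ?body qs (\<lambda>t q'. I q' \<and> Suc t + f q' \<le> f qs)"
    proof (cases "?y \<in> X")
      case True
      let ?q' = "set_reg rIt (q + Suc i) (set_reg rT 1 (set_reg rW 1 (set_reg rU (ad ?y 0) (set_reg rX (adp (LL ! i)) qs))))"
      have "good (Suc i) X up ?q'" unfolding good_def
        using g i True unfolding dr by (auto simp: insert_absorb)
      then have "I ?q' \<and> Suc 12 + f ?q' \<le> f qs" by (intro fin) (use qs in auto)
      then show ?thesis using g(2) m1 m2 m3 True qs(1) by (simp del: wp_Seq add: wp_Seq[of "Load _ _"] wp_Seq[of "LoadF _ _ _"] wp_Seq[of "Cond _ _ _"])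
    next
      case False
      let ?s1 = "set_reg rW 0 (set_reg rU (ad ?y 0) (set_reg rX (adp (LL ! i)) qs))"
      obtain p where p: "p \<in> X" "{p, ?y} \<in> E" "need X p ?y \<le> k" using g(6) False unfolding dr by auto
      have lk: "link X ?y = p" using link_eq[OF g(4) False p(1,2)] .
      have XV: "X \<noteq> V" using False yn V_eq by auto
      have hh: "heap0 \<le> h" using LL(3,4) by simp
      have "wp add_vertex ?s1 (\<lambda>t s'. t \<le> 15 * D + 41 * n + 130 \<and> out_inv r (mem s') (insert ?y X) (up(?y := ?y # up p)) \<and>
         regs s' rCc = cost vw (insert ?y X) \<and> (\<forall>i. heap0 \<le> i \<and> i < h \<longrightarrow> mem s' i = mem ?s1 i) \<and>
         out s' = out ?s1 @ enc_moves (extend_moves k X (up p) p ?y))"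
        by (rule wp_add_vertex[where h = h]) (use g qs XV hh yn False p in auto)
      then have "wp add_vertex ?s1 (\<lambda>t s'. wp (Inc rIt 1) s' (\<lambda>t' q'. I q' \<and> Suc (1 + (3 + (3 + (Suc t + t')))) + f q' \<le> f qs))"
      proof (rule wp_frame)
        fix t :: nat and s' :: ram_state
        assume A: "t \<le> 15 * D + 41 * n + 130 \<and> out_inv r (mem s') (insert ?y X) (up(?y := ?y # up p)) \<and>
         regs s' rCc = cost vw (insert ?y X) \<and> (\<forall>i. heap0 \<le> i \<and> i < h \<longrightarrow> mem s' i = mem ?s1 i) \<and>
         out s' = out ?s1 @ enc_moves (extend_moves k X (up p) p ?y)"
         and fr: "\<And>x. x \<notin> writes add_vertex \<Longrightarrow> regs s' x = regs ?s1 x"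
        let ?q' = "set_reg rIt (q + Suc i) (set_reg rT 1 s')"
        have s': "regs s' rZ = 0" "regs s' rR = ad r 0" "regs s' rBP = k" "regs s' rH = h" "regs s' rItE = q + ?l" "regs s' rIt = q + i"
          using fr qs g(2) by (auto simp: add_vertex_effects)
        have "good (Suc i) (insert ?y X) (up(?y := ?y # up p)) ?q'" unfolding good_def
        proof (intro conjI)
          show "conn (insert ?y X)" using conn_insert[OF g(4) p(1,2)] .
          show "up_ok r (insert ?y X) (up(?y := ?y # up p))" using up_ok_insert[OF g(5) p(1,2) False] .
          show "path k (insert ?y X) (drop (Suc i) ?ys)" using g(6) unfolding dr by simp
          show "insert ?y X \<union> set (drop (Suc i) ?ys) = V" using g(7) unfolding dr by auto
          show "out ?q' @ enc_moves (emit k (insert ?y X) (up(?y := ?y # up p)) (drop (Suc i) ?ys)) = tg"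
            using g(9) A False lk unfolding dr by (simp del: fun_upd_apply)
        qed (use A i in auto)
        then have "I ?q' \<and> Suc (1 + (3 + (3 + (Suc t + 2)))) + f ?q' \<le> f qs"
          by (intro fin) (use A s' qs in auto)
        then show "wp (Inc rIt 1) s' (\<lambda>t' q'. I q' \<and> Suc (1 + (3 + (3 + (Suc t + t')))) + f q' \<le> f qs)" using s'(6) by simp
      qed
      then show ?thesis using g(2) m1 m2 m3 False qs(1) by (simp del: One_nat_def wp_Seq wp_Inc add: wp_Seq[of "Load _ _"] wp_Seq[of "LoadF _ _ _"] wp_Seq[of "Cond _ _ _"])
    qed
  qed
  let ?s0 = "set_reg rItE (q + ?l) (set_reg rIt q (set_reg rCc (vw r) (set_mem (ad r 0 + 15) 1 (set_reg rT (ad r 0 + 15) (set_reg rY 1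
     (put r (set_reg rW r (set_reg rR (ad r 0) (set_reg rX (adp (hd LL)) (put k s))))))))))"
  have I0: "I ?s0"
  proof -
    have ne: "heap0 \<le> i \<Longrightarrow> i \<noteq> ad r 0 + 15" for i using ad_less[OF r(1) D0, of 15] by auto
    have "good 0 {r} (\<lambda>x. [x]) ?s0" unfolding good_def
    proof (intro conjI)
      show "out_inv r (mem ?s0) {r} (\<lambda>x. [x])" using static_out_inv[OF st r(1)] by simp
      show "conn {r}" using conn_single[OF rV] .
      show "up_ok r {r} (\<lambda>x. [x])" by (simp add: up_ok_def)
      show "{r} \<noteq> V \<longrightarrow> regs ?s0 rCc = cost vw {r}"
      proof
        assume "{r} \<noteq> V"
        then have "bd {r} \<noteq> {}" using bd_ne conn_single[OF rV] by blast
        then have "bd {r} = {r}" using bd_sub[of "{r}"] by auto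
        then show "regs ?s0 rCc = cost vw {r}" by (simp add: cost_def)
      qed
      show "out ?s0 @ enc_moves (emit k {r} (\<lambda>x. [x]) (drop 0 ?ys)) = tg" using tg o by simp
    qed (use r rg in auto)
    then show ?thesis unfolding I_def using rg ne by auto
  qed
  have f0: "f ?s0 \<le> 2 * n * ?C + 1"
  proof -
    have "?l * ?C \<le> 2 * n * ?C" using r(7) by (rule mult_le_mono1)
    then show ?thesis by (simp add: f_def)
  qed
  have "wp (While (Less rIt rItE) ?body) ?s0 (\<lambda>t s'. 20 + t \<le> 2 * n * ?C + 30 \<and> out s' = tg)"
  proof (rule wp_mono[OF loop[OF I0]])
    fix t :: nat and qs :: ram_state
    assume A: "t \<le> f ?s0 \<and> I qs \<and> \<not> holds (Less rIt rItE) qs"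
    have qs: "regs qs rItE = q + ?l" and ex: "\<exists>i X up. good i X up qs" using A unfolding I_def by blast+
    obtain i X up where gd: "good i X up qs" using ex by (elim exE)
    have g: "i \<le> ?l" "regs qs rIt = q + i" "out qs @ enc_moves (emit k X up (drop i ?ys)) = tg" using gd unfolding good_def by blast+
    have "i = ?l" using A qs g(1,2) by simp
    then have "out qs = tg" using g(3) by simp
    then show "20 + t \<le> 2 * n * ?C + 30 \<and> out qs = tg" using A f0 by linarith
  qed
  note fin = this
  have m1: "?M q = adp (hd LL)" using LL(2) r(4) unfolding holds_list_def by (metis add.right_neutral hd_conv_nth length_greater_0_conv)
  have vh: "valid (hd LL)" using subsetD[OF r(6) hd_in_set[OF r(4)]] by simp
  have m2: "?M (adp (hd LL) + 17) = ad r 0" using static_V0[OF st vh] r(5) by simp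
  have m3: "?M (ad r 0 + 10) = r" "?M (ad r 0 + 12) = vw r" using st r(1) unfolding static_def by blast+
  show ?thesis unfolding print_strategy_def tg_def[symmetric]
    using fin
    by (simp del: wp_Seq wp_Cond add: rg m1 m2 m3 wp_Seq[of "Write _"] wp_Seq[of "Load _ _"] wp_Seq[of "LoadF _ _ _"] wp_Seq[of "Const _ _"] wp_Seq[of "StoreF _ _ _"] wp_Seq[of "Copy _ _"] wp_Seq[of "Add _ _ _"])
       (erule wp_mono, elim conjE, intro conjI, linarith, assumption)
qed

end

section \<open>Reading the input\<close>

abbreviation (input) "rM \<equiv> (35::nat)"

text \<open>The input cell of the weight is reused for the address of the vertex, so that edges can
  turn vertex numbers into addresses by one load. Field 11 starts at 32, the offset of mask
  1.\<close>

definition read_vertex :: "nat \<Rightarrow> program" where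
  "read_vertex str = (Load rW rQ ;; Const rY 32 ;; StoreF rP 12 rW ;; StoreF rP 10 rI ;; StoreF rP 11 rY ;;
     Store rQ rP ;; Inc rI 1 ;; Inc rQ 1 ;; Inc rP str)"

text \<open>Field 11 of an end is the offset of its next free single-bit record and doubles with
  every edge. Field 8 provisionally holds the offset that this edge has at the other end.\<close>

definition read_edge :: program where
  "read_edge = (Load rS rQ ;; Inc rS 2 ;; Load rS rS ;; LoadF rA rQ 1 ;; Inc rA 2 ;; Load rA rA ;; LoadF rW rQ 2 ;;
     LoadF rX rS 11 ;; LoadF rC rA 11 ;; LoadF rND rS 14 ;; LoadF rMn rA 14 ;; Inc rND 1 ;; Inc rMn 1 ;;
     Add rV rS rX ;; Add rY rA rC ;;
     StoreF rV 9 rW ;; StoreF rY 9 rW ;; StoreF rV 13 rA ;; StoreF rY 13 rS ;; StoreF rV 8 rC ;; StoreF rY 8 rX ;;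
     Add rX rX rX ;; Add rC rC rC ;; StoreF rS 11 rX ;; StoreF rA 11 rC ;; StoreF rS 14 rND ;; StoreF rA 14 rMn ;;
     Inc rQ 3 ;; Inc rI 1)"

text \<open>\<open>rHB\<close> follows the highest bit of the mask. At a power of two the
  provisional offset in field 8 is replaced by the address of the neighbour's full mask without the
  bit of this edge, which requires the final degree of the neighbour.\<close>

definition make_record :: program where
  "make_record = (Add rX rP rI ;; Add rY rHB rHB ;; Cond (Equal rI rY) (Copy rHB rY) Skip ;;
     Cond (Equal rI rHB)
       (LoadF rC rX 13 ;; LoadF rS rC 11 ;; LoadF rA rX 8 ;; Add rC rC rS ;; Const rS 32 ;; Sub rC rC rS ;;
        Sub rC rC rA ;; StoreF rX 8 rC) Skip ;;
     Const rA 1 ;; StoreF rX 0 rW ;; StoreF rX 17 rP ;; StoreF rX 3 rA ;; StoreF rX 18 rHB ;; Inc rI 32)"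

definition make_records :: "nat \<Rightarrow> program" where
  "make_records str = (LoadF rQE rP 11 ;; LoadF rW rP 12 ;; Const rHB 32 ;; Const rI 32 ;; StoreF rP 17 rP ;;
     While (Less rI rQE) make_record ;; Inc rP str)"

definition init :: "nat \<Rightarrow> program" where
  "init str = (Const rX 0 ;; Load rN rX ;; Const rX 1 ;; Load rM rX ;;
     Const rB 2 ;; Add rB rB rN ;; Add rB rB rM ;; Add rB rB rM ;; Add rB rB rM ;;
     Const rI 0 ;; Copy rP rB ;; Const rQ 2 ;; While (Less rI rN) (read_vertex str) ;;
     Copy rE rP ;; Copy rH rP ;; Const rI 0 ;; While (Less rI rM) read_edge ;;
     Copy rP rB ;; While (Less rP rE) (make_records str))"

lemma nth_concat_triples:
  "i < length xs \<Longrightarrow> j < 3 \<Longrightarrow> concat (map (\<lambda>x. [f x, g x, h x]) xs) ! (3 * i + j) =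
     (if j = 0 then f (xs ! i) else if j = 1 then g (xs ! i) else h (xs ! i))"
proof (induction xs arbitrary: i)
  case (Cons x xs)
  show ?case
  proof (cases i)
    case 0
    then show ?thesis using Cons.prems by (auto simp: less_Suc_eq numeral_eq_Suc)
  next
    case (Suc i')
    then have "3 * i + j = Suc (Suc (Suc (3 * i' + j)))" by simp
    then show ?thesis using Cons Suc by simp
  qed
qed simp

lemma length_concat_triples: "length (concat (map (\<lambda>x. [f x, g x, h x]) xs)) = 3 * length xs"
  by (induction xs) auto

context tree_input begin

lemma base_le: "base \<le> ad v m"
  by (simp add: ad_def)

lemma below_ad: "x < base \<Longrightarrow> x \<noteq> ad v m + f"
  using base_le[of v m] by linarith

lemma es_less: assumes "i < length es" shows "fst (es ! i) < n" "snd (es ! i) < n" "fst (es ! i) \<noteq> snd (es ! i)"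
proof -
  have "es ! i \<in> set es" using assms by simp
  then have "{fst (es ! i), snd (es ! i)} \<in> E" using es_edges by (force simp: image_iff split: prod.splits)
  then show "fst (es ! i) < n" "snd (es ! i) < n" "fst (es ! i) \<noteq> snd (es ! i)" using edgeD V_eq by auto
qed

section \<open>Contents of memory while the input is read\<close>

definition edges_in :: "(nat \<Rightarrow> nat) \<Rightarrow> bool" where
  "edges_in M \<longleftrightarrow> (\<forall>i<length es. M (2 + n + 3 * i) = fst (es ! i) \<and> M (2 + n + 3 * i + 1) = snd (es ! i) \<and>
     M (2 + n + 3 * i + 2) = ew {fst (es ! i), snd (es ! i)})"

lemma edges_in_agree:
  assumes "edges_in M" "\<And>a. 2 + n \<le> a \<Longrightarrow> a < base \<Longrightarrow> M' a = M a" shows "edges_in M'"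
proof -
  have "M' (2 + n + 3 * i) = M (2 + n + 3 * i) \<and> M' (2 + n + 3 * i + 1) = M (2 + n + 3 * i + 1) \<and>
    M' (2 + n + 3 * i + 2) = M (2 + n + 3 * i + 2)" if "i < length es" for i
    using that by (intro conjI assms(2)) (auto simp: base_def)
  then show ?thesis using assms(1) unfolding edges_in_def by auto
qed

text \<open>Memory beyond the input is initially 0; the last conjunct carries this along for the
  fields not yet written.\<close>

definition vertices_read :: "nat \<Rightarrow> (nat \<Rightarrow> nat) \<Rightarrow> bool" where
  "vertices_read k M \<longleftrightarrow> (\<forall>v<k. M (2 + v) = ad v 0 \<and> M (ad v 0 + 10) = v \<and> M (ad v 0 + 11) = 32 \<and> M (ad v 0 + 12) = vw v) \<and>
     (\<forall>v. k \<le> v \<and> v < n \<longrightarrow> M (2 + v) = vw v) \<and> edges_in M \<and>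
     (\<forall>v<n. \<forall>m<2 ^ D. \<forall>f<32. m \<noteq> 0 \<or> f \<notin> {10, 11, 12} \<longrightarrow> M (ad v m + f) = 0)"

lemma vertices_read_step:
  assumes I: "vertices_read k M" and k: "k < n"
    and M': "M' = M(ad k 0 + 12 := M (2 + k), ad k 0 + 10 := k, ad k 0 + 11 := 32, 2 + k := ad k 0)"
  shows "vertices_read (Suc k) M'"
proof -
  have rd: "M' (ad v m + f) = (if v = k \<and> m = 0 \<and> f = 11 then 32 else if v = k \<and> m = 0 \<and> f = 10 then k
      else if v = k \<and> m = 0 \<and> f = 12 then vw k else M (ad v m + f))" if "v < n" "m < 2 ^ D" "f < 32" for v m f
  proof -
    have "ad v m + f \<noteq> 2 + k" using base_le[of v m] k by (simp add: base_def)
    moreover have "M (2 + k) = vw k" using I k by (simp add: vertices_read_def)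
    ultimately show ?thesis using that unfolding M' by (simp add: ad_eq)
  qed
  have lo: "M' a = (if a = 2 + k then ad k 0 else M a)" if "a < base" for a
    unfolding M' using below_ad[OF that] by simp
  have lov: "M' (2 + v) = (if v = k then ad k 0 else M (2 + v))" if "v < n" for v
    using lo[of "2 + v"] that by (simp add: base_def)
  have e: "edges_in M'"
  proof (rule edges_in_agree)
    show "edges_in M" using I by (simp add: vertices_read_def)
  qed (use k lo in auto)
  have 1: "M' (2 + v) = ad v 0 \<and> M' (ad v 0 + 10) = v \<and> M' (ad v 0 + 11) = 32 \<and> M' (ad v 0 + 12) = vw v"
    if "v < Suc k" for v
  proof (cases "v = k")
    case True
    then show ?thesis using k rd[of k 0 10] rd[of k 0 11] rd[of k 0 12] lov[of k] by simp
  next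
    case False
    then have v: "v < k" "v < n" using that k by auto
    then show ?thesis using I rd[of v 0 10] rd[of v 0 11] rd[of v 0 12] lov[of v] by (simp add: vertices_read_def)
  qed
  have 2: "M' (2 + v) = vw v" if "Suc k \<le> v" "v < n" for v
    using I that lov[of v] by (simp add: vertices_read_def)
  have 3: "M' (ad v m + f) = 0" if "v < n" "m < 2 ^ D" "f < 32" "m \<noteq> 0 \<or> f \<notin> {10, 11, 12}" for v m f
    using I that rd[OF that(1-3)] unfolding vertices_read_def by auto
  show ?thesis unfolding vertices_read_def using 1 2 3 e by blast
qed

text \<open>\<open>xs\<close> are the edges processed so far, and the slot of a neighbour is its
  position in \<open>adjl xs v\<close>. The existential locates \<open>v\<close> among the
  neighbours of its neighbour, the slot whose offset field 8 holds.\<close>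

definition edges_read :: "(nat \<times> nat) list \<Rightarrow> (nat \<Rightarrow> nat) \<Rightarrow> bool" where
  "edges_read xs M \<longleftrightarrow>
     (\<forall>v<n. M (2 + v) = ad v 0 \<and> M (ad v 0) = 0 \<and> M (ad v 0 + 10) = v \<and> M (ad v 0 + 11) = 32 * 2 ^ length (adjl xs v) \<and>
        M (ad v 0 + 12) = vw v \<and> M (ad v 0 + 14) = length (adjl xs v) \<and> M (ad v 0 + 15) = 0) \<and>
     (\<forall>v<n. \<forall>j<length (adjl xs v). M (ad v (2 ^ j) + 9) = ew {v, adjl xs v ! j} \<and>
        M (ad v (2 ^ j) + 13) = ad (adjl xs v ! j) 0 \<and>
        (\<exists>i<length (adjl xs (adjl xs v ! j)). adjl xs (adjl xs v ! j) ! i = v \<and> M (ad v (2 ^ j) + 8) = 32 * 2 ^ i)) \<and>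
     (\<forall>v<n. \<forall>m<2 ^ D. M (ad v m + 3) = 0) \<and> edges_in M"

lemma edges_read_Nil: assumes "vertices_read n M" shows "edges_read [] M"
proof -
  have z: "M (ad v m + f) = 0" if "v < n" "m < 2 ^ D" "f < 32" "m \<noteq> 0 \<or> f \<notin> {10, 11, 12}" for v m f
    using assms that unfolding vertices_read_def by blast
  show ?thesis using assms z[of _ 0 0] z[of _ 0 14] z[of _ 0 15] z[of _ _ 3]
    unfolding edges_read_def vertices_read_def by simp
qed

text \<open>A new edge is appended to both adjacency lists, so slots already assigned do not move,
  and the cells written belong to the two new slots and to the counters of both ends.\<close>

lemma edges_read_step:
  assumes I: "edges_read xs M" and ab: "a < n" "b < n" "a \<noteq> b"
    and le: "\<And>v. v < n \<Longrightarrow> length (adjl (xs @ [(a, b)]) v) \<le> D"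
    and M': "M' = M(ad a (2 ^ length (adjl xs a)) + 9 := ew {a, b}, ad b (2 ^ length (adjl xs b)) + 9 := ew {a, b},
       ad a (2 ^ length (adjl xs a)) + 13 := ad b 0, ad b (2 ^ length (adjl xs b)) + 13 := ad a 0,
       ad a (2 ^ length (adjl xs a)) + 8 := 32 * 2 ^ length (adjl xs b),
       ad b (2 ^ length (adjl xs b)) + 8 := 32 * 2 ^ length (adjl xs a),
       ad a 0 + 11 := 32 * 2 ^ Suc (length (adjl xs a)), ad b 0 + 11 := 32 * 2 ^ Suc (length (adjl xs b)),
       ad a 0 + 14 := Suc (length (adjl xs a)), ad b 0 + 14 := Suc (length (adjl xs b)))"
  shows "edges_read (xs @ [(a, b)]) M'"
proof -
  define la lb where "la = length (adjl xs a)" and "lb = length (adjl xs b)"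
  note l = la_def[symmetric] lb_def[symmetric]
  define A where "A = (\<lambda>v. adjl xs v)"
  define A' where "A' = (\<lambda>v. adjl (xs @ [(a, b)]) v)"
  have A': "A' v = (if v = a then A v @ [b] else if v = b then A v @ [a] else A v)" for v
    using ab by (simp add: A'_def A_def adjl_append)
  have lA: "length (A a) = la" "length (A b) = lb" by (simp_all add: A_def la_def lb_def)
  have le': "length (A' v) \<le> D" if "v < n" for v using le[OF that] by (simp add: A'_def)
  have P: "(2::nat) ^ la < 2 ^ D" "(2::nat) ^ lb < 2 ^ D"
    using le'[OF ab(1)] le'[OF ab(2)] ab(3) lA by (simp_all add: A')
  have rd: "M' (ad v m + f) =
      (if v = b \<and> m = 0 \<and> f = 14 then Suc lb else if v = a \<and> m = 0 \<and> f = 14 then Suc la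
       else if v = b \<and> m = 0 \<and> f = 11 then 32 * 2 ^ Suc lb else if v = a \<and> m = 0 \<and> f = 11 then 32 * 2 ^ Suc la
       else if v = b \<and> m = 2 ^ lb \<and> f = 8 then 32 * 2 ^ la else if v = a \<and> m = 2 ^ la \<and> f = 8 then 32 * 2 ^ lb
       else if v = b \<and> m = 2 ^ lb \<and> f = 13 then ad a 0 else if v = a \<and> m = 2 ^ la \<and> f = 13 then ad b 0
       else if v = b \<and> m = 2 ^ lb \<and> f = 9 then ew {a, b} else if v = a \<and> m = 2 ^ la \<and> f = 9 then ew {a, b}
       else M (ad v m + f))" if "v < n" "m < 2 ^ D" "f < 32" for v m f
  proof -
    have eq: "k < 2 ^ D \<Longrightarrow> g < 32 \<Longrightarrow> (ad v m + f = ad u k + g) = (v = u \<and> m = k \<and> f = g)" for u k g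
      using ad_eq that by blast
    show ?thesis unfolding M' l fun_upd_apply by (simp add: eq P del: power_Suc cong: if_cong split del: if_split)
  qed
  have lo: "M' x = M x" if "x < base" for x
    unfolding M' using below_ad[OF that] by simp
  have e: "edges_in M'"
    using edges_in_agree[of M M'] lo I by (simp add: edges_read_def)
  have 1: "M' (2 + v) = ad v 0 \<and> M' (ad v 0) = 0 \<and> M' (ad v 0 + 10) = v \<and> M' (ad v 0 + 11) = 32 * 2 ^ length (A' v) \<and>
      M' (ad v 0 + 12) = vw v \<and> M' (ad v 0 + 14) = length (A' v) \<and> M' (ad v 0 + 15) = 0" if v: "v < n" for v
  proof -
    have "M' (2 + v) = M (2 + v)" using lo[of "2 + v"] v by (simp add: base_def)
    then show ?thesis using I v rd[of v 0 0] rd[of v 0 10] rd[of v 0 11] rd[of v 0 12] rd[of v 0 14] rd[of v 0 15]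
      by (auto simp: edges_read_def A' lA A_def[symmetric])
  qed
  have 2: "M' (ad v (2 ^ j) + 9) = ew {v, A' v ! j} \<and> M' (ad v (2 ^ j) + 13) = ad (A' v ! j) 0 \<and>
        (\<exists>i<length (A' (A' v ! j)). A' (A' v ! j) ! i = v \<and> M' (ad v (2 ^ j) + 8) = 32 * 2 ^ i)"
    if v: "v < n" and j: "j < length (A' v)" for v j
  proof (cases "j < length (A v)")
    case True
    define c where "c = A v ! j"
    have c: "A' v ! j = c" using True by (auto simp: A' nth_append c_def)
    have lt: "(2::nat) ^ j < 2 ^ D"
      using le'[OF v] True by (auto simp: A' split: if_splits)
    have ne: "v = a \<Longrightarrow> (2::nat) ^ j \<noteq> 2 ^ la" "v = b \<Longrightarrow> (2::nat) ^ j \<noteq> 2 ^ lb" using True lA by auto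
    have f: "M' (ad v (2 ^ j) + f) = M (ad v (2 ^ j) + f)" if "f < 32" for f
      using rd[OF v lt that] ne by auto
    obtain i where i: "i < length (A c)" "A c ! i = v" "M (ad v (2 ^ j) + 8) = 32 * 2 ^ i"
      and c9: "M (ad v (2 ^ j) + 9) = ew {v, c}" "M (ad v (2 ^ j) + 13) = ad c 0"
      using I v True unfolding edges_read_def c_def A_def by blast
    have "i < length (A' c)" "A' c ! i = v" using i by (auto simp: A' nth_append)
    then show ?thesis unfolding c using c9 i(3) by (auto simp: f)
  next
    case False
    then have "v = a \<and> j = la \<or> v = b \<and> j = lb" using j lA by (auto simp: A' split: if_splits)
    then show ?thesis
    proof (elim disjE conjE)
      assume va: "v = a" "j = la"
      have "A' v ! j = b" "A' b ! lb = a" "lb < length (A' b)" using va ab by (simp_all add: A' lA[symmetric])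
      then show ?thesis using va ab rd[of a "2 ^ la" 9] rd[of a "2 ^ la" 13] rd[of a "2 ^ la" 8] P by auto
    next
      assume va: "v = b" "j = lb"
      have "A' v ! j = a" "A' a ! la = b" "la < length (A' a)" using va ab by (simp_all add: A' lA[symmetric])
      then show ?thesis using va ab rd[of b "2 ^ lb" 9] rd[of b "2 ^ lb" 13] rd[of b "2 ^ lb" 8] P
        by (auto simp: insert_commute)
    qed
  qed
  have 3: "M' (ad v m + 3) = 0" if "v < n" "m < 2 ^ D" for v m
    using I that rd[OF that, of 3] by (simp add: edges_read_def)
  show ?thesis unfolding edges_read_def A'_def[symmetric] using 1 2 3 e by blast
qed

text \<open>The first \<open>l\<close> masks of \<open>v\<close> are finished. Field 8 of a
  single-bit record has its final value or still the provisional offset, according to whether its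
  mask is below \<open>l\<close>.\<close>

definition record_ok :: "(nat \<Rightarrow> nat) \<Rightarrow> nat \<Rightarrow> nat \<Rightarrow> bool" where
  "record_ok M l v \<longleftrightarrow> l \<le> 2 ^ d v \<and>
     M (ad v 0) = 0 \<and> M (ad v 0 + 10) = v \<and> M (ad v 0 + 11) = 32 * 2 ^ d v \<and> M (ad v 0 + 12) = vw v \<and>
     M (ad v 0 + 14) = d v \<and> M (ad v 0 + 15) = 0 \<and> (0 < l \<longrightarrow> M (ad v 0 + 17) = ad v 0) \<and>
     (\<forall>m. 0 < m \<and> m < l \<longrightarrow> M (ad v m) = vw v \<and> M (ad v m + 17) = ad v 0 \<and>
        (\<exists>j. 2 ^ j \<le> m \<and> m < 2 ^ Suc j \<and> M (ad v m + 18) = 32 * 2 ^ j)) \<and>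
     (\<forall>j<d v. M (ad v (2 ^ j) + 9) = ew {v, nbr v j} \<and> M (ad v (2 ^ j) + 13) = ad (nbr v j) 0 \<and>
        (\<exists>i<d (nbr v j). nbr (nbr v j) i = v \<and> M (ad v (2 ^ j) + 8) =
           (if 2 ^ j < l then ad (nbr v j) (2 ^ d (nbr v j) - 1 - 2 ^ i) else 32 * 2 ^ i))) \<and>
     (\<forall>m<2 ^ D. M (ad v m + 3) = (if 0 < m \<and> m < l then 1 else 0))"

lemma pow_d_le: "v < n \<Longrightarrow> (2::nat) ^ d v \<le> 2 ^ D"
  using d_le V_eq by simp

lemma record_ok_0: assumes "edges_read es M" "v < n" shows "record_ok M 0 v"
  using assms unfolding edges_read_def record_ok_def d_def nbr_def by simp

lemma record_ok_agree:
  assumes I: "record_ok M l v" and v: "v < n" and a: "\<And>k f. k < 2 ^ D \<Longrightarrow> f < 32 \<Longrightarrow> M' (ad v k + f) = M (ad v k + f)"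
  shows "record_ok M' l v"
proof -
  have p: "(2::nat) ^ j < 2 ^ D" if "j < d v" for j
    using that d_le[of v] V_eq v by simp
  have "l \<le> 2 ^ d v" using I by (simp add: record_ok_def)
  then have p': "m < 2 ^ D" if "m < l" for m
    using that pow_d_le[OF v] by linarith
  have a0: "M' (ad v k) = M (ad v k)" if "k < 2 ^ D" for k using a[OF that, of 0] by simp
  have s: "M' (ad v (2 ^ j) + f) = M (ad v (2 ^ j) + f)" if "j < d v" "f < 32" for j f using a p that by blast
  show ?thesis using I unfolding record_ok_def by (simp add: a a0 s p' del: power_Suc cong: conj_cong)
qed

lemma record_ok_start:
  assumes I: "record_ok M 0 v" and v: "v < n"
  shows "record_ok (M(ad v 0 + 17 := ad v 0)) 1 v"
proof -
  define M' where "M' = M(ad v 0 + 17 := ad v 0)"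
  have rd: "M' (ad v m + f) = (if m = 0 \<and> f = 17 then ad v 0 else M (ad v m + f))"
    if "m < 2 ^ D" "f < 32" for m f
    using that ad_eq[of m 0 f 17 v v] by (simp add: M'_def)
  have p: "(2::nat) ^ j < 2 ^ D" if "j < d v" for j
    using that d_le[of v] V_eq v by simp
  have r0: "M' (ad v k) = M (ad v k)" if "k < 2 ^ D" for k using rd[OF that, of 0] by simp
  have s: "M' (ad v (2 ^ j) + f) = M (ad v (2 ^ j) + f)" if "j < d v" "f < 32" for j f
    using rd[OF p[OF that(1)] that(2)] by simp
  show ?thesis using I unfolding record_ok_def M'_def[symmetric] by (simp add: rd r0 s del: power_Suc) auto
qed

lemma record_ok_done:
  assumes I: "\<And>v. v < n \<Longrightarrow> record_ok M (2 ^ d v) v"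
  shows "static M" "todo M {}"
proof -
  \<comment> \<open>The full mask without the bit of \<open>v\<close> selects all other neighbours
    of \<open>c\<close>; it is the witness that \<open>static\<close> asks for.\<close>
  have c: "\<exists>m. m < 2 ^ d c \<and> ad c (2 ^ d c - 1 - 2 ^ i) = ad c m \<and> nbrs c m = nb c - {v}"
    if "i < d c" "nbr c i = v" for c i v
  proof (intro exI conjI)
    have "i \<in> slots (2 ^ d c - 1)" using that unfolding slots_full by simp
    then show "nbrs c (2 ^ d c - 1 - 2 ^ i) = nb c - {v}"
      using nbrs_remove(1)[of "2 ^ d c - 1" c i] nbrs_full that by simp
  qed (auto simp: less_imp_diff_less)
  have z: "M (ad v 0) = 0" "M (ad v 0 + 17) = ad v 0" if "v < n" for v
    using I[OF that] unfolding record_ok_def by auto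
  have m: "M (ad v m) = vw v \<and> M (ad v m + 17) = ad v 0 \<and>
        (\<exists>j. 2 ^ j \<le> m \<and> m < 2 ^ Suc j \<and> M (ad v m + 18) = 32 * 2 ^ j)" if "v < n" "m < 2 ^ d v" "0 < m" for v m
    using I[OF that(1)] that unfolding record_ok_def by auto
  have 1: "M (ad v m) = (if m = 0 then 0 else vw v) \<and> M (ad v m + 17) = ad v 0 \<and>
       (0 < m \<longrightarrow> (\<exists>j. 2 ^ j \<le> m \<and> m < 2 ^ Suc j \<and> M (ad v m + 18) = 32 * 2 ^ j))" if "v < n \<and> m < 2 ^ d v" for v m
    using z[of v] m[of v m] that by (cases "m = 0") auto
  have 2: "M (ad v (2 ^ j) + 9) = ew {v, nbr v j} \<and> M (ad v (2 ^ j) + 13) = ad (nbr v j) 0 \<and>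
       (\<exists>m. m < 2 ^ d (nbr v j) \<and> M (ad v (2 ^ j) + 8) = ad (nbr v j) m \<and> nbrs (nbr v j) m = nb (nbr v j) - {v})"
    if vj: "v < n \<and> j < d v" for v j
  proof -
    obtain i where i: "i < d (nbr v j)" "nbr (nbr v j) i = v"
      "M (ad v (2 ^ j) + 8) = ad (nbr v j) (2 ^ d (nbr v j) - 1 - 2 ^ i)"
      and f: "M (ad v (2 ^ j) + 9) = ew {v, nbr v j}" "M (ad v (2 ^ j) + 13) = ad (nbr v j) 0"
      using I[of v] vj unfolding record_ok_def by auto
    show ?thesis unfolding i(3) using f c[OF i(1,2)] by blast
  qed
  have 3: "M (ad v 0 + 10) = v \<and> M (ad v 0 + 11) = 32 * 2 ^ d v \<and> M (ad v 0 + 12) = vw v \<and>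
       M (ad v 0 + 14) = d v \<and> M (ad v 0 + 15) = 0" if "v < n" for v
    using I[OF that] unfolding record_ok_def by blast
  show "static M" unfolding static_def using 1 2 3 by blast
  show "todo M {}" using I unfolding record_ok_def todo_def valid_def by auto
qed

lemma record_ok_step:
  assumes I: "record_ok M m v" and v: "v < n" "0 < m" "m < 2 ^ d v"
    and e: "2 ^ e \<le> m" "m < 2 ^ Suc e" and deg11: "\<And>u. u < n \<Longrightarrow> M (ad u 0 + 11) = 32 * 2 ^ d u"
    and M1: "M1 = (if m = 2 ^ e then M(ad v m + 8 := M (ad v m + 13) + M (M (ad v m + 13) + 11) - 32 - M (ad v m + 8)) else M)"
    and M': "M' = M1(ad v m + 0 := vw v, ad v m + 17 := ad v 0, ad v m + 3 := 1, ad v m + 18 := 32 * 2 ^ e)"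
  shows "record_ok M' (Suc m) v"
proof -
  have p: "(2::nat) ^ j < 2 ^ D" if "j < d v" for j
    using that d_le[of v] V_eq v by simp
  have mD: "m < 2 ^ D" using v(3) pow_d_le[OF v(1)] by linarith
  define w where "w = M (ad v m + 13) + M (M (ad v m + 13) + 11) - 32 - M (ad v m + 8)"
  have rd: "M' (ad u k + f) = (if u = v \<and> k = m \<and> f = 18 then 32 * 2 ^ e else if u = v \<and> k = m \<and> f = 3 then 1
      else if u = v \<and> k = m \<and> f = 17 then ad v 0 else if u = v \<and> k = m \<and> f = 0 then vw v
      else if m = 2 ^ e \<and> u = v \<and> k = m \<and> f = 8 then w else M (ad u k + f))" if "k < 2 ^ D" "f < 32" for u k f
  proof -
    have eq: "g < 32 \<Longrightarrow> (ad u k + f = ad v m + g) = (u = v \<and> k = m \<and> f = g)" for g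
      using ad_eq that mD by blast
    have eq0: "(ad u k + f = ad v m) = (u = v \<and> k = m \<and> f = 0)" using eq[of 0] by simp
    have 1: "M1 (ad u k + f) = (if m = 2 ^ e \<and> u = v \<and> k = m \<and> f = 8 then w else M (ad u k + f))"
      unfolding M1 w_def[symmetric] using eq[of 8] by auto
    show ?thesis unfolding M' fun_upd_apply by (simp add: eq eq0 1 cong: if_cong split del: if_split)
  qed
  have r0: "M' (ad u k) = (if u = v \<and> k = m then vw v else M (ad u k))" if "k < 2 ^ D" for u k
    using rd[OF that, of 0] by auto
  have w: "w = ad (nbr v e) (2 ^ d (nbr v e) - 1 - 2 ^ i)"
    if "m = 2 ^ e" "e < d v" "i < d (nbr v e)" "M (ad v (2 ^ e) + 13) = ad (nbr v e) 0"
      "M (ad v (2 ^ e) + 8) = 32 * 2 ^ i" "nbr v e < n" "M (ad (nbr v e) 0 + 11) = 32 * 2 ^ d (nbr v e)" for i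
  proof -
    have "Suc (2 ^ i) \<le> (2::nat) ^ d (nbr v e)" using that(3) by (simp add: Suc_le_eq)
    moreover have "w = ad (nbr v e) 0 + 32 * 2 ^ d (nbr v e) - 32 - 32 * 2 ^ i" using that unfolding w_def by simp
    ultimately show ?thesis unfolding ad_def by simp
  qed
  have 0: "Suc m \<le> 2 ^ d v" using v by simp
  have 1: "M' (ad v 0) = 0" "M' (ad v 0 + 10) = v" "M' (ad v 0 + 11) = 32 * 2 ^ d v" "M' (ad v 0 + 12) = vw v"
    "M' (ad v 0 + 14) = d v" "M' (ad v 0 + 15) = 0" "M' (ad v 0 + 17) = ad v 0"
    using I v(2) by (simp_all add: record_ok_def rd r0)
  have 2: "M' (ad v k) = vw v \<and> M' (ad v k + 17) = ad v 0 \<and>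
        (\<exists>j. 2 ^ j \<le> k \<and> k < 2 ^ Suc j \<and> M' (ad v k + 18) = 32 * 2 ^ j)" if "0 < k" "k < Suc m" for k
  proof (cases "k = m")
    case True
    have "M' (ad v m + 17) = ad v 0" "M' (ad v m + 18) = 32 * 2 ^ e" using rd[OF mD] by simp_all
    then show ?thesis using True e r0[OF mD] by auto
  next
    case False
    then have k: "k < m" "k < 2 ^ D" using that mD by auto
    have "M (ad v k) = vw v \<and> M (ad v k + 17) = ad v 0 \<and>
        (\<exists>j. 2 ^ j \<le> k \<and> k < 2 ^ Suc j \<and> M (ad v k + 18) = 32 * 2 ^ j)"
      using I k(1) that(1) unfolding record_ok_def by blast
    then show ?thesis using rd[OF k(2), of 17 v] rd[OF k(2), of 18 v] r0[OF k(2), of v] False by simp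
  qed
  have 3: "M' (ad v (2 ^ j) + 9) = ew {v, nbr v j} \<and> M' (ad v (2 ^ j) + 13) = ad (nbr v j) 0 \<and>
        (\<exists>i<d (nbr v j). nbr (nbr v j) i = v \<and> M' (ad v (2 ^ j) + 8) =
           (if 2 ^ j < Suc m then ad (nbr v j) (2 ^ d (nbr v j) - 1 - 2 ^ i) else 32 * 2 ^ i))" if j: "j < d v" for j
  proof -
    obtain i where i: "i < d (nbr v j)" "nbr (nbr v j) i = v"
      "M (ad v (2 ^ j) + 8) = (if 2 ^ j < m then ad (nbr v j) (2 ^ d (nbr v j) - 1 - 2 ^ i) else 32 * 2 ^ i)"
      and f: "M (ad v (2 ^ j) + 9) = ew {v, nbr v j}" "M (ad v (2 ^ j) + 13) = ad (nbr v j) 0"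
      using I j unfolding record_ok_def by blast
    have f': "M' (ad v (2 ^ j) + 9) = ew {v, nbr v j}" "M' (ad v (2 ^ j) + 13) = ad (nbr v j) 0"
      using f p[OF j] by (simp_all add: rd)
    have "M' (ad v (2 ^ j) + 8) = (if 2 ^ j < Suc m then ad (nbr v j) (2 ^ d (nbr v j) - 1 - 2 ^ i) else 32 * 2 ^ i)"
    proof (cases "2 ^ j = m")
      case True
      have je: "j = e"
      proof (rule ccontr)
        assume "j \<noteq> e"
        then consider "j < e" | "Suc e \<le> j" by linarith
        then show False
        proof cases
          case 1
          then have "(2::nat) ^ j < 2 ^ e" by simp
          then show False using e True by simp
        next
          case 2
          then have "(2::nat) ^ Suc e \<le> 2 ^ j" by (intro power_increasing) auto
          then show False using e True by simp
        qed
      qed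
      have "nbr v j < n" using nbr_in[OF j] nb_sub V_eq by blast
      then have "w = ad (nbr v j) (2 ^ d (nbr v j) - 1 - 2 ^ i)"
        using w[of i] True je j i f deg11 by simp
      moreover have "M' (ad v (2 ^ j) + 8) = w" using rd[OF p[OF j], of 8 v] True je by simp
      ultimately show ?thesis using True by simp
    next
      case False
      then show ?thesis using rd[OF p[OF j], of 8 v] i(3) by auto
    qed
    then show ?thesis using f' i by blast
  qed
  have 4: "M' (ad v k + 3) = (if 0 < k \<and> k < Suc m then 1 else 0)" if "k < 2 ^ D" for k
    using I that rd[OF that, of 3 v] v(2) by (auto simp: record_ok_def)
  show ?thesis unfolding record_ok_def using 0 1 2 3 4 by blast
qed

text \<open>\<open>L\<close> tells how far each vertex has got. Records of different vertices are
  disjoint, so a change confined to those of \<open>v\<close> affects only its own entry.\<close>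

lemma records_update:
  assumes I: "\<And>u. u < n \<Longrightarrow> record_ok M (L u) u" and "record_ok M' l v"
    and a: "\<And>x. (\<And>m f. m < 2 ^ D \<Longrightarrow> f < 32 \<Longrightarrow> x \<noteq> ad v m + f) \<Longrightarrow> M' x = M x" and u: "u < n"
  shows "record_ok M' ((L(v := l)) u) u"
proof (cases "u = v")
  case False
  have "record_ok M' (L u) u"
  proof (rule record_ok_agree[OF I[OF u] u])
    fix k f :: nat assume kf: "k < 2 ^ D" "f < 32"
    show "M' (ad u k + f) = M (ad u k + f)" by (rule a) (use ad_eq kf False in blast)
  qed
  then show ?thesis using False by simp
qed (use assms(2) in simp)

lemma records_start:
  assumes I: "\<And>u. u < n \<Longrightarrow> record_ok M (L u) u" and v: "v < n" "L v = 0" and u: "u < n"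
  shows "record_ok (M(ad v 0 + 17 := ad v 0)) ((L(v := 1)) u) u"
proof (rule records_update[OF I _ _ u])
  show "record_ok (M(ad v 0 + 17 := ad v 0)) 1 v" using record_ok_start I v by metis
  fix x assume x: "\<And>m f. m < 2 ^ D \<Longrightarrow> f < 32 \<Longrightarrow> x \<noteq> ad v m + f"
  show "(M(ad v 0 + 17 := ad v 0)) x = M x" using x[of 0 17] by simp
qed

lemma records_step:
  assumes I: "\<And>u. u < n \<Longrightarrow> record_ok M (L u) u" and v: "v < n" "L v = m" "0 < m" "m < 2 ^ d v"
    and e: "2 ^ e \<le> m" "m < 2 ^ Suc e"
    and M1: "M1 = (if m = 2 ^ e then M(ad v m + 8 := M (ad v m + 13) + M (M (ad v m + 13) + 11) - 32 - M (ad v m + 8)) else M)"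
    and M': "M' = M1(ad v m + 0 := vw v, ad v m + 17 := ad v 0, ad v m + 3 := 1, ad v m + 18 := 32 * 2 ^ e)"
  shows "\<forall>u<n. record_ok M' ((L(v := Suc m)) u) u"
proof (intro allI impI, rule records_update[OF I])
  show "record_ok M' (Suc m) v"
    using record_ok_step[OF _ v(1,3,4) e _ M1 M'] I[OF v(1)] I v(2) unfolding record_ok_def by auto
  have mD: "m < 2 ^ D" using v(4) pow_d_le[OF v(1)] by linarith
  fix x assume "\<And>m f. m < 2 ^ D \<Longrightarrow> f < 32 \<Longrightarrow> x \<noteq> ad v m + f"
  note x = this[OF mD]
  show "M' x = M x" unfolding M' M1 using x[of 0] x[of 3] x[of 8] x[of 17] x[of 18] by auto
qed

lemma ad_next: "ad v 0 + 32 * 2 ^ D = ad (Suc v) 0"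
  by (simp add: ad_def)

section \<open>Correctness and time of the reading programs\<close>

lemma wp_read_vertices:
  fixes s :: ram_state
  assumes "vertices_read 0 (mem s)" "regs s rI = 0" "regs s rN = n" "regs s rP = base" "regs s rQ = 2"
  shows "wp (While (Less rI rN) (read_vertex (32 * 2 ^ D))) s
    (\<lambda>t s'. t \<le> 20 * n + 1 \<and> vertices_read n (mem s') \<and> regs s' rP = heap0 \<and> regs s' rQ = 2 + n)"
proof -
  let ?I = "\<lambda>s. \<exists>k\<le>n. regs s rI = k \<and> regs s rN = n \<and> regs s rP = ad k 0 \<and> regs s rQ = 2 + k \<and> vertices_read k (mem s)"
  let ?f = "\<lambda>s. 20 * (n - regs s rI) + 1"
  have "wp (While (Less rI rN) (read_vertex (32 * 2 ^ D))) s (\<lambda>t s'. t \<le> ?f s \<and> ?I s' \<and> \<not> holds (Less rI rN) s')"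
  proof (rule wp_While[where f = ?f])
    show "?I s" using assms by (auto simp: ad_def)
  next
    fix s assume I: "?I s" and b: "holds (Less rI rN) s"
    then obtain k where k: "k < n" "regs s rI = k" "regs s rN = n" "regs s rP = ad k 0" "regs s rQ = 2 + k"
      "vertices_read k (mem s)" by auto
    have st: "vertices_read (Suc k) ((mem s)(ad k 0 + 12 := mem s (2 + k), ad k 0 + 10 := k, ad k 0 + 11 := 32, 2 + k := ad k 0))"
      by (rule vertices_read_step[OF k(6,1) refl])
    show "wp (read_vertex (32 * 2 ^ D)) s (\<lambda>t s'. ?I s' \<and> Suc t + ?f s' \<le> ?f s)"
      using st k unfolding read_vertex_def by (simp add: ad_next)
  qed simp
  then show ?thesis by (rule wp_mono) (use assms in \<open>auto simp: heap0_def\<close>)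
qed

lemma wp_read_edges:
  fixes s :: ram_state
  assumes "edges_read [] (mem s)" "regs s rI = 0" "regs s rM = length es" "regs s rQ = 2 + n"
  shows "wp (While (Less rI rM) read_edge) s (\<lambda>t s'. t \<le> 80 * length es + 1 \<and> edges_read es (mem s'))"
proof -
  let ?I = "\<lambda>s. \<exists>k\<le>length es. regs s rI = k \<and> regs s rM = length es \<and> regs s rQ = 2 + n + 3 * k \<and> edges_read (take k es) (mem s)"
  let ?f = "\<lambda>s. 80 * (length es - regs s rI) + 1"
  have "wp (While (Less rI rM) read_edge) s (\<lambda>t s'. t \<le> ?f s \<and> ?I s' \<and> \<not> holds (Less rI rM) s')"
  proof (rule wp_While[where f = ?f])
    show "?I s" using assms by auto
  next
    fix s assume I: "?I s" and b: "holds (Less rI rM) s"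
    then obtain k where k: "k < length es" "regs s rI = k" "regs s rM = length es" "regs s rQ = 2 + n + 3 * k"
      "edges_read (take k es) (mem s)" by auto
    define a b where "a = fst (es ! k)" and "b = snd (es ! k)"
    let ?xs = "take k es"
    have tk: "take (Suc k) es = ?xs @ [(a, b)]" using k(1) by (simp add: take_Suc_conv_app_nth a_def b_def)
    have ab: "a < n" "b < n" "a \<noteq> b" using es_less[OF k(1)] by (simp_all add: a_def b_def)
    have le: "length (adjl (?xs @ [(a, b)]) v) \<le> D" if "v < n" for v
    proof -
      have "length (adjl (take (Suc k) es) v) \<le> length (adjl (take (Suc k) es @ drop (Suc k) es) v)"
        unfolding adjl_append by simp
      then have "length (adjl (take (Suc k) es) v) \<le> d v" by (simp add: d_def)
      then show ?thesis using d_le[of v] that V_eq unfolding tk by simp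
    qed
    note st = edges_read_step[OF k(5) ab le refl]
    have in1: "mem s (2 + n + 3 * k) = a" "mem s (2 + n + 3 * k + 1) = b" "mem s (2 + n + 3 * k + 2) = ew {a, b}"
      using k(1,5) unfolding edges_read_def edges_in_def a_def b_def by blast+
    have in2: "mem s (2 + v) = ad v 0" "mem s (ad v 0 + 11) = 32 * 2 ^ length (adjl ?xs v)"
      "mem s (ad v 0 + 14) = length (adjl ?xs v)" if "v < n" for v
      using k(5) that unfolding edges_read_def by blast+
    note ad0 = ad_add[of _ 0, simplified]
    show "wp read_edge s (\<lambda>t s'. ?I s' \<and> Suc t + ?f s' \<le> ?f s)"
      using st in1 in2[OF ab(1)] in2[OF ab(2)] k(1-4) unfolding read_edge_def
      by (simp add: ad0 tk)
  qed simp
  then show ?thesis by (rule wp_mono) (use assms in auto)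
qed

text \<open>On entry \<open>m\<close> may equal \<open>2 ^ Suc e\<close>: then a new highest bit
  begins, which the program recognises by doubling \<open>rHB\<close>. The other cases separate
  powers of two from the remaining masks.\<close>

lemma wp_make_record:
  fixes s :: ram_state
  assumes I: "\<And>u. u < n \<Longrightarrow> record_ok (mem s) (L u) u" and v: "v < n" "L v = m" "0 < m" "m < 2 ^ d v"
    and r: "regs s rP = ad v 0" "regs s rI = 32 * m" "regs s rW = vw v" "regs s rHB = 32 * 2 ^ e"
    and e: "2 ^ e \<le> m" "m \<le> 2 ^ Suc e"
  shows "wp make_record s (\<lambda>t s'. t \<le> 45 \<and> (\<forall>u<n. record_ok (mem s') ((L(v := Suc m)) u) u) \<and>
    regs s' rI = 32 * Suc m \<and> (\<exists>e. regs s' rHB = 32 * 2 ^ e \<and> 2 ^ e \<le> Suc m \<and> Suc m \<le> 2 ^ Suc e))"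
proof -
  note ad0 = ad_add[of _ 0, simplified]
  consider "m = 2 ^ Suc e" | "m < 2 ^ Suc e" "m = 2 ^ e" | "m < 2 ^ Suc e" "m \<noteq> 2 ^ e" using e by linarith
  then show ?thesis
  proof cases
    case 1
    then have e': "2 ^ Suc e \<le> m" "m < 2 ^ Suc (Suc e)" by simp_all
    have x: "\<exists>e. 64 * 2 ^ f = (32 * 2 ^ e :: nat) \<and> 2 ^ e \<le> Suc (2 * 2 ^ f) \<and> Suc (2 * 2 ^ f) \<le> (2::nat) * 2 ^ e" for f
      by (rule exI[of _ "Suc f"]) simp
    have ad1: "ad v 0 + 64 * 2 ^ e = ad v (2 * 2 ^ e)" using ad0[of v "2 * 2 ^ e"] by simp
    show ?thesis using records_step[OF I v e' refl refl] r 1 x[of e] unfolding make_record_def by (simp add: ad1)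
  next
    case 2
    show ?thesis using records_step[OF I v e(1) 2(1) refl refl] r 2 unfolding make_record_def
      by (simp add: ad0)
  next
    case 3
    have "32 * m \<noteq> 32 * 2 ^ e + 32 * 2 ^ e" using 3 by simp
    then show ?thesis using records_step[OF I v e(1) 3(1) refl refl] r 3 e(1) unfolding make_record_def
      by (simp add: ad0)
  qed
qed

lemma wp_make_records:
  fixes s :: ram_state
  assumes I: "\<And>u. u < n \<Longrightarrow> record_ok (mem s) (L u) u" and v: "v < n" "L v = 0" and r: "regs s rP = ad v 0"
  shows "wp (make_records (32 * 2 ^ D)) s (\<lambda>t s'. t \<le> 50 * 2 ^ D + 20 \<and>
    (\<forall>u<n. record_ok (mem s') ((L(v := 2 ^ d v)) u) u) \<and> regs s' rP = ad (Suc v) 0)"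
proof -
  let ?I = "\<lambda>s. \<exists>m. 0 < m \<and> m \<le> 2 ^ d v \<and> (\<forall>u<n. record_ok (mem s) ((L(v := m)) u) u) \<and> regs s rP = ad v 0 \<and>
    regs s rI = 32 * m \<and> regs s rW = vw v \<and> regs s rQE = 32 * 2 ^ d v \<and>
    (\<exists>e. regs s rHB = 32 * 2 ^ e \<and> 2 ^ e \<le> m \<and> m \<le> 2 ^ Suc e)"
  let ?f = "\<lambda>s. 50 * (2 ^ d v - regs s rI div 32) + 1"
  have loop: "wp (While (Less rI rQE) make_record) s' (\<lambda>t s'. t \<le> 50 * 2 ^ D + 1 \<and>
      (\<forall>u<n. record_ok (mem s') ((L(v := 2 ^ d v)) u) u) \<and> regs s' rP = ad v 0)" if s': "?I s'" for s' :: ram_state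
  proof -
    have "wp (While (Less rI rQE) make_record) s' (\<lambda>t s. t \<le> ?f s' \<and> ?I s \<and> \<not> holds (Less rI rQE) s)"
    proof (rule wp_While[where f = ?f])
      show "?I s'" by (rule s')
    next
      fix s assume Is: "?I s" and b: "holds (Less rI rQE) s"
      then obtain m e where m: "0 < m" "m < 2 ^ d v" "\<forall>u<n. record_ok (mem s) ((L(v := m)) u) u" "regs s rP = ad v 0"
        "regs s rI = 32 * m" "regs s rW = vw v" "regs s rQE = 32 * 2 ^ d v"
        "regs s rHB = 32 * 2 ^ e" "2 ^ e \<le> m" "m \<le> 2 ^ Suc e" by auto
      have w: "wp make_record s (\<lambda>t s'. t \<le> 45 \<and> (\<forall>u<n. record_ok (mem s') (((L(v := m))(v := Suc m)) u) u) \<and>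
          regs s' rI = 32 * Suc m \<and> (\<exists>e. regs s' rHB = 32 * 2 ^ e \<and> 2 ^ e \<le> Suc m \<and> Suc m \<le> 2 ^ Suc e))"
        by (rule wp_make_record[of s "L(v := m)" v m e]) (use m v in auto)
      have wr: "writes make_record = {rT, rX, rY, rHB, rC, rS, rA, rI}" unfolding make_record_def by auto
      show "wp make_record s (\<lambda>t s'. ?I s' \<and> Suc t + ?f s' \<le> ?f s)"
      proof (rule wp_frame[OF w], elim conjE, rule conjI, rule exI[of _ "Suc m"])
        fix t :: nat and s' :: ram_state assume t: "t \<le> 45" and i: "regs s' rI = 32 * Suc m"
        show "Suc t + ?f s' \<le> ?f s" using t i m(2) unfolding i m(5) by simp
      qed (use m in \<open>simp_all add: wr\<close>)
    qed simp
    then show ?thesis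
    proof (rule wp_mono, elim conjE exE, intro conjI)
      fix t m e :: nat and s'' :: ram_state
      assume h: "t \<le> 50 * (2 ^ d v - regs s' rI div 32) + 1" "\<not> holds (Less rI rQE) s''" "regs s'' rI = 32 * m"
        "regs s'' rQE = 32 * 2 ^ d v" "m \<le> 2 ^ d v" "\<forall>u<n. record_ok (mem s'') ((L(v := m)) u) u"
      show "t \<le> 50 * 2 ^ D + 1" using h(1) pow_d_le[OF v(1)] by linarith
      have "m = 2 ^ d v" using h(2-5) by simp
      then show "\<forall>u<n. record_ok (mem s'') ((L(v := 2 ^ d v)) u) u" using h(6) by simp
    qed
  qed
  define s1 where "s1 = set_mem (ad v 0 + 17) (ad v 0) (set_reg rT (ad v 0 + 17) (set_reg rI 32 (set_reg rHB 32
     (set_reg rW (vw v) (set_reg rQE (32 * 2 ^ d v) s)))))"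
  have f: "mem s (ad v 0 + 11) = 32 * 2 ^ d v" "mem s (ad v 0 + 12) = vw v"
    using I[OF v(1)] by (auto simp: record_ok_def)
  have st: "\<forall>u<n. record_ok ((mem s)(ad v 0 + 17 := ad v 0)) ((L(v := 1)) u) u"
    using records_start[OF I v] by blast
  have I1: "?I s1"
    by (rule exI[of _ 1], intro conjI exI[of _ 0]) (use st r in \<open>simp_all add: s1_def\<close>)
  show ?thesis unfolding make_records_def
    by (simp add: r f s1_def[symmetric]) (rule wp_mono[OF loop[OF I1]], simp add: ad_next)
qed

lemma wp_make_all_records:
  fixes s :: ram_state
  assumes I: "\<And>u. u < n \<Longrightarrow> record_ok (mem s) 0 u" and r: "regs s rP = base" "regs s rE = heap0"
  shows "wp (While (Less rP rE) (make_records (32 * 2 ^ D))) s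
    (\<lambda>t s'. t \<le> n * (50 * 2 ^ D + 21) + 1 \<and> static (mem s') \<and> todo (mem s') {})"
proof -
  let ?P = "While (Less rP rE) (make_records (32 * 2 ^ D))"
  let ?k = "\<lambda>s. (regs s rP - base) div (32 * 2 ^ D)"
  let ?I = "\<lambda>s. \<exists>v\<le>n. regs s rP = ad v 0 \<and> regs s rE = heap0 \<and> (\<forall>u<n. record_ok (mem s) (if u < v then 2 ^ d u else 0) u)"
  let ?f = "\<lambda>s. (n - ?k s) * (50 * 2 ^ D + 21) + 1"
  have k: "?k s = v" if "regs s rP = ad v 0" for s :: ram_state and v
    using that by (simp add: ad_def)
  have lt: "ad v 0 < heap0 \<longleftrightarrow> v < n" for v by (simp add: ad_def heap0_def)
  have "wp ?P s (\<lambda>t s'. t \<le> ?f s \<and> ?I s' \<and> \<not> holds (Less rP rE) s')"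
  proof (rule wp_While[where f = ?f])
    show "?I s" by (rule exI[of _ 0]) (use I r in \<open>auto simp: ad_def\<close>)
  next
    fix s assume "?I s" and b: "holds (Less rP rE) s"
    then obtain v where v: "v < n" "regs s rP = ad v 0" "regs s rE = heap0"
      "\<forall>u<n. record_ok (mem s) (if u < v then 2 ^ d u else 0) u" using lt by auto
    let ?L = "\<lambda>u. if u < v then 2 ^ d u else 0"
    have L: "(?L(v := 2 ^ d v)) u = (if u < Suc v then 2 ^ d u else 0)" for u by auto
    have w: "wp (make_records (32 * 2 ^ D)) s (\<lambda>t s'. t \<le> 50 * 2 ^ D + 20 \<and>
      (\<forall>u<n. record_ok (mem s') ((?L(v := 2 ^ d v)) u) u) \<and> regs s' rP = ad (Suc v) 0)"
      by (rule wp_make_records) (use v in auto)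
    note w = w[unfolded L]
    have wr: "rE \<notin> writes (make_records (32 * 2 ^ D))" unfolding make_records_def make_record_def by auto
    show "wp (make_records (32 * 2 ^ D)) s (\<lambda>t s'. ?I s' \<and> Suc t + ?f s' \<le> ?f s)"
    proof (rule wp_frame[OF w], elim conjE, intro conjI exI[of _ "Suc v"])
      fix t :: nat and s' :: ram_state assume t: "t \<le> 50 * 2 ^ D + 20" and s': "regs s' rP = ad (Suc v) 0"
        and re: "\<And>x. x \<notin> writes (make_records (32 * 2 ^ D)) \<Longrightarrow> regs s' x = regs s x"
      obtain j where j: "n = Suc v + j" using v(1) less_natE by auto
      show "Suc t + ?f s' \<le> ?f s" unfolding k[OF s'] k[OF v(2)] using t by (simp add: j)
      show "regs s' rE = heap0" using re[OF wr] v by simp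
    qed (use v(1) in auto)
  qed simp
  then show ?thesis
  proof (rule wp_mono, elim conjE exE)
    fix t v :: nat and s' :: ram_state
    assume h: "t \<le> ?f s" "\<not> holds (Less rP rE) s'" "v \<le> n" "regs s' rP = ad v 0" "regs s' rE = heap0"
      "\<forall>u<n. record_ok (mem s') (if u < v then 2 ^ d u else 0) u"
    have "v = n" using h(2-5) lt[of v] by simp
    then have ok: "record_ok (mem s') (2 ^ d u) u" if "u < n" for u using h(6) that by auto
    show "t \<le> n * (50 * 2 ^ D + 21) + 1 \<and> static (mem s') \<and> todo (mem s') {}"
      using h(1) record_ok_done[OF ok] r by simp
  qed
qed

text \<open>Distinct pairs of vertex numbers give a quadratic bound, which is well within the cubic
  time allowed.\<close>

lemma length_es: "length es \<le> n * n"
proof -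
  have "distinct es" using es_distinct by (simp add: distinct_map)
  then have "length es = card (set es)" by (simp add: distinct_card)
  also have "\<dots> \<le> card ({..<n} \<times> {..<n})"
  proof (rule card_mono)
    show "set es \<subseteq> {..<n} \<times> {..<n}" using es_less by (force simp: in_set_conv_nth)
  qed simp
  finally show ?thesis by simp
qed

lemma input_read: "vertices_read 0 (mem (initial_state (encode_input T es)))"
  "mem (initial_state (encode_input T es)) 0 = n" "mem (initial_state (encode_input T es)) 1 = length es"
proof -
  let ?X = "encode_input T es" and ?M = "mem (initial_state (encode_input T es))"
  let ?c = "concat (map (\<lambda>x. [fst x, snd x, ew {fst x, snd x}]) es)"
  have X: "?X = [n, length es] @ map vw [0..<n] @ ?c"
    by (auto simp: encode_input_def n_def intro!: arg_cong[where f = concat])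
  have len: "length ?X = base" unfolding X by (simp only: length_append length_concat_triples) (simp add: base_def)
  show "?M 0 = n" "?M 1 = length es" by (simp_all add: initial_state_def X)
  have 1: "?M (2 + v) = vw v" if "v < n" for v
    using that by (simp add: initial_state_def len base_def) (simp add: X nth_append)
  have 2: "?M (2 + n + 3 * i + j) = (if j = 0 then fst (es ! i) else if j = 1 then snd (es ! i) else ew {fst (es ! i), snd (es ! i)})"
    if "i < length es" "j < 3" for i j
  proof -
    have "2 + n + 3 * i + j < base" using that by (simp add: base_def)
    then have "?M (2 + n + 3 * i + j) = ?X ! (2 + n + (3 * i + j))" by (simp add: initial_state_def len add.assoc)
    also have "\<dots> = ?c ! (3 * i + j)" unfolding X by (simp add: nth_append)
    finally show ?thesis unfolding nth_concat_triples[OF that] .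
  qed
  have "edges_in ?M" unfolding edges_in_def using 2[of _ 0] 2[of _ 1] 2[of _ 2] by simp
  moreover have "?M (ad v m + f) = 0" for v m f using base_le[of v m] by (simp add: initial_state_def len)
  ultimately show "vertices_read 0 ?M" using 1 unfolding vertices_read_def by simp
qed

lemma wp_init:
  "wp (init (32 * 2 ^ D)) (initial_state (encode_input T es)) (\<lambda>t s. t \<le> 20 * n + 80 * (n * n) + n * (50 * 2 ^ D + 21) + 30 \<and>
     static (mem s) \<and> todo (mem s) {} \<and> regs s rZ = 0 \<and> regs s rB = base \<and> regs s rE = heap0 \<and> regs s rH = heap0 \<and> out s = [])"
proof -
  let ?s = "initial_state (encode_input T es)"
  have b: "2 + n + length es + length es + length es = base" by (simp add: base_def)
  have z: "regs ?s x = 0" "out ?s = []" for x by (simp_all add: initial_state_def)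
  let ?V = "While (Less rI rN) (read_vertex (32 * 2 ^ D))" and ?E = "While (Less rI rM) read_edge"
    and ?R = "While (Less rP rE) (make_records (32 * 2 ^ D))"
  have fV: "writes ?V = {rT, rW, rY, rI, rQ, rP}" "\<not> prints ?V" unfolding read_vertex_def by auto
  have fE: "writes ?E = {rT, rS, rA, rW, rX, rC, rND, rMn, rV, rY, rQ, rI}" "\<not> prints ?E" unfolding read_edge_def by auto
  have fR: "writes ?R = {rT, rX, rY, rHB, rC, rS, rA, rI, rQE, rW, rP}" "\<not> prints ?R"
    unfolding make_records_def make_record_def by auto
  let ?Q = "\<lambda>s. regs s rZ = 0 \<and> regs s rB = base \<and> regs s rE = heap0 \<and> regs s rH = heap0 \<and> out s = []"
  have R: "wp ?R s (\<lambda>t s'. t \<le> n * (50 * 2 ^ D + 21) + 1 \<and> static (mem s') \<and> todo (mem s') {} \<and> ?Q s')"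
    if s: "edges_read es (mem s)" "regs s rP = base" "?Q s" for s :: ram_state
  proof -
    have "wp ?R s (\<lambda>t s'. t \<le> n * (50 * 2 ^ D + 21) + 1 \<and> static (mem s') \<and> todo (mem s') {})"
      by (rule wp_make_all_records) (use s record_ok_0 in auto)
    then show ?thesis by (rule wp_frame) (use s fR in simp)
  qed
  have E: "wp ?E s (\<lambda>t s'. t \<le> 80 * (n * n) + 1 \<and> edges_read es (mem s') \<and> ?Q s')"
    if s: "edges_read [] (mem s)" "regs s rI = 0" "regs s rM = length es" "regs s rQ = 2 + n" "?Q s" for s :: ram_state
    by (rule wp_frame[OF wp_read_edges[OF s(1-4)]]) (use s(5) fE length_es in simp)
  have V: "wp ?V s (\<lambda>t s'. t \<le> 20 * n + 1 \<and> edges_read [] (mem s') \<and> regs s' rP = heap0 \<and> regs s' rQ = 2 + n \<and>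
      regs s' rM = length es \<and> regs s' rZ = 0 \<and> regs s' rB = base \<and> out s' = [])"
    if s: "vertices_read 0 (mem s)" "regs s rI = 0" "regs s rN = n" "regs s rP = base" "regs s rQ = 2"
      "regs s rM = length es" "regs s rZ = 0" "regs s rB = base" "out s = []" for s :: ram_state
    by (rule wp_frame[OF wp_read_vertices[OF s(1-5)]]) (use s(6-) fV edges_read_Nil in simp)
  define s1 where "s1 = set_reg rQ 2 (set_reg rP base (set_reg rI 0 (set_reg rB base (set_reg rM (length es)
      (set_reg rX 1 (set_reg rN n (set_reg rX 0 ?s)))))))"
  have sV: "wp ?V s1 (\<lambda>t s'. t \<le> 20 * n + 1 \<and> edges_read [] (mem s') \<and> regs s' rP = heap0 \<and> regs s' rQ = 2 + n \<and>
      regs s' rM = length es \<and> regs s' rZ = 0 \<and> regs s' rB = base \<and> out s' = [])"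
    by (rule V) (use input_read z in \<open>simp_all add: s1_def\<close>)
  have rest: "wp (Copy rE rP ;; Copy rH rP ;; Const rI 0 ;; ?E ;; Copy rP rB ;; ?R) s
      (\<lambda>t s. t \<le> 80 * (n * n) + n * (50 * 2 ^ D + 21) + 6 \<and> static (mem s) \<and> todo (mem s) {} \<and> ?Q s)"
    if s: "edges_read [] (mem s) \<and> regs s rP = heap0 \<and> regs s rQ = 2 + n \<and>
      regs s rM = length es \<and> regs s rZ = 0 \<and> regs s rB = base \<and> out s = []" for s :: ram_state
  proof -
    have "wp ?E (set_reg rI 0 (set_reg rH heap0 (set_reg rE heap0 s))) (\<lambda>t s'. wp ?R (set_reg rP base s')
        (\<lambda>t' s. t + t' \<le> 80 * (n * n) + n * (50 * 2 ^ D + 21) + 2 \<and> static (mem s) \<and> todo (mem s) {} \<and> ?Q s) \<and> regs s' rB = base)"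
    proof (rule wp_mono[OF E])
      fix t :: nat and s' :: ram_state assume a: "t \<le> 80 * (n * n) + 1 \<and> edges_read es (mem s') \<and> ?Q s'"
      have "wp ?R (set_reg rP base s') (\<lambda>t' s. t' \<le> n * (50 * 2 ^ D + 21) + 1 \<and> static (mem s) \<and> todo (mem s) {} \<and> ?Q s)"
        by (rule R) (use a in simp_all)
      then show "wp ?R (set_reg rP base s') (\<lambda>t' s. t + t' \<le> 80 * (n * n) + n * (50 * 2 ^ D + 21) + 2 \<and>
          static (mem s) \<and> todo (mem s) {} \<and> ?Q s) \<and> regs s' rB = base"
        using a by (auto elim!: wp_mono)
    qed (use s in simp_all)
    then show ?thesis using s
      by (simp del: wp_Seq add: wp_Seq[of "Copy _ _"] wp_Seq[of "Const _ _"] wp_Seq[of "While _ _"])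
         (erule wp_mono, elim conjE, simp, erule wp_mono, simp)
  qed
  have "wp ?V s1 (\<lambda>t s. wp (Copy rE rP ;; Copy rH rP ;; Const rI 0 ;; ?E ;; Copy rP rB ;; ?R) s
      (\<lambda>t' s. t + t' \<le> 20 * n + 80 * (n * n) + n * (50 * 2 ^ D + 21) + 7 \<and> static (mem s) \<and> todo (mem s) {} \<and> ?Q s))"
  proof (rule wp_mono[OF sV])
    fix t :: nat and s' :: ram_state assume a: "t \<le> 20 * n + 1 \<and> edges_read [] (mem s') \<and> regs s' rP = heap0 \<and> regs s' rQ = 2 + n \<and>
      regs s' rM = length es \<and> regs s' rZ = 0 \<and> regs s' rB = base \<and> out s' = []"
    show "wp (Copy rE rP ;; Copy rH rP ;; Const rI 0 ;; ?E ;; Copy rP rB ;; ?R) s'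
      (\<lambda>t' s. t + t' \<le> 20 * n + 80 * (n * n) + n * (50 * 2 ^ D + 21) + 7 \<and> static (mem s) \<and> todo (mem s) {} \<and> ?Q s)"
      by (rule wp_mono[OF rest]) (use a in auto)
  qed
  then have "wp (?V ;; Copy rE rP ;; Copy rH rP ;; Const rI 0 ;; ?E ;; Copy rP rB ;; ?R) s1
      (\<lambda>t s. t \<le> 20 * n + 80 * (n * n) + n * (50 * 2 ^ D + 21) + 7 \<and> static (mem s) \<and> todo (mem s) {} \<and> ?Q s)"
    by (simp only: wp_Seq[of ?V])
  then show ?thesis unfolding init_def
    by (simp del: wp_Seq add: wp_Seq[of "Copy _ _"] wp_Seq[of "Const _ _"] wp_Seq[of "Load _ _"] wp_Seq[of "Add _ _ _"] input_read[simplified] z b[simplified] s1_def[simplified, symmetric])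
       (erule wp_mono, simp)
qed

end

section \<open>The complete algorithm\<close>

text \<open>There is one program for each degree bound, because the distance
  \<open>32 * 2 ^ D\<close> between vertices has to be a constant of the program text.\<close>

definition solver :: "nat \<Rightarrow> program" where
  "solver str = (init str ;; compute ;; roots str ;; print_strategy)"

definition solver_time :: "nat \<Rightarrow> nat \<Rightarrow> nat" where
  "solver_time D n = (20 * n + 80 * (n * n) + n * (50 * 2 ^ D + 21) + 30) +
     ((n * 2 ^ D + 1) * (n * 2 ^ D * (30 * D + 20) + D * (200 * (n + 1) * (n + 1) + 61) + 60) + 2) +
     (n * (200 * (n + 1) * (n + 1) + 41) + 4) + (2 * n * (15 * D + 41 * n + 145) + 30)"

text \<open>Every summand is bounded by a multiple of \<open>(D + 1) * p * p * n ^ 3\<close> with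
  \<open>p = 2 ^ D\<close>. The factors are 3000 for the table, 201 for the input, 841 for the
  starting vertices, 402 for printing and 36 for the constants; 100000 leaves ample room for their
  sum.\<close>

lemma solver_time_bound: assumes "1 \<le> n" shows "solver_time D n \<le> 100000 * (D + 1) * 2 ^ D * 2 ^ D * n ^ 3"
proof -
  define p where "p = (2::nat) ^ D"
  have p: "1 \<le> p" by (simp add: p_def)
  have n: "1 \<le> n" "n \<le> n * n" "n * n \<le> n * n * n" "1 \<le> n * n * n" using assms by auto
  let ?N = "n * n * n"
  have k: "a * b \<le> c * e" if "a \<le> c" "b \<le> e" for a b c e :: nat using that by (rule mult_le_mono)
  have q: "(n + 1) * (n + 1) \<le> 4 * (n * n)" 
    using mult_le_mono[of "n + 1" "2 * n" "n + 1" "2 * n"] n(1) by simp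
  have s: "n * p * (30 * D + 20) + D * (200 * (n + 1) * (n + 1) + 61) + 60 \<le> 1500 * (D + 1) * p * (n * n)"
  proof -
    have "n * p * (30 * D + 20) \<le> (n * n) * p * (30 * (D + 1))" using n by (intro k) auto
    moreover have "D * (200 * (n + 1) * (n + 1) + 61) \<le> (D + 1) * p * (861 * (n * n))"
    proof (intro k)
      have "200 * (n + 1) * (n + 1) = 200 * ((n + 1) * (n + 1))" by (simp only: mult.assoc)
      then show "200 * (n + 1) * (n + 1) + 61 \<le> 861 * (n * n)" using q n by linarith
      show "D \<le> (D + 1) * p" using k[of D "D + 1" 1 p] p by simp
    qed
    moreover have "60 \<le> 60 * ((D + 1) * p * (n * n))" using p n by simp
    ultimately show ?thesis by (simp add: algebra_simps)
  qed
  have "n * p + 1 \<le> 2 * (p * n)" using p n by simp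
  then have "(n * p + 1) * (n * p * (30 * D + 20) + D * (200 * (n + 1) * (n + 1) + 61) + 60) \<le>
      2 * (p * n) * (1500 * (D + 1) * p * (n * n))" using s by (rule k)
  also have "\<dots> = 3000 * ((D + 1) * p * p * ?N)" by (simp add: algebra_simps)
  finally have 1: "(n * p + 1) * (n * p * (30 * D + 20) + D * (200 * (n + 1) * (n + 1) + 61) + 60) \<le> 3000 * ((D + 1) * p * p * ?N)" .
  have a: "b * ?N \<le> b * ((D + 1) * p * p * ?N)" for b using p by simp
  have 2: "20 * n + 80 * (n * n) + n * (50 * p + 21) + 30 \<le> 201 * ((D + 1) * p * p * ?N)"
  proof -
    have "n * (50 * p + 21) \<le> ?N * (71 * ((D + 1) * p * p))"
    proof (rule k)
      have "p \<le> (D + 1) * p * p" using p by simp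
      then show "50 * p + 21 \<le> 71 * ((D + 1) * p * p)" using p by linarith
    qed (use n in linarith)
    moreover have "20 * n + 80 * (n * n) + 30 \<le> 130 * ?N" using n by linarith
    ultimately show ?thesis using a[of 130] by (simp add: algebra_simps)
  qed
  have 3: "n * (200 * (n + 1) * (n + 1) + 41) \<le> 841 * ((D + 1) * p * p * ?N)"
  proof -
    have "n * (200 * (n + 1) * (n + 1) + 41) \<le> n * (841 * (n * n))"
    proof (rule k)
      have "200 * (n + 1) * (n + 1) = 200 * ((n + 1) * (n + 1))" by (simp only: mult.assoc)
      then show "200 * (n + 1) * (n + 1) + 41 \<le> 841 * (n * n)" using q n by linarith
    qed simp
    also have "\<dots> = 841 * ?N" by simp
    finally show ?thesis using a[of 841] by linarith
  qed
  have 4: "2 * n * (15 * D + 41 * n + 145) \<le> 402 * ((D + 1) * p * p * ?N)"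
  proof -
    have "15 \<le> 201 * (n * n)" using n by linarith
    then have "D * 15 \<le> D * (201 * (n * n))" by (rule mult_le_mono2)
    moreover have "(D + 1) * (201 * (n * n)) = D * (201 * (n * n)) + 201 * (n * n)" by (simp only: distrib_right mult_1)
    ultimately have "15 * D + 41 * n + 145 \<le> (D + 1) * (201 * (n * n))" using n by linarith
    then have "2 * n * (15 * D + 41 * n + 145) \<le> 2 * n * ((D + 1) * (201 * (n * n)))" by (rule k[OF order_refl])
    also have "\<dots> = 402 * ((D + 1) * ?N)" by (simp add: algebra_simps)
    also have "\<dots> \<le> 402 * ((D + 1) * p * p * ?N)"
      using mult_le_mono2[OF mult_le_mono[OF p p], of "D + 1"]
      by (intro mult_le_mono2 mult_le_mono1) (simp only: mult.assoc mult_1_right)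
    finally show ?thesis .
  qed
  have 5: "36 \<le> 36 * ((D + 1) * p * p * ?N)" using p n by simp
  have "solver_time D n \<le> 100000 * ((D + 1) * p * p * ?N)"
    unfolding solver_time_def p_def[symmetric] using 1 2 3 4 5 by linarith
  then show ?thesis by (simp only: p_def power3_eq_cube mult.assoc)
qed

lemma solver_time_bigo: "(\<lambda>n. real (solver_time D n)) \<in> O(\<lambda>n. real n ^ 3 * ln (real n))"
proof (rule bigoI[where c = "real (100000 * (D + 1) * 2 ^ D * 2 ^ D)"])
  show "\<forall>\<^sub>F n in sequentially. norm (real (solver_time D n)) \<le>
      real (100000 * (D + 1) * 2 ^ D * 2 ^ D) * norm (real n ^ 3 * ln (real n))"
    using eventually_ge_at_top[of 3]
  proof eventually_elim
    case (elim n)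
    \<comment> \<open>From \<open>n = 3\<close> on the logarithm is at least 1, so it may be
      inserted as a factor into the cubic bound.\<close>
    have "exp 1 \<le> real n" using exp_le elim by linarith
    then have l: "1 \<le> ln (real n)" using elim ln_ge_iff[of "real n" 1] by simp
    have "real (solver_time D n) \<le> real (100000 * (D + 1) * 2 ^ D * 2 ^ D * n ^ 3)"
      using solver_time_bound[of n D] elim by (intro of_nat_mono) simp
    also have "\<dots> = real (100000 * (D + 1) * 2 ^ D * 2 ^ D) * (real n ^ 3 * 1)" by simp
    also have "\<dots> \<le> real (100000 * (D + 1) * 2 ^ D * 2 ^ D) * (real n ^ 3 * ln (real n))"
      using l by (intro mult_left_mono) auto
    also have "real n ^ 3 * ln (real n) = norm (real n ^ 3 * ln (real n))" using l by simp
    finally show ?case by simp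
  qed
qed

lemma wp_Seq_bound:
  assumes "wp P s (\<lambda>t s'. t \<le> b \<and> R s')" "\<And>s'. R s' \<Longrightarrow> wp P' s' (\<lambda>t s''. t \<le> b' \<and> Q s'')"
  shows "wp (P ;; P') s (\<lambda>t s''. t \<le> b + b' \<and> Q s'')"
  unfolding wp_Seq using assms(1)
proof (rule wp_mono)
  fix t s' assume t: "t \<le> b \<and> R s'"
  then have "wp P' s' (\<lambda>t s''. t \<le> b' \<and> Q s'')" using assms(2) by blast
  then show "wp P' s' (\<lambda>t' s''. t + t' \<le> b + b' \<and> Q s'')" by (rule wp_mono) (use t in auto)
qed

lemma (in tree_input) wp_solver:
  "wp (solver (32 * 2 ^ D)) (initial_state (encode_input T es)) (\<lambda>t s. t \<le> solver_time D n \<and>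
     (\<exists>r ms. out s = encode_strategy (connected_search_number T) r ms \<and>
        connected_search_strategy T (connected_search_number T) r ms))"
proof -
  have n: "0 < n" unfolding n_def using finV V_ne by (simp add: card_gt_0_iff)
  let ?t1 = "20 * n + 80 * (n * n) + n * (50 * 2 ^ D + 21) + 30"
  let ?t2 = "(n * 2 ^ D + 1) * step_time + 2" and ?t3 = "n * (200 * (n + 1) * (n + 1) + 41) + 4"
    and ?t4 = "2 * n * (15 * D + 41 * n + 145) + 30"
  let ?Q = "\<lambda>s. \<exists>r ms. out s = encode_strategy (connected_search_number T) r ms \<and>
        connected_search_strategy T (connected_search_number T) r ms"
  have 4: "wp print_strategy s (\<lambda>t s'. t \<le> ?t4 \<and> ?Q s')"
    if "static (mem s) \<and> heap0 \<le> regs s rH \<and> root_inv n s \<and> regs s rZ = 0 \<and> out s = []" for s :: ram_state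
  proof -
    from that have a: "static (mem s)" "heap0 \<le> regs s rH" "root_inv n s" "regs s rZ = 0" "out s = []"
      by blast+
    have ri: "\<exists>r LL. rooted r (regs s rBP) LL \<and> holds_list (mem s) (regs s rBPtr) LL \<and> heap0 \<le> regs s rBPtr \<and>
        regs s rBPtr + length LL \<le> regs s rH \<and> regs s rBLen = length LL"
      "\<forall>r'<n. \<forall>b. reach b {r'} V \<longrightarrow> regs s rBP \<le> b"
      using a(3) n unfolding root_inv_def by auto
    from ri(1) obtain r LL where r: "rooted r (regs s rBP) LL" "holds_list (mem s) (regs s rBPtr) LL"
      "heap0 \<le> regs s rBPtr" "regs s rBPtr + length LL \<le> regs s rH" "regs s rBLen = length LL" by (elim exE conjE)
    let ?k = "regs s rBP" and ?ys = "map fst LL"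
    have "r < n" using r(1) by (simp add: rooted_def)
    then have p: "r \<in> V" "path ?k {r} ?ys" "{r} \<union> set ?ys = V" using r(1) unfolding rooted_def by (auto simp only: V_eq lessThan_iff set_map)
    \<comment> \<open>The chosen peak is a lower bound for every starting vertex by
      \<open>root_inv\<close>, and it is attained; so it is the search number.\<close>
    have k: "connected_search_number T = ?k"
    proof (rule optimal_strategy[OF p])
      fix r' b assume "r' \<in> V" "reach b {r'} V"
      moreover have "r' < n" using \<open>r' \<in> V\<close> unfolding V_eq by simp
      ultimately show "?k \<le> b" using ri(2) by blast
    qed
    have st: "connected_search_strategy T ?k r (emit ?k {r} (\<lambda>x. [x]) ?ys)" by (rule emit_strategy[OF p])
    have "wp print_strategy s (\<lambda>t s'. t \<le> ?t4 \<and> out s' = encode_strategy ?k r (emit ?k {r} (\<lambda>x. [x]) ?ys))"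
      by (rule wp_print) (use a r in simp_all)
    then show ?thesis
    proof (rule wp_mono, elim conjE)
      fix t s' assume "t \<le> ?t4" "out s' = encode_strategy ?k r (emit ?k {r} (\<lambda>x. [x]) ?ys)"
      then show "t \<le> ?t4 \<and> ?Q s'" unfolding k using st by blast
    qed
  qed
  have 3: "wp (roots (32 * 2 ^ D)) s (\<lambda>t s'. t \<le> ?t3 \<and> static (mem s') \<and> heap0 \<le> regs s' rH \<and> root_inv n s' \<and>
      regs s' rZ = 0 \<and> out s' = [])"
    if a: "static (mem s) \<and> table (mem s) (regs s rH) items \<and> regs s rZ = 0 \<and> regs s rB = base \<and> regs s rE = heap0 \<and>
      out s = []" for s :: ram_state
  proof -
    have "wp (roots (32 * 2 ^ D)) s (\<lambda>t s'. t \<le> ?t3 \<and> static (mem s') \<and> heap0 \<le> regs s' rH \<and> root_inv n s')"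
      by (rule wp_roots) (use a in simp_all)
    moreover have "rZ \<notin> writes (roots (32 * 2 ^ D))" "\<not> prints (roots (32 * 2 ^ D))" by (simp_all add: roots_effects run_jumps_effects)
    ultimately show ?thesis by (elim wp_frame) (use a in simp)
  qed
  have 2: "wp compute s (\<lambda>t s'. t \<le> ?t2 \<and> static (mem s') \<and> table (mem s') (regs s' rH) items \<and>
      regs s' rZ = 0 \<and> regs s' rB = base \<and> regs s' rE = heap0 \<and> out s' = [])"
    if a: "static (mem s) \<and> todo (mem s) {} \<and> regs s rZ = 0 \<and> regs s rB = base \<and> regs s rE = heap0 \<and>
      regs s rH = heap0 \<and> out s = []" for s :: ram_state
  proof -
    have "wp compute s (\<lambda>t s'. t \<le> ?t2 \<and> static (mem s') \<and> table (mem s') (regs s' rH) items)"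
      by (rule wp_compute) (use a in simp_all)
    moreover have "rZ \<notin> writes compute" "rB \<notin> writes compute" "rE \<notin> writes compute" "\<not> prints compute"
      by (simp_all add: compute_effects find_effects process_effects run_jumps_effects)
    ultimately show ?thesis by (elim wp_frame) (use a in simp)
  qed
  have time: "solver_time D n = ?t1 + ?t2 + ?t3 + ?t4" by (simp add: solver_time_def step_time_def)
  have 34: "wp (roots (32 * 2 ^ D) ;; print_strategy) s (\<lambda>t s'. t \<le> ?t3 + ?t4 \<and> ?Q s')"
    if a: "static (mem s) \<and> table (mem s) (regs s rH) items \<and> regs s rZ = 0 \<and> regs s rB = base \<and> regs s rE = heap0 \<and>
      out s = []" for s :: ram_state
    by (rule wp_Seq_bound[OF 3[OF a] 4])
  have 24: "wp (compute ;; roots (32 * 2 ^ D) ;; print_strategy) s (\<lambda>t s'. t \<le> ?t2 + (?t3 + ?t4) \<and> ?Q s')"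
    if a: "static (mem s) \<and> todo (mem s) {} \<and> regs s rZ = 0 \<and> regs s rB = base \<and> regs s rE = heap0 \<and>
      regs s rH = heap0 \<and> out s = []" for s :: ram_state
    by (rule wp_Seq_bound[OF 2[OF a] 34])
  have "wp (solver (32 * 2 ^ D)) (initial_state (encode_input T es)) (\<lambda>t s. t \<le> ?t1 + (?t2 + (?t3 + ?t4)) \<and> ?Q s)"
    unfolding solver_def by (rule wp_Seq_bound[OF wp_init 24])
  then show ?thesis unfolding time by (simp only: add.assoc)
qed

theorem theorem1:
  fixes \<Delta> :: nat
  assumes "0 < \<Delta>"
  shows "\<exists>(P :: program) (time :: nat \<Rightarrow> nat).
    (\<lambda>n. real (time n)) \<in> O(\<lambda>n. real n ^ 3 * ln (real n)) \<and>
    (\<forall>(T :: nat wgraph) es. weighted_tree T \<and> max_degree T \<le> \<Delta> \<and> edge_listing T es \<longrightarrow>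
      (\<exists>t \<sigma> r ms.
        exec P (initial_state (encode_input T es)) t \<sigma> \<and>
        t \<le> time (card (verts T)) \<and>
        out \<sigma> = encode_strategy (connected_search_number T) r ms \<and>
        connected_search_strategy T (connected_search_number T) r ms))"
proof (rule exI[of _ "solver (32 * 2 ^ \<Delta>)"], rule exI[of _ "solver_time \<Delta>"], intro conjI allI impI)
  show "(\<lambda>n. real (solver_time \<Delta> n)) \<in> O(\<lambda>n. real n ^ 3 * ln (real n))" by (rule solver_time_bigo)
next
  fix T :: "nat wgraph" and es
  assume a: "weighted_tree T \<and> max_degree T \<le> \<Delta> \<and> edge_listing T es"
  interpret tree_input T es \<Delta> by unfold_locales (use a in auto)
  show "\<exists>t \<sigma> r ms.
        exec (solver (32 * 2 ^ \<Delta>)) (initial_state (encode_input T es)) t \<sigma> \<and>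
        t \<le> solver_time \<Delta> (card (verts T)) \<and>
        out \<sigma> = encode_strategy (connected_search_number T) r ms \<and>
        connected_search_strategy T (connected_search_number T) r ms"
    using wp_solver unfolding wp_def n_def by blast
qed

end
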